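(* Let $\Sigma\subset\mathbb{R}^2$ be a compact $C^2$ curve with nonzero curvature, let $\omega\in\mathbb{S}^1$, and let $p,q\in[1,\infty]$. Consider the following two estimates. (S) There exists a constant $C=C_{\Sigma,\omega,p,q}>0$ such that for all $t\in\mathbb{R}$ and all Schwartz functions $f\in\mathcal{S}(\mathbb{R}^2)$, $$\|E_\Sigma f\|_{L^q(\{x\in\mathbb{R}^2:\,|x\cdot\omega-t|\le 1/2\})}\le C\|f\|_{L^p(\Sigma)}.$$ (R) There exists a constant $C=C_{\Sigma,\omega,p,q}>0$ such that for all $t\in\mathbb{R}$ and all Schwartz functions $f\in\mathcal{S}(\mathbb{R}^2)$, $$\bigl(\mathcal{R}(|E_\Sigma f|^q)(\omega,t)\bigr)^{1/q}\le C\|f\|_{L^p(\Sigma)}.$$ Then: (a) (Transversal case) If $n(\xi)\cdot\omega\ne 0$ for all $\xi\in\Sigma$, then each of the estimates (S) and (R) holds if and only if $$\frac1p+\frac1q\le 1\quad\text{and}\quad q\ge 2.$$ (b) (Non-transversal case) If there exists $\xi\in\Sigma$ with $n(\xi)\cdot\omega=0$, then each of the estimates (S) and (R) holds if and only if $$\begin{cases}\frac1p+\frac2q\le 1, & \text{if } p\le q,\\[2pt] \frac1p+\frac2q<1, & \text{if } p>q.\end{cases}$$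
   Context: $\mathbb{S}^1\subset\mathbb{R}^2$ is the unit circle centered at $0$, and $n(\xi)$ denotes the normal vector of $\Sigma$ at $\xi\in\Sigma$. "Nonzero curvature" means that the curvature of $\Sigma$ vanishes nowhere. For a compact curve $\Sigma$, $\mu$ denotes the induced Lebesgue (arc length) measure on $\Sigma$, and $L^p(\Sigma)=L^p(\Sigma,d\mu)$. The Fourier extension operator is defined for $f\in\mathcal{S}(\mathbb{R}^2)$ by $$E_\Sigma f(x)=\int_\Sigma f(\xi)e^{2\pi i\xi\cdot x}\,d\mu(\xi),\qquad x\in\mathbb{R}^2.$$ The Radon transform is $$\mathcal{R}g(\omega,t)=\int_{\{x\in\mathbb{R}^2:\ x\cdot\omega=t\}}g(x)\,d\lambda_{\omega,t}(x),\qquad(\omega,t)\in\mathbb{S}^1\times\mathbb{R},$$ where $\lambda_{\omega,t}$ is Lebesgue (one-dimensional) measure on the line $\{x\in\mathbb{R}^2:x\cdot\omega=t\}$. Thus $(\mathcal{R}(|E_\Sigma f|^q)(\omega,t))^{1/q}$ is the $L^q$ norm of $E_\Sigma f$ on this line; for $q=\infty$ it is interpreted as the $L^\infty$ norm on the line. Conventions: $1/\infty=0$. *)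

theory Defs
  imports "HOL-Analysis.Analysis" "HOL-Probability.Essential_Supremum"
begin

section \<open>Plane curves\<close>

definition rot90 :: "real^2 \<Rightarrow> real^2" where
  "rot90 v = vector [- (v $ 2), v $ 1]"

text \<open>Derivatives along \<open>{0..1}\<close>, one-sided at the end points.\<close>

definition velocity :: "(real \<Rightarrow> real^2) \<Rightarrow> real \<Rightarrow> real^2" where
  "velocity \<gamma> s = vector_derivative \<gamma> (at s within {0..1})"

definition acceleration :: "(real \<Rightarrow> real^2) \<Rightarrow> real \<Rightarrow> real^2" where
  "acceleration \<gamma> s = vector_derivative (velocity \<gamma>) (at s within {0..1})"

definition C2_path :: "(real \<Rightarrow> real^2) \<Rightarrow> bool" where
  "C2_path \<gamma> \<longleftrightarrow>
     (\<forall>s\<in>{0..1}. \<gamma> differentiable (at s within {0..1})) \<and>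
     (\<forall>s\<in>{0..1}. velocity \<gamma> differentiable (at s within {0..1})) \<and>
     continuous_on {0..1} (acceleration \<gamma>)"

text \<open>
  A compact (connected, embedded) \<open>C\<^sup>2\<close> curve is given by a regular \<open>C\<^sup>2\<close> parametrisation of
  either an arc with end points or a closed curve.  In the closed case the last two conditions
  say that the 1-periodic extension of the parametrisation is \<open>C\<^sup>2\<close>.  The curve as a set
  is \<open>path_image \<gamma>\<close>.
\<close>

definition compact_C2_curve :: "(real \<Rightarrow> real^2) \<Rightarrow> bool" where
  "compact_C2_curve \<gamma> \<longleftrightarrow>
     C2_path \<gamma> \<and> (\<forall>s\<in>{0..1}. velocity \<gamma> s \<noteq> 0) \<and>
     (arc \<gamma> \<or>
      simple_path \<gamma> \<and> pathfinish \<gamma> = pathstart \<gamma> \<and>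
      velocity \<gamma> 1 = velocity \<gamma> 0 \<and> acceleration \<gamma> 1 = acceleration \<gamma> 0)"

text \<open>
  In the closed case the parameter values 0 and 1 of the base point have the same velocity and
  acceleration, so the choice of parameter made by \<open>inv_into\<close> is immaterial below.
\<close>

definition curve_param :: "(real \<Rightarrow> real^2) \<Rightarrow> real^2 \<Rightarrow> real" where
  "curve_param \<gamma> \<xi> = inv_into {0..1} \<gamma> \<xi>"

definition curve_normal :: "(real \<Rightarrow> real^2) \<Rightarrow> real^2 \<Rightarrow> real^2" where
  "curve_normal \<gamma> \<xi> =
     (let v = velocity \<gamma> (curve_param \<gamma> \<xi>) in (1 / norm v) *\<^sub>R rot90 v)"

text \<open>Signed curvature \<open>det (\<gamma>', \<gamma>'') / |\<gamma>'|\<^sup>3\<close>.\<close>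

definition curve_curvature :: "(real \<Rightarrow> real^2) \<Rightarrow> real^2 \<Rightarrow> real" where
  "curve_curvature \<gamma> \<xi> =
     (let s = curve_param \<gamma> \<xi>; v = velocity \<gamma> s; a = acceleration \<gamma> s
      in (v $ 1 * a $ 2 - v $ 2 * a $ 1) / norm v ^ 3)"

definition arc_length_measure :: "(real \<Rightarrow> real^2) \<Rightarrow> (real^2) measure" where
  "arc_length_measure \<gamma> =
     distr (density (lebesgue_on {0..1}) (\<lambda>s. ennreal (norm (velocity \<gamma> s)))) borel \<gamma>"


section \<open>Schwartz functions and the extension operator\<close>

definition partial_derivative :: "2 \<Rightarrow> (real^2 \<Rightarrow> complex) \<Rightarrow> real^2 \<Rightarrow> complex" where
  "partial_derivative i f x = frechet_derivative f (at x) (axis i 1)"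

definition schwartz :: "(real^2 \<Rightarrow> complex) \<Rightarrow> bool" where
  "schwartz f \<longleftrightarrow>
     (\<forall>is :: 2 list. let g = foldr partial_derivative is f in
        (\<forall>x. g differentiable (at x)) \<and>
        (\<forall>N :: nat. \<exists>B. \<forall>x. norm x ^ N * norm (g x) \<le> B))"

definition fourier_extension ::
  "(real \<Rightarrow> real^2) \<Rightarrow> (real^2 \<Rightarrow> complex) \<Rightarrow> real^2 \<Rightarrow> complex" where
  "fourier_extension \<gamma> f x =
     (\<integral>\<xi>. f \<xi> * exp (2 * complex_of_real pi * \<i> * complex_of_real (\<xi> \<bullet> x))
        \<partial>arc_length_measure \<gamma>)"


section \<open>Lebesgue norms and the Radon transform\<close>

text \<open>
  Norms take values in \<open>[0, \<infinity>]\<close>, so that an estimate against a finite quantity asserts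
  finiteness.  Powers are only used with exponents \<open>r > 0\<close>.
\<close>

definition ennreal_rpow :: "ennreal \<Rightarrow> real \<Rightarrow> ennreal" where
  "ennreal_rpow x r = (if x = \<infinity> then \<infinity> else ennreal (enn2real x powr r))"

definition Lp_norm :: "ennreal \<Rightarrow> 'a measure \<Rightarrow> ('a \<Rightarrow> complex) \<Rightarrow> ennreal" where
  "Lp_norm p M f =
     (if p = \<infinity> then esssup M (\<lambda>x. ennreal (norm (f x)))
      else ennreal_rpow
             (\<integral>\<^sup>+ x. ennreal_rpow (ennreal (norm (f x))) (enn2real p) \<partial>M)
             (1 / enn2real p))"

text \<open>
  One-dimensional Lebesgue measure on the line \<open>{x. x \<bullet> \<omega> = t}\<close>, for a unit vector \<open>\<omega>\<close>.
\<close>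

definition line_measure :: "real^2 \<Rightarrow> real \<Rightarrow> (real^2) measure" where
  "line_measure \<omega> t = distr lborel borel (\<lambda>s. t *\<^sub>R \<omega> + s *\<^sub>R rot90 \<omega>)"

lemma line_eq_range:
  assumes "\<omega> \<in> sphere 0 1"
  shows "{x. x \<bullet> \<omega> = t} = range (\<lambda>s. t *\<^sub>R \<omega> + s *\<^sub>R rot90 \<omega>)"
proof -
  have 1: "\<omega> $ 1 * \<omega> $ 1 + \<omega> $ 2 * \<omega> $ 2 = 1"
    using assms by (simp add: norm_eq_1 inner_vec_def sum_2)
  show ?thesis
  proof (intro equalityI subsetI)
    fix x assume "x \<in> {x. x \<bullet> \<omega> = t}"
    then have t: "t = x $ 1 * \<omega> $ 1 + x $ 2 * \<omega> $ 2"
      by (simp add: inner_vec_def sum_2)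
    have "x $ 1 = x $ 1 * (\<omega> $ 1 * \<omega> $ 1 + \<omega> $ 2 * \<omega> $ 2)"
      and "x $ 2 = x $ 2 * (\<omega> $ 1 * \<omega> $ 1 + \<omega> $ 2 * \<omega> $ 2)"
      by (simp_all add: 1)
    then have "x = t *\<^sub>R \<omega> + (x \<bullet> rot90 \<omega>) *\<^sub>R rot90 \<omega>"
      unfolding vec_eq_iff forall_2
      by (simp add: t rot90_def inner_vec_def sum_2 algebra_simps)
    then show "x \<in> range (\<lambda>s. t *\<^sub>R \<omega> + s *\<^sub>R rot90 \<omega>)" by blast
  next
    fix x assume "x \<in> range (\<lambda>s. t *\<^sub>R \<omega> + s *\<^sub>R rot90 \<omega>)"
    then obtain s where "x = t *\<^sub>R \<omega> + s *\<^sub>R rot90 \<omega>" by blast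
    then have "x \<bullet> \<omega> = t * (\<omega> $ 1 * \<omega> $ 1 + \<omega> $ 2 * \<omega> $ 2)"
      by (simp add: rot90_def inner_vec_def sum_2 algebra_simps)
    then show "x \<in> {x. x \<bullet> \<omega> = t}" by (simp add: 1)
  qed
qed

definition radon :: "(real^2 \<Rightarrow> ennreal) \<Rightarrow> real^2 \<Rightarrow> real \<Rightarrow> ennreal" where
  "radon g \<omega> t = (\<integral>\<^sup>+ x. g x \<partial>line_measure \<omega> t)"

text \<open>\<open>(\<R>(|F|\<^sup>q)(\<omega>,t))\<^sup>1\<^sup>/\<^sup>q\<close>, read as the \<open>L\<^sup>\<infinity>\<close> norm on the line if \<open>q = \<infinity>\<close>.\<close>

definition radon_norm :: "ennreal \<Rightarrow> (real^2 \<Rightarrow> complex) \<Rightarrow> real^2 \<Rightarrow> real \<Rightarrow> ennreal" where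
  "radon_norm q F \<omega> t =
     (if q = \<infinity> then Lp_norm \<infinity> (line_measure \<omega> t) F
      else ennreal_rpow
             (radon (\<lambda>x. ennreal_rpow (ennreal (norm (F x))) (enn2real q)) \<omega> t)
             (1 / enn2real q))"


section \<open>The two estimates\<close>

definition strip :: "real^2 \<Rightarrow> real \<Rightarrow> (real^2) set" where
  "strip \<omega> t = {x. \<bar>x \<bullet> \<omega> - t\<bar> \<le> 1/2}"

definition strip_estimate ::
  "(real \<Rightarrow> real^2) \<Rightarrow> real^2 \<Rightarrow> ennreal \<Rightarrow> ennreal \<Rightarrow> bool" where
  "strip_estimate \<gamma> \<omega> p q \<longleftrightarrow>
     (\<exists>C::real. C > 0 \<and> (\<forall>t f. schwartz f \<longrightarrow>
        Lp_norm q (lebesgue_on (strip \<omega> t)) (fourier_extension \<gamma> f)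
          \<le> ennreal C * Lp_norm p (arc_length_measure \<gamma>) f))"

definition radon_estimate ::
  "(real \<Rightarrow> real^2) \<Rightarrow> real^2 \<Rightarrow> ennreal \<Rightarrow> ennreal \<Rightarrow> bool" where
  "radon_estimate \<gamma> \<omega> p q \<longleftrightarrow>
     (\<exists>C::real. C > 0 \<and> (\<forall>t f. schwartz f \<longrightarrow>
        radon_norm q (fourier_extension \<gamma> f) \<omega> t
          \<le> ennreal C * Lp_norm p (arc_length_measure \<gamma>) f))"

end

(* Fix unit vectors omega and omega' spanning the plane. On the line x . omega = t the extension operator is a
   one-dimensional oscillatory integral with phase s * (gamma(u) . omega'), the transpose of h |-> ft h o phase. By
   duality, (R) for (p, q) follows from a bound of ft h o phase in L^{p'}(0, 1) by the L^{q'} norm of h. If the phase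
   has no critical points this is Hausdorff-Young and a change of variables. Nonzero curvature makes the critical points
   nondegenerate, so in general the change of variables produces the weights |y - y_j|^{-1/2}: Hoelder's inequality
   handles 1/p + 2/q < 1, and the line 1/p + 2/q = 1 follows from Paley's inequality by real interpolation. The bounds
   are uniform in t, and (S) follows from (R) by Fubini.

   Conversely (S), and a fortiori (R), is tested on Gaussians concentrated at one point (Knapp's example), on
   Rudin-Shapiro polynomials (q >= 2), and, on the line 1/p + 2/q = 1 with p > q, on a mollified power
   |xi - xi_0|^{-1/p} at a tangency point xi_0. *)
theory Submission
  imports Defs "HOL-Probability.Probability"
begin

section \<open>The Fourier transform on the line\<close>

text \<open>The offset \<open>t\<close> enters the one-dimensional integral only through a factor of
  modulus 1 in the amplitude, which is why every bound is uniform in \<open>t\<close>. For finite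
  \<open>q\<close> positive results are therefore proved for (R) alone, while the examples must
  produce lower bounds on a whole interval of offsets in order to refute (S).

  Real interpolation between it and the trivial bound from L^1 to L^\<infinity> reaches the
  exponents with q' \<le> p', that is p \<le> q. The extreme case is p = q = 3, where both dual
  exponents are 3/2: this is the origin of the exponent in Paley's inequality.

  The Fourier transform acts on bounded measurable functions of compact support. This class is
  stable under cutting by height and under modulation, contains the truncated extremal functions of
  duality, and makes every integral converge absolutely.

  A closed curve has two parameters at its base point. Local estimates by the distance in the plane
  therefore refer to finitely many parameters instead of one.\<close>

definition bdd_cpt :: "(real \<Rightarrow> complex) \<Rightarrow> bool" where
  "bdd_cpt h \<longleftrightarrow> h \<in> borel_measurable borel \<and> (\<exists>B. \<forall>s. norm (h s) \<le> B) \<and>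
     (\<exists>R. \<forall>s. \<bar>s\<bar> > R \<longrightarrow> h s = 0)"

text \<open>The sign of the exponent is that of the extension operator, so that the two operators
  are transposes under the bilinear pairing, without a complex conjugate.\<close>

definition ft :: "(real \<Rightarrow> complex) \<Rightarrow> real \<Rightarrow> complex" where
  "ft h y = (\<integral>s. h s * cis (2 * pi * s * y) \<partial>lborel)"

lemma bdd_cptD:
  assumes "bdd_cpt h"
  obtains B R where "h \<in> borel_measurable borel" "B > 0" "R > 0"
    "\<And>s. norm (h s) \<le> B" "\<And>s. \<bar>s\<bar> > R \<Longrightarrow> h s = 0"
proof -
  obtain B R where "h \<in> borel_measurable borel" "\<And>s. norm (h s) \<le> B" "\<And>s. \<bar>s\<bar> > R \<Longrightarrow> h s = 0"
    using assms unfolding bdd_cpt_def by metis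
  then show ?thesis
    by (intro that[of "max B 1" "max R 1"]) (auto simp: le_max_iff_disj)
qed

lemma bdd_cpt_measurable [measurable_dest]: "bdd_cpt h \<Longrightarrow> h \<in> borel_measurable borel"
  by (simp add: bdd_cpt_def)

lemma integrable_bdd_cpt:
  fixes g :: "real \<Rightarrow> 'a::{banach,second_countable_topology}"
  assumes "g \<in> borel_measurable borel" "\<And>s. norm (g s) \<le> B" "\<And>s. \<bar>s\<bar> > R \<Longrightarrow> g s = 0"
  shows "integrable lborel g"
proof (rule integrableI_bounded_set[where A = "{-R..R}" and B = B])
  show "emeasure lborel {- R..R} < \<infinity>"
    by (simp add: emeasure_lborel_Icc_eq)
  show "AE x in lborel. x \<in> {- R..R} \<longrightarrow> norm (g x) \<le> B"
    using assms by auto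
  show "AE x in lborel. x \<notin> {- R..R} \<longrightarrow> g x = 0"
    using assms(3) by (intro AE_I2) (auto simp: abs_if split: if_splits)
qed (use assms in auto)

lemma bdd_cpt_integrable:
  assumes "bdd_cpt h" shows "integrable lborel h"
proof -
  obtain B R where "h \<in> borel_measurable borel" "\<And>s. norm (h s) \<le> B" "\<And>s. \<bar>s\<bar> > R \<Longrightarrow> h s = 0"
    by (rule bdd_cptD[OF assms]) (rule that; simp)
  then show ?thesis by (rule integrable_bdd_cpt)
qed

lemma bdd_cpt_integrable_powr:
  assumes "bdd_cpt h" "P > 0" shows "integrable lborel (\<lambda>s. norm (h s) powr P)"
proof -
  obtain B R where h [measurable]: "h \<in> borel_measurable borel" and "B > 0"
    and BR: "\<And>s. norm (h s) \<le> B" "\<And>s. \<bar>s\<bar> > R \<Longrightarrow> h s = 0"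
    by (rule bdd_cptD[OF assms(1)]) (rule that; simp)
  show ?thesis
    by (rule integrable_bdd_cpt[where B = "B powr P" and R = R])
      (use BR assms in \<open>auto intro!: powr_mono2\<close>)
qed

lemma bdd_cpt_mult:
  assumes "bdd_cpt h" "g \<in> borel_measurable borel" "\<And>s. norm (g s) \<le> B"
  shows "bdd_cpt (\<lambda>s. h s * g s)"
proof -
  obtain B' R where h [measurable]: "h \<in> borel_measurable borel" and "B' > 0"
    and BR: "\<And>s. norm (h s) \<le> B'" "\<And>s. \<bar>s\<bar> > R \<Longrightarrow> h s = 0"
    by (rule bdd_cptD[OF assms(1)]) (rule that; simp)
  have "norm (h s * g s) \<le> B' * B" for s
    unfolding norm_mult by (intro mult_mono BR assms) (use \<open>B' > 0\<close> in auto)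
  then show ?thesis
    unfolding bdd_cpt_def using BR assms(2) by (intro conjI exI[of _ "B' * B"] exI[of _ R]) auto
qed

lemma measurable_ft [measurable]:
  assumes "bdd_cpt h" shows "ft h \<in> borel_measurable borel"
proof -
  have [measurable]: "h \<in> borel_measurable borel"
    using assms by (rule bdd_cpt_measurable)
  have "(\<lambda>(y,s). h s * cis (2 * pi * s * y)) \<in> borel_measurable (borel \<Otimes>\<^sub>M lborel)"
    unfolding cis_conv_exp by measurable
  from lborel.borel_measurable_lebesgue_integral[OF this] show ?thesis
    by (simp add: ft_def[abs_def])
qed

lemma integrable_ft_integrand:
  assumes "bdd_cpt h"
  shows "integrable lborel (\<lambda>s. h s * cis (2 * pi * s * y))"
  by (intro bdd_cpt_integrable bdd_cpt_mult[where B = 1] assms) (auto simp: cis_conv_exp)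

lemma norm_ft_le:
  assumes "bdd_cpt h"
  shows "norm (ft h y) \<le> (\<integral>s. norm (h s) \<partial>lborel)"
  unfolding ft_def by (rule order_trans[OF integral_norm_bound]) (simp add: norm_mult)

lemma ft_diff:
  assumes "bdd_cpt g" "bdd_cpt h"
  shows "ft (\<lambda>s. g s - h s) y = ft g y - ft h y"
  unfolding ft_def left_diff_distrib
  by (intro Bochner_Integration.integral_diff integrable_ft_integrand assms)

section \<open>Plancherel's inequality by Gaussian averaging\<close>

lemma measurable_cnj [measurable]: "cnj \<in> borel_measurable borel"
  by (intro borel_measurable_continuous_onI continuous_intros)

text \<open>Up to a constant factor the integrand is the normal density with mean \<open>a\<close>
  and standard deviation \<open>1 / (2 * pi * \<sigma>)\<close>. It arises as the Fourier transform
  of a Gaussian weight of width \<open>\<sigma>\<close>.\<close>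

lemma nn_integral_exp_sq:
  assumes "\<sigma> > 0"
  shows "(\<integral>\<^sup>+ b. ennreal (exp (- ((2 * pi * \<sigma> * (b - a))\<^sup>2) / 2)) \<partial>lborel) = ennreal (1 / (sqrt (2*pi) * \<sigma>))"
proof -
  define s where "s = 1 / (2 * pi * \<sigma>)"
  have "s > 0" using assms by (simp add: s_def)
  interpret prob_space "density lborel (normal_density a s)"
    by (rule prob_space_normal_density[OF \<open>s > 0\<close>])
  have "(\<integral>\<^sup>+ b. ennreal (normal_density a s b) \<partial>lborel) = 1"
    using emeasure_space_1 by (simp add: emeasure_density)
  have *: "exp (- ((2 * pi * \<sigma> * (b - a))\<^sup>2) / 2) = sqrt (2 * pi * s\<^sup>2) * normal_density a s b" for b
    using assms by (simp add: normal_density_def s_def field_simps power2_eq_square)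
  have "(\<integral>\<^sup>+ b. ennreal (exp (- ((2 * pi * \<sigma> * (b - a))\<^sup>2) / 2)) \<partial>lborel)
     = ennreal (sqrt (2 * pi * s\<^sup>2)) * (\<integral>\<^sup>+ b. ennreal (normal_density a s b) \<partial>lborel)"
    unfolding * by (subst nn_integral_cmult[symmetric]) (auto simp: ennreal_mult)
  also have "\<dots> = ennreal (sqrt (2 * pi * s\<^sup>2))"
    using \<open>_ = 1\<close> by simp
  also have "sqrt (2 * pi * s\<^sup>2) = 1 / (sqrt (2*pi) * \<sigma>)"
  proof (rule real_sqrt_unique)
    show "(1 / (sqrt (2 * pi) * \<sigma>))\<^sup>2 = 2 * pi * s\<^sup>2"
      by (simp add: s_def power_divide power_mult_distrib) (simp add: power2_eq_square)
  qed (use assms in simp)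
  finally show ?thesis .
qed

text \<open>The square of \<open>ft h\<close> is a double integral of \<open>h a\<close> times the
  conjugate of \<open>h b\<close> against a character in \<open>a - b\<close>. Averaging over a
  normal variable of standard deviation \<open>\<sigma>\<close> turns the character into the
  Gaussian \<open>E (a - b)\<close>. Bounding the product of the two values by half the sum of their
  squares leaves the integral of \<open>E\<close>, which is exactly the reciprocal of the mass of
  the Gaussian weight.\<close>

lemma ft_L2_gaussian:
  assumes "bdd_cpt h" "\<sigma> > 0"
  shows "(\<integral>\<^sup>+ y. ennreal ((norm (ft h y))\<^sup>2 * exp (- (y/\<sigma>)\<^sup>2 / 2)) \<partial>lborel)
       \<le> (\<integral>\<^sup>+ s. ennreal ((norm (h s))\<^sup>2) \<partial>lborel)"
proof -
  obtain B R where h [measurable]: "h \<in> borel_measurable borel" and "B > 0" "R > 0"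
    and BR: "\<And>s. norm (h s) \<le> B" "\<And>s. \<bar>s\<bar> > R \<Longrightarrow> h s = 0"
    by (rule bdd_cptD[OF assms(1)]) (rule that; simp)
  let ?N = "std_normal_distribution"
  let ?P = "lborel \<Otimes>\<^sub>M lborel :: (real \<times> real) measure"
  interpret N: prob_space ?N
    by (rule prob_space_normal_density) simp
  interpret P: pair_sigma_finite "lborel :: real measure" "lborel :: real measure" ..
  have P2: "sigma_finite_measure ?P"
    by (rule sigma_finite_pair_measure) (rule lborel.sigma_finite_measure_axioms)+
  then interpret P2: sigma_finite_measure ?P .
  interpret NP: pair_sigma_finite ?N ?P ..
  define k where "k = (\<lambda>z::real\<times>real. h (fst z) * cnj (h (snd z)))"
  have [measurable]: "k \<in> borel_measurable ?P"
    unfolding k_def by measurable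
  let ?A = "{-R..R} \<times> {-R..R}"
  have A: "?A \<in> sets ?P" by auto
  have fA: "emeasure ?P ?A < \<infinity>"
    by (subst lborel.emeasure_pair_measure_Times) (auto simp: emeasure_lborel_Icc_eq ennreal_mult_less_top)
  have kb: "norm (k z) \<le> B * B" for z
    unfolding k_def norm_mult by (intro mult_mono) (use BR \<open>B > 0\<close> in auto)
  have k0: "k z = 0" if "z \<notin> ?A" for z
  proof -
    have "\<bar>fst z\<bar> > R \<or> \<bar>snd z\<bar> > R" using that by (cases z) auto
    then show ?thesis using BR(2) by (auto simp: k_def)
  qed
  \<comment> \<open>Absolute integrability for Fubini's theorem: the normal law is finite, and
    \<open>k\<close> is bounded and lives on a square.\<close>
  have int: "integrable (?N \<Otimes>\<^sub>M ?P) (\<lambda>(x, z). k z * cis (2 * pi * (\<sigma> * x) * (fst z - snd z)))"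
  proof (rule integrableI_bounded_set[where A = "UNIV \<times> ?A" and B = "B * B"])
    show "(\<lambda>(x, z). k z * cis (2 * pi * (\<sigma> * x) * (fst z - snd z))) \<in> borel_measurable (?N \<Otimes>\<^sub>M ?P)"
      unfolding cis_conv_exp by measurable
    show "UNIV \<times> ?A \<in> sets (?N \<Otimes>\<^sub>M ?P)"
      using A by (intro pair_measureI) auto
    have "emeasure ?N UNIV = 1" using N.emeasure_space_1 by simp
    then show "emeasure (?N \<Otimes>\<^sub>M ?P) (UNIV \<times> ?A) < \<infinity>"
      by (subst sigma_finite_measure.emeasure_pair_measure_Times[OF P2]) (use A fA in \<open>auto simp: ennreal_mult_less_top\<close>)
    show "AE x in ?N \<Otimes>\<^sub>M ?P. x \<in> UNIV \<times> ?A \<longrightarrow>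
       norm (case x of (x, z) \<Rightarrow> k z * cis (2 * pi * (\<sigma> * x) * (fst z - snd z))) \<le> B * B"
      using kb by (intro AE_I2) (auto simp: norm_mult)
  qed (use k0 in \<open>auto intro!: AE_I2 split: prod.splits\<close>)
  have intP: "integrable ?P (\<lambda>z. k z * cis (2 * pi * y * (fst z - snd z)))" for y
  proof (rule integrableI_bounded_set[where A = "?A" and B = "B * B"])
    show "(\<lambda>z. k z * cis (2 * pi * y * (fst z - snd z))) \<in> borel_measurable ?P"
      unfolding cis_conv_exp by measurable
    show "AE x in ?P. x \<in> ?A \<longrightarrow> norm (k x * cis (2 * pi * y * (fst x - snd x))) \<le> B * B"
      using kb by (intro AE_I2) (auto simp: norm_mult)
  qed (use A fA k0 in \<open>auto intro!: AE_I2\<close>)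
  have sq: "complex_of_real ((norm (ft h y))\<^sup>2) = (\<integral>z. k z * cis (2 * pi * y * (fst z - snd z)) \<partial>?P)" for y
  proof -
    have "complex_of_real ((norm (ft h y))\<^sup>2) = ft h y * cnj (ft h y)"
      by (rule complex_norm_square)
    also have "\<dots> = (\<integral>a. (h a * cis (2 * pi * a * y)) * cnj (ft h y) \<partial>lborel)"
      unfolding ft_def[of h y] using integrable_ft_integrand[OF assms(1), of y] by simp
    also have "\<dots> = (\<integral>a. (\<integral>b. k (a,b) * cis (2 * pi * y * (fst (a,b) - snd (a,b))) \<partial>lborel) \<partial>lborel)"
    proof (intro Bochner_Integration.integral_cong refl)
      fix a
      have "cnj (ft h y) = (\<integral>b. cnj (h b * cis (2 * pi * b * y)) \<partial>lborel)"
        unfolding ft_def by (rule Bochner_Integration.integral_cnj[symmetric])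
      moreover have "integrable lborel (\<lambda>b. cnj (h b * cis (2 * pi * b * y)))"
        using integrable_ft_integrand[OF assms(1), of y] by (rule integrable_cnj)
      ultimately have "(h a * cis (2 * pi * a * y)) * cnj (ft h y) = 
          (\<integral>b. (h a * cis (2 * pi * a * y)) * cnj (h b * cis (2 * pi * b * y)) \<partial>lborel)"
        by simp
      also have "(\<lambda>b. (h a * cis (2 * pi * a * y)) * cnj (h b * cis (2 * pi * b * y)))
        = (\<lambda>b. k (a,b) * cis (2 * pi * y * (fst (a,b) - snd (a,b))))"
        by (simp add: k_def cis_cnj cis_mult mult.commute mult.left_commute mult.assoc right_diff_distrib flip: diff_conv_add_uminus)
      finally show "(h a * cis (2 * pi * a * y)) * cnj (ft h y) =
         (\<integral>b. k (a,b) * cis (2 * pi * y * (fst (a,b) - snd (a,b))) \<partial>lborel)" .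
    qed
    also have "\<dots> = (\<integral>z. k z * cis (2 * pi * y * (fst z - snd z)) \<partial>?P)"
      using lborel_pair.integral_fst'[OF intP[of y]] by simp
    finally show ?thesis .
  qed
  define E where "E = (\<lambda>u::real. exp (- ((2 * pi * \<sigma> * u)\<^sup>2) / 2))"
  have E0: "E u \<ge> 0" "E u \<le> 1" for u by (auto simp: E_def)
  \<comment> \<open>The characteristic function of the standard normal law at
    \<open>2 * pi * \<sigma> * u\<close>.\<close>
  have chr: "(\<integral>x. cis (2 * pi * (\<sigma> * x) * u) \<partial>?N) = complex_of_real (E u)" for u
    using fun_cong[OF char_std_normal_distribution, of "2 * pi * \<sigma> * u"]
    by (simp add: char_def E_def cis_conv_exp mult_ac)
  have intft: "integrable ?N (\<lambda>x. (norm (ft h (\<sigma> * x)))\<^sup>2)"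
  proof (rule N.integrable_const_bound)
    show "AE x in ?N. norm ((norm (ft h (\<sigma> * x)))\<^sup>2) \<le> (\<integral>s. norm (h s) \<partial>lborel)\<^sup>2"
      using norm_ft_le[OF assms(1)] by (intro AE_I2) (auto intro!: power_mono)
  qed (use measurable_ft[OF assms(1)] in measurable)
  have "complex_of_real (\<integral>x. (norm (ft h (\<sigma> * x)))\<^sup>2 \<partial>?N) 
      = (\<integral>x. complex_of_real ((norm (ft h (\<sigma> * x)))\<^sup>2) \<partial>?N)"
    by (rule integral_complex_of_real[symmetric])
  also have "\<dots> = (\<integral>x. (\<integral>z. k z * cis (2 * pi * (\<sigma> * x) * (fst z - snd z)) \<partial>?P) \<partial>?N)"
    by (simp only: sq)
  also have "\<dots> = (\<integral>z. (\<integral>x. k z * cis (2 * pi * (\<sigma> * x) * (fst z - snd z)) \<partial>?N) \<partial>?P)"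
    using NP.Fubini_integral[OF int] by simp
  also have "\<dots> = (\<integral>z. k z * complex_of_real (E (fst z - snd z)) \<partial>?P)"
    by (subst integral_mult_right_zero) (simp only: chr)
  finally have J: "complex_of_real (\<integral>x. (norm (ft h (\<sigma> * x)))\<^sup>2 \<partial>?N) 
     = (\<integral>z. k z * complex_of_real (E (fst z - snd z)) \<partial>?P)" .
  have [measurable]: "E \<in> borel_measurable borel"
    unfolding E_def by measurable
  have intE: "integrable ?P (\<lambda>z. k z * complex_of_real (E (fst z - snd z)))"
  proof (rule integrableI_bounded_set[where A = "?A" and B = "B * B"])
    have "norm (k z * complex_of_real (E (fst z - snd z))) \<le> (B * B) * 1" for z
      unfolding norm_mult by (intro mult_mono kb) (use E0 \<open>B > 0\<close> in auto)
    then show "AE x in ?P. x \<in> ?A \<longrightarrow> norm (k x * complex_of_real (E (fst x - snd x))) \<le> B * B"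
      by (intro AE_I2) auto
  qed (use A fA k0 in \<open>auto intro!: AE_I2\<close>)
  define c where "c = 1 / (sqrt (2*pi) * \<sigma>)"
  have cE: "(\<integral>\<^sup>+ b. ennreal (E (b - a)) \<partial>lborel) = ennreal c" for a
    using nn_integral_exp_sq[OF assms(2), of a] by (simp add: E_def c_def)
  have cE2: "(\<integral>\<^sup>+ b. ennreal (x * E (b - a)) \<partial>lborel) = ennreal x * ennreal c" if "x \<ge> 0" for x a
  proof -
    have "(\<integral>\<^sup>+ b. ennreal (x * E (b - a)) \<partial>lborel) = (\<integral>\<^sup>+ b. ennreal x * ennreal (E (b - a)) \<partial>lborel)"
      using that E0 by (simp add: ennreal_mult)
    also have "\<dots> = ennreal x * ennreal c"
      by (subst nn_integral_cmult) (simp_all add: cE)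
    finally show ?thesis .
  qed
  have sym: "E (a - b) = E (b - a)" for a b
    by (simp add: E_def power2_commute power_mult_distrib)
  have "ennreal (\<integral>x. (norm (ft h (\<sigma> * x)))\<^sup>2 \<partial>?N) = ennreal (norm (\<integral>z. k z * complex_of_real (E (fst z - snd z)) \<partial>?P))"
    unfolding J[symmetric] norm_of_real by simp
  also have "\<dots> \<le> (\<integral>\<^sup>+ z. ennreal (norm (k z * complex_of_real (E (fst z - snd z)))) \<partial>?P)"
    by (rule integral_norm_bound_ennreal[OF intE])
  also have "\<dots> \<le> (\<integral>\<^sup>+ z. ennreal ((norm (h (fst z)))\<^sup>2 / 2 * E (snd z - fst z)) + ennreal ((norm (h (snd z)))\<^sup>2 / 2 * E (fst z - snd z)) \<partial>?P)"
  proof (rule nn_integral_mono)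
    fix z :: "real \<times> real"
    have "norm (k z) \<le> (norm (h (fst z)))\<^sup>2 / 2 + (norm (h (snd z)))\<^sup>2 / 2"
      using sum_squares_bound[of "norm (h (fst z))" "norm (h (snd z))"] by (simp add: k_def norm_mult)
    then have "norm (k z * complex_of_real (E (fst z - snd z))) \<le> 
       ((norm (h (fst z)))\<^sup>2 / 2 + (norm (h (snd z)))\<^sup>2 / 2) * E (fst z - snd z)"
      using E0 by (simp add: norm_mult mult_right_mono)
    then show "ennreal (norm (k z * complex_of_real (E (fst z - snd z)))) \<le> 
       ennreal ((norm (h (fst z)))\<^sup>2 / 2 * E (snd z - fst z)) + ennreal ((norm (h (snd z)))\<^sup>2 / 2 * E (fst z - snd z))"
      by (subst ennreal_plus[symmetric]) (use E0 in \<open>auto intro!: ennreal_leI simp: sym[of "fst z"] algebra_simps simp del: ennreal_plus\<close>)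
  qed
  also have "\<dots> = (\<integral>\<^sup>+ z. ennreal ((norm (h (fst z)))\<^sup>2 / 2 * E (snd z - fst z)) \<partial>?P)
      + (\<integral>\<^sup>+ z. ennreal ((norm (h (snd z)))\<^sup>2 / 2 * E (fst z - snd z)) \<partial>?P)"
    by (rule nn_integral_add) measurable
  also have "(\<integral>\<^sup>+ z. ennreal ((norm (h (fst z)))\<^sup>2 / 2 * E (snd z - fst z)) \<partial>?P) 
     = (\<integral>\<^sup>+ a. \<integral>\<^sup>+ b. ennreal ((norm (h a))\<^sup>2 / 2 * E (b - a)) \<partial>lborel \<partial>lborel)"
    by (subst lborel.nn_integral_fst[symmetric]) auto
  also have "\<dots> = (\<integral>\<^sup>+ a. ennreal ((norm (h a))\<^sup>2 / 2) * ennreal c \<partial>lborel)"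
    by (intro nn_integral_cong cE2) simp
  also have "(\<integral>\<^sup>+ z. ennreal ((norm (h (snd z)))\<^sup>2 / 2 * E (fst z - snd z)) \<partial>?P) 
     = (\<integral>\<^sup>+ b. \<integral>\<^sup>+ a. ennreal ((norm (h b))\<^sup>2 / 2 * E (a - b)) \<partial>lborel \<partial>lborel)"
    by (subst lborel_pair.nn_integral_snd[symmetric]) auto
  also have "\<dots> = (\<integral>\<^sup>+ a. ennreal ((norm (h a))\<^sup>2 / 2) * ennreal c \<partial>lborel)"
    by (intro nn_integral_cong cE2) simp
  also have "(\<integral>\<^sup>+ a. ennreal ((norm (h a))\<^sup>2 / 2) * ennreal c \<partial>lborel) + (\<integral>\<^sup>+ a. ennreal ((norm (h a))\<^sup>2 / 2) * ennreal c \<partial>lborel)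
     = (\<integral>\<^sup>+ a. ennreal ((norm (h a))\<^sup>2 / 2) * ennreal c + ennreal ((norm (h a))\<^sup>2 / 2) * ennreal c \<partial>lborel)"
    by (rule nn_integral_add[symmetric]) measurable
  also have "\<dots> = (\<integral>\<^sup>+ a. ennreal ((norm (h a))\<^sup>2) * ennreal c \<partial>lborel)"
    by (intro nn_integral_cong) (simp add: ennreal_plus[symmetric] distrib_right[symmetric] del: ennreal_plus)
  also have "\<dots> = ennreal c * (\<integral>\<^sup>+ a. ennreal ((norm (h a))\<^sup>2) \<partial>lborel)"
    by (subst nn_integral_multc) (auto simp: mult.commute)
  finally have main: "ennreal (\<integral>x. (norm (ft h (\<sigma> * x)))\<^sup>2 \<partial>?N) \<le> ennreal c * (\<integral>\<^sup>+ a. ennreal ((norm (h a))\<^sup>2) \<partial>lborel)" .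
  have mft [measurable]: "ft h \<in> borel_measurable borel" by (rule measurable_ft[OF assms(1)])
  \<comment> \<open>Back to Lebesgue measure by the substitution \<open>y = \<sigma> * x\<close>;
    the normalisations multiply to \<open>\<sigma> * sqrt (2*pi) * c = 1\<close>.\<close>
  have "(\<integral>\<^sup>+ y. ennreal ((norm (ft h y))\<^sup>2 * exp (- (y/\<sigma>)\<^sup>2 / 2)) \<partial>lborel)
    = ennreal \<sigma> * (\<integral>\<^sup>+ x. ennreal ((norm (ft h (\<sigma> * x)))\<^sup>2 * exp (- x\<^sup>2 / 2)) \<partial>lborel)"
    using assms(2) by (subst nn_integral_real_affine[where c = \<sigma> and t = 0]) auto
  also have "(\<integral>\<^sup>+ x. ennreal ((norm (ft h (\<sigma> * x)))\<^sup>2 * exp (- x\<^sup>2 / 2)) \<partial>lborel)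
     = (\<integral>\<^sup>+ x. ennreal (sqrt (2*pi)) * (ennreal (std_normal_density x) * ennreal ((norm (ft h (\<sigma> * x)))\<^sup>2)) \<partial>lborel)"
    by (intro nn_integral_cong) (simp add: ennreal_mult[symmetric] std_normal_density_def)
  also have "\<dots> = ennreal (sqrt (2*pi)) * (\<integral>\<^sup>+ x. ennreal ((norm (ft h (\<sigma> * x)))\<^sup>2) \<partial>?N)"
    by (subst nn_integral_density) (auto simp: nn_integral_cmult)
  also have "(\<integral>\<^sup>+ x. ennreal ((norm (ft h (\<sigma> * x)))\<^sup>2) \<partial>?N) = ennreal (\<integral>x. (norm (ft h (\<sigma> * x)))\<^sup>2 \<partial>?N)"
    by (rule nn_integral_eq_integral[OF intft]) auto
  also have "ennreal \<sigma> * (ennreal (sqrt (2*pi)) * ennreal (\<integral>x. (norm (ft h (\<sigma> * x)))\<^sup>2 \<partial>?N))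
     \<le> ennreal \<sigma> * (ennreal (sqrt (2*pi)) * (ennreal c * (\<integral>\<^sup>+ a. ennreal ((norm (h a))\<^sup>2) \<partial>lborel)))"
    by (intro mult_left_mono main) auto
  also have "\<dots> = ennreal (\<sigma> * sqrt (2*pi) * c) * (\<integral>\<^sup>+ a. ennreal ((norm (h a))\<^sup>2) \<partial>lborel)"
  proof -
    have "c \<ge> 0" using assms(2) by (simp add: c_def)
    then show ?thesis using assms(2) by (simp add: ennreal_mult mult.assoc)
  qed
  also have "\<sigma> * sqrt (2*pi) * c = 1" using assms(2) by (simp add: c_def)
  finally show ?thesis by simp
qed

text \<open>Fatou's lemma as the width of the Gaussian weight tends to infinity. This is the
  inequality half of Plancherel's theorem.\<close>

lemma ft_L2_le:
  assumes "bdd_cpt h"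
  shows "(\<integral>\<^sup>+ y. ennreal ((norm (ft h y))\<^sup>2) \<partial>lborel) \<le> (\<integral>\<^sup>+ s. ennreal ((norm (h s))\<^sup>2) \<partial>lborel)"
proof -
  have [measurable]: "ft h \<in> borel_measurable borel" by (rule measurable_ft[OF assms])
  let ?g = "\<lambda>n y. ennreal ((norm (ft h y))\<^sup>2 * exp (- (y / real (Suc n))\<^sup>2 / 2))"
  have lim: "(\<lambda>n. ?g n y) \<longlonglongrightarrow> ennreal ((norm (ft h y))\<^sup>2)" for y
  proof -
    have "(\<lambda>n. y / real (Suc n)) \<longlonglongrightarrow> 0"
      by (rule LIMSEQ_Suc[OF lim_const_over_n])
    then have "(\<lambda>n. (norm (ft h y))\<^sup>2 * exp (- (y / real (Suc n))\<^sup>2 / 2)) \<longlonglongrightarrow> (norm (ft h y))\<^sup>2 * exp (- 0\<^sup>2 / 2)"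
      by (intro tendsto_intros) auto
    then show ?thesis by (intro tendsto_ennrealI) (simp del: of_nat_Suc)
  qed
  have "(\<integral>\<^sup>+ y. ennreal ((norm (ft h y))\<^sup>2) \<partial>lborel) = (\<integral>\<^sup>+ y. liminf (\<lambda>n. ?g n y) \<partial>lborel)"
    by (intro nn_integral_cong lim_imp_Liminf[OF _ lim, symmetric]) simp
  also have "\<dots> \<le> liminf (\<lambda>n. \<integral>\<^sup>+ y. ?g n y \<partial>lborel)"
    by (rule nn_integral_liminf) measurable
  also have "\<dots> \<le> liminf (\<lambda>n::nat. \<integral>\<^sup>+ s. ennreal ((norm (h s))\<^sup>2) \<partial>lborel)"
    by (intro Liminf_mono always_eventually allI ft_L2_gaussian[OF assms]) simp
  also have "\<dots> = (\<integral>\<^sup>+ s. ennreal ((norm (h s))\<^sup>2) \<partial>lborel)"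
    by (simp add: Liminf_const)
  finally show ?thesis .
qed

section \<open>Real interpolation\<close>

lemma nn_integral_powr_Icc:
  assumes "a > -1" "c \<ge> 0"
  shows "(\<integral>\<^sup>+ l. ennreal (l powr a) * indicator {0..c} l \<partial>lborel) = ennreal (c powr (a+1) / (a+1))"
  by (intro nn_integral_has_integral_lebesgue' has_integral_powr_from_0 assms) simp

text \<open>Integral of the derivative of \<open>l powr Q\<close>. The interval is open at both
  ends, so that a level \<open>l\<close> in it is positive and strictly below \<open>c\<close>; the
  splitting at each level relies on this.\<close>

lemma powr_layer_cake:
  assumes "Q > 0" "c \<ge> 0"
  shows "ennreal (c powr Q) = (\<integral>\<^sup>+ l. ennreal (Q * l powr (Q - 1)) * indicator {0<..<c} l \<partial>lborel)"
proof -
  have "AE l in lborel. l \<noteq> 0 \<and> l \<noteq> c"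
    using AE_lborel_singleton[of "0::real"] AE_lborel_singleton[of c] by eventually_elim auto
  then have "(\<integral>\<^sup>+ l. ennreal (Q * l powr (Q - 1)) * indicator {0<..<c} l \<partial>lborel)
    = (\<integral>\<^sup>+ l. ennreal Q * (ennreal (l powr (Q - 1)) * indicator {0..c} l) \<partial>lborel)"
    by (intro nn_integral_cong_AE, eventually_elim) (use assms in \<open>auto simp: ennreal_mult indicator_def\<close>)
  also have "\<dots> = ennreal Q * ennreal (c powr (Q - 1 + 1) / (Q - 1 + 1))"
    using assms by (subst nn_integral_cmult) (auto simp: nn_integral_powr_Icc)
  also have "\<dots> = ennreal (c powr Q)"
    using assms by (simp flip: ennreal_mult)
  finally show ?thesis ..
qed

lemma bdd_cpt_cutoff:
  assumes "bdd_cpt h" "{s. P s} \<in> sets borel"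
  shows "bdd_cpt (\<lambda>s. if P s then h s else 0)"
proof -
  have "(\<lambda>s. if P s then h s else 0) = (\<lambda>s. h s * indicator {s. P s} s)"
    by (auto simp: indicator_def)
  moreover have "bdd_cpt \<dots>"
    using assms by (intro bdd_cpt_mult[where B = 1] borel_measurable_indicator) (auto simp: indicator_def)
  ultimately show ?thesis by simp
qed

lemma measurable_norm_le [measurable]:
  assumes "bdd_cpt h" shows "{s. norm (h s) \<le> c} \<in> sets borel"
proof -
  have [measurable]: "h \<in> borel_measurable borel" using assms by (rule bdd_cpt_measurable)
  show ?thesis by measurable
qed

text \<open>At level \<open>l\<close> split \<open>h\<close> at the height where its upper part has \<open>L\<^sup>1\<close> norm at most \<open>l/2\<close>; the transform of
  the upper part is then below \<open>l/2\<close>, so only the strong bound for the lower part is needed.\<close>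

theorem marcinkiewicz_strong:
  fixes \<nu> :: "real measure" and A P Q \<rho> :: real
  assumes sets [measurable_cong]: "sets \<nu> = sets borel" and sf: "sigma_finite_measure \<nu>"
    and P: "1 < P" "P < \<rho>" and A: "A \<ge> 0"
    and strong: "\<And>h. bdd_cpt h \<Longrightarrow>
      (\<integral>\<^sup>+ y. ennreal (norm (ft h y) powr \<rho>) \<partial>\<nu>) \<le> ennreal A * (\<integral>\<^sup>+ s. ennreal (norm (h s) powr \<rho>) \<partial>lborel)"
    and Q: "Q = (\<rho> - 1) * P / (P - 1)"
  shows "\<exists>C\<ge>0. \<forall>h. bdd_cpt h \<longrightarrow>
    (\<integral>\<^sup>+ y. ennreal (norm (ft h y) powr Q) \<partial>\<nu>) \<le> ennreal (C * (\<integral>s. norm (h s) powr P \<partial>lborel) powr (Q / P))"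
proof -
  interpret sigma_finite_measure \<nu> by (rule sf)
  interpret pair_sigma_finite lborel \<nu> ..
  have Q\<rho>: "Q - \<rho> = (\<rho> - P) / (P - 1)" and QP: "Q / P = (\<rho> - 1) / (P - 1)"
    using P by (auto simp: Q field_simps)
  have "Q - \<rho> > 0" unfolding Q\<rho> using P by simp
  then have "Q > 1" "Q > \<rho>" using P by auto
  define C where "C = A * Q * 2 powr \<rho> * 2 powr (Q - \<rho>) / (Q - \<rho>)"
  have "C \<ge> 0" using A \<open>Q > 1\<close> \<open>Q - \<rho> > 0\<close> by (simp add: C_def)
  moreover have "(\<integral>\<^sup>+ y. ennreal (norm (ft h y) powr Q) \<partial>\<nu>) \<le> ennreal (C * (\<integral>s. norm (h s) powr P \<partial>lborel) powr (Q / P))"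
    if h: "bdd_cpt h" for h
  proof -
    have [measurable]: "h \<in> borel_measurable borel" using h by (rule bdd_cpt_measurable)
    have [measurable]: "ft h \<in> borel_measurable borel" using h by (rule measurable_ft)
    define N where "N = (\<integral>s. norm (h s) powr P \<partial>lborel)"
    have intP: "integrable lborel (\<lambda>s. norm (h s) powr P)"
      using h P by (intro bdd_cpt_integrable_powr) auto
    have "N \<ge> 0" unfolding N_def by simp
    show ?thesis
    proof (cases "N = 0")
      case True
      then have "AE s in lborel. norm (h s) powr P = 0"
        using intP by (subst (asm) N_def) (auto simp: integral_nonneg_eq_0_iff_AE)
      then have "AE s in lborel. h s = 0" by simp
      then have "ft h y = 0" for y
        unfolding ft_def by (intro integral_eq_zero_AE) auto
      then show ?thesis by simp
    next
      case False
      with \<open>N \<ge> 0\<close> have "N > 0" by simp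
      \<comment> \<open>The height solves \<open>\<sigma> l powr (P - 1) = 2 * N / l\<close>. Above
        it \<open>norm (h s)\<close> is at most \<open>l / (2 * N)\<close> times its
        \<open>P\<close>-th power, so the upper part has integral at most
        \<open>l / 2\<close>.\<close>
      define \<sigma> where "\<sigma> = (\<lambda>l. (2 * N / l) powr (1 / (P - 1)))"
      have [measurable]: "\<sigma> \<in> borel_measurable borel" unfolding \<sigma>_def by measurable
      define g where "g = (\<lambda>l s. if norm (h s) \<le> \<sigma> l then h s else 0)"
      have g: "bdd_cpt (g l)" for l
        unfolding g_def by (intro bdd_cpt_cutoff h measurable_norm_le)
      have [measurable]: "(\<lambda>(l, y). ft (g l) y) \<in> borel_measurable (borel \<Otimes>\<^sub>M borel)"
        unfolding ft_def g_def cis_conv_exp by measurable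
      have tail: "norm (ft h y) \<le> l / 2 + norm (ft (g l) y)" if "l > 0" for l y
      proof -
        have hg: "bdd_cpt (\<lambda>s. h s - g l s)"
        proof -
          have "(\<lambda>s. h s - g l s) = (\<lambda>s. if \<not> norm (h s) \<le> \<sigma> l then h s else 0)"
            by (auto simp: g_def)
          moreover have "bdd_cpt \<dots>"
            by (intro bdd_cpt_cutoff h) measurable
          ultimately show ?thesis by simp
        qed
        have \<sigma>P: "\<sigma> l powr (P - 1) = 2 * N / l"
          using \<open>l > 0\<close> \<open>N > 0\<close> P by (simp add: \<sigma>_def powr_powr)
        have "\<sigma> l > 0" using \<open>l > 0\<close> \<open>N > 0\<close> by (simp add: \<sigma>_def)
        have "norm (h s - g l s) \<le> l / (2 * N) * norm (h s) powr P" for s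
        proof (cases "norm (h s) \<le> \<sigma> l")
          case True
          then show ?thesis using \<open>l > 0\<close> \<open>N > 0\<close> by (simp add: g_def)
        next
          case False
          then have "(2 * N / l) * norm (h s) \<le> norm (h s) powr (P - 1) * norm (h s)"
            unfolding \<sigma>P[symmetric] using P \<open>\<sigma> l > 0\<close>
            by (intro mult_right_mono powr_mono2) auto
          also have "\<dots> = norm (h s) powr P"
            using False \<open>\<sigma> l > 0\<close> P by (cases "h s = 0") (simp_all add: powr_diff)
          finally show ?thesis
            using False \<open>l > 0\<close> \<open>N > 0\<close> by (simp add: g_def field_simps)
        qed
        then have "(\<integral>s. norm (h s - g l s) \<partial>lborel) \<le> (\<integral>s. l / (2 * N) * norm (h s) powr P \<partial>lborel)"
          using bdd_cpt_integrable[OF hg] intP by (intro integral_mono) auto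
        also have "\<dots> = l / 2"
          using \<open>N > 0\<close> by (simp add: N_def[symmetric])
        finally have "norm (ft (\<lambda>s. h s - g l s) y) \<le> l / 2"
          using norm_ft_le[OF hg, of y] by linarith
        moreover have "ft h y = ft (\<lambda>s. h s - g l s) y + ft (g l) y"
          by (simp add: ft_diff h g)
        ultimately show ?thesis
          using norm_triangle_ineq[of "ft (\<lambda>s. h s - g l s) y" "ft (g l) y"] by simp
      qed
      let ?c = "\<lambda>l::real. Q * l powr (Q - 1) * (2 / l) powr \<rho>"
      have "(\<integral>\<^sup>+ y. ennreal (norm (ft h y) powr Q) \<partial>\<nu>) 
        = (\<integral>\<^sup>+ y. \<integral>\<^sup>+ l. ennreal (Q * l powr (Q - 1)) * indicator {0<..<norm (ft h y)} l \<partial>lborel \<partial>\<nu>)"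
        using \<open>Q > 1\<close> by (intro nn_integral_cong powr_layer_cake) auto
      also have "\<dots> \<le> (\<integral>\<^sup>+ y. \<integral>\<^sup>+ l. ennreal (?c l) * indicator {0<..} l * ennreal (norm (ft (g l) y) powr \<rho>) \<partial>lborel \<partial>\<nu>)"
      proof (intro nn_integral_mono)
        fix y l
        show "ennreal (Q * l powr (Q - 1)) * indicator {0<..<norm (ft h y)} l
           \<le> ennreal (?c l) * indicator {0<..} l * ennreal (norm (ft (g l) y) powr \<rho>)"
        proof (cases "0 < l \<and> l < norm (ft h y)")
          case True
          \<comment> \<open>Chebyshev's inequality with exponent \<open>\<rho>\<close>: the upper
            part contributes at most \<open>l / 2\<close>, so the lower part must supply the other
            half of the level.\<close>
          then have "1 \<le> (2 / l) * norm (ft (g l) y)"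
            using tail[of l y] by (simp add: field_simps)
          then have "1 powr \<rho> \<le> ((2 / l) * norm (ft (g l) y)) powr \<rho>"
            using P by (intro powr_mono2) auto
          also have "\<dots> = (2 / l) powr \<rho> * norm (ft (g l) y) powr \<rho>"
            using True by (subst powr_mult) auto
          finally have "Q * l powr (Q - 1) * 1 \<le> Q * l powr (Q - 1) * ((2 / l) powr \<rho> * norm (ft (g l) y) powr \<rho>)"
            using \<open>Q > 1\<close> by (intro mult_left_mono) auto
          then show ?thesis
            using True \<open>Q > 1\<close> by (simp add: ennreal_mult[symmetric] mult.assoc)
        qed auto
      qed
      also have "\<dots> = (\<integral>\<^sup>+ l. \<integral>\<^sup>+ y. ennreal (?c l) * indicator {0<..} l * ennreal (norm (ft (g l) y) powr \<rho>) \<partial>\<nu> \<partial>lborel)"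
        by (rule Fubini') measurable
      also have "\<dots> = (\<integral>\<^sup>+ l. ennreal (?c l) * indicator {0<..} l * (\<integral>\<^sup>+ y. ennreal (norm (ft (g l) y) powr \<rho>) \<partial>\<nu>) \<partial>lborel)"
      proof (intro nn_integral_cong nn_integral_cmult)
        fix l
        have [measurable]: "ft (g l) \<in> borel_measurable borel" by (rule measurable_ft[OF g])
        show "(\<lambda>y. ennreal (norm (ft (g l) y) powr \<rho>)) \<in> borel_measurable \<nu>" by measurable
      qed
      also have "\<dots> \<le> (\<integral>\<^sup>+ l. ennreal (?c l) * indicator {0<..} l * (ennreal A * (\<integral>\<^sup>+ s. ennreal (norm (g l s) powr \<rho>) \<partial>lborel)) \<partial>lborel)"
        by (intro nn_integral_mono mult_left_mono strong g) auto
      also have "\<dots> = (\<integral>\<^sup>+ l. \<integral>\<^sup>+ s. ennreal (A * ?c l) * indicator {0<..} l * ennreal (norm (g l s) powr \<rho>) \<partial>lborel \<partial>lborel)"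
      proof (intro nn_integral_cong)
        fix l
        have [measurable]: "g l \<in> borel_measurable borel" by (rule bdd_cpt_measurable[OF g])
        show "ennreal (?c l) * indicator {0<..} l * (ennreal A * (\<integral>\<^sup>+ s. ennreal (norm (g l s) powr \<rho>) \<partial>lborel))
          = (\<integral>\<^sup>+ s. ennreal (A * ?c l) * indicator {0<..} l * ennreal (norm (g l s) powr \<rho>) \<partial>lborel)"
          using A \<open>Q > 1\<close> by (subst nn_integral_cmult) (auto simp: ennreal_mult' mult_ac)
      qed
      also have "\<dots> = (\<integral>\<^sup>+ s. \<integral>\<^sup>+ l. ennreal (A * ?c l) * indicator {0<..} l * ennreal (norm (g l s) powr \<rho>) \<partial>lborel \<partial>lborel)"
        unfolding g_def by (rule lborel_pair.Fubini') measurable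
      also have "\<dots> \<le> (\<integral>\<^sup>+ s. ennreal (C * N powr (Q - \<rho>)) * ennreal (norm (h s) powr P) \<partial>lborel)"
      proof (rule nn_integral_mono)
        fix s
        show "(\<integral>\<^sup>+ l. ennreal (A * ?c l) * indicator {0<..} l * ennreal (norm (g l s) powr \<rho>) \<partial>lborel)
            \<le> ennreal (C * N powr (Q - \<rho>)) * ennreal (norm (h s) powr P)"
        proof (cases "h s = 0")
          case True
          then have "g l s = 0" for l by (simp add: g_def)
          then show ?thesis by simp
        next
          case False
          define a where "a = norm (h s)"
          have "a > 0" using False by (simp add: a_def)
          \<comment> \<open>For fixed \<open>s\<close>, the condition that the height at level
            \<open>l\<close> is at least \<open>norm (h s)\<close> reads \<open>l \<le> L\<close>.
            The integral in \<open>l\<close> thus runs over a bounded interval, and it converges at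
            0 because \<open>Q > \<rho>\<close>.\<close>
          define L where "L = 2 * N * a powr (-(P - 1))"
          have "L \<ge> 0" using \<open>N > 0\<close> by (simp add: L_def)
          have L: "L = 2 * N / a powr (P - 1)"
            unfolding L_def powr_minus divide_inverse ..
          have iff: "a \<le> \<sigma> l \<longleftrightarrow> l \<le> L" if "l > 0" for l
          proof -
            have "\<sigma> l \<ge> 0" by (simp add: \<sigma>_def)
            then have "a \<le> \<sigma> l \<longleftrightarrow> a powr (P - 1) \<le> \<sigma> l powr (P - 1)"
              using P \<open>a > 0\<close> powr_mono2[of "P - 1" a "\<sigma> l"] powr_less_mono2[of "P - 1" "\<sigma> l" a]
              by (auto simp: not_le[symmetric])
            also have "\<sigma> l powr (P - 1) = 2 * N / l"
              using \<open>l > 0\<close> \<open>N > 0\<close> P by (simp add: \<sigma>_def powr_powr)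
            also have "a powr (P - 1) \<le> 2 * N / l \<longleftrightarrow> l \<le> L"
              using \<open>l > 0\<close> \<open>a > 0\<close> by (simp add: L field_simps)
            finally show ?thesis .
          qed
          have "(\<integral>\<^sup>+ l. ennreal (A * ?c l) * indicator {0<..} l * ennreal (norm (g l s) powr \<rho>) \<partial>lborel)
             \<le> (\<integral>\<^sup>+ l. ennreal (A * Q * 2 powr \<rho> * a powr \<rho>) * (ennreal (l powr (Q - 1 - \<rho>)) * indicator {0..L} l) \<partial>lborel)"
          proof (rule nn_integral_mono)
            fix l
            show "ennreal (A * ?c l) * indicator {0<..} l * ennreal (norm (g l s) powr \<rho>)
              \<le> ennreal (A * Q * 2 powr \<rho> * a powr \<rho>) * (ennreal (l powr (Q - 1 - \<rho>)) * indicator {0..L} l)"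
            proof (cases "0 < l \<and> l \<le> L")
              case True
              have "A * ?c l * a powr \<rho> = A * Q * 2 powr \<rho> * a powr \<rho> * l powr (Q - 1 - \<rho>)"
                using True by (simp add: powr_divide powr_diff)
              then have "ennreal (A * ?c l) * ennreal (a powr \<rho>)
                 = ennreal (A * Q * 2 powr \<rho> * a powr \<rho>) * ennreal (l powr (Q - 1 - \<rho>))"
                by (simp only: ennreal_mult''[symmetric] powr_ge_zero)
              then show ?thesis
                using True iff[of l] by (simp add: g_def a_def)
            next
              case False
              then show ?thesis using iff[of l] P by (cases "l > 0") (auto simp: g_def a_def)
            qed
          qed
          also have "\<dots> = ennreal (A * Q * 2 powr \<rho> * a powr \<rho>) * ennreal (L powr (Q - 1 - \<rho> + 1) / (Q - 1 - \<rho> + 1))"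
            using \<open>Q - \<rho> > 0\<close> \<open>L \<ge> 0\<close> by (subst nn_integral_cmult) (auto simp: nn_integral_powr_Icc)
          also have "\<dots> = ennreal (A * Q * 2 powr \<rho> * a powr \<rho> * (L powr (Q - \<rho>) / (Q - \<rho>)))"
            using A \<open>Q > 1\<close> \<open>Q - \<rho> > 0\<close> by (simp add: ennreal_mult[symmetric])
          also have "L powr (Q - \<rho>) = 2 powr (Q - \<rho>) * N powr (Q - \<rho>) * a powr (P - \<rho>)"
          proof -
            have "L powr (Q - \<rho>) = 2 powr (Q - \<rho>) * N powr (Q - \<rho>) * a powr (-(P - 1) * (Q - \<rho>))"
              using \<open>N > 0\<close> by (simp add: L_def powr_mult powr_powr)
            \<comment> \<open>The choice of \<open>Q\<close> makes the total power of
              \<open>a\<close> equal to \<open>P\<close>.\<close>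
            also have "-(P - 1) * (Q - \<rho>) = P - \<rho>"
              unfolding Q\<rho> using P by (simp add: field_simps)
            finally show ?thesis .
          qed
          also have "A * Q * 2 powr \<rho> * a powr \<rho> * (2 powr (Q - \<rho>) * N powr (Q - \<rho>) * a powr (P - \<rho>) / (Q - \<rho>))
             = C * N powr (Q - \<rho>) * (a powr \<rho> * a powr (P - \<rho>))"
            by (simp add: C_def)
          also have "a powr \<rho> * a powr (P - \<rho>) = a powr P"
            by (simp flip: powr_add)
          finally show ?thesis
            using \<open>C \<ge> 0\<close> by (simp add: a_def ennreal_mult)
        qed
      qed
      also have "\<dots> = ennreal (C * N powr (Q - \<rho>)) * ennreal N"
        using nn_integral_eq_integral[OF intP] by (subst nn_integral_cmult) (auto simp: N_def)
      also have "\<dots> = ennreal (C * (N powr (Q - \<rho>) * N powr 1))"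
        using \<open>N > 0\<close> \<open>C \<ge> 0\<close> by (simp add: ennreal_mult mult.assoc)
      also have "N powr (Q - \<rho>) * N powr 1 = N powr (Q / P)"
      proof -
        have "Q - \<rho> + 1 = Q / P" unfolding QP Q\<rho> using P by (simp add: field_simps)
        then show ?thesis by (metis powr_add)
      qed
      finally show ?thesis by (simp add: N_def)
    qed
  qed
  ultimately show ?thesis by blast
qed

section \<open>Paley's inequality\<close>

lemma nn_integral_inverse_square_tail:
  assumes "b > 0"
  shows "(\<integral>\<^sup>+ y. ennreal (\<bar>y\<bar> powr (-2)) * indicator {y. b \<le> \<bar>y\<bar>} y \<partial>lborel) = ennreal (2 / b)"
proof -
  have p: "(\<integral>\<^sup>+ y. ennreal (y powr (-2)) * indicator {b..} y \<partial>lborel) = ennreal (1 / b)"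
  proof -
    have "((\<lambda>y::real. y powr (-2)) has_integral 1 / b) {b..}"
      using has_integral_powr_to_inf[of "-2" b] assms by (simp add: powr_minus_divide)
    then show ?thesis
      by (intro nn_integral_has_integral_lebesgue') auto
  qed
  have "(\<integral>\<^sup>+ y. ennreal (\<bar>y\<bar> powr (-2)) * indicator {..-b} y \<partial>lborel)
      = (\<integral>\<^sup>+ y. ennreal (\<bar>-y\<bar> powr (-2)) * indicator {..-b} (-y) \<partial>lborel)"
    by (subst nn_integral_real_affine[where c = "-1" and t = 0]) auto
  also have "\<dots> = (\<integral>\<^sup>+ y. ennreal (y powr (-2)) * indicator {b..} y \<partial>lborel)"
    using assms by (intro nn_integral_cong) (auto simp: indicator_def)
  finally have m: "(\<integral>\<^sup>+ y. ennreal (\<bar>y\<bar> powr (-2)) * indicator {..-b} y \<partial>lborel) = ennreal (1 / b)"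
    by (simp add: p)
  have "(\<integral>\<^sup>+ y. ennreal (\<bar>y\<bar> powr (-2)) * indicator {y. b \<le> \<bar>y\<bar>} y \<partial>lborel)
     = (\<integral>\<^sup>+ y. ennreal (\<bar>y\<bar> powr (-2)) * indicator {..-b} y + ennreal (y powr (-2)) * indicator {b..} y \<partial>lborel)"
    using assms by (intro nn_integral_cong) (auto simp: indicator_def abs_if)
  also have "\<dots> = ennreal (1 / b) + ennreal (1 / b)"
    by (subst nn_integral_add) (auto simp: p m)
  finally show ?thesis using assms by (simp flip: ennreal_plus)
qed

text \<open>Apply the layer cake formula to \<open>\<bar>y\<bar> * norm (ft h y)\<close> with respect to \<open>dy / y\<^sup>2\<close>, and at level \<open>l\<close>
  cut \<open>h\<close> at height \<open>l\<close>: the upper part is treated by the trivial bound, the lower part in \<open>L\<^sup>2\<close>.\<close>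

theorem paley_three_halves:
  assumes h: "bdd_cpt h"
  shows "(\<integral>\<^sup>+ y. ennreal (norm (ft h y) powr (3/2) * \<bar>y\<bar> powr (-1/2)) \<partial>lborel)
     \<le> ennreal 24 * (\<integral>\<^sup>+ s. ennreal (norm (h s) powr (3/2)) \<partial>lborel)"
proof -
  have [measurable]: "h \<in> borel_measurable borel" using h by (rule bdd_cpt_measurable)
  have [measurable]: "ft h \<in> borel_measurable borel" using h by (rule measurable_ft)
  define g where "g = (\<lambda>l s. if norm (h s) \<le> l then h s else 0)"
  define k where "k = (\<lambda>l s. if \<not> norm (h s) \<le> l then h s else 0)"
  have g: "bdd_cpt (g l)" and k: "bdd_cpt (k l)" for l
    unfolding g_def k_def by (intro bdd_cpt_cutoff h, measurable)+
  have kg: "k l = (\<lambda>s. h s - g l s)" for l by (auto simp: k_def g_def)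
  define N where "N = (\<lambda>l. \<integral>s. norm (k l s) \<partial>lborel)"
  have N0: "N l \<ge> 0" for l by (simp add: N_def)
  have [measurable]: "(\<lambda>(l, y). ft (g l) y) \<in> borel_measurable (borel \<Otimes>\<^sub>M borel)"
    unfolding ft_def g_def cis_conv_exp by measurable
  have [measurable]: "N \<in> borel_measurable borel"
    unfolding N_def k_def by measurable
  let ?c = "\<lambda>l::real. 3/2 * l powr (3/2 - 1)"
  \<comment> \<open>\<open>?u\<close> covers those \<open>y\<close> at which the upper part of
    \<open>h\<close>, whose transform is bounded by its integral \<open>N l\<close>, may already
    reach half the level. For the other \<open>y\<close> Chebyshev's inequality yields
    \<open>?v\<close>: the squared factor \<open>\<bar>y\<bar>\<close> cancels the density
    \<open>1 / y^2\<close>, so that the unweighted \<open>L^2\<close> bound applies.\<close>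
  let ?u = "\<lambda>l y. ennreal (\<bar>y\<bar> powr (-2)) * indicator {y. l / 2 \<le> \<bar>y\<bar> * N l} y"
  let ?v = "\<lambda>l y. ennreal (4 / l\<^sup>2) * ennreal ((norm (ft (g l) y))\<^sup>2)"
  \<comment> \<open>Because \<open>-1/2 = 3/2 - 2\<close>, the weight splits into the
    \<open>3/2\<close> power of \<open>\<bar>y\<bar>\<close> and the density
    \<open>1 / y^2\<close>.\<close>
  have "(\<integral>\<^sup>+ y. ennreal (norm (ft h y) powr (3/2) * \<bar>y\<bar> powr (-1/2)) \<partial>lborel)
     = (\<integral>\<^sup>+ y. ennreal (\<bar>y\<bar> powr (-2)) * ennreal ((\<bar>y\<bar> * norm (ft h y)) powr (3/2)) \<partial>lborel)"
    by (intro nn_integral_cong) (auto simp: powr_mult mult_ac simp flip: ennreal_mult powr_add mult.assoc)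
  also have "\<dots> = (\<integral>\<^sup>+ y. ennreal (\<bar>y\<bar> powr (-2)) * (\<integral>\<^sup>+ l. ennreal (?c l) * indicator {0<..<\<bar>y\<bar> * norm (ft h y)} l \<partial>lborel) \<partial>lborel)"
    by (subst powr_layer_cake) auto
  also have "\<dots> = (\<integral>\<^sup>+ y. \<integral>\<^sup>+ l. ennreal (\<bar>y\<bar> powr (-2)) * (ennreal (?c l) * indicator {0<..<\<bar>y\<bar> * norm (ft h y)} l) \<partial>lborel \<partial>lborel)"
    by (subst nn_integral_cmult) auto
  also have "\<dots> \<le> (\<integral>\<^sup>+ y. \<integral>\<^sup>+ l. ennreal (?c l) * indicator {0<..} l * (?u l y + ?v l y) \<partial>lborel \<partial>lborel)"
  proof (intro nn_integral_mono)
    fix y l :: real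
    show "ennreal (\<bar>y\<bar> powr (-2)) * (ennreal (?c l) * indicator {0<..<\<bar>y\<bar> * norm (ft h y)} l)
       \<le> ennreal (?c l) * indicator {0<..} l * (?u l y + ?v l y)"
    proof (cases "0 < l \<and> l < \<bar>y\<bar> * norm (ft h y)")
      case True
      then have "y \<noteq> 0" by auto
      have "ennreal (\<bar>y\<bar> powr (-2)) \<le> ?u l y + ?v l y"
      proof (cases "l / 2 \<le> \<bar>y\<bar> * N l")
        case True
        then show ?thesis by simp
      next
        case False
        have "ft h y = ft (k l) y + ft (g l) y"
          unfolding kg by (simp add: ft_diff h g)
        then have "norm (ft h y) \<le> N l + norm (ft (g l) y)"
          using norm_ft_le[OF k, of l y] norm_triangle_ineq[of "ft (k l) y" "ft (g l) y"] by (simp add: N_def)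
        then have "\<bar>y\<bar> * norm (ft h y) \<le> \<bar>y\<bar> * N l + \<bar>y\<bar> * norm (ft (g l) y)"
          by (metis abs_ge_zero distrib_left mult_left_mono)
        then have "1 \<le> 2 / l * (\<bar>y\<bar> * norm (ft (g l) y))"
          using False \<open>0 < l \<and> _\<close> by (simp add: field_simps)
        then have "1\<^sup>2 \<le> (2 / l * (\<bar>y\<bar> * norm (ft (g l) y)))\<^sup>2"
          by (intro power_mono) auto
        then have "\<bar>y\<bar> powr (-2) * 1 \<le> \<bar>y\<bar> powr (-2) * (2 / l * (\<bar>y\<bar> * norm (ft (g l) y)))\<^sup>2"
          by (intro mult_left_mono) auto
        also have "\<dots> = 4 / l\<^sup>2 * (norm (ft (g l) y))\<^sup>2"
          using \<open>y \<noteq> 0\<close> by (simp add: powr_minus_divide power_mult_distrib power_divide)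
        finally have "ennreal (\<bar>y\<bar> powr (-2)) \<le> ?v l y"
          by (simp flip: ennreal_mult)
        then show ?thesis by (simp add: add_increasing)
      qed
      then have "ennreal (?c l) * ennreal (\<bar>y\<bar> powr (-2)) \<le> ennreal (?c l) * (?u l y + ?v l y)"
        by (rule mult_left_mono) simp
      then show ?thesis using True by (simp add: mult.commute)
    qed auto
  qed
  also have "\<dots> = (\<integral>\<^sup>+ l. \<integral>\<^sup>+ y. ennreal (?c l) * indicator {0<..} l * (?u l y + ?v l y) \<partial>lborel \<partial>lborel)"
    by (rule lborel_pair.Fubini') measurable
  also have "\<dots> \<le> (\<integral>\<^sup>+ l. (\<integral>\<^sup>+ s. (if 0 < l \<and> l < norm (h s) then ennreal (6 * l powr (-1/2)) * ennreal (norm (h s)) else 0)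
      + ennreal (6 * l powr (-3/2)) * indicator {0<..} l * ennreal ((norm (g l s))\<^sup>2) \<partial>lborel) \<partial>lborel)"
  proof (rule nn_integral_mono)
    fix l :: real
    have [measurable]: "g l \<in> borel_measurable borel" by (rule bdd_cpt_measurable[OF g])
    have [measurable]: "k l \<in> borel_measurable borel" by (rule bdd_cpt_measurable[OF k])
    have [measurable]: "ft (g l) \<in> borel_measurable borel" by (rule measurable_ft[OF g])
    show "(\<integral>\<^sup>+ y. ennreal (?c l) * indicator {0<..} l * (?u l y + ?v l y) \<partial>lborel)
      \<le> (\<integral>\<^sup>+ s. (if 0 < l \<and> l < norm (h s) then ennreal (6 * l powr (-1/2)) * ennreal (norm (h s)) else 0)
      + ennreal (6 * l powr (-3/2)) * indicator {0<..} l * ennreal ((norm (g l s))\<^sup>2) \<partial>lborel)"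
    proof (cases "l > 0")
      case True
      have Nk: "ennreal (N l) = (\<integral>\<^sup>+ s. ennreal (norm (k l s)) \<partial>lborel)"
        unfolding N_def using bdd_cpt_integrable[OF k]
        by (subst nn_integral_eq_integral) auto
      have U: "(\<integral>\<^sup>+ y. ?u l y \<partial>lborel) \<le> ennreal (4 / l) * ennreal (N l)"
      proof (cases "N l = 0")
        case True
        then show ?thesis using \<open>l > 0\<close> by simp
      next
        case False
        with N0[of l] have "N l > 0" by simp
        then have "(\<integral>\<^sup>+ y. ?u l y \<partial>lborel) = (\<integral>\<^sup>+ y. ennreal (\<bar>y\<bar> powr (-2)) * indicator {y. l / (2 * N l) \<le> \<bar>y\<bar>} y \<partial>lborel)"
          by (intro nn_integral_cong) (auto simp: indicator_def field_simps)
        also have "\<dots> = ennreal (2 / (l / (2 * N l)))"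
          using \<open>l > 0\<close> \<open>N l > 0\<close> by (intro nn_integral_inverse_square_tail) auto
        finally show ?thesis
          using \<open>l > 0\<close> \<open>N l > 0\<close> by (simp flip: ennreal_mult)
      qed
      have V: "(\<integral>\<^sup>+ y. ?v l y \<partial>lborel) \<le> ennreal (4 / l\<^sup>2) * (\<integral>\<^sup>+ s. ennreal ((norm (g l s))\<^sup>2) \<partial>lborel)"
        by (subst nn_integral_cmult) (auto intro!: mult_left_mono ft_L2_le g)
      have "(\<integral>\<^sup>+ y. ennreal (?c l) * indicator {0<..} l * (?u l y + ?v l y) \<partial>lborel)
        = ennreal (?c l) * ((\<integral>\<^sup>+ y. ?u l y \<partial>lborel) + (\<integral>\<^sup>+ y. ?v l y \<partial>lborel))"
        using True by (simp add: nn_integral_cmult nn_integral_add)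
      also have "\<dots> \<le> ennreal (?c l) * (ennreal (4 / l) * (\<integral>\<^sup>+ s. ennreal (norm (k l s)) \<partial>lborel) + ennreal (4 / l\<^sup>2) * (\<integral>\<^sup>+ s. ennreal ((norm (g l s))\<^sup>2) \<partial>lborel))"
        using U V unfolding Nk by (intro mult_left_mono add_mono) auto
      also have "\<dots> = (\<integral>\<^sup>+ s. ennreal (?c l) * (ennreal (4 / l) * ennreal (norm (k l s)) + ennreal (4 / l\<^sup>2) * ennreal ((norm (g l s))\<^sup>2)) \<partial>lborel)"
        by (simp add: nn_integral_cmult nn_integral_add)
      also have "\<dots> = (\<integral>\<^sup>+ s. (if 0 < l \<and> l < norm (h s) then ennreal (6 * l powr (-1/2)) * ennreal (norm (h s)) else 0)
      + ennreal (6 * l powr (-3/2)) * indicator {0<..} l * ennreal ((norm (g l s))\<^sup>2) \<partial>lborel)"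
      proof (rule nn_integral_cong)
        fix s
        have 1: "?c l * (4 / l) = 6 * l powr (-1/2)"
        proof -
          have "l powr (3/2 - 1) / l powr 1 = l powr (3/2 - 1 - 1)" by (rule powr_diff[symmetric])
          then show ?thesis using True by simp
        qed
        have 2: "?c l * (4 / l\<^sup>2) = 6 * l powr (-3/2)"
        proof -
          have "l powr (3/2 - 1) / l powr 2 = l powr (3/2 - 1 - 2)" by (rule powr_diff[symmetric])
          then show ?thesis using True by simp
        qed
        have "ennreal (?c l) * (ennreal (4 / l) * ennreal (norm (k l s)) + ennreal (4 / l\<^sup>2) * ennreal ((norm (g l s))\<^sup>2))
          = ennreal (?c l * (4 / l)) * ennreal (norm (k l s)) + ennreal (?c l * (4 / l\<^sup>2)) * ennreal ((norm (g l s))\<^sup>2)"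
        proof -
          have "ennreal (?c l * (4 / l)) = ennreal (?c l) * ennreal (4 / l)"
            and "ennreal (?c l * (4 / l\<^sup>2)) = ennreal (?c l) * ennreal (4 / l\<^sup>2)"
            using True by (intro ennreal_mult''; simp)+
          then show ?thesis by (simp only: distrib_left mult.assoc)
        qed
        then show "ennreal (?c l) * (ennreal (4 / l) * ennreal (norm (k l s)) + ennreal (4 / l\<^sup>2) * ennreal ((norm (g l s))\<^sup>2))
          = (if 0 < l \<and> l < norm (h s) then ennreal (6 * l powr (-1/2)) * ennreal (norm (h s)) else 0)
      + ennreal (6 * l powr (-3/2)) * indicator {0<..} l * ennreal ((norm (g l s))\<^sup>2)"
          unfolding 1 2 using True by (auto simp: k_def indicator_def)
      qed
      finally show ?thesis .
    qed simp
  qed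
  also have "\<dots> = (\<integral>\<^sup>+ s. (\<integral>\<^sup>+ l. (if 0 < l \<and> l < norm (h s) then ennreal (6 * l powr (-1/2)) * ennreal (norm (h s)) else 0)
      + ennreal (6 * l powr (-3/2)) * indicator {0<..} l * ennreal ((norm (g l s))\<^sup>2) \<partial>lborel) \<partial>lborel)"
    unfolding g_def by (rule lborel_pair.Fubini') measurable
  also have "\<dots> \<le> (\<integral>\<^sup>+ s. ennreal 24 * ennreal (norm (h s) powr (3/2)) \<partial>lborel)"
  proof (rule nn_integral_mono)
    fix s
    define a where "a = norm (h s)"
    have "a \<ge> 0" by (simp add: a_def)
    show "(\<integral>\<^sup>+ l. (if 0 < l \<and> l < norm (h s) then ennreal (6 * l powr (-1/2)) * ennreal (norm (h s)) else 0)
      + ennreal (6 * l powr (-3/2)) * indicator {0<..} l * ennreal ((norm (g l s))\<^sup>2) \<partial>lborel)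
      \<le> ennreal 24 * ennreal (norm (h s) powr (3/2))"
    proof (cases "a = 0")
      case True
      then have *: "h s = 0" "g l s = 0" for l by (auto simp: a_def g_def)
      show ?thesis by (simp add: * cong: if_cong)
    next
      case False
      with \<open>a \<ge> 0\<close> have "a > 0" by simp
      \<comment> \<open>The upper part occurs at levels below \<open>a\<close>, where the exponent
        \<open>-1/2\<close> is integrable at 0; the lower part occurs at levels from
        \<open>a\<close> on, where \<open>-3/2\<close> is integrable at infinity. Each contributes
        \<open>12 * a powr (3/2)\<close>.\<close>
      have "(\<integral>\<^sup>+ l. (if 0 < l \<and> l < norm (h s) then ennreal (6 * l powr (-1/2)) * ennreal (norm (h s)) else 0)
          + ennreal (6 * l powr (-3/2)) * indicator {0<..} l * ennreal ((norm (g l s))\<^sup>2) \<partial>lborel)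
        \<le> (\<integral>\<^sup>+ l. ennreal (6 * a) * (ennreal (l powr (-1/2)) * indicator {0..a} l)
          + ennreal (6 * a\<^sup>2) * (ennreal (l powr (-3/2)) * indicator {a..} l) \<partial>lborel)"
        using \<open>a > 0\<close> by (intro nn_integral_mono add_mono) 
           (auto simp: g_def indicator_def a_def mult_ac simp flip: ennreal_mult)
      also have "\<dots> = ennreal (6 * a) * (\<integral>\<^sup>+ l. ennreal (l powr (-1/2)) * indicator {0..a} l \<partial>lborel)
          + ennreal (6 * a\<^sup>2) * (\<integral>\<^sup>+ l. ennreal (l powr (-3/2)) * indicator {a..} l \<partial>lborel)"
        by (simp add: nn_integral_cmult nn_integral_add)
      also have "(\<integral>\<^sup>+ l. ennreal (l powr (-1/2)) * indicator {0..a} l \<partial>lborel) = ennreal (2 * a powr (1/2))"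
        using nn_integral_powr_Icc[of "-1/2" a] \<open>a > 0\<close> by (simp add: mult.commute)
      also have "(\<integral>\<^sup>+ l. ennreal (l powr (-3/2)) * indicator {a..} l \<partial>lborel) = ennreal (2 * a powr (-1/2))"
      proof -
        have "((\<lambda>y::real. y powr (-3/2)) has_integral 2 * a powr (-1/2)) {a..}"
          using has_integral_powr_to_inf[of "-3/2" a] \<open>a > 0\<close> by (simp add: mult.commute)
        then show ?thesis
          by (intro nn_integral_has_integral_lebesgue') auto
      qed
      also have "ennreal (6 * a) * ennreal (2 * a powr (1/2)) + ennreal (6 * a\<^sup>2) * ennreal (2 * a powr (-1/2))
         = ennreal (12 * (a powr 1 * a powr (1/2)) + 12 * (a powr 2 * a powr (-1/2)))"
        using \<open>a > 0\<close> by (simp flip: ennreal_mult ennreal_plus)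
      also have "12 * (a powr 1 * a powr (1/2)) + 12 * (a powr 2 * a powr (-1/2)) = 24 * a powr (3/2)"
        by (simp only: powr_add[symmetric]) simp
      finally show ?thesis by (simp add: a_def ennreal_mult)
    qed
  qed
  also have "\<dots> = ennreal 24 * (\<integral>\<^sup>+ s. ennreal (norm (h s) powr (3/2)) \<partial>lborel)"
    by (subst nn_integral_cmult) auto
  finally show ?thesis .
qed

section \<open>Extension by duality\<close>

text \<open>Young's inequality for \<open>f / a\<close> and \<open>g / b\<close>, with
  \<open>a\<close> and \<open>b\<close> the two norms. Vanishing norms are treated apart because
  they cannot be normalised.\<close>

lemma holder_lborel:
  fixes f g :: "real \<Rightarrow> real"
  assumes [measurable]: "f \<in> borel_measurable borel" "g \<in> borel_measurable borel"
    and nn: "\<And>u. f u \<ge> 0" "\<And>u. g u \<ge> 0"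
    and p: "p > 1" and r: "r > 1" and pr: "1/p + 1/r = 1"
    and f: "integrable lborel (\<lambda>u. f u powr p)" and g: "integrable lborel (\<lambda>u. g u powr r)"
  shows "(\<integral>\<^sup>+u. ennreal (f u * g u) \<partial>lborel)
    \<le> ennreal ((\<integral>u. f u powr p \<partial>lborel) powr (1/p) * (\<integral>u. g u powr r \<partial>lborel) powr (1/r))"
proof -
  define A where "A = (\<integral>u. f u powr p \<partial>lborel)"
  define B where "B = (\<integral>u. g u powr r \<partial>lborel)"
  have "A \<ge> 0" "B \<ge> 0" by (auto simp: A_def B_def)
  consider "A = 0" | "B = 0" | "A > 0" "B > 0" using \<open>A \<ge> 0\<close> \<open>B \<ge> 0\<close> by linarith
  then show ?thesis
  proof cases
    case 1
    then have "AE u in lborel. f u powr p = 0"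
      using f by (subst (asm) A_def) (auto simp: integral_nonneg_eq_0_iff_AE)
    then have "AE u in lborel. ennreal (f u * g u) = 0" by eventually_elim simp
    then have "(\<integral>\<^sup>+u. ennreal (f u * g u) \<partial>lborel) = 0" by (subst nn_integral_0_iff_AE) auto
    then show ?thesis by simp
  next
    case 2
    then have "AE u in lborel. g u powr r = 0"
      using g by (subst (asm) B_def) (auto simp: integral_nonneg_eq_0_iff_AE)
    then have "AE u in lborel. ennreal (f u * g u) = 0" by eventually_elim simp
    then have "(\<integral>\<^sup>+u. ennreal (f u * g u) \<partial>lborel) = 0" by (subst nn_integral_0_iff_AE) auto
    then show ?thesis by simp
  next
    case 3
    define a where "a = A powr (1/p)"
    define b where "b = B powr (1/r)"
    have ab: "a > 0" "b > 0" using 3 by (auto simp: a_def b_def)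
    have ap: "a powr p = A" "b powr r = B" using 3 p r by (auto simp: a_def b_def powr_powr)
    have "(\<integral>\<^sup>+u. ennreal (f u * g u) \<partial>lborel) \<le>
      (\<integral>\<^sup>+u. ennreal (a * b / (p * A) * f u powr p + a * b / (r * B) * g u powr r) \<partial>lborel)"
    proof (intro nn_integral_mono ennreal_leI)
      fix u
      have "(f u / a) * (g u / b) \<le> (f u / a) powr p / p + (g u / b) powr r / r"
        using Youngs_inequality[OF p r pr, of "f u / a" "g u / b"] nn ab by auto
      also have "\<dots> = f u powr p / A / p + g u powr r / B / r"
        using nn ab by (simp add: powr_divide ap)
      finally have "a * b * ((f u / a) * (g u / b)) \<le> a * b * (f u powr p / A / p + g u powr r / B / r)"
        using ab by (intro mult_left_mono) auto
      then show "f u * g u \<le> a * b / (p * A) * f u powr p + a * b / (r * B) * g u powr r"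
        using ab by (simp add: distrib_left mult_ac)
    qed
    also have "\<dots> = ennreal (\<integral>u. (a * b / (p * A) * f u powr p + a * b / (r * B) * g u powr r) \<partial>lborel)"
      using f g ab p r \<open>A \<ge> 0\<close> \<open>B \<ge> 0\<close> by (intro nn_integral_eq_integral) auto
    also have "(\<integral>u. (a * b / (p * A) * f u powr p + a * b / (r * B) * g u powr r) \<partial>lborel)
      = a * b / (p * A) * A + a * b / (r * B) * B"
      using f g by (simp add: A_def B_def)
    also have "\<dots> = a * b * (1/p + 1/r)"
      using 3 p r by (simp add: field_simps)
    finally show ?thesis by (simp add: pr a_def b_def A_def B_def)
  qed
qed

text \<open>Boundedness from \<open>L^P\<close> of the line to \<open>L^r\<close> of the parameter
  interval, raised to the power \<open>r\<close> so that no root of an extended real is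
  taken.\<close>

definition restriction_bound :: "(real \<Rightarrow> real) \<Rightarrow> real \<Rightarrow> real \<Rightarrow> bool" where
  "restriction_bound \<phi> r P \<longleftrightarrow> (\<exists>C\<ge>0. \<forall>h. bdd_cpt h \<longrightarrow>
     (\<integral>\<^sup>+ u. ennreal (norm (ft h (\<phi> u)) powr r) * indicator {0..1} u \<partial>lborel)
       \<le> ennreal (C * (\<integral>s. norm (h s) powr P \<partial>lborel) powr (r / P)))"

definition ext_op :: "(real \<Rightarrow> real) \<Rightarrow> (real \<Rightarrow> complex) \<Rightarrow> real \<Rightarrow> complex" where
  "ext_op \<phi> F s = (\<integral>u. F u * cis (2 * pi * s * \<phi> u) \<partial>lborel)"

lemma integrable_ext_op_integrand:
  fixes F :: "real \<Rightarrow> complex" and \<phi> :: "real \<Rightarrow> real"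
  assumes "F \<in> borel_measurable borel" "\<phi> \<in> borel_measurable borel"
    and "\<And>u. norm (F u) \<le> B" "\<And>u. u \<notin> {0..1} \<Longrightarrow> F u = 0"
  shows "integrable lborel (\<lambda>u. F u * cis (2 * pi * s * \<phi> u))"
proof (rule integrable_bdd_cpt[where B = B and R = 1])
  show "(\<lambda>u. F u * cis (2 * pi * s * \<phi> u)) \<in> borel_measurable borel"
    using assms(1,2) unfolding cis_conv_exp by measurable
  fix u :: real assume "1 < \<bar>u\<bar>"
  then have "u \<notin> {0..1}" by auto
  then show "F u * cis (2 * pi * s * \<phi> u) = 0" using assms(4) by simp
qed (use assms in \<open>auto simp: norm_mult\<close>)

lemma measurable_ext_op:
  assumes [measurable]: "F \<in> borel_measurable borel" "\<phi> \<in> borel_measurable borel"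
  shows "ext_op \<phi> F \<in> borel_measurable borel"
  unfolding ext_op_def cis_conv_exp by measurable

lemma norm_ext_op_le:
  fixes F :: "real \<Rightarrow> complex" and \<phi> :: "real \<Rightarrow> real"
  assumes [measurable]: "F \<in> borel_measurable borel" "\<phi> \<in> borel_measurable borel"
    and B: "\<And>u. norm (F u) \<le> B" "\<And>u. u \<notin> {0..1} \<Longrightarrow> F u = 0"
  shows "norm (ext_op \<phi> F s) \<le> B"
proof -
  have "norm (ext_op \<phi> F s) \<le> (\<integral>u. norm (F u * cis (2 * pi * s * \<phi> u)) \<partial>lborel)"
    unfolding ext_op_def by (rule integral_norm_bound)
  also have "\<dots> \<le> (\<integral>u. B * indicator {0..1::real} u \<partial>lborel)"
  proof (rule Bochner_Integration.integral_mono)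
    show "integrable lborel (\<lambda>u. norm (F u * cis (2 * pi * s * \<phi> u)))"
      using assms by (intro integrable_norm integrable_ext_op_integrand) auto
    fix u show "norm (F u * cis (2 * pi * s * \<phi> u)) \<le> B * indicator {0..1} u"
      using B by (auto simp: norm_mult indicator_def)
  qed auto
  also have "\<dots> = B" by simp
  finally show ?thesis .
qed

text \<open>Fubini's theorem on the box \<open>{-R..R} \<times> {0..1}\<close>, outside which the
  integrand vanishes.\<close>

lemma ext_op_pairing:
  fixes F :: "real \<Rightarrow> complex" and \<phi> :: "real \<Rightarrow> real"
  assumes F [measurable]: "F \<in> borel_measurable borel" and \<phi> [measurable]: "\<phi> \<in> borel_measurable borel"
    and B: "\<And>u. norm (F u) \<le> B" and supp: "\<And>u. u \<notin> {0..1} \<Longrightarrow> F u = 0"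
    and h: "bdd_cpt h"
  shows "(\<integral>s. ext_op \<phi> F s * h s \<partial>lborel) = (\<integral>u. F u * ft h (\<phi> u) \<partial>lborel)"
proof -
  obtain B' R where [measurable]: "h \<in> borel_measurable borel" and "B' > 0"
    and hb: "\<And>s. norm (h s) \<le> B'" and h0: "\<And>s. \<bar>s\<bar> > R \<Longrightarrow> h s = 0"
    by (rule bdd_cptD[OF h]) (rule that; simp)
  have "B \<ge> 0" using order_trans[OF norm_ge_zero B[of 0]] .
  have int2: "integrable (lborel \<Otimes>\<^sub>M lborel) (\<lambda>(s, u). F u * cis (2 * pi * s * \<phi> u) * h s)"
  proof (rule integrableI_bounded_set[where A = "{-R..R} \<times> {0..1}" and B = "B * B'"])
    show "(\<lambda>(s, u). F u * cis (2 * pi * s * \<phi> u) * h s) \<in> borel_measurable (lborel \<Otimes>\<^sub>M lborel)"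
      unfolding cis_conv_exp by measurable
    show "emeasure (lborel \<Otimes>\<^sub>M lborel) ({- R..R} \<times> {0..1::real}) < \<infinity>"
      by (subst lborel.emeasure_pair_measure_Times) (auto simp: emeasure_lborel_Icc_eq ennreal_mult_less_top)
    have "norm (F u * cis (2 * pi * s * \<phi> u) * h s) \<le> B * B'" for s u
      unfolding norm_mult using B[of u] hb[of s] \<open>B \<ge> 0\<close> by (auto intro!: mult_mono)
    then show "AE x in lborel \<Otimes>\<^sub>M lborel. x \<in> {- R..R} \<times> {0..1} \<longrightarrow>
      norm (case x of (s, u) \<Rightarrow> F u * cis (2 * pi * s * \<phi> u) * h s) \<le> B * B'"
      by (intro AE_I2) auto
    show "AE x in lborel \<Otimes>\<^sub>M lborel. x \<notin> {- R..R} \<times> {0..1} \<longrightarrow>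
      (case x of (s, u) \<Rightarrow> F u * cis (2 * pi * s * \<phi> u) * h s) = 0"
    proof (intro AE_I2 impI)
      fix x :: "real \<times> real" assume "x \<notin> {- R..R} \<times> {0..1}"
      then have "\<bar>fst x\<bar> > R \<or> snd x \<notin> {0..1}" by (cases x) auto
      then have "h (fst x) = 0 \<or> F (snd x) = 0"
        using supp[of "snd x"] h0[of "fst x"] by blast
      then show "(case x of (s, u) \<Rightarrow> F u * cis (2 * pi * s * \<phi> u) * h s) = 0"
        by (auto simp: case_prod_beta)
    qed
  qed auto
  have "(\<integral>s. ext_op \<phi> F s * h s \<partial>lborel) = (\<integral>s. (\<integral>u. F u * cis (2 * pi * s * \<phi> u) * h s \<partial>lborel) \<partial>lborel)"
    unfolding ext_op_def using integrable_ext_op_integrand[OF F \<phi> B supp] by simp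
  also have "\<dots> = (\<integral>u. (\<integral>s. F u * cis (2 * pi * s * \<phi> u) * h s \<partial>lborel) \<partial>lborel)"
    using lborel_pair.Fubini_integral[OF int2] by simp
  also have "\<dots> = (\<integral>u. F u * ft h (\<phi> u) \<partial>lborel)"
    unfolding ft_def by (intro Bochner_Integration.integral_cong refl)
      (simp add: mult.assoc mult.commute[of "cis _"])
  finally show ?thesis .
qed

text \<open>The extension operator is the transpose of \<open>h \<mapsto> ft h \<circ> \<phi>\<close>; testing against
  \<open>h = |T|\<^sup>q\<^sup>-\<^sup>2 cnj T\<close> on \<open>{-R..R}\<close> avoids any a priori integrability of \<open>T\<close>.\<close>

theorem extension_by_duality:
  fixes \<phi> :: "real \<Rightarrow> real"
  assumes \<phi> [measurable]: "\<phi> \<in> borel_measurable borel"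
    and p: "p > 1" and r: "r > 1" and pr: "1/p + 1/r = 1"
    and q: "q > 1" and P: "P > 1" and qP: "1/q + 1/P = 1"
    and R: "restriction_bound \<phi> r P"
  shows "\<exists>C\<ge>0. \<forall>F B. F \<in> borel_measurable borel \<longrightarrow> (\<forall>u. norm (F u) \<le> B) \<longrightarrow> (\<forall>u. u \<notin> {0..1} \<longrightarrow> F u = 0) \<longrightarrow>
    (\<integral>\<^sup>+ s. ennreal (norm (ext_op \<phi> F s) powr q) \<partial>lborel) \<le> ennreal (C * (\<integral>u. norm (F u) powr p \<partial>lborel) powr (q / p))"
proof -
  obtain C where "C \<ge> 0" and C: "\<And>h. bdd_cpt h \<Longrightarrow>
     (\<integral>\<^sup>+ u. ennreal (norm (ft h (\<phi> u)) powr r) * indicator {0..1} u \<partial>lborel)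
       \<le> ennreal (C * (\<integral>s. norm (h s) powr P \<partial>lborel) powr (r / P))"
    using R unfolding restriction_bound_def by blast
  \<comment> \<open>This makes the \<open>P\<close>-th power of the test function equal to the
    \<open>q\<close>-th power of \<open>T\<close> on the window, so that its norm and its pairing
    with \<open>T\<close> are governed by the same number \<open>X\<close>.\<close>
  have qP1: "(q - 1) * P = q" using qP q P by (simp add: field_simps)
  have "(\<integral>\<^sup>+ s. ennreal (norm (ext_op \<phi> F s) powr q) \<partial>lborel)
     \<le> ennreal (C powr (q / r) * (\<integral>u. norm (F u) powr p \<partial>lborel) powr (q / p))"
    if F [measurable]: "F \<in> borel_measurable borel" and B: "\<And>u. norm (F u) \<le> B" and supp: "\<And>u. u \<notin> {0..1} \<Longrightarrow> F u = 0" for F B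
  proof -
    define T where "T = ext_op \<phi> F"
    have [measurable]: "T \<in> borel_measurable borel"
      unfolding T_def by (intro measurable_ext_op F \<phi>)
    have TB: "norm (T s) \<le> B" for s
      unfolding T_def by (rule norm_ext_op_le) (use B supp in auto)
    have "B \<ge> 0" using order_trans[OF norm_ge_zero TB[of 0]] .
    have intF: "integrable lborel (\<lambda>u. norm (F u) powr p)"
    proof (rule integrable_bdd_cpt[where B = "B powr p" and R = 1])
      fix u :: real assume "1 < \<bar>u\<bar>"
      then have "u \<notin> {0..1}" by auto
      then show "norm (F u) powr p = 0" using supp by simp
    qed (use B p in \<open>auto intro!: powr_mono2\<close>)
    define D where "D = C powr (1/r) * (\<integral>u. norm (F u) powr p \<partial>lborel) powr (1/p)"
    have "D \<ge> 0" by (simp add: D_def)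
    have bound: "(\<integral>\<^sup>+ s. ennreal (norm (T s) powr q) * indicator {-real n..real n} s \<partial>lborel) \<le> ennreal (D powr q)" for n
    proof -
      define h where "h = (\<lambda>s. (complex_of_real (norm (T s) powr (q - 2)) * cnj (T s)) * indicator {-real n..real n} s)"
      have [measurable]: "h \<in> borel_measurable borel" unfolding h_def by measurable
      have nh: "norm (h s) = norm (T s) powr (q - 1) * indicator {-real n..real n} s" for s
      proof (cases "T s = 0")
        case False
        then have "norm (T s) powr (q - 2) * norm (T s) = norm (T s) powr (q - 2 + 1)"
          by (simp only: powr_add) simp
        then show ?thesis by (simp add: h_def norm_mult indicator_def)
      qed (simp add: h_def)
      have hb: "norm (h s) \<le> B powr (q - 1)" for s
        unfolding nh using TB[of s] q by (auto simp: indicator_def intro!: powr_mono2)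
      have "h s = 0" if "real n < \<bar>s\<bar>" for s using that by (auto simp: h_def indicator_def)
      then have h: "bdd_cpt h" unfolding bdd_cpt_def using hb \<open>h \<in> borel_measurable borel\<close> by blast
      define X where "X = (\<integral>s. norm (T s) powr q * indicator {-real n..real n} s \<partial>lborel)"
      have intX: "integrable lborel (\<lambda>s. norm (T s) powr q * indicator {-real n..real n} s)"
        by (rule integrable_bdd_cpt[where B = "B powr q" and R = "real n"])
          (use TB q in \<open>auto simp: indicator_def intro!: powr_mono2\<close>)
      have "X \<ge> 0" unfolding X_def by simp
      have hP: "norm (h s) powr P = norm (T s) powr q * indicator {-real n..real n} s" for s
        using P by (auto simp: nh indicator_def powr_powr qP1)
      have Th: "T s * h s = complex_of_real (norm (T s) powr q * indicator {-real n..real n} s)" for s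
      proof (cases "T s = 0")
        case False
        have "T s * cnj (T s) = complex_of_real ((norm (T s))\<^sup>2)"
          by (rule complex_norm_square[symmetric])
        also have "(norm (T s))\<^sup>2 = norm (T s) powr 2" using False by simp
        finally have "T s * h s = complex_of_real (norm (T s) powr (q - 2) * norm (T s) powr 2) * indicator {-real n..real n} s"
          by (simp add: h_def mult_ac)
        also have "norm (T s) powr (q - 2) * norm (T s) powr 2 = norm (T s) powr q"
          by (simp only: powr_add[symmetric]) simp
        finally show ?thesis by (simp add: indicator_def)
      qed (simp add: h_def)
      have [measurable]: "ft h \<in> borel_measurable borel" by (rule measurable_ft[OF h])
      have "complex_of_real X = (\<integral>s. T s * h s \<partial>lborel)"
        unfolding Th X_def by (rule integral_complex_of_real[symmetric])
      also have "\<dots> = (\<integral>u. F u * ft h (\<phi> u) \<partial>lborel)"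
        unfolding T_def by (rule ext_op_pairing[OF F \<phi> B supp h])
      finally have X: "complex_of_real X = (\<integral>u. F u * ft h (\<phi> u) \<partial>lborel)" .
      define G where "G = (\<lambda>u. norm (ft h (\<phi> u)) * indicator {0..1} u)"
      have [measurable]: "G \<in> borel_measurable borel" unfolding G_def by measurable
      define K where "K = (\<integral>s. norm (h s) \<partial>lborel)"
      have "K \<ge> 0" by (simp add: K_def)
      have G01: "0 \<le> G u" "G u \<le> K" "u \<notin> {0..1} \<Longrightarrow> G u = 0" for u
        using norm_ft_le[OF h, of "\<phi> u"] \<open>K \<ge> 0\<close> by (auto simp: G_def K_def indicator_def)
      have intG: "integrable lborel (\<lambda>u. G u powr r)"
      proof (rule integrable_bdd_cpt[where B = "K powr r" and R = 1])
        fix u :: real assume "1 < \<bar>u\<bar>"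
        then have "u \<notin> {0..1}" by auto
        then show "G u powr r = 0" using G01 by simp
      qed (use G01 r in \<open>auto intro!: powr_mono2\<close>)
      have "ennreal (\<integral>u. G u powr r \<partial>lborel) = (\<integral>\<^sup>+u. ennreal (G u powr r) \<partial>lborel)"
        using intG by (intro nn_integral_eq_integral[symmetric]) auto
      also have "\<dots> = (\<integral>\<^sup>+ u. ennreal (norm (ft h (\<phi> u)) powr r) * indicator {0..1} u \<partial>lborel)"
        using r by (intro nn_integral_cong) (auto simp: G_def indicator_def)
      also have "\<dots> \<le> ennreal (C * X powr (r / P))"
        using C[OF h] by (simp add: hP X_def)
      finally have GX: "(\<integral>u. G u powr r \<partial>lborel) \<le> C * X powr (r / P)"
        using \<open>C \<ge> 0\<close> by simp
      have "ennreal X \<le> (\<integral>\<^sup>+u. ennreal (norm (F u * ft h (\<phi> u))) \<partial>lborel)"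
      proof -
        have "integrable lborel (\<lambda>u. F u * ft h (\<phi> u))"
        proof (rule integrable_bdd_cpt[where B = "B * K" and R = 1])
          fix u :: real 
          show "norm (F u * ft h (\<phi> u)) \<le> B * K"
            unfolding norm_mult using B[of u] norm_ft_le[OF h, of "\<phi> u"] \<open>B \<ge> 0\<close>
            by (auto intro!: mult_mono simp: K_def)
          assume "1 < \<bar>u\<bar>"
          then have "u \<notin> {0..1}" by auto
          then show "F u * ft h (\<phi> u) = 0" using supp by simp
        qed measurable
        from integral_norm_bound_ennreal[OF this] show ?thesis
          using \<open>X \<ge> 0\<close> by (simp add: X[symmetric])
      qed
      also have "\<dots> = (\<integral>\<^sup>+u. ennreal (norm (F u) * G u) \<partial>lborel)"
        using supp by (intro nn_integral_cong) (auto simp: G_def norm_mult indicator_def)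
      also have "\<dots> \<le> ennreal ((\<integral>u. norm (F u) powr p \<partial>lborel) powr (1/p) * (\<integral>u. G u powr r \<partial>lborel) powr (1/r))"
        by (rule holder_lborel) (use p r pr intF intG G01 in auto)
      also have "\<dots> \<le> ennreal ((\<integral>u. norm (F u) powr p \<partial>lborel) powr (1/p) * (C * X powr (r / P)) powr (1/r))"
        using GX r by (intro ennreal_leI mult_left_mono powr_mono2) auto
      also have "(C * X powr (r / P)) powr (1/r) = C powr (1/r) * X powr (1 / P)"
        using r \<open>C \<ge> 0\<close> by (simp add: powr_mult powr_powr)
      finally have "X \<le> D * X powr (1 / P)"
        by (simp add: D_def mult_ac)
      \<comment> \<open>The window makes \<open>X\<close> finite, so \<open>X powr (1 / P)\<close>
        can be divided out, and \<open>1 - 1/P = 1/q\<close>.\<close>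
      have "X \<le> D powr q"
      proof (cases "X = 0")
        case False
        with \<open>X \<ge> 0\<close> have "X > 0" by simp
        have "X powr (1 / q) * X powr (1/P) = X"
          using qP \<open>X > 0\<close> by (simp flip: powr_add)
        then have "X powr (1 / q) * X powr (1/P) \<le> D * X powr (1 / P)"
          using \<open>X \<le> D * X powr (1 / P)\<close> by simp
        then have "X powr (1 / q) \<le> D" using \<open>X > 0\<close> by simp
        then have "(X powr (1 / q)) powr q \<le> D powr q"
          using q by (intro powr_mono2) auto
        then show ?thesis using q \<open>X > 0\<close> by (simp add: powr_powr)
      qed simp
      moreover have "(\<integral>\<^sup>+ s. ennreal (norm (T s) powr q) * indicator {-real n..real n} s \<partial>lborel) = ennreal X"
        unfolding X_def using intX
        by (subst nn_integral_eq_integral[symmetric]) (auto simp: indicator_def intro!: nn_integral_cong)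
      ultimately show ?thesis by simp
    qed
    have "(\<integral>\<^sup>+ s. ennreal (norm (T s) powr q) \<partial>lborel)
      = (\<integral>\<^sup>+ s. (SUP n. ennreal (norm (T s) powr q) * indicator {-real n..real n} s) \<partial>lborel)"
    proof (intro nn_integral_cong antisym)
      fix s
      obtain n :: nat where "\<bar>s\<bar> \<le> real n" using real_arch_simple by blast
      then have "ennreal (norm (T s) powr q) = ennreal (norm (T s) powr q) * indicator {-real n..real n} s"
        by (auto simp: indicator_def)
      also have "\<dots> \<le> (SUP n. ennreal (norm (T s) powr q) * indicator {-real n..real n} s)"
        by (rule SUP_upper) simp
      finally show "ennreal (norm (T s) powr q) \<le> (SUP n. ennreal (norm (T s) powr q) * indicator {-real n..real n} s)" .
    qed (auto intro!: SUP_least simp: indicator_def)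
    also have "\<dots> = (SUP n. \<integral>\<^sup>+ s. ennreal (norm (T s) powr q) * indicator {-real n..real n} s \<partial>lborel)"
      by (rule nn_integral_monotone_convergence_SUP) (auto simp: incseq_def le_fun_def indicator_def)
    also have "\<dots> \<le> ennreal (D powr q)"
      by (intro SUP_least bound)
    also have "D powr q = C powr (q / r) * (\<integral>u. norm (F u) powr p \<partial>lborel) powr (q / p)"
      by (simp add: D_def powr_mult powr_powr)
    finally show ?thesis by (simp add: T_def)
  qed
  then show ?thesis
    by (intro exI[of _ "C powr (q / r)"]) auto
qed

section \<open>Hausdorff-Young and restriction bounds with and without weights\<close>

lemma hausdorff_young:
  assumes q: "q \<ge> 2" and qP: "1/q + 1/P = 1"
  shows "\<exists>C\<ge>0. \<forall>h. bdd_cpt h \<longrightarrow>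
    (\<integral>\<^sup>+ y. ennreal (norm (ft h y) powr q) \<partial>lborel) \<le> ennreal (C * (\<integral>s. norm (h s) powr P \<partial>lborel) powr (q / P))"
proof -
  have "P \<noteq> 0" using qP q by (intro notI) simp
  have P: "P = q / (q - 1)" using qP q \<open>P \<noteq> 0\<close> by (simp add: field_simps)
  have L2: "(\<integral>\<^sup>+ y. ennreal (norm (ft h y) powr 2) \<partial>lborel) \<le> ennreal 1 * (\<integral>\<^sup>+ s. ennreal (norm (h s) powr 2) \<partial>lborel)"
    if "bdd_cpt h" for h using ft_L2_le[OF that] by simp
  show ?thesis
  proof (cases "q = 2")
    case True
    then have "P = 2" by (simp add: P)
    show ?thesis unfolding True \<open>P = 2\<close>
    proof (intro exI[of _ 1] conjI allI impI)
      fix h assume h: "bdd_cpt h"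
      have "(\<integral>\<^sup>+ s. ennreal (norm (h s) powr 2) \<partial>lborel) = ennreal (\<integral>s. norm (h s) powr 2 \<partial>lborel)"
        using bdd_cpt_integrable_powr[OF h, of 2] by (intro nn_integral_eq_integral) auto
      then show "(\<integral>\<^sup>+ y. ennreal (norm (ft h y) powr 2) \<partial>lborel) \<le> ennreal (1 * (\<integral>s. norm (h s) powr 2 \<partial>lborel) powr (2 / 2))"
        using L2[OF h] by simp
    qed simp
  next
    case False
    with q have "q > 2" by simp
    \<comment> \<open>Interpolation between the trivial \<open>L^1\<close> bound and Plancherel's
      inequality, with \<open>\<rho> = 2\<close>; the conjugate exponents satisfy the required
      relation.\<close>
    have "P > 1" "P < 2" using \<open>q > 2\<close> by (auto simp: P field_simps)
    moreover have "q = (2 - 1) * P / (P - 1)" using \<open>q > 2\<close> by (simp add: P field_simps)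
    ultimately show ?thesis
      using L2 by (intro marcinkiewicz_strong[where \<rho> = 2 and A = 1]) 
        (auto intro: lborel.sigma_finite_measure_axioms)
  qed
qed

text \<open>The hypothesis \<open>push\<close> says that the image of the parameter interval under
  the phase has density at most \<open>K\<close>; restriction then costs no more than
  Hausdorff-Young with \<open>r = q\<close>.\<close>

lemma restriction_bound_transversal:
  assumes push: "\<And>G. G \<in> borel_measurable borel \<Longrightarrow>
      (\<integral>\<^sup>+ u. G (\<phi> u) * indicator {0..1} u \<partial>lborel) \<le> ennreal K * (\<integral>\<^sup>+ y. G y \<partial>lborel)"
    and K: "K \<ge> 0"
    and q: "q \<ge> 2" and qP: "1/q + 1/P = 1"
  shows "restriction_bound \<phi> q P"
proof -
  obtain C where "C \<ge> 0" and C: "\<And>h. bdd_cpt h \<Longrightarrow>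
    (\<integral>\<^sup>+ y. ennreal (norm (ft h y) powr q) \<partial>lborel) \<le> ennreal (C * (\<integral>s. norm (h s) powr P \<partial>lborel) powr (q / P))"
    using hausdorff_young[OF q qP] by blast
  show ?thesis unfolding restriction_bound_def
  proof (intro exI[of _ "K * C"] conjI allI impI)
    fix h assume h: "bdd_cpt h"
    have [measurable]: "ft h \<in> borel_measurable borel" by (rule measurable_ft[OF h])
    have "(\<integral>\<^sup>+ u. ennreal (norm (ft h (\<phi> u)) powr q) * indicator {0..1} u \<partial>lborel)
      \<le> ennreal K * (\<integral>\<^sup>+ y. ennreal (norm (ft h y) powr q) \<partial>lborel)"
      by (rule push[of "\<lambda>y. ennreal (norm (ft h y) powr q)"]) measurable
    also have "\<dots> \<le> ennreal K * ennreal (C * (\<integral>s. norm (h s) powr P \<partial>lborel) powr (q / P))"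
      by (intro mult_left_mono C h) simp
    finally show "(\<integral>\<^sup>+ u. ennreal (norm (ft h (\<phi> u)) powr q) * indicator {0..1} u \<partial>lborel)
      \<le> ennreal (K * C * (\<integral>s. norm (h s) powr P \<partial>lborel) powr (q / P))"
      using K \<open>C \<ge> 0\<close> by (simp add: ennreal_mult mult.assoc)
  qed (use K \<open>C \<ge> 0\<close> in simp)
qed

lemma ft_shift: "ft h (y0 + y) = ft (\<lambda>s. h s * cis (2 * pi * s * y0)) y"
  unfolding ft_def by (simp add: mult.assoc cis_mult distrib_left)

lemma bdd_cpt_modulate:
  assumes "bdd_cpt h" shows "bdd_cpt (\<lambda>s. h s * cis (2 * pi * s * y0))"
  by (rule bdd_cpt_mult[where B = 1]) (use assms in \<open>auto simp: cis_conv_exp\<close>)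

text \<open>Moving the singularity of the weight to \<open>y0\<close> modulates \<open>h\<close> and
  leaves its modulus unchanged, so one constant serves all \<open>y0\<close>. The case
  \<open>r = 3/2\<close> is Paley's inequality; larger \<open>r\<close> follow by interpolation with
  \<open>\<rho> = 3/2\<close>, because \<open>(3/2 - 1) * P / (P - 1) = r\<close>. The condition
  \<open>r \<ge> 3/2\<close> amounts to \<open>P \<le> r\<close>.\<close>

lemma paley_weighted:
  assumes r: "r \<ge> 3/2" and P: "1/(2*r) + 1/P = 1"
  shows "\<exists>C\<ge>0. \<forall>h y0. bdd_cpt h \<longrightarrow>
    (\<integral>\<^sup>+ y. ennreal (norm (ft h y) powr r) * ennreal (\<bar>y - y0\<bar> powr (-1/2)) \<partial>lborel)
      \<le> ennreal (C * (\<integral>s. norm (h s) powr P \<partial>lborel) powr (r / P))"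
proof -
  have "P \<noteq> 0" using P r by (intro notI) simp
  have P': "P = 2 * r / (2 * r - 1)" using P r \<open>P \<noteq> 0\<close> by (simp add: field_simps)
  define \<nu> where "\<nu> = density lborel (\<lambda>y::real. ennreal (\<bar>y\<bar> powr (-1/2)))"
  have [measurable_cong]: "sets \<nu> = sets borel" by (simp add: \<nu>_def)
  have nu: "(\<integral>\<^sup>+ y. f y \<partial>\<nu>) = (\<integral>\<^sup>+ y. f y * ennreal (\<bar>y\<bar> powr (-1/2)) \<partial>lborel)" if "f \<in> borel_measurable borel" for f
    unfolding \<nu>_def using that by (subst nn_integral_density) (auto simp: mult.commute)
  have base: "(\<integral>\<^sup>+ y. ennreal (norm (ft h y) powr (3/2)) \<partial>\<nu>) \<le> ennreal 24 * (\<integral>\<^sup>+ s. ennreal (norm (h s) powr (3/2)) \<partial>lborel)"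
    if h: "bdd_cpt h" for h
  proof -
    have [measurable]: "ft h \<in> borel_measurable borel" by (rule measurable_ft[OF h])
    show ?thesis using paley_three_halves[OF h] by (subst nu) (auto simp: ennreal_mult)
  qed
  have "\<exists>C\<ge>0. \<forall>h. bdd_cpt h \<longrightarrow>
    (\<integral>\<^sup>+ y. ennreal (norm (ft h y) powr r) \<partial>\<nu>)
      \<le> ennreal (C * (\<integral>s. norm (h s) powr P \<partial>lborel) powr (r / P))"
  proof (cases "r = 3/2")
    case True
    have P32: "P = 3/2" unfolding P' True by simp
    show ?thesis unfolding True P32
    proof (intro exI[of _ 24] conjI allI impI)
      fix h assume h: "bdd_cpt h"
      have "(\<integral>\<^sup>+ s. ennreal (norm (h s) powr (3/2)) \<partial>lborel) = ennreal (\<integral>s. norm (h s) powr (3/2) \<partial>lborel)"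
        using bdd_cpt_integrable_powr[OF h, of "3/2"] by (intro nn_integral_eq_integral) auto
      then show "(\<integral>\<^sup>+ y. ennreal (norm (ft h y) powr (3/2)) \<partial>\<nu>) \<le> ennreal (24 * (\<integral>s. norm (h s) powr (3/2) \<partial>lborel) powr (3/2 / (3/2)))"
        using base[OF h] by (simp add: ennreal_mult)
    qed simp
  next
    case False
    with r have "r > 3/2" by simp
    have "P > 1" "P < 3/2" using \<open>r > 3/2\<close> by (auto simp: P' field_simps)
    moreover have "r = (3/2 - 1) * P / (P - 1)" using \<open>r > 3/2\<close> by (simp add: P' field_simps)
    moreover have "sigma_finite_measure \<nu>"
      unfolding \<nu>_def by (subst sigma_finite_measure.sigma_finite_iff_density_finite[OF lborel.sigma_finite_measure_axioms]) auto
    ultimately show ?thesis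
      using base by (intro marcinkiewicz_strong[where \<rho> = "3/2" and A = 24]) (auto simp: \<nu>_def)
  qed
  then obtain C where "C \<ge> 0" and C: "\<And>h. bdd_cpt h \<Longrightarrow> 
     (\<integral>\<^sup>+ y. ennreal (norm (ft h y) powr r) \<partial>\<nu>) \<le> ennreal (C * (\<integral>s. norm (h s) powr P \<partial>lborel) powr (r / P))"
    by blast
  show ?thesis
  proof (intro exI[of _ C] conjI allI impI)
    fix h y0 assume h: "bdd_cpt h"
    let ?h = "\<lambda>s. h s * cis (2 * pi * s * y0)"
    have [measurable]: "ft h \<in> borel_measurable borel" by (rule measurable_ft[OF h])
    have h': "bdd_cpt ?h" by (rule bdd_cpt_modulate[OF h])
    have "(\<integral>\<^sup>+ y. ennreal (norm (ft h y) powr r) * ennreal (\<bar>y - y0\<bar> powr (-1/2)) \<partial>lborel)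
       = (\<integral>\<^sup>+ y. ennreal (norm (ft h (y0 + 1 * y)) powr r) * ennreal (\<bar>(y0 + 1 * y) - y0\<bar> powr (-1/2)) \<partial>lborel)"
      by (subst nn_integral_real_affine[where c = 1 and t = y0]) auto
    also have "\<dots> = (\<integral>\<^sup>+ y. ennreal (norm (ft ?h y) powr r) \<partial>\<nu>)"
      using measurable_ft[OF h'] by (subst nu) (auto simp: ft_shift)
    also have "\<dots> \<le> ennreal (C * (\<integral>s. norm (?h s) powr P \<partial>lborel) powr (r / P))"
      by (rule C[OF h'])
    finally show "(\<integral>\<^sup>+ y. ennreal (norm (ft h y) powr r) * ennreal (\<bar>y - y0\<bar> powr (-1/2)) \<partial>lborel)
      \<le> ennreal (C * (\<integral>s. norm (h s) powr P \<partial>lborel) powr (r / P))"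
      by (simp add: norm_mult)
  qed (fact \<open>C \<ge> 0\<close>)
qed

text \<open>Since \<open>S\<close> contains the range of the phase, its indicator can be inserted
  before the push-forward, and the weighted inequality is required on \<open>S\<close> only: a
  bounded window off the critical line, the whole line on it.\<close>

lemma restriction_bound_of_weighted:
  assumes push: "\<And>G. G \<in> borel_measurable borel \<Longrightarrow>
      (\<integral>\<^sup>+ u. G (\<phi> u) * indicator {0..1} u \<partial>lborel)
        \<le> ennreal K * (\<Sum>y0\<in>Y. \<integral>\<^sup>+ y. G y * ennreal (\<bar>y - y0\<bar> powr (-1/2)) \<partial>lborel)"
    and K: "K \<ge> 0" and S: "S \<in> sets borel" and \<phi>S: "\<And>u. u \<in> {0..1} \<Longrightarrow> \<phi> u \<in> S"
    and w: "\<And>y0. \<exists>C\<ge>0. \<forall>h. bdd_cpt h \<longrightarrow>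
      (\<integral>\<^sup>+ y. ennreal (norm (ft h y) powr r) * indicator S y * ennreal (\<bar>y - y0\<bar> powr (-1/2)) \<partial>lborel)
        \<le> ennreal (C * (\<integral>s. norm (h s) powr P \<partial>lborel) powr (r / P))"
  shows "restriction_bound \<phi> r P"
proof -
  have "\<forall>y0. \<exists>C. C \<ge> 0 \<and> (\<forall>h. bdd_cpt h \<longrightarrow>
      (\<integral>\<^sup>+ y. ennreal (norm (ft h y) powr r) * indicator S y * ennreal (\<bar>y - y0\<bar> powr (-1/2)) \<partial>lborel)
        \<le> ennreal (C * (\<integral>s. norm (h s) powr P \<partial>lborel) powr (r / P)))"
    using w by simp
  from choice[OF this] obtain C where "\<forall>y0. C y0 \<ge> 0 \<and> (\<forall>h. bdd_cpt h \<longrightarrow>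
      (\<integral>\<^sup>+ y. ennreal (norm (ft h y) powr r) * indicator S y * ennreal (\<bar>y - y0\<bar> powr (-1/2)) \<partial>lborel)
        \<le> ennreal (C y0 * (\<integral>s. norm (h s) powr P \<partial>lborel) powr (r / P)))" ..
  then have C0: "\<And>y0. C y0 \<ge> 0" and C: "\<And>y0 h. bdd_cpt h \<Longrightarrow>
      (\<integral>\<^sup>+ y. ennreal (norm (ft h y) powr r) * indicator S y * ennreal (\<bar>y - y0\<bar> powr (-1/2)) \<partial>lborel)
        \<le> ennreal (C y0 * (\<integral>s. norm (h s) powr P \<partial>lborel) powr (r / P))"
    by simp_all
  show ?thesis unfolding restriction_bound_def
  proof (intro exI[of _ "K * (\<Sum>y0\<in>Y. C y0)"] conjI allI impI)
    fix h assume h: "bdd_cpt h"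
    have [measurable]: "ft h \<in> borel_measurable borel" "S \<in> sets borel" by (rule measurable_ft[OF h]) fact
    let ?X = "(\<integral>s. norm (h s) powr P \<partial>lborel) powr (r / P)"
    have "(\<integral>\<^sup>+ u. ennreal (norm (ft h (\<phi> u)) powr r) * indicator {0..1} u \<partial>lborel)
      = (\<integral>\<^sup>+ u. (ennreal (norm (ft h (\<phi> u)) powr r) * indicator S (\<phi> u)) * indicator {0..1} u \<partial>lborel)"
      using \<phi>S by (intro nn_integral_cong) (auto simp: indicator_def)
    also have "\<dots> \<le> ennreal K * (\<Sum>y0\<in>Y. \<integral>\<^sup>+ y. ennreal (norm (ft h y) powr r) * indicator S y * ennreal (\<bar>y - y0\<bar> powr (-1/2)) \<partial>lborel)"
      by (rule push[of "\<lambda>y. ennreal (norm (ft h y) powr r) * indicator S y"]) measurable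
    also have "\<dots> \<le> ennreal K * (\<Sum>y0\<in>Y. ennreal (C y0 * ?X))"
      by (intro mult_left_mono sum_mono C h) simp
    also have "(\<Sum>y0\<in>Y. ennreal (C y0 * ?X)) = ennreal ((\<Sum>y0\<in>Y. C y0) * ?X)"
      unfolding sum_distrib_right by (rule sum_ennreal) (simp add: C0)
    finally show "(\<integral>\<^sup>+ u. ennreal (norm (ft h (\<phi> u)) powr r) * indicator {0..1} u \<partial>lborel)
      \<le> ennreal (K * (\<Sum>y0\<in>Y. C y0) * ?X)"
      using K by (simp add: ennreal_mult' mult.assoc)
  next
    show "0 \<le> K * (\<Sum>y0\<in>Y. C y0)"
      by (intro mult_nonneg_nonneg K sum_nonneg C0)
  qed
qed

text \<open>After translation by \<open>y0\<close> the window lies in \<open>{-L..L}\<close> with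
  \<open>L = \<bar>M\<bar> + \<bar>y0\<bar>\<close>, and the power is integrable on either side of
  0.\<close>

lemma integrable_powr_window:
  assumes c: "0 \<le> c" "c < 1"
  shows "integrable lborel (\<lambda>y::real. \<bar>y - y0\<bar> powr (-c) * indicator {-M..M} y)"
proof (rule integrableI_bounded)
  define L where "L = \<bar>M\<bar> + \<bar>y0\<bar>"
  have "L \<ge> 0" by (simp add: L_def)
  have p: "(\<integral>\<^sup>+ y. ennreal (\<bar>y\<bar> powr (-c)) * indicator {0..L} y \<partial>lborel) = ennreal (L powr (-c + 1) / (-c + 1))"
  proof -
    have "(\<integral>\<^sup>+ y. ennreal (\<bar>y\<bar> powr (-c)) * indicator {0..L} y \<partial>lborel) = (\<integral>\<^sup>+ y. ennreal (y powr (-c)) * indicator {0..L} y \<partial>lborel)"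
      by (intro nn_integral_cong) (auto simp: indicator_def)
    then show ?thesis using nn_integral_powr_Icc[of "-c" L] c \<open>L \<ge> 0\<close> by simp
  qed
  have "(\<integral>\<^sup>+ y. ennreal (\<bar>y\<bar> powr (-c)) * indicator {-L..0} y \<partial>lborel)
      = (\<integral>\<^sup>+ y. ennreal (\<bar>-y\<bar> powr (-c)) * indicator {-L..0} (-y) \<partial>lborel)"
    by (subst nn_integral_real_affine[where c = "-1" and t = 0]) auto
  also have "\<dots> = (\<integral>\<^sup>+ y. ennreal (\<bar>y\<bar> powr (-c)) * indicator {0..L} y \<partial>lborel)"
    by (intro nn_integral_cong) (auto simp: indicator_def)
  finally have m: "(\<integral>\<^sup>+ y. ennreal (\<bar>y\<bar> powr (-c)) * indicator {-L..0} y \<partial>lborel) = ennreal (L powr (-c + 1) / (-c + 1))"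
    by (simp add: p)
  have "(\<integral>\<^sup>+ y. ennreal (norm (\<bar>y - y0\<bar> powr (-c) * indicator {-M..M} y)) \<partial>lborel)
    = (\<integral>\<^sup>+ y. ennreal (norm (\<bar>(y0 + 1 * y) - y0\<bar> powr (-c) * indicator {-M..M} (y0 + 1 * y))) \<partial>lborel)"
    by (subst nn_integral_real_affine[where c = 1 and t = y0]) auto
  also have "\<dots> \<le> (\<integral>\<^sup>+ y. ennreal (\<bar>y\<bar> powr (-c)) * indicator {-L..0} y + ennreal (\<bar>y\<bar> powr (-c)) * indicator {0..L} y \<partial>lborel)"
    by (intro nn_integral_mono) (auto simp: indicator_def L_def abs_if split: if_splits)
  also have "\<dots> = ennreal (L powr (-c + 1) / (-c + 1)) + ennreal (L powr (-c + 1) / (-c + 1))"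
    by (subst nn_integral_add) (simp_all only: p m, measurable)
  also have "\<dots> < \<infinity>" by simp
  finally show "(\<integral>\<^sup>+ y. ennreal (norm (\<bar>y - y0\<bar> powr (-c) * indicator {-M..M} y)) \<partial>lborel) < \<infinity>" .
qed measurable

text \<open>Hoelder's inequality with exponents \<open>a = q / r\<close> and
  \<open>b = a / (a - 1)\<close>. As \<open>a > 2\<close>, the weight is raised to a power
  \<open>b < 2\<close>, and \<open>\<bar>y - y0\<bar> powr (-(b/2))\<close> is locally integrable;
  the window \<open>{-M..M}\<close> removes the divergence at infinity.\<close>

lemma hausdorff_young_weighted:
  assumes q: "q > 2 * r" and r: "r > 1" and qP: "1/q + 1/P = 1"
  shows "\<exists>C\<ge>0. \<forall>h. bdd_cpt h \<longrightarrow>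
      (\<integral>\<^sup>+ y. ennreal (norm (ft h y) powr r) * indicator {-M..M} y * ennreal (\<bar>y - y0\<bar> powr (-1/2)) \<partial>lborel)
        \<le> ennreal (C * (\<integral>s. norm (h s) powr P \<partial>lborel) powr (r / P))"
proof -
  obtain C where "C \<ge> 0" and C: "\<And>h. bdd_cpt h \<Longrightarrow>
    (\<integral>\<^sup>+ y. ennreal (norm (ft h y) powr q) \<partial>lborel) \<le> ennreal (C * (\<integral>s. norm (h s) powr P \<partial>lborel) powr (q / P))"
    using hausdorff_young[of q P] q r qP by fastforce
  define a where "a = q / r"
  define b where "b = a / (a - 1)"
  have a: "a > 2" using q r by (simp add: a_def field_simps)
  have b: "b > 1" "b < 2" using a by (auto simp: b_def field_simps)
  have ab: "1/a + 1/b = 1" using a by (simp add: b_def field_simps)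
  define g where "g = (\<lambda>y. \<bar>y - y0\<bar> powr (-1/2) * indicator {-M..M} y)"
  have [measurable]: "g \<in> borel_measurable borel" unfolding g_def by measurable
  have gb: "g y powr b = \<bar>y - y0\<bar> powr (-(b/2)) * indicator {-M..M} y" for y
    using b by (auto simp: g_def indicator_def powr_powr)
  have intg: "integrable lborel (\<lambda>y. g y powr b)"
    unfolding gb using b by (intro integrable_powr_window) auto
  define D where "D = (\<integral>y. g y powr b \<partial>lborel) powr (1/b)"
  show ?thesis
  proof (intro exI[of _ "C powr (1/a) * D"] conjI allI impI)
    fix h assume h: "bdd_cpt h"
    have [measurable]: "ft h \<in> borel_measurable borel" by (rule measurable_ft[OF h])
    let ?X = "\<integral>s. norm (h s) powr P \<partial>lborel"
    define f where "f = (\<lambda>y. norm (ft h y) powr r * indicator {-M..M} y)"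
    have [measurable]: "f \<in> borel_measurable borel" unfolding f_def by measurable
    have fa: "f y powr a = norm (ft h y) powr q * indicator {-M..M} y" for y
      using r a by (auto simp: f_def indicator_def powr_powr a_def)
    have intf: "integrable lborel (\<lambda>y. f y powr a)"
    proof (rule integrable_bdd_cpt[where B = "(\<integral>s. norm (h s) \<partial>lborel) powr q" and R = "\<bar>M\<bar>"])
      fix y
      show "norm (f y powr a) \<le> (\<integral>s. norm (h s) \<partial>lborel) powr q"
        unfolding fa using norm_ft_le[OF h, of y] q r by (auto simp: indicator_def intro!: powr_mono2)
      show "\<bar>M\<bar> < \<bar>y\<bar> \<Longrightarrow> f y powr a = 0" unfolding fa by (auto simp: indicator_def)
    qed measurable
    have "ennreal (\<integral>y. f y powr a \<partial>lborel) = (\<integral>\<^sup>+y. ennreal (f y powr a) \<partial>lborel)"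
      using intf by (intro nn_integral_eq_integral[symmetric]) auto
    also have "\<dots> \<le> (\<integral>\<^sup>+y. ennreal (norm (ft h y) powr q) \<partial>lborel)"
      unfolding fa by (intro nn_integral_mono ennreal_leI) (auto simp: indicator_def)
    also have "\<dots> \<le> ennreal (C * ?X powr (q / P))" by (rule C[OF h])
    finally have fX: "(\<integral>y. f y powr a \<partial>lborel) \<le> C * ?X powr (q / P)"
      using \<open>C \<ge> 0\<close> by simp
    have "(\<integral>\<^sup>+ y. ennreal (norm (ft h y) powr r) * indicator {-M..M} y * ennreal (\<bar>y - y0\<bar> powr (-1/2)) \<partial>lborel)
      = (\<integral>\<^sup>+ y. ennreal (f y * g y) \<partial>lborel)"
      by (intro nn_integral_cong) (auto simp: f_def g_def indicator_def ennreal_mult)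
    also have "\<dots> \<le> ennreal ((\<integral>y. f y powr a \<partial>lborel) powr (1/a) * D)"
      unfolding D_def by (rule holder_lborel) (use a b ab intf intg in \<open>auto simp: f_def g_def\<close>)
    also have "\<dots> \<le> ennreal ((C * ?X powr (q / P)) powr (1/a) * D)"
      using fX a by (intro ennreal_leI mult_right_mono powr_mono2) (auto simp: D_def)
    also have "(C * ?X powr (q / P)) powr (1/a) = C powr (1/a) * ?X powr (r / P)"
      using \<open>C \<ge> 0\<close> q r by (simp add: powr_mult powr_powr a_def)
    finally show "(\<integral>\<^sup>+ y. ennreal (norm (ft h y) powr r) * indicator {-M..M} y * ennreal (\<bar>y - y0\<bar> powr (-1/2)) \<partial>lborel)
        \<le> ennreal (C powr (1/a) * D * ?X powr (r / P))"
      by (simp add: mult_ac)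
  qed (simp add: D_def)
qed

text \<open>For \<open>q > 2 * r\<close> the phase is confined to a bounded window and the weight
  has room to spare in Hoelder's inequality. For \<open>q = 2 * r\<close> there is none, and the
  weighted Paley inequality takes over.\<close>

lemma restriction_bound_nontransversal:
  assumes push: "\<And>G. G \<in> borel_measurable borel \<Longrightarrow>
      (\<integral>\<^sup>+ u. G (\<phi> u) * indicator {0..1} u \<partial>lborel)
        \<le> ennreal K * (\<Sum>y0\<in>Y. \<integral>\<^sup>+ y. G y * ennreal (\<bar>y - y0\<bar> powr (-1/2)) \<partial>lborel)"
    and K: "K \<ge> 0" and M: "\<And>u. u \<in> {0..1} \<Longrightarrow> \<bar>\<phi> u\<bar> \<le> M"
    and r: "r > 1" and q: "q > 2 * r \<or> q = 2 * r \<and> r \<ge> 3/2" and qP: "1/q + 1/P = 1"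
  shows "restriction_bound \<phi> r P"
proof (cases "q > 2 * r")
  case True
  show ?thesis
    by (rule restriction_bound_of_weighted[OF push K, where S = "{-M..M}"])
      (use hausdorff_young_weighted[OF True r qP] M in \<open>auto simp: abs_le_iff minus_le_iff\<close>)
next
  case False
  then have "q = 2 * r" "r \<ge> 3/2" using q by auto
  obtain C where "C \<ge> 0" and "\<And>h y0. bdd_cpt h \<Longrightarrow>
    (\<integral>\<^sup>+ y. ennreal (norm (ft h y) powr r) * ennreal (\<bar>y - y0\<bar> powr (-1/2)) \<partial>lborel)
      \<le> ennreal (C * (\<integral>s. norm (h s) powr P \<partial>lborel) powr (r / P))"
    using paley_weighted[of r P] \<open>r \<ge> 3/2\<close> qP \<open>q = 2 * r\<close> by blast
  then show ?thesis
    by (intro restriction_bound_of_weighted[OF push K, where S = UNIV]) auto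
qed

section \<open>Push-forward under the phase\<close>

text \<open>Substitution on compact subintervals and monotone convergence, since the derivative is
  controlled only inside the interval and may tend to 0 at an end. The result is an inequality
  because the image is enlarged to the whole line.\<close>

lemma nn_integral_push_Ioo_pos:
  fixes \<phi> \<phi>' :: "real \<Rightarrow> real"
  assumes [measurable]: "\<phi> \<in> borel_measurable borel" "\<phi>' \<in> borel_measurable borel" "G \<in> borel_measurable borel"
    and der: "\<And>u. u \<in> {a<..<b} \<Longrightarrow> (\<phi> has_real_derivative \<phi>' u) (at u)"
    and cont: "continuous_on {a<..<b} \<phi>'" and pos: "\<And>u. u \<in> {a<..<b} \<Longrightarrow> \<phi>' u > 0"
  shows "(\<integral>\<^sup>+ u. G (\<phi> u) * ennreal (\<phi>' u) * indicator {a<..<b} u \<partial>lborel) \<le> (\<integral>\<^sup>+ y. G y \<partial>lborel)"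
proof (cases "a < b")
  case True
  \<comment> \<open>With 3 in the denominator \<open>d n\<close> stays below half the length already
    for \<open>n = 0\<close>, so no subinterval is empty.\<close>
  define d where "d = (\<lambda>n::nat. (b - a) / (real n + 3))"
  have d: "0 < d n" "d n < (b - a) / 2" "m \<le> n \<Longrightarrow> d n \<le> d m" for m n
  proof -
    show "0 < d n" "m \<le> n \<Longrightarrow> d n \<le> d m" using True by (auto simp: d_def intro!: divide_left_mono)
    show "d n < (b - a) / 2" unfolding d_def using True by (intro divide_strict_left_mono) auto
  qed
  have d0: "d \<longlonglongrightarrow> 0"
    unfolding d_def by real_asymp
  let ?I = "\<lambda>n. {a + d n..b - d n}"
  let ?F = "\<lambda>u. G (\<phi> u) * ennreal (\<phi>' u)"
  have "(\<integral>\<^sup>+ u. ?F u * indicator {a<..<b} u \<partial>lborel) = (\<integral>\<^sup>+ u. (SUP n. ?F u * indicator (?I n) u) \<partial>lborel)"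
  proof (intro nn_integral_cong antisym)
    fix u
    show "?F u * indicator {a<..<b} u \<le> (SUP n. ?F u * indicator (?I n) u)"
    proof (cases "u \<in> {a<..<b}")
      case True
      then have "eventually (\<lambda>n. d n < min (u - a) (b - u)) sequentially"
        by (intro order_tendstoD(2)[OF d0]) auto
      then obtain n where "d n < min (u - a) (b - u)" by (auto simp: eventually_sequentially)
      then have "?F u * indicator {a<..<b} u = ?F u * indicator (?I n) u"
        using True by (auto simp: indicator_def)
      also have "\<dots> \<le> (SUP n. ?F u * indicator (?I n) u)" by (rule SUP_upper) simp
      finally show ?thesis .
    qed simp
    show "(SUP n. ?F u * indicator (?I n) u) \<le> ?F u * indicator {a<..<b} u"
    proof (rule SUP_least)
      fix n show "?F u * indicator (?I n) u \<le> ?F u * indicator {a<..<b} u"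
        using d(1)[of n] by (auto simp: indicator_def)
    qed
  qed
  also have "\<dots> = (SUP n. \<integral>\<^sup>+ u. ?F u * indicator (?I n) u \<partial>lborel)"
  proof (rule nn_integral_monotone_convergence_SUP)
    have "?I m \<subseteq> ?I n" if "m \<le> n" for m n using d(3)[OF that] by auto
    then show "incseq (\<lambda>n u. ?F u * indicator (?I n) u)"
      by (fastforce simp: incseq_def le_fun_def indicator_def)
  qed measurable
  also have "\<dots> \<le> (\<integral>\<^sup>+ y. G y \<partial>lborel)"
  proof (rule SUP_least)
    fix n
    have sub: "?I n \<subseteq> {a<..<b}" using d(1)[of n] by auto
    have der_n: "(\<phi> has_real_derivative \<phi>' x) (at x)" and pos_n: "\<phi>' x \<ge> 0" if "x \<in> ?I n" for x
      using der[of x] pos[of x] subsetD[OF sub that] by (auto intro: less_imp_le)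
    have "(\<integral>\<^sup>+x. G x * indicator {\<phi> (a + d n)..\<phi> (b - d n)} x \<partial>lborel) = (\<integral>\<^sup>+ u. ?F u * indicator (?I n) u \<partial>lborel)"
      by (rule nn_integral_substitution_aux[OF _ _ der_n continuous_on_subset[OF cont sub] pos_n])
        (use d(2)[of n] in \<open>auto simp: field_simps\<close>)
    then have "(\<integral>\<^sup>+ u. ?F u * indicator (?I n) u \<partial>lborel) = (\<integral>\<^sup>+x. G x * indicator {\<phi> (a + d n)..\<phi> (b - d n)} x \<partial>lborel)" ..
    also have "\<dots> \<le> (\<integral>\<^sup>+ y. G y \<partial>lborel)"
      by (intro nn_integral_mono) (auto simp: indicator_def)
    finally show "(\<integral>\<^sup>+ u. ?F u * indicator (?I n) u \<partial>lborel) \<le> (\<integral>\<^sup>+ y. G y \<partial>lborel)" .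
  qed
  finally show ?thesis .
qed simp

text \<open>A decreasing phase becomes an increasing one by reflecting the image.\<close>

lemma nn_integral_push_Ioo:
  fixes \<phi> \<phi>' :: "real \<Rightarrow> real"
  assumes m [measurable]: "\<phi> \<in> borel_measurable borel" "\<phi>' \<in> borel_measurable borel" "G \<in> borel_measurable borel"
    and der: "\<And>u. u \<in> {a<..<b} \<Longrightarrow> (\<phi> has_real_derivative \<phi>' u) (at u)"
    and cont: "continuous_on {a<..<b} \<phi>'" 
    and sgn: "(\<forall>u\<in>{a<..<b}. \<phi>' u > 0) \<or> (\<forall>u\<in>{a<..<b}. \<phi>' u < 0)"
  shows "(\<integral>\<^sup>+ u. G (\<phi> u) * ennreal \<bar>\<phi>' u\<bar> * indicator {a<..<b} u \<partial>lborel) \<le> (\<integral>\<^sup>+ y. G y \<partial>lborel)"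
  using sgn
proof
  assume "\<forall>u\<in>{a<..<b}. \<phi>' u > 0"
  then have "(\<integral>\<^sup>+ u. G (\<phi> u) * ennreal \<bar>\<phi>' u\<bar> * indicator {a<..<b} u \<partial>lborel)
      = (\<integral>\<^sup>+ u. G (\<phi> u) * ennreal (\<phi>' u) * indicator {a<..<b} u \<partial>lborel)"
    by (intro nn_integral_cong) (auto simp: indicator_def abs_of_pos)
  then show ?thesis
    using nn_integral_push_Ioo_pos[OF m der cont] \<open>\<forall>u\<in>{a<..<b}. \<phi>' u > 0\<close> by auto
next
  assume neg: "\<forall>u\<in>{a<..<b}. \<phi>' u < 0"
  have "(\<integral>\<^sup>+ u. G (\<phi> u) * ennreal \<bar>\<phi>' u\<bar> * indicator {a<..<b} u \<partial>lborel)
      = (\<integral>\<^sup>+ u. G (- (- \<phi> u)) * ennreal (- \<phi>' u) * indicator {a<..<b} u \<partial>lborel)"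
    using neg by (intro nn_integral_cong) (auto simp: indicator_def abs_of_neg)
  also have "\<dots> \<le> (\<integral>\<^sup>+ y. G (- y) \<partial>lborel)"
    by (rule nn_integral_push_Ioo_pos[where G = "\<lambda>y. G (- y)"])
      (use neg in \<open>auto intro!: derivative_eq_intros der continuous_intros cont\<close>)
  also have "\<dots> = (\<integral>\<^sup>+ y. G y \<partial>lborel)"
    by (subst (2) nn_integral_real_affine[where c = "-1" and t = 0]) auto
  finally show ?thesis .
qed

text \<open>The hypothesis on \<open>w\<close> supplies the missing Jacobian: up to the factor
  \<open>K\<close>, \<open>w (\<phi> u)\<close> dominates the reciprocal of the derivative. It is
  applied with \<open>w = 1\<close> at regular points and with
  \<open>w y = \<bar>y - \<phi> u0\<bar> powr (-1/2)\<close> at critical ones.\<close>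

lemma nn_integral_push_weighted:
  fixes \<phi> \<phi>' :: "real \<Rightarrow> real"
  assumes m [measurable]: "\<phi> \<in> borel_measurable borel" "\<phi>' \<in> borel_measurable borel" "G \<in> borel_measurable borel" 
      "w \<in> borel_measurable borel"
    and der: "\<And>u. u \<in> {a<..<b} \<Longrightarrow> (\<phi> has_real_derivative \<phi>' u) (at u)"
    and cont: "continuous_on {a<..<b} \<phi>'" 
    and sgn: "(\<forall>u\<in>{a<..<b}. \<phi>' u > 0) \<or> (\<forall>u\<in>{a<..<b}. \<phi>' u < 0)"
    and w: "\<And>u. u \<in> {a<..<b} \<Longrightarrow> 1 \<le> K * (w (\<phi> u) * \<bar>\<phi>' u\<bar>)" and K: "K \<ge> 0"
    and w0: "\<And>y. w y \<ge> 0"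
  shows "(\<integral>\<^sup>+ u. G (\<phi> u) * indicator {a<..<b} u \<partial>lborel) \<le> ennreal K * (\<integral>\<^sup>+ y. G y * ennreal (w y) \<partial>lborel)"
proof -
  have "(\<integral>\<^sup>+ u. G (\<phi> u) * indicator {a<..<b} u \<partial>lborel)
    \<le> (\<integral>\<^sup>+ u. ennreal K * ((G (\<phi> u) * ennreal (w (\<phi> u))) * ennreal \<bar>\<phi>' u\<bar> * indicator {a<..<b} u) \<partial>lborel)"
  proof (rule nn_integral_mono)
    fix u
    show "G (\<phi> u) * indicator {a<..<b} u \<le> ennreal K * ((G (\<phi> u) * ennreal (w (\<phi> u))) * ennreal \<bar>\<phi>' u\<bar> * indicator {a<..<b} u)"
    proof (cases "u \<in> {a<..<b}")
      case True
      have "ennreal 1 \<le> ennreal (K * (w (\<phi> u) * \<bar>\<phi>' u\<bar>))" using w[OF True] by (rule ennreal_leI)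
      also have "\<dots> = ennreal K * (ennreal (w (\<phi> u)) * ennreal \<bar>\<phi>' u\<bar>)"
        using K w0 by (simp add: ennreal_mult)
      finally have "G (\<phi> u) * 1 \<le> G (\<phi> u) * (ennreal K * (ennreal (w (\<phi> u)) * ennreal \<bar>\<phi>' u\<bar>))"
        by (intro mult_left_mono) auto
      then show ?thesis using True by (simp add: mult_ac)
    qed simp
  qed
  also have "\<dots> = ennreal K * (\<integral>\<^sup>+ u. (G (\<phi> u) * ennreal (w (\<phi> u))) * ennreal \<bar>\<phi>' u\<bar> * indicator {a<..<b} u \<partial>lborel)"
    by (rule nn_integral_cmult) measurable
  also have "\<dots> \<le> ennreal K * (\<integral>\<^sup>+ y. G y * ennreal (w y) \<partial>lborel)"
    by (intro mult_left_mono nn_integral_push_Ioo[where G = "\<lambda>y. G y * ennreal (w y)", OF _ _ _ der cont sgn]) auto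
  finally show ?thesis .
qed

text \<open>By continuity the derivative keeps its sign and at least half its size near
  \<open>u0\<close>; the two ends of the parameter interval are null sets.\<close>

lemma push_local_regular:
  fixes \<phi> \<phi>' :: "real \<Rightarrow> real"
  assumes m [measurable]: "\<phi> \<in> borel_measurable borel" "\<phi>' \<in> borel_measurable borel"
    and der: "\<And>u. u \<in> {0..1} \<Longrightarrow> (\<phi> has_real_derivative \<phi>' u) (at u within {0..1})"
    and cont: "continuous_on {0..1} \<phi>'" and u0: "u0 \<in> {0..1}" "\<phi>' u0 \<noteq> 0"
  shows "\<exists>\<epsilon>>0. \<exists>K\<ge>0. \<forall>G. G \<in> borel_measurable borel \<longrightarrow>
    (\<integral>\<^sup>+ u. G (\<phi> u) * indicator ({0..1} \<inter> ball u0 \<epsilon>) u \<partial>lborel) \<le> ennreal K * (\<integral>\<^sup>+ y. G y \<partial>lborel)"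
proof -
  define c where "c = \<bar>\<phi>' u0\<bar> / 2"
  have "c > 0" using u0 by (simp add: c_def)
  obtain \<epsilon> where "\<epsilon> > 0" and \<epsilon>: "\<And>u. u \<in> {0..1} \<Longrightarrow> dist u u0 < \<epsilon> \<Longrightarrow> dist (\<phi>' u) (\<phi>' u0) < c"
    using cont u0 \<open>c > 0\<close> unfolding continuous_on_iff by blast
  define a b where "a = max 0 (u0 - \<epsilon>)" and "b = min 1 (u0 + \<epsilon>)"
  have ab: "u \<in> {0<..<1}" "dist u u0 < \<epsilon>" if "u \<in> {a<..<b}" for u
    using that by (auto simp: a_def b_def dist_real_def)
  have near: "\<bar>\<phi>' u - \<phi>' u0\<bar> < c" if "u \<in> {a<..<b}" for u
    using \<epsilon>[of u] ab[OF that] by (auto simp: dist_real_def)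
  have sgn: "(\<forall>u\<in>{a<..<b}. \<phi>' u > 0) \<or> (\<forall>u\<in>{a<..<b}. \<phi>' u < 0)"
  proof (cases "\<phi>' u0 > 0")
    case True
    have "\<phi>' u > 0" if "u \<in> {a<..<b}" for u
      using near[OF that] True unfolding c_def by (auto simp: abs_if split: if_splits)
    then show ?thesis by blast
  next
    case False
    have "\<phi>' u < 0" if "u \<in> {a<..<b}" for u
      using near[OF that] False u0(2) unfolding c_def by (auto simp: abs_if split: if_splits)
    then show ?thesis by blast
  qed
  have low: "1 \<le> 1/c * (1 * \<bar>\<phi>' u\<bar>)" if "u \<in> {a<..<b}" for u
  proof -
    have "c \<le> \<bar>\<phi>' u\<bar>" using near[OF that] unfolding c_def by (auto simp: abs_if split: if_splits)
    then show ?thesis using \<open>c > 0\<close> by (simp add: field_simps)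
  qed
  have der': "(\<phi> has_real_derivative \<phi>' u) (at u)" if "u \<in> {a<..<b}" for u
    using der[of u] ab(1)[OF that] by (simp add: at_within_Icc_at)
  have cont': "continuous_on {a<..<b} \<phi>'"
    using cont by (rule continuous_on_subset) (auto simp: a_def b_def)
  show ?thesis
  proof (rule exI[of _ \<epsilon>], rule conjI, fact \<open>\<epsilon> > 0\<close>, rule exI[of _ "1/c"], intro conjI allI impI)
    fix G :: "real \<Rightarrow> ennreal" assume [measurable]: "G \<in> borel_measurable borel"
    have [measurable]: "ball (x::real) e \<in> sets borel" for x e by simp
    have "AE u::real in lborel. u \<noteq> 0 \<and> u \<noteq> 1"
      using AE_lborel_singleton[of "0::real"] AE_lborel_singleton[of "1::real"] by eventually_elim auto
    then have "(\<integral>\<^sup>+ u. G (\<phi> u) * indicator ({0..1} \<inter> ball u0 \<epsilon>) u \<partial>lborel) = (\<integral>\<^sup>+ u. G (\<phi> u) * indicator {a<..<b} u \<partial>lborel)"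
      by (intro nn_integral_cong_AE) (erule eventually_mono, auto simp: indicator_def a_def b_def dist_real_def)
    also have "\<dots> \<le> ennreal (1/c) * (\<integral>\<^sup>+ y. G y * ennreal 1 \<partial>lborel)"
      by (rule nn_integral_push_weighted[OF _ _ _ _ der' cont' sgn low]) (use \<open>c > 0\<close> in auto)
    finally show "(\<integral>\<^sup>+ u. G (\<phi> u) * indicator ({0..1} \<inter> ball u0 \<epsilon>) u \<partial>lborel) \<le> ennreal (1/c) * (\<integral>\<^sup>+ y. G y \<partial>lborel)"
      by simp
  qed (use \<open>c > 0\<close> in auto)
qed

text \<open>With \<open>c = \<bar>D\<bar> / 2\<close>, the modulus of \<open>\<phi>'\<close> lies
  between \<open>c * \<bar>u - u0\<bar>\<close> and \<open>3 * c * \<bar>u - u0\<bar>\<close>. The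
  mean value theorem and the upper bound make the increment of \<open>\<phi>\<close> at most
  quadratic in \<open>\<bar>u - u0\<bar>\<close>, so by the lower bound
  \<open>\<bar>\<phi>' u\<bar>\<close> dominates the square root of that increment: precisely the
  Jacobian that the weight compensates. The two sides of \<open>u0\<close> are treated separately,
  whence the factor 2.\<close>

lemma push_local_critical:
  fixes \<phi> \<phi>' :: "real \<Rightarrow> real"
  assumes m [measurable]: "\<phi> \<in> borel_measurable borel" "\<phi>' \<in> borel_measurable borel"
    and der: "\<And>u. u \<in> {0..1} \<Longrightarrow> (\<phi> has_real_derivative \<phi>' u) (at u within {0..1})"
    and cont: "continuous_on {0..1} \<phi>'" and u0: "u0 \<in> {0..1}" "\<phi>' u0 = 0"
    and der2: "(\<phi>' has_real_derivative D) (at u0 within {0..1})" and D: "D \<noteq> 0"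
  shows "\<exists>\<epsilon>>0. \<exists>K\<ge>0. \<forall>G. G \<in> borel_measurable borel \<longrightarrow>
    (\<integral>\<^sup>+ u. G (\<phi> u) * indicator ({0..1} \<inter> ball u0 \<epsilon>) u \<partial>lborel)
       \<le> ennreal K * (\<integral>\<^sup>+ y. G y * ennreal (\<bar>y - \<phi> u0\<bar> powr (-1/2)) \<partial>lborel)"
proof -
  define c where "c = \<bar>D\<bar> / 2"
  have "c > 0" using D by (simp add: c_def)
  have "(\<phi>' has_derivative (*) D) (at u0 within {0..1})"
    using der2 by (simp add: has_field_derivative_def)
  then obtain \<epsilon> where "\<epsilon> > 0" and \<epsilon>: "\<And>u. u \<in> {0..1} \<Longrightarrow> \<bar>u - u0\<bar> < \<epsilon> \<Longrightarrow> \<bar>\<phi>' u - D * (u - u0)\<bar> \<le> c * \<bar>u - u0\<bar>"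
    using \<open>c > 0\<close> u0 unfolding has_derivative_within_alt by (auto simp: real_norm_def)
  have low: "c * \<bar>u - u0\<bar> \<le> \<bar>\<phi>' u\<bar>" and up: "\<bar>\<phi>' u\<bar> \<le> 3 * c * \<bar>u - u0\<bar>"
    and sg: "\<phi>' u * (D * (u - u0)) > 0 \<or> u = u0"
    if "u \<in> {0..1}" "\<bar>u - u0\<bar> < \<epsilon>" for u
  proof -
    have e: "\<bar>\<phi>' u - D * (u - u0)\<bar> \<le> c * \<bar>u - u0\<bar>" by (rule \<epsilon>[OF that])
    have Dc: "\<bar>D * (u - u0)\<bar> = 2 * (c * \<bar>u - u0\<bar>)" by (simp add: c_def abs_mult)
    show "c * \<bar>u - u0\<bar> \<le> \<bar>\<phi>' u\<bar>" "\<bar>\<phi>' u\<bar> \<le> 3 * c * \<bar>u - u0\<bar>" using e Dc by linarith+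
    show "\<phi>' u * (D * (u - u0)) > 0 \<or> u = u0"
    proof (cases "u = u0")
      case False
      then have "c * \<bar>u - u0\<bar> > 0" using \<open>c > 0\<close> by simp
      then have "\<phi>' u > 0 \<and> D * (u - u0) > 0 \<or> \<phi>' u < 0 \<and> D * (u - u0) < 0"
        using e Dc by linarith
      then show ?thesis by (auto simp: zero_less_mult_iff)
    qed simp
  qed
  \<comment> \<open>Comes from \<open>sqrt \<bar>\<phi> u - \<phi> u0\<bar> \<le> sqrt (3 * c) *
    \<bar>u - u0\<bar>\<close> and
    \<open>c * \<bar>u - u0\<bar> \<le> \<bar>\<phi>' u\<bar>\<close>.\<close>
  define K where "K = sqrt (3 * c) / c"
  have "K \<ge> 0" using \<open>c > 0\<close> by (simp add: K_def)
  define w where "w = (\<lambda>y. \<bar>y - \<phi> u0\<bar> powr (-1/2))"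
  have [measurable]: "w \<in> borel_measurable borel" unfolding w_def by measurable
  have wlow: "1 \<le> K * (w (\<phi> u) * \<bar>\<phi>' u\<bar>)" if u: "u \<in> {0..1}" "\<bar>u - u0\<bar> < \<epsilon>" "u \<noteq> u0" for u
  proof -
    \<comment> \<open>The mean value theorem between \<open>min u u0\<close> and
      \<open>max u u0\<close>, which handles both sides of \<open>u0\<close> at once.\<close>
    have "\<exists>\<xi>. min u u0 < \<xi> \<and> \<xi> < max u u0 \<and> \<bar>\<phi> u - \<phi> u0\<bar> = \<bar>u - u0\<bar> * \<bar>\<phi>' \<xi>\<bar>"
    proof -
      have lt: "min u u0 < max u u0" using u(3) by auto
      have sub: "{min u u0..max u u0} \<subseteq> {0..1}" using u u0 by auto
      have "continuous_on {min u u0..max u u0} \<phi>"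
        by (rule DERIV_continuous_on[OF DERIV_subset[OF der sub]]) (use sub in blast)
      moreover have "(\<phi> has_real_derivative \<phi>' x) (at x)" if "min u u0 < x" "x < max u u0" for x
      proof -
        have "x \<in> {0<..<1}" using that u u0 by (auto simp: min_def max_def split: if_splits)
        then show ?thesis using der[of x] by (simp add: at_within_Icc_at)
      qed
      ultimately obtain l z where "min u u0 < z" "z < max u u0" "(\<phi> has_real_derivative l) (at z)"
          "\<phi> (max u u0) - \<phi> (min u u0) = (max u u0 - min u u0) * l"
        using MVT[OF lt] real_differentiable_def by metis
      moreover have "(\<phi> has_real_derivative \<phi>' z) (at z)"
        using calculation(1,2) \<open>\<And>x. min u u0 < x \<Longrightarrow> x < max u u0 \<Longrightarrow> (\<phi> has_real_derivative \<phi>' x) (at x)\<close> by simp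
      ultimately have "l = \<phi>' z" using DERIV_unique by blast
      with \<open>\<phi> (max u u0) - \<phi> (min u u0) = (max u u0 - min u u0) * l\<close>
      have "\<bar>\<phi> (max u u0) - \<phi> (min u u0)\<bar> = \<bar>max u u0 - min u u0\<bar> * \<bar>\<phi>' z\<bar>"
        by (simp add: abs_mult)
      then have "\<bar>\<phi> u - \<phi> u0\<bar> = \<bar>u - u0\<bar> * \<bar>\<phi>' z\<bar>"
        by (auto simp: min_def max_def abs_minus_commute split: if_splits)
      with \<open>min u u0 < z\<close> \<open>z < max u u0\<close> show ?thesis by blast
    qed
    then obtain \<xi> where \<xi>: "min u u0 < \<xi>" "\<xi> < max u u0" and mv: "\<bar>\<phi> u - \<phi> u0\<bar> = \<bar>u - u0\<bar> * \<bar>\<phi>' \<xi>\<bar>" by blast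
    have \<xi>01: "\<xi> \<in> {0..1}" "\<bar>\<xi> - u0\<bar> < \<epsilon>" "\<xi> \<noteq> u0" "\<bar>\<xi> - u0\<bar> \<le> \<bar>u - u0\<bar>"
      using \<xi> u u0 by (auto simp: min_def max_def split: if_splits)
    have "\<phi>' \<xi> \<noteq> 0" using sg[OF \<xi>01(1,2)] \<xi>01(3) by auto
    then have pos: "\<bar>\<phi> u - \<phi> u0\<bar> > 0" using mv u(3) by simp
    have "\<bar>\<phi>' \<xi>\<bar> \<le> 3 * c * \<bar>u - u0\<bar>"
      using up[OF \<xi>01(1,2)] \<xi>01(4) \<open>c > 0\<close> by (smt (verit) mult_left_mono)
    then have "\<bar>\<phi> u - \<phi> u0\<bar> \<le> \<bar>u - u0\<bar> * (3 * c * \<bar>u - u0\<bar>)"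
      unfolding mv by (intro mult_left_mono) auto
    then have "sqrt \<bar>\<phi> u - \<phi> u0\<bar> \<le> sqrt (3 * c * (\<bar>u - u0\<bar>)\<^sup>2)"
      by (intro real_sqrt_le_mono) (simp add: power2_eq_square mult_ac)
    also have "\<dots> = sqrt (3 * c) * \<bar>u - u0\<bar>" by (simp add: real_sqrt_mult)
    also have "\<dots> = K * (c * \<bar>u - u0\<bar>)" using \<open>c > 0\<close> by (simp add: K_def)
    also have "\<dots> \<le> K * \<bar>\<phi>' u\<bar>" using low[OF u(1,2)] \<open>K \<ge> 0\<close> by (rule mult_left_mono)
    finally have "1 \<le> (K * \<bar>\<phi>' u\<bar>) / sqrt \<bar>\<phi> u - \<phi> u0\<bar>"
      using pos by (subst le_divide_eq_1_pos) auto
    moreover have "w (\<phi> u) = 1 / sqrt \<bar>\<phi> u - \<phi> u0\<bar>"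
      by (simp add: w_def powr_minus_divide powr_half_sqrt)
    ultimately show ?thesis by (simp add: mult_ac)
  qed
  define a b where "a = max 0 (u0 - \<epsilon>)" and "b = min 1 (u0 + \<epsilon>)"
  have in_a: "u \<in> {0<..<1}" "u \<in> {0..1}" "\<bar>u - u0\<bar> < \<epsilon>" "u < u0" if "u \<in> {a<..<u0}" for u
    using that u0 by (auto simp: a_def)
  have in_b: "u \<in> {0<..<1}" "u \<in> {0..1}" "\<bar>u - u0\<bar> < \<epsilon>" "u > u0" if "u \<in> {u0<..<b}" for u
    using that u0 by (auto simp: b_def)
  have sgn_a: "(\<forall>u\<in>{a<..<u0}. \<phi>' u > 0) \<or> (\<forall>u\<in>{a<..<u0}. \<phi>' u < 0)"
  proof (cases "D > 0")
    case True
    then have "\<phi>' u < 0" if "u \<in> {a<..<u0}" for u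
      using sg[OF in_a(2,3)[OF that]] in_a(4)[OF that] D by (auto simp: zero_less_mult_iff mult_less_0_iff)
    then show ?thesis by blast
  next
    case False
    then have "\<phi>' u > 0" if "u \<in> {a<..<u0}" for u
      using sg[OF in_a(2,3)[OF that]] in_a(4)[OF that] D by (auto simp: zero_less_mult_iff mult_less_0_iff)
    then show ?thesis by blast
  qed
  have sgn_b: "(\<forall>u\<in>{u0<..<b}. \<phi>' u > 0) \<or> (\<forall>u\<in>{u0<..<b}. \<phi>' u < 0)"
  proof (cases "D > 0")
    case True
    then have "\<phi>' u > 0" if "u \<in> {u0<..<b}" for u
      using sg[OF in_b(2,3)[OF that]] in_b(4)[OF that] D by (auto simp: zero_less_mult_iff mult_less_0_iff)
    then show ?thesis by blast
  next
    case False
    then have "\<phi>' u < 0" if "u \<in> {u0<..<b}" for u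
      using sg[OF in_b(2,3)[OF that]] in_b(4)[OF that] D by (auto simp: zero_less_mult_iff mult_less_0_iff)
    then show ?thesis by blast
  qed
  have der': "(\<phi> has_real_derivative \<phi>' u) (at u)" if "u \<in> {0<..<1}" for u
    using der[of u] that by (simp add: at_within_Icc_at)
  show ?thesis
  proof (rule exI[of _ \<epsilon>], rule conjI, fact \<open>\<epsilon> > 0\<close>, rule exI[of _ "2 * K"], intro conjI allI impI)
    fix G :: "real \<Rightarrow> ennreal" assume [measurable]: "G \<in> borel_measurable borel"
    have [measurable]: "ball (x::real) e \<in> sets borel" for x e by simp
    let ?I = "\<integral>\<^sup>+ y. G y * ennreal (w y) \<partial>lborel"
    have "AE u in lborel. u \<noteq> 0 \<and> u \<noteq> 1 \<and> u \<noteq> u0"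
      using AE_lborel_singleton[of "0::real"] AE_lborel_singleton[of "1::real"] AE_lborel_singleton[of u0] by eventually_elim auto
    then have "(\<integral>\<^sup>+ u. G (\<phi> u) * indicator ({0..1} \<inter> ball u0 \<epsilon>) u \<partial>lborel)
        = (\<integral>\<^sup>+ u. G (\<phi> u) * indicator {a<..<u0} u + G (\<phi> u) * indicator {u0<..<b} u \<partial>lborel)"
      using u0 by (intro nn_integral_cong_AE) (erule eventually_mono, auto simp: indicator_def a_def b_def dist_real_def)
    also have "\<dots> = (\<integral>\<^sup>+ u. G (\<phi> u) * indicator {a<..<u0} u \<partial>lborel) + (\<integral>\<^sup>+ u. G (\<phi> u) * indicator {u0<..<b} u \<partial>lborel)"
      by (rule nn_integral_add) measurable
    also have "\<dots> \<le> ennreal K * ?I + ennreal K * ?I"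
    proof (intro add_mono)
      show "(\<integral>\<^sup>+ u. G (\<phi> u) * indicator {a<..<u0} u \<partial>lborel) \<le> ennreal K * ?I"
      proof (rule nn_integral_push_weighted[OF _ _ _ _ _ _ sgn_a])
        show "continuous_on {a<..<u0} \<phi>'" using cont in_a(2) by (rule continuous_on_subset[OF _ subsetI])
        show "1 \<le> K * (w (\<phi> u) * \<bar>\<phi>' u\<bar>)" if "u \<in> {a<..<u0}" for u
          using wlow[of u] in_a[OF that] by auto
      qed (use \<open>K \<ge> 0\<close> der' in_a(1) in \<open>auto simp: w_def\<close>)
      show "(\<integral>\<^sup>+ u. G (\<phi> u) * indicator {u0<..<b} u \<partial>lborel) \<le> ennreal K * ?I"
      proof (rule nn_integral_push_weighted[OF _ _ _ _ _ _ sgn_b])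
        show "continuous_on {u0<..<b} \<phi>'" using cont in_b(2) by (rule continuous_on_subset[OF _ subsetI])
        show "1 \<le> K * (w (\<phi> u) * \<bar>\<phi>' u\<bar>)" if "u \<in> {u0<..<b}" for u
          using wlow[of u] in_b[OF that] by auto
      qed (use \<open>K \<ge> 0\<close> der' in_b(1) in \<open>auto simp: w_def\<close>)
    qed
    also have "\<dots> = ennreal (2 * K) * ?I"
      using \<open>K \<ge> 0\<close> by (simp add: distrib_right[symmetric] ennreal_plus[symmetric] del: ennreal_plus)
    finally show "(\<integral>\<^sup>+ u. G (\<phi> u) * indicator ({0..1} \<inter> ball u0 \<epsilon>) u \<partial>lborel)
       \<le> ennreal (2 * K) * (\<integral>\<^sup>+ y. G y * ennreal (\<bar>y - \<phi> u0\<bar> powr (-1/2)) \<partial>lborel)"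
      by (simp add: w_def)
  qed (use \<open>K \<ge> 0\<close> in auto)
qed

text \<open>Compactness of the parameter interval. The functional \<open>J\<close> is left abstract
  to serve both cases. Each local bound is weakened to the sum over all values of the phase at the
  centres, which leaves a single constant, the sum of the local ones.\<close>

lemma push_globalize:
  fixes \<phi> :: "real \<Rightarrow> real" and J :: "(real \<Rightarrow> ennreal) \<Rightarrow> real \<Rightarrow> ennreal"
  assumes [measurable]: "\<phi> \<in> borel_measurable borel"
    and loc: "\<And>u0. u0 \<in> {0..1} \<Longrightarrow> \<exists>\<epsilon>>0. \<exists>K\<ge>0. \<forall>G. G \<in> borel_measurable borel \<longrightarrow>
      (\<integral>\<^sup>+ u. G (\<phi> u) * indicator ({0..1} \<inter> ball u0 \<epsilon>) u \<partial>lborel) \<le> ennreal K * J G (\<phi> u0)"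
  shows "\<exists>K\<ge>0. \<exists>Y. finite Y \<and> (\<forall>G. G \<in> borel_measurable borel \<longrightarrow>
      (\<integral>\<^sup>+ u. G (\<phi> u) * indicator {0..1} u \<partial>lborel) \<le> ennreal K * (\<Sum>y0\<in>Y. J G y0))"
proof -
  obtain \<epsilon> K where \<epsilon>: "\<And>u0. u0 \<in> {0..1} \<Longrightarrow> \<epsilon> u0 > (0::real)" and K: "\<And>u0. u0 \<in> {0..1} \<Longrightarrow> K u0 \<ge> (0::real)"
    and b: "\<And>u0 G. u0 \<in> {0..1} \<Longrightarrow> G \<in> borel_measurable borel \<Longrightarrow> 
       (\<integral>\<^sup>+ u. G (\<phi> u) * indicator ({0..1} \<inter> ball u0 (\<epsilon> u0)) u \<partial>lborel) \<le> ennreal (K u0) * J G (\<phi> u0)"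
  proof -
    have "\<forall>u0\<in>{0..1}. \<exists>z. fst z > 0 \<and> snd z \<ge> (0::real) \<and> (\<forall>G. G \<in> borel_measurable borel \<longrightarrow>
      (\<integral>\<^sup>+ u. G (\<phi> u) * indicator ({0..1} \<inter> ball u0 (fst z)) u \<partial>lborel) \<le> ennreal (snd z) * J G (\<phi> u0))"
      using loc by simp
    from bchoice[OF this] obtain z where z: "\<forall>u0\<in>{0..1}. fst (z u0) > 0 \<and> snd (z u0) \<ge> (0::real) \<and> (\<forall>G. G \<in> borel_measurable borel \<longrightarrow>
      (\<integral>\<^sup>+ u. G (\<phi> u) * indicator ({0..1} \<inter> ball u0 (fst (z u0))) u \<partial>lborel) \<le> ennreal (snd (z u0)) * J G (\<phi> u0))" ..
    show ?thesis by (rule that[of "\<lambda>u. fst (z u)" "\<lambda>u. snd (z u)"]) (use z in blast)+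
  qed
  obtain T where T: "T \<subseteq> {0..1}" "finite T" "{0..1} \<subseteq> (\<Union>u0\<in>T. ball u0 (\<epsilon> u0))"
  proof (rule compactE_image[of "{0..1::real}" "{0..1}" "\<lambda>u. ball u (\<epsilon> u)"])
    show "{0..1} \<subseteq> (\<Union>u\<in>{0..1}. ball u (\<epsilon> u))"
    proof
      fix u :: real assume "u \<in> {0..1}"
      then show "u \<in> (\<Union>u\<in>{0..1}. ball u (\<epsilon> u))" using \<epsilon>[of u] by (intro UN_I[of u]) auto
    qed
  qed (use that in auto)
  show ?thesis
  proof (intro exI[of _ "\<Sum>u0\<in>T. K u0"] exI[of _ "\<phi> ` T"] conjI allI impI)
    show "0 \<le> (\<Sum>u0\<in>T. K u0)" using T K by (intro sum_nonneg) auto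
    fix G :: "real \<Rightarrow> ennreal" assume [measurable]: "G \<in> borel_measurable borel"
    have [measurable]: "ball (x::real) e \<in> sets borel" for x e by simp
    have "(\<integral>\<^sup>+ u. G (\<phi> u) * indicator {0..1} u \<partial>lborel)
       \<le> (\<integral>\<^sup>+ u. (\<Sum>u0\<in>T. G (\<phi> u) * indicator ({0..1} \<inter> ball u0 (\<epsilon> u0)) u) \<partial>lborel)"
    proof (rule nn_integral_mono)
      fix u
      show "G (\<phi> u) * indicator {0..1} u \<le> (\<Sum>u0\<in>T. G (\<phi> u) * indicator ({0..1} \<inter> ball u0 (\<epsilon> u0)) u)"
      proof (cases "u \<in> {0..1}")
        case True
        then obtain u0 where "u0 \<in> T" "u \<in> ball u0 (\<epsilon> u0)" using T by blast
        then have "G (\<phi> u) * indicator {0..1} u = G (\<phi> u) * indicator ({0..1} \<inter> ball u0 (\<epsilon> u0)) u"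
          by (auto simp: indicator_def)
        also have "\<dots> \<le> (\<Sum>u0\<in>T. G (\<phi> u) * indicator ({0..1} \<inter> ball u0 (\<epsilon> u0)) u)"
          using \<open>u0 \<in> T\<close> \<open>finite T\<close> by (intro member_le_sum) auto
        finally show ?thesis .
      qed simp
    qed
    also have "\<dots> = (\<Sum>u0\<in>T. \<integral>\<^sup>+ u. G (\<phi> u) * indicator ({0..1} \<inter> ball u0 (\<epsilon> u0)) u \<partial>lborel)"
      by (rule nn_integral_sum) measurable
    also have "\<dots> \<le> (\<Sum>u0\<in>T. ennreal (K u0) * (\<Sum>y0\<in>\<phi> ` T. J G y0))"
    proof (rule sum_mono)
      fix u0 assume "u0 \<in> T"
      then have "u0 \<in> {0..1}" using T by auto
      have "J G (\<phi> u0) \<le> (\<Sum>y0\<in>\<phi> ` T. J G y0)"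
        using \<open>u0 \<in> T\<close> \<open>finite T\<close> by (intro member_le_sum) auto
      then show "(\<integral>\<^sup>+ u. G (\<phi> u) * indicator ({0..1} \<inter> ball u0 (\<epsilon> u0)) u \<partial>lborel) \<le> ennreal (K u0) * (\<Sum>y0\<in>\<phi> ` T. J G y0)"
        using b[OF \<open>u0 \<in> {0..1}\<close>, of G] by (meson \<open>G \<in> borel_measurable borel\<close> mult_left_mono order_trans zero_le)
    qed
    also have "\<dots> = ennreal (\<Sum>u0\<in>T. K u0) * (\<Sum>y0\<in>\<phi> ` T. J G y0)"
      using T K by (subst sum_ennreal[symmetric]) (auto simp: sum_distrib_right)
    finally show "(\<integral>\<^sup>+ u. G (\<phi> u) * indicator {0..1} u \<partial>lborel) \<le> ennreal (\<Sum>u0\<in>T. K u0) * (\<Sum>y0\<in>\<phi> ` T. J G y0)" .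
  qed (use T in simp)
qed

text \<open>Here the local functional is the same at every point, so the sum over \<open>Y\<close>
  merely multiplies the constant by the number of values.\<close>

lemma push_transversal:
  fixes \<phi> \<phi>' :: "real \<Rightarrow> real"
  assumes m: "\<phi> \<in> borel_measurable borel" "\<phi>' \<in> borel_measurable borel"
    and der: "\<And>u. u \<in> {0..1} \<Longrightarrow> (\<phi> has_real_derivative \<phi>' u) (at u within {0..1})"
    and cont: "continuous_on {0..1} \<phi>'" and nz: "\<And>u. u \<in> {0..1} \<Longrightarrow> \<phi>' u \<noteq> 0"
  shows "\<exists>K\<ge>0. \<forall>G. G \<in> borel_measurable borel \<longrightarrow>
      (\<integral>\<^sup>+ u. G (\<phi> u) * indicator {0..1} u \<partial>lborel) \<le> ennreal K * (\<integral>\<^sup>+ y. G y \<partial>lborel)"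
proof -
  obtain K and Y :: "real set" where "K \<ge> 0" "finite Y" and KY: "\<And>G. G \<in> borel_measurable borel \<Longrightarrow>
      (\<integral>\<^sup>+ u. G (\<phi> u) * indicator {0..1} u \<partial>lborel) \<le> ennreal K * (\<Sum>y0\<in>Y. \<integral>\<^sup>+ y. G y \<partial>lborel)"
  proof -
    have "\<exists>K\<ge>0. \<exists>Y :: real set. finite Y \<and> (\<forall>G. G \<in> borel_measurable borel \<longrightarrow>
      (\<integral>\<^sup>+ u. G (\<phi> u) * indicator {0..1} u \<partial>lborel) \<le> ennreal K * (\<Sum>y0\<in>Y. \<integral>\<^sup>+ y. G y \<partial>lborel))"
      by (rule push_globalize[OF m(1), where J = "\<lambda>G y0. \<integral>\<^sup>+ y. G y \<partial>lborel"])
        (rule push_local_regular[OF m der cont _ nz])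
    then show ?thesis using that by blast
  qed
  show ?thesis
  proof (intro exI[of _ "K * real (card Y)"] conjI allI impI)
    fix G :: "real \<Rightarrow> ennreal" assume "G \<in> borel_measurable borel"
    from KY[OF this] show "(\<integral>\<^sup>+ u. G (\<phi> u) * indicator {0..1} u \<partial>lborel) \<le> ennreal (K * real (card Y)) * (\<integral>\<^sup>+ y. G y \<partial>lborel)"
      using \<open>K \<ge> 0\<close> by (simp add: ennreal_mult mult.assoc ennreal_of_nat_eq_real_of_nat)
  qed (use \<open>K \<ge> 0\<close> in simp)
qed

text \<open>At a regular point the local bound carries no weight, but one can be inserted:
  \<open>y\<close> and \<open>\<phi> u0\<close> both lie in \<open>{-M..M}\<close>, so
  \<open>\<bar>y - \<phi> u0\<bar> \<le> 2 * M\<close>, and \<open>sqrt (2 * M)\<close> times the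
  weight is at least 1 unless \<open>y = \<phi> u0\<close>.\<close>

lemma push_nontransversal:
  fixes \<phi> \<phi>' :: "real \<Rightarrow> real"
  assumes m [measurable]: "\<phi> \<in> borel_measurable borel" "\<phi>' \<in> borel_measurable borel"
    and der: "\<And>u. u \<in> {0..1} \<Longrightarrow> (\<phi> has_real_derivative \<phi>' u) (at u within {0..1})"
    and der2: "\<And>u. u \<in> {0..1} \<Longrightarrow> (\<phi>' has_real_derivative \<phi>'' u) (at u within {0..1})"
    and nz: "\<And>u. u \<in> {0..1} \<Longrightarrow> \<phi>' u = 0 \<Longrightarrow> \<phi>'' u \<noteq> 0"
    and M: "\<And>u. u \<in> {0..1} \<Longrightarrow> \<bar>\<phi> u\<bar> \<le> M"
  shows "\<exists>K\<ge>0. \<exists>Y. finite Y \<and> (\<forall>G. G \<in> borel_measurable borel \<longrightarrow>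
      (\<integral>\<^sup>+ u. G (\<phi> u) * indicator {0..1} u \<partial>lborel)
        \<le> ennreal K * (\<Sum>y0\<in>Y. \<integral>\<^sup>+ y. G y * ennreal (\<bar>y - y0\<bar> powr (-1/2)) \<partial>lborel))"
proof (rule push_globalize[OF m(1), where J = "\<lambda>G y0. \<integral>\<^sup>+ y. G y * ennreal (\<bar>y - y0\<bar> powr (-1/2)) \<partial>lborel"])
  fix u0 :: real assume u0: "u0 \<in> {0..1}"
  have cont: "continuous_on {0..1} \<phi>'" using der2 by (rule DERIV_continuous_on)
  show "\<exists>\<epsilon>>0. \<exists>K\<ge>0. \<forall>G. G \<in> borel_measurable borel \<longrightarrow>
      (\<integral>\<^sup>+ u. G (\<phi> u) * indicator ({0..1} \<inter> ball u0 \<epsilon>) u \<partial>lborel)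
       \<le> ennreal K * (\<integral>\<^sup>+ y. G y * ennreal (\<bar>y - \<phi> u0\<bar> powr (-1/2)) \<partial>lborel)"
  proof (cases "\<phi>' u0 = 0")
    case True
    then show ?thesis by (intro push_local_critical[OF m der cont u0 _ der2[OF u0]] nz u0)
  next
    case False
    obtain \<epsilon> K where "\<epsilon> > 0" "K \<ge> 0" and b: "\<And>G. G \<in> borel_measurable borel \<Longrightarrow>
      (\<integral>\<^sup>+ u. G (\<phi> u) * indicator ({0..1} \<inter> ball u0 \<epsilon>) u \<partial>lborel) \<le> ennreal K * (\<integral>\<^sup>+ y. G y \<partial>lborel)"
      using push_local_regular[OF m der cont u0 False] by blast
    define L where "L = sqrt (2 * M)"
    have "M \<ge> 0" using M[OF u0] by linarith
    show ?thesis
    proof (rule exI[of _ \<epsilon>], rule conjI, fact \<open>\<epsilon> > 0\<close>, rule exI[of _ "K * L"], intro conjI allI impI)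
      fix G :: "real \<Rightarrow> ennreal" assume [measurable]: "G \<in> borel_measurable borel"
    have [measurable]: "ball (x::real) e \<in> sets borel" for x e by simp
      have "(\<integral>\<^sup>+ u. G (\<phi> u) * indicator ({0..1} \<inter> ball u0 \<epsilon>) u \<partial>lborel)
         = (\<integral>\<^sup>+ u. (G (\<phi> u) * indicator {-M..M} (\<phi> u)) * indicator ({0..1} \<inter> ball u0 \<epsilon>) u \<partial>lborel)"
      proof (intro nn_integral_cong)
        fix u
        show "G (\<phi> u) * indicator ({0..1} \<inter> ball u0 \<epsilon>) u = G (\<phi> u) * indicator {-M..M} (\<phi> u) * indicator ({0..1} \<inter> ball u0 \<epsilon>) u"
          using M[of u] by (auto simp: indicator_def abs_le_iff)
      qed
      also have "\<dots> \<le> ennreal K * (\<integral>\<^sup>+ y. G y * indicator {-M..M} y \<partial>lborel)"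
        by (rule b[of "\<lambda>y. G y * indicator {-M..M} y"]) measurable
      also have "(\<integral>\<^sup>+ y. G y * indicator {-M..M} y \<partial>lborel) \<le> (\<integral>\<^sup>+ y. ennreal L * (G y * ennreal (\<bar>y - \<phi> u0\<bar> powr (-1/2))) \<partial>lborel)"
      proof (rule nn_integral_mono_AE)
        \<comment> \<open>In the code \<open>0 powr (-1/2)\<close> is 0, so the inequality may fail
          at the single point \<open>y = \<phi> u0\<close>.\<close>
        have "G y * indicator {-M..M} y \<le> ennreal L * (G y * ennreal (\<bar>y - \<phi> u0\<bar> powr (-1/2)))" if "y \<noteq> \<phi> u0" for y
        proof (cases "y \<in> {-M..M}")
          case True
          then have "\<bar>y - \<phi> u0\<bar> \<le> 2 * M" using M[OF u0] by auto
          then have "sqrt \<bar>y - \<phi> u0\<bar> \<le> L" by (simp add: L_def)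
          then have "1 \<le> L * (\<bar>y - \<phi> u0\<bar> powr (-1/2))"
            using that by (simp add: powr_minus_divide powr_half_sqrt field_simps)
          then have "ennreal 1 \<le> ennreal (L * (\<bar>y - \<phi> u0\<bar> powr (-1/2)))" by (rule ennreal_leI)
          then have "G y * 1 \<le> G y * (ennreal L * ennreal (\<bar>y - \<phi> u0\<bar> powr (-1/2)))"
            by (intro mult_left_mono) (auto simp: L_def ennreal_mult \<open>M \<ge> 0\<close>)
          then show ?thesis using True by (simp add: mult_ac)
        qed simp
        then show "AE y in lborel. G y * indicator {-M..M} y \<le> ennreal L * (G y * ennreal (\<bar>y - \<phi> u0\<bar> powr (-1/2)))"
          using AE_lborel_singleton[of "\<phi> u0"] by (rule eventually_mono[rotated])
      qed
      also have "\<dots> = ennreal L * (\<integral>\<^sup>+ y. G y * ennreal (\<bar>y - \<phi> u0\<bar> powr (-1/2)) \<partial>lborel)"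
        by (rule nn_integral_cmult) measurable
      finally show "(\<integral>\<^sup>+ u. G (\<phi> u) * indicator ({0..1} \<inter> ball u0 \<epsilon>) u \<partial>lborel)
        \<le> ennreal (K * L) * (\<integral>\<^sup>+ y. G y * ennreal (\<bar>y - \<phi> u0\<bar> powr (-1/2)) \<partial>lborel)"
        using \<open>K \<ge> 0\<close> \<open>M \<ge> 0\<close> by (simp add: ennreal_mult L_def mult.assoc mult_left_mono)
    qed (use \<open>\<epsilon> > 0\<close> \<open>K \<ge> 0\<close> \<open>M \<ge> 0\<close> in \<open>auto simp: L_def\<close>)
  qed
qed

section \<open>Curves and lines in the plane\<close>

lemma ennreal_rpow_ennreal: "x \<ge> 0 \<Longrightarrow> ennreal_rpow (ennreal x) r = ennreal (x powr r)"
  by (simp add: ennreal_rpow_def)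

lemma ennreal_rpow_mono:
  assumes "x \<le> y" "r \<ge> 0" shows "ennreal_rpow x r \<le> ennreal_rpow y r"
proof (cases "y = \<infinity>")
  case False
  then have "x \<noteq> \<infinity>" using assms(1) by (auto simp: top_unique)
  then show ?thesis using assms False
    by (auto simp: ennreal_rpow_def intro!: ennreal_leI powr_mono2 enn2real_mono simp: less_top)
qed (simp add: ennreal_rpow_def)

lemma measurable_ennreal_rpow [measurable]: "(\<lambda>x. ennreal_rpow x r) \<in> borel_measurable borel"
  unfolding ennreal_rpow_def by measurable

lemma schwartz_differentiable: "schwartz f \<Longrightarrow> f differentiable (at x)"
  unfolding schwartz_def Let_def by (drule spec[of _ "[]"]) simp

lemma schwartz_continuous: "schwartz f \<Longrightarrow> continuous_on UNIV f"
  by (intro continuous_at_imp_continuous_on ballI differentiable_imp_continuous_within schwartz_differentiable)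

lemma inner_rot90: "rot90 v \<bullet> w = - (v \<bullet> rot90 w)"
  by (simp add: rot90_def inner_vec_def sum_2)

locale curve_line =
  fixes \<gamma> :: "real \<Rightarrow> real^2" and \<omega> :: "real^2"
  assumes curve: "compact_C2_curve \<gamma>"
    and curv: "\<And>\<xi>. \<xi> \<in> path_image \<gamma> \<Longrightarrow> curve_curvature \<gamma> \<xi> \<noteq> 0"
    and om: "\<omega> \<in> sphere 0 1"
begin

text \<open>In the coordinates \<open>x = t \<cdot> \<omega> + s \<cdot> om'\<close> the extension of \<open>f\<close> is
  \<open>ext_op phase (ampl f t) s\<close>; the curve is tangent to the direction \<open>\<omega>\<close> exactly where \<open>phase1\<close> vanishes.\<close>

definition "om' = rot90 \<omega>"
text \<open>The data of the curve are extended by 0 off \<open>{0..1}\<close>, which makes them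
  Borel functions on the line; the factor \<open>speed\<close> then removes the region outside from
  every integral along the curve.\<close>

definition "gm u = (if u \<in> {0..1} then \<gamma> u else 0)"
definition "speed u = (if u \<in> {0..1} then norm (velocity \<gamma> u) else 0)"
definition "along u = (if u \<in> {0..1} then \<gamma> u \<bullet> \<omega> else 0)"
definition "phase u = (if u \<in> {0..1} then \<gamma> u \<bullet> om' else 0)"
definition "phase1 u = (if u \<in> {0..1} then velocity \<gamma> u \<bullet> om' else 0)"
definition "phase2 u = (if u \<in> {0..1} then acceleration \<gamma> u \<bullet> om' else 0)"

lemma curve_derivative: "u \<in> {0..1} \<Longrightarrow> (\<gamma> has_vector_derivative velocity \<gamma> u) (at u within {0..1})"
  using curve unfolding compact_C2_curve_def C2_path_def velocity_def
  by (auto simp: vector_derivative_works[symmetric])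

lemma velocity_derivative: "u \<in> {0..1} \<Longrightarrow> (velocity \<gamma> has_vector_derivative acceleration \<gamma> u) (at u within {0..1})"
  using curve unfolding compact_C2_curve_def C2_path_def acceleration_def
  by (auto simp: vector_derivative_works[symmetric])

lemma continuous_on_curve: "continuous_on {0..1} \<gamma>" and continuous_on_velocity: "continuous_on {0..1} (velocity \<gamma>)"
  by (rule continuous_on_vector_derivative[OF curve_derivative] continuous_on_vector_derivative[OF velocity_derivative], assumption)+

lemma velocity_nonzero: "u \<in> {0..1} \<Longrightarrow> velocity \<gamma> u \<noteq> 0"
  using curve by (auto simp: compact_C2_curve_def)

lemma inner_der:
  assumes "(g has_vector_derivative g') (at u within S)"
  shows "((\<lambda>u. g u \<bullet> x) has_real_derivative g' \<bullet> x) (at u within S)"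
  unfolding has_real_derivative_iff_has_vector_derivative
  using bounded_linear.has_vector_derivative[OF bounded_linear_inner_left assms] .

lemma phase_der: "u \<in> {0..1} \<Longrightarrow> (phase has_real_derivative phase1 u) (at u within {0..1})"
  by (rule has_field_derivative_transform_within[where f = "\<lambda>u. \<gamma> u \<bullet> om'" and d = 1])
    (auto simp: phase_def phase1_def intro!: inner_der curve_derivative)

lemma phase1_der: "u \<in> {0..1} \<Longrightarrow> (phase1 has_real_derivative phase2 u) (at u within {0..1})"
  by (rule has_field_derivative_transform_within[where f = "\<lambda>u. velocity \<gamma> u \<bullet> om'" and d = 1])
    (auto simp: phase1_def phase2_def intro!: inner_der velocity_derivative)

lemma cont_phase1: "continuous_on {0..1} phase1"
  using phase1_der by (rule DERIV_continuous_on)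

lemma measurable_if_Icc:
  fixes g :: "real \<Rightarrow> 'a::real_normed_vector"
  assumes "continuous_on {0..1} g"
  shows "(\<lambda>u. if u \<in> {0..1} then g u else 0) \<in> borel_measurable borel"
  using borel_measurable_continuous_on_if[of "{0..1}" g "\<lambda>_. 0"] assms by simp

lemma measurable_curve [measurable]:
  "gm \<in> borel_measurable borel" "speed \<in> borel_measurable borel" "along \<in> borel_measurable borel" 
  "phase \<in> borel_measurable borel" "phase1 \<in> borel_measurable borel"
  unfolding gm_def[abs_def] speed_def[abs_def] along_def[abs_def] phase_def[abs_def] phase1_def[abs_def]
  by (intro measurable_if_Icc continuous_intros continuous_on_curve continuous_on_velocity)+

lemma gm_image: "u \<in> {0..1} \<Longrightarrow> gm u \<in> path_image \<gamma>"
  by (auto simp: gm_def path_image_def)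

lemma compact_curve: "compact (path_image \<gamma>)"
  unfolding path_image_def by (intro compact_continuous_image continuous_on_curve compact_Icc)

lemma continuous_bounded_on_curve:
  fixes f :: "real^2 \<Rightarrow> 'b::real_normed_vector"
  assumes "continuous_on UNIV f"
  obtains B where "B > 0" "\<And>u. u \<in> {0..1} \<Longrightarrow> norm (f (gm u)) \<le> B"
proof -
  have "compact (f ` path_image \<gamma>)"
    using assms compact_curve by (intro compact_continuous_image) (auto intro: continuous_on_subset)
  then have "bounded (f ` path_image \<gamma>)" by (rule compact_imp_bounded)
  then obtain B where "B > 0" "\<forall>y\<in>f ` path_image \<gamma>. norm y \<le> B"
    using bounded_pos by blast
  then show ?thesis using that gm_image by blast
qed

lemma speed_bounds: obtains c W where "c > 0" "W > 0" "\<And>u. u \<in> {0..1} \<Longrightarrow> c \<le> speed u" "\<And>u. speed u \<le> W"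
proof -
  have ne: "{0..1::real} \<noteq> {}" by simp
  have cn: "continuous_on {0..1} (\<lambda>u. norm (velocity \<gamma> u))" by (intro continuous_intros continuous_on_velocity)
  obtain a where a: "a \<in> {0..1}" "\<forall>u\<in>{0..1}. norm (velocity \<gamma> a) \<le> norm (velocity \<gamma> u)"
    using continuous_attains_inf[OF compact_Icc ne cn] by blast
  obtain b where b: "b \<in> {0..1}" "\<forall>u\<in>{0..1}. norm (velocity \<gamma> u) \<le> norm (velocity \<gamma> b)"
    using continuous_attains_sup[OF compact_Icc ne cn] by blast
  show ?thesis
  proof (rule that)
    show "norm (velocity \<gamma> a) > 0" "norm (velocity \<gamma> b) > 0" using velocity_nonzero a(1) b(1) by auto
  qed (use a b in \<open>auto simp: speed_def\<close>)
qed

lemma speed_nonneg [simp]: "0 \<le> speed u" by (simp add: speed_def)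

lemma speed_outside [simp]: "u \<notin> {0..1} \<Longrightarrow> speed u = 0" by (simp only: speed_def if_False)

text \<open>Passes from the completed Lebesgue measure on the parameter interval to
  \<open>lborel\<close>: on the interval the integrand agrees with the Borel function built from
  \<open>speed\<close> and \<open>gm\<close>.\<close>

lemma arc_length_measure_eq:
  "arc_length_measure \<gamma> = distr (density lborel (\<lambda>u. ennreal (speed u))) borel gm"
proof (rule measure_eqI)
  fix A assume "A \<in> sets (arc_length_measure \<gamma>)"
  then have A: "A \<in> sets borel" by (simp add: arc_length_measure_def)
  let ?L = "lebesgue_on {0..1::real}"
  have mg: "\<gamma> \<in> borel_measurable ?L"
    by (rule continuous_imp_measurable_on_sets_lebesgue[OF continuous_on_curve]) simp
  have mv: "(\<lambda>u. norm (velocity \<gamma> u)) \<in> borel_measurable ?L"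
    by (rule continuous_imp_measurable_on_sets_lebesgue) (auto intro!: continuous_intros continuous_on_velocity)
  have pre: "\<gamma> -` A \<inter> space ?L \<in> sets ?L" using mg A by (rule measurable_sets)
  have "emeasure (arc_length_measure \<gamma>) A = (\<integral>\<^sup>+ u. ennreal (norm (velocity \<gamma> u)) * indicator (\<gamma> -` A \<inter> space ?L) u \<partial>?L)"
    unfolding arc_length_measure_def
    by (subst emeasure_distr) (use mg mv A pre in \<open>auto intro!: emeasure_density\<close>)
  also have "\<dots> = (\<integral>\<^sup>+ u. ennreal (norm (velocity \<gamma> u)) * indicator (\<gamma> -` A \<inter> space ?L) u * indicator {0..1} u \<partial>lebesgue)"
    by (subst nn_integral_restrict_space) auto
  also have "\<dots> = (\<integral>\<^sup>+ u. ennreal (speed u) * indicator (gm -` A) u \<partial>lborel)"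
    unfolding nn_integral_completion
    by (intro nn_integral_cong) (auto simp: speed_def gm_def indicator_def space_restrict_space)
  also have "\<dots> = emeasure (distr (density lborel (\<lambda>u. ennreal (speed u))) borel gm) A"
    using A measurable_sets[OF measurable_curve(1) A] by (subst emeasure_distr) (auto simp: emeasure_density)
  finally show "emeasure (arc_length_measure \<gamma>) A = emeasure (distr (density lborel (\<lambda>u. ennreal (speed u))) borel gm) A" .
qed (simp add: arc_length_measure_def)

lemma nn_integral_arc:
  assumes [measurable]: "g \<in> borel_measurable borel"
  shows "(\<integral>\<^sup>+ \<xi>. g \<xi> \<partial>arc_length_measure \<gamma>) = (\<integral>\<^sup>+ u. ennreal (speed u) * g (gm u) \<partial>lborel)"
  unfolding arc_length_measure_eq by (simp add: nn_integral_distr nn_integral_density)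

lemma integral_arc:
  fixes g :: "real^2 \<Rightarrow> complex"
  assumes [measurable]: "g \<in> borel_measurable borel"
  shows "(\<integral> \<xi>. g \<xi> \<partial>arc_length_measure \<gamma>) = (\<integral> u. speed u *\<^sub>R g (gm u) \<partial>lborel)"
  unfolding arc_length_measure_eq by (subst integral_distr) (auto simp: integral_density)

text \<open>The density of arc length and the whole dependence on the offset \<open>t\<close> are
  absorbed in the amplitude, whose modulus is independent of \<open>t\<close>.\<close>

definition "ampl f t u = f (gm u) * complex_of_real (speed u) * cis (2 * pi * t * along u)"

lemma fourier_extension_line:
  assumes f: "continuous_on UNIV f"
  shows "fourier_extension \<gamma> f (t *\<^sub>R \<omega> + s *\<^sub>R om') = ext_op phase (ampl f t) s"
proof -
  have [measurable]: "f \<in> borel_measurable borel" using f by (rule borel_measurable_continuous_onI)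
  have "fourier_extension \<gamma> f (t *\<^sub>R \<omega> + s *\<^sub>R om') = 
     (\<integral> u. speed u *\<^sub>R (f (gm u) * exp (2 * complex_of_real pi * \<i> * complex_of_real (gm u \<bullet> (t *\<^sub>R \<omega> + s *\<^sub>R om')))) \<partial>lborel)"
    unfolding fourier_extension_def by (subst integral_arc) auto
  also have "\<dots> = ext_op phase (ampl f t) s"
    unfolding ext_op_def
  proof (intro Bochner_Integration.integral_cong refl)
    fix u
    have "exp (2 * complex_of_real pi * \<i> * complex_of_real (gm u \<bullet> (t *\<^sub>R \<omega> + s *\<^sub>R om')))
      = cis (2 * pi * t * along u) * cis (2 * pi * s * phase u)" if "u \<in> {0..1}"
      using that by (simp add: cis_conv_exp gm_def along_def phase_def inner_add_right ring_distribs mult_ac flip: exp_add)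
    then show "speed u *\<^sub>R (f (gm u) * exp (2 * complex_of_real pi * \<i> * complex_of_real (gm u \<bullet> (t *\<^sub>R \<omega> + s *\<^sub>R om'))))
      = ampl f t u * cis (2 * pi * s * phase u)"
      by (cases "u \<in> {0..1}") (simp_all add: ampl_def scaleR_conv_of_real mult_ac)
  qed
  finally show ?thesis .
qed

lemma ampl_props:
  assumes f: "continuous_on UNIV f"
  shows "ampl f t \<in> borel_measurable borel" "norm (ampl f t u) = norm (f (gm u)) * speed u"
    "u \<notin> {0..1} \<Longrightarrow> ampl f t u = 0" "\<exists>B>0. \<forall>t u. norm (ampl f t u) \<le> B"
proof -
  have [measurable]: "f \<in> borel_measurable borel" using f by (rule borel_measurable_continuous_onI)
  show "ampl f t \<in> borel_measurable borel" unfolding ampl_def cis_conv_exp by measurable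
  show n: "norm (ampl f t u) = norm (f (gm u)) * speed u" for t u
    by (simp add: ampl_def norm_mult)
  show "u \<notin> {0..1} \<Longrightarrow> ampl f t u = 0" by (simp only: ampl_def speed_outside) simp
  obtain B where B: "B > 0" "\<And>u. u \<in> {0..1} \<Longrightarrow> norm (f (gm u)) \<le> B"
    by (rule continuous_bounded_on_curve[OF f]) blast
  obtain c W where W: "W > 0" "\<And>u. speed u \<le> W" by (rule speed_bounds) blast
  have "norm (ampl f t u) \<le> B * W" for t u
    unfolding n using B W by (cases "u \<in> {0..1}") (auto intro!: mult_mono)
  then show "\<exists>B>0. \<forall>t u. norm (ampl f t u) \<le> B"
    using B W by (intro exI[of _ "B * W"]) auto
qed

definition "Lp_power P f = (\<integral>u. norm (f (gm u)) powr P * speed u \<partial>lborel)"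

lemma integrable_Lp_power:
  assumes f: "continuous_on UNIV f" and "P > 0"
  shows "integrable lborel (\<lambda>u. norm (f (gm u)) powr P * speed u)"
proof -
  have [measurable]: "f \<in> borel_measurable borel" using f by (rule borel_measurable_continuous_onI)
  obtain B where B: "B > 0" "\<And>u. u \<in> {0..1} \<Longrightarrow> norm (f (gm u)) \<le> B"
    by (rule continuous_bounded_on_curve[OF f]) blast
  obtain c W where W: "W > 0" "\<And>u. speed u \<le> W" by (rule speed_bounds) blast
  show ?thesis
  proof (rule integrable_bdd_cpt[where B = "B powr P * W" and R = 1])
    fix u
    show "norm (norm (f (gm u)) powr P * speed u) \<le> B powr P * W"
      using B W \<open>P > 0\<close> by (cases "u \<in> {0..1}") (auto intro!: mult_mono powr_mono2 simp: abs_mult)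
    show "1 < \<bar>u\<bar> \<Longrightarrow> norm (f (gm u)) powr P * speed u = 0"
      by (subst speed_outside) auto
  qed measurable
qed

lemma Lp_power_nonneg [simp]: "Lp_power P f \<ge> 0"
  by (simp add: Lp_power_def)

lemma Lp_norm_arc:
  assumes f: "continuous_on UNIV f" and P: "P > 0"
  shows "Lp_norm (ennreal P) (arc_length_measure \<gamma>) f = ennreal (Lp_power P f powr (1/P))"
proof -
  have [measurable]: "f \<in> borel_measurable borel" using f by (rule borel_measurable_continuous_onI)
  have "(\<integral>\<^sup>+ x. ennreal_rpow (ennreal (norm (f x))) P \<partial>arc_length_measure \<gamma>)
    = (\<integral>\<^sup>+ u. ennreal (speed u) * ennreal_rpow (ennreal (norm (f (gm u)))) P \<partial>lborel)"
    by (rule nn_integral_arc) measurable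
  also have "\<dots> = (\<integral>\<^sup>+ u. ennreal (norm (f (gm u)) powr P * speed u) \<partial>lborel)"
    by (intro nn_integral_cong) (simp add: ennreal_rpow_ennreal ennreal_mult mult.commute)
  also have "\<dots> = ennreal (Lp_power P f)"
    unfolding Lp_power_def using integrable_Lp_power[OF f P] by (intro nn_integral_eq_integral) auto
  finally show ?thesis using P by (simp add: Lp_norm_def ennreal_rpow_ennreal)
qed

text \<open>The speed has a positive lower bound, so null sets for arc length correspond to null
  sets of parameters.\<close>

lemma AE_Lp_norm_infinity:
  assumes f: "continuous_on UNIV f"
  shows "AE u in lborel. u \<in> {0..1} \<longrightarrow> ennreal (norm (f (gm u))) \<le> Lp_norm \<infinity> (arc_length_measure \<gamma>) f"
proof -
  have [measurable]: "f \<in> borel_measurable borel" using f by (rule borel_measurable_continuous_onI)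
  obtain c W where c: "c > 0" "\<And>u. u \<in> {0..1} \<Longrightarrow> c \<le> speed u" by (rule speed_bounds) blast
  have "AE x in arc_length_measure \<gamma>. ennreal (norm (f x)) \<le> Lp_norm \<infinity> (arc_length_measure \<gamma>) f"
    using esssup_AE[of "\<lambda>x. ennreal (norm (f x))"] by (simp add: Lp_norm_def)
  then have "AE u in density lborel (\<lambda>u. ennreal (speed u)). ennreal (norm (f (gm u))) \<le> Lp_norm \<infinity> (arc_length_measure \<gamma>) f"
    by (subst (asm) (2) arc_length_measure_eq, subst (asm) AE_distr_iff) auto
  then have "AE u in lborel. 0 < ennreal (speed u) \<longrightarrow> ennreal (norm (f (gm u))) \<le> Lp_norm \<infinity> (arc_length_measure \<gamma>) f"
    by (subst (asm) AE_density) auto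
  then show ?thesis
  proof (rule eventually_mono, intro impI)
    fix u assume u: "0 < ennreal (speed u) \<longrightarrow> ennreal (norm (f (gm u))) \<le> Lp_norm \<infinity> (arc_length_measure \<gamma>) f" "u \<in> {0..1}"
    have "speed u > 0" using c(1) c(2)[OF u(2)] by linarith
    then show "ennreal (norm (f (gm u))) \<le> Lp_norm \<infinity> (arc_length_measure \<gamma>) f" using u(1) by simp
  qed
qed

definition "curve_length = (\<integral>u. speed u \<partial>lborel)"

lemma integrable_speed: "integrable lborel speed"
proof -
  obtain c W where W: "W > 0" "\<And>u. speed u \<le> W" by (rule speed_bounds) blast
  show ?thesis
    by (rule integrable_bdd_cpt[where B = W and R = 1]) (use W in \<open>auto simp del: speed_outside intro!: speed_outside\<close>)
qed

lemma curve_length_nonneg: "curve_length \<ge> 0" by (simp add: curve_length_def)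

text \<open>Monotonicity of the norms in the exponent on a space of finite mass. For finite
  \<open>p'\<close> it follows from
  \<open>x powr P \<le> L powr P + L powr (P - p') * x powr p'\<close>, where \<open>L\<close> is
  the larger norm: values up to \<open>L\<close> are covered by the first term, larger ones by the
  second, and integration gives \<open>L powr P\<close> times
  \<open>curve_length + 1\<close>.\<close>

lemma Lp_norm_arc_mono:
  assumes f: "continuous_on UNIV f" and P: "P \<ge> 1" and p: "ennreal P \<le> p"
  shows "Lp_norm (ennreal P) (arc_length_measure \<gamma>) f
    \<le> ennreal ((curve_length + 1) powr (1/P)) * Lp_norm p (arc_length_measure \<gamma>) f"
proof -
  let ?L = "Lp_norm p (arc_length_measure \<gamma>) f"
  have main: "Lp_power P f \<le> L powr P * (curve_length + 1)" if L: "?L = ennreal L" "L \<ge> 0" for L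
  proof (cases p)
    case (real p')
    then have p': "P \<le> p'" "p' > 0" using p P by auto
    have Lp: "L = Lp_power p' f powr (1/p')"
      using L Lp_norm_arc[OF f \<open>p' > 0\<close>] real by simp
    show ?thesis
    proof (cases "Lp_power p' f = 0")
      case True
      then have "AE u in lborel. norm (f (gm u)) powr p' * speed u = 0"
        using integrable_Lp_power[OF f \<open>p' > 0\<close>] by (subst (asm) Lp_power_def, subst (asm) integral_nonneg_eq_0_iff_AE) auto
      then have "AE u in lborel. norm (f (gm u)) powr P * speed u = 0"
        by eventually_elim auto
      then have "Lp_power P f = 0" unfolding Lp_power_def by (rule integral_eq_zero_AE)
      then show ?thesis using curve_length_nonneg by simp
    next
      case False
      then have "Lp_power p' f > 0" using Lp_power_nonneg[of p' f] by linarith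
      then have "L > 0" by (simp add: Lp)
      have Lp': "L powr p' = Lp_power p' f" using \<open>Lp_power p' f > 0\<close> p' by (simp add: Lp powr_powr)
      have pw: "x powr P \<le> L powr P + L powr (P - p') * x powr p'" if "x \<ge> 0" for x
      proof (cases "x \<le> L")
        case True
        then have "x powr P \<le> L powr P" using that P by (intro powr_mono2) auto
        then show ?thesis by (simp add: add_increasing2)
      next
        case False
        then have "x > 0" using \<open>L > 0\<close> by simp
        have "x powr (P - p') \<le> L powr (P - p')"
          using False \<open>L > 0\<close> p' by (intro powr_mono2') auto
        then have "x powr (P - p') * x powr p' \<le> L powr (P - p') * x powr p'"
          by (rule mult_right_mono) simp
        then show ?thesis by (simp flip: powr_add add: add_increasing)
      qed
      have "Lp_power P f \<le> (\<integral>u. L powr P * speed u + L powr (P - p') * (norm (f (gm u)) powr p' * speed u) \<partial>lborel)"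
        unfolding Lp_power_def
      proof (rule Bochner_Integration.integral_mono)
        fix u
        have "norm (f (gm u)) powr P * speed u \<le> (L powr P + L powr (P - p') * norm (f (gm u)) powr p') * speed u"
          by (intro mult_right_mono pw) auto
        then show "norm (f (gm u)) powr P * speed u \<le> L powr P * speed u + L powr (P - p') * (norm (f (gm u)) powr p' * speed u)"
          by (simp add: algebra_simps)
      qed (use integrable_Lp_power[OF f] P p' integrable_speed in \<open>auto intro!: Bochner_Integration.integrable_add\<close>)
      also have "\<dots> = L powr P * curve_length + L powr (P - p') * Lp_power p' f"
        unfolding Lp_power_def curve_length_def using integrable_Lp_power[OF f \<open>p' > 0\<close>] integrable_speed
        by (subst Bochner_Integration.integral_add) auto
      also have "L powr (P - p') * Lp_power p' f = L powr P"
        unfolding Lp'[symmetric] by (simp flip: powr_add)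
      finally show ?thesis by (simp add: algebra_simps)
    qed
  next
    case top
    have ae: "AE u in lborel. norm (f (gm u)) powr P * speed u \<le> L powr P * speed u"
      using AE_Lp_norm_infinity[OF f]
    proof (rule eventually_mono)
      fix u assume u: "u \<in> {0..1} \<longrightarrow> ennreal (norm (f (gm u))) \<le> Lp_norm \<infinity> (arc_length_measure \<gamma>) f"
      show "norm (f (gm u)) powr P * speed u \<le> L powr P * speed u"
      proof (cases "u \<in> {0..1}")
        case True
        then have "norm (f (gm u)) \<le> L" using u L top by simp
        then show ?thesis using P by (intro mult_right_mono powr_mono2) auto
      qed (subst (1 2) speed_outside; simp)
    qed
    have "Lp_power P f \<le> (\<integral>u. L powr P * speed u \<partial>lborel)"
      unfolding Lp_power_def by (rule integral_mono_AE) (use integrable_Lp_power[OF f] P integrable_speed ae in auto)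
    also have "\<dots> = L powr P * curve_length" by (simp add: curve_length_def)
    also have "\<dots> \<le> L powr P * (curve_length + 1)" by (intro mult_left_mono) auto
    finally show ?thesis .
  qed
  show ?thesis
  proof (cases ?L)
    case (real L)
    have "Lp_power P f powr (1/P) \<le> (L powr P * (curve_length + 1)) powr (1/P)"
      using main[OF real(2,1)] P by (intro powr_mono2) auto
    also have "\<dots> = (curve_length + 1) powr (1/P) * L"
      using real curve_length_nonneg P by (simp add: powr_mult powr_powr)
    finally have "ennreal (Lp_power P f powr (1/P)) \<le> ennreal ((curve_length + 1) powr (1/P) * L)" by (rule ennreal_leI)
    also have "\<dots> = ennreal ((curve_length + 1) powr (1/P)) * ?L" using real by (simp add: ennreal_mult)
    finally show ?thesis using P by (simp add: Lp_norm_arc[OF f])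
  next
    case top
    have "(curve_length + 1) powr (1/P) > 0" using curve_length_nonneg by simp
    then show ?thesis using top by (simp add: ennreal_mult_top)
  qed
qed

section \<open>Norms on lines\<close>

definition "line_power Q f t = (\<integral>\<^sup>+ s. ennreal (norm (ext_op phase (ampl f t) s) powr Q) \<partial>lborel)"

lemma measurable_fourier_extension:
  assumes f: "continuous_on UNIV f"
  shows "fourier_extension \<gamma> f \<in> borel_measurable borel"
proof -
  have [measurable]: "f \<in> borel_measurable borel" using f by (rule borel_measurable_continuous_onI)
  have "fourier_extension \<gamma> f = (\<lambda>x. \<integral> u. speed u *\<^sub>R (f (gm u) * exp (2 * complex_of_real pi * \<i> * complex_of_real (gm u \<bullet> x))) \<partial>lborel)"
    unfolding fourier_extension_def by (intro ext, subst integral_arc) auto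
  also have "\<dots> \<in> borel_measurable borel" by measurable
  finally show ?thesis .
qed

lemma nn_integral_line:
  assumes [measurable]: "g \<in> borel_measurable borel"
  shows "(\<integral>\<^sup>+ x. g x \<partial>line_measure \<omega> t) = (\<integral>\<^sup>+ s. g (t *\<^sub>R \<omega> + s *\<^sub>R om') \<partial>lborel)"
  unfolding line_measure_def om'_def by (subst nn_integral_distr) auto

lemma radon_line_power:
  assumes f: "continuous_on UNIV f" and Q: "Q > 0"
  shows "radon (\<lambda>x. ennreal_rpow (ennreal (norm (fourier_extension \<gamma> f x))) Q) \<omega> t = line_power Q f t"
proof -
  have [measurable]: "fourier_extension \<gamma> f \<in> borel_measurable borel" by (rule measurable_fourier_extension[OF f])
  show ?thesis unfolding radon_def
    by (subst nn_integral_line) (auto simp: line_power_def fourier_extension_line[OF f] ennreal_rpow_ennreal)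
qed

lemma radon_norm_line_power:
  assumes f: "continuous_on UNIV f" and Q: "Q > 0"
  shows "radon_norm (ennreal Q) (fourier_extension \<gamma> f) \<omega> t = ennreal_rpow (line_power Q f t) (1/Q)"
  using radon_line_power[OF f Q] Q by (simp add: radon_norm_def)

text \<open>The modulus of the amplitude is \<open>norm f\<close> times \<open>speed\<close>; its
  \<open>p\<close>-th power costs a factor \<open>W powr (p - 1)\<close> against arc length, where
  \<open>W\<close> bounds the speed. The passage to any \<open>p' \<ge> p\<close> uses the finite
  length of the curve, and the summand 1 in \<open>K\<close> keeps the constant positive.\<close>

lemma radon_estimate_of_restriction:
  assumes p: "p > 1" and r: "r > 1" and pr: "1/p + 1/r = 1"
    and q: "q > 1" and P: "P > 1" and qP: "1/q + 1/P = 1"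
    and R: "restriction_bound phase r P" and pp: "ennreal p \<le> p'"
  shows "radon_estimate \<gamma> \<omega> p' (ennreal q)"
proof -
  obtain C where "C \<ge> 0" and C: "\<And>F B. F \<in> borel_measurable borel \<Longrightarrow> (\<And>u. norm (F u) \<le> B) \<Longrightarrow> (\<And>u. u \<notin> {0..1} \<Longrightarrow> F u = 0) \<Longrightarrow>
    (\<integral>\<^sup>+ s. ennreal (norm (ext_op phase F s) powr q) \<partial>lborel) \<le> ennreal (C * (\<integral>u. norm (F u) powr p \<partial>lborel) powr (q / p))"
    using extension_by_duality[OF measurable_curve(4) p r pr q P qP R] by blast
  obtain c W where W: "W > 0" "\<And>u. speed u \<le> W" by (rule speed_bounds) blast
  define K where "K = C powr (1/q) * W powr ((p - 1) / p) * (curve_length + 1) powr (1/p) + 1"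
  have "K > 0" by (simp add: K_def add_nonneg_pos)
  have main: "radon_norm (ennreal q) (fourier_extension \<gamma> f) \<omega> t \<le> ennreal K * Lp_norm p' (arc_length_measure \<gamma>) f"
    if "schwartz f" for f t
  proof -
    have f: "continuous_on UNIV f" using that by (rule schwartz_continuous)
    obtain B where B: "\<And>u. norm (ampl f t u) \<le> B" using ampl_props(4)[OF f] by blast
    have intW: "integrable lborel (\<lambda>u. W powr (p - 1) * (norm (f (gm u)) powr p * speed u))"
      using integrable_Lp_power[OF f] p by auto
    have "(\<integral>u. norm (ampl f t u) powr p \<partial>lborel) \<le> (\<integral>u. W powr (p - 1) * (norm (f (gm u)) powr p * speed u) \<partial>lborel)"
    proof (rule integral_mono_AE')
      have "norm (ampl f t u) powr p \<le> W powr (p - 1) * (norm (f (gm u)) powr p * speed u)" for u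
      proof -
        have "speed u powr p = speed u powr (p - 1) * speed u powr 1" by (simp only: powr_add[symmetric]) simp
        also have "\<dots> \<le> W powr (p - 1) * speed u"
          using W p by (auto intro!: mult_mono powr_mono2)
        finally have "norm (f (gm u)) powr p * speed u powr p \<le> norm (f (gm u)) powr p * (W powr (p - 1) * speed u)"
          by (rule mult_left_mono) simp
        then show ?thesis by (simp add: ampl_props(2)[OF f] powr_mult mult_ac)
      qed
      then show "AE u in lborel. norm (ampl f t u) powr p \<le> W powr (p - 1) * (norm (f (gm u)) powr p * speed u)"
        by (intro AE_I2)
    qed (use intW in auto)
    also have "\<dots> = W powr (p - 1) * Lp_power p f" using p by (simp add: Lp_power_def)
    finally have amp: "(\<integral>u. norm (ampl f t u) powr p \<partial>lborel) \<le> W powr (p - 1) * Lp_power p f" .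
    have "line_power q f t \<le> ennreal (C * (\<integral>u. norm (ampl f t u) powr p \<partial>lborel) powr (q / p))"
      unfolding line_power_def by (rule C[of _ B]) (use B ampl_props[OF f] in auto)
    also have "\<dots> \<le> ennreal (C * (W powr (p - 1) * Lp_power p f) powr (q / p))"
      using amp \<open>C \<ge> 0\<close> p q by (intro ennreal_leI mult_left_mono powr_mono2) auto
    finally have "ennreal_rpow (line_power q f t) (1/q) \<le> ennreal_rpow (ennreal (C * (W powr (p - 1) * Lp_power p f) powr (q / p))) (1/q)"
      using q by (intro ennreal_rpow_mono) auto
    also have "\<dots> = ennreal (C powr (1/q) * W powr ((p - 1) / p) * Lp_power p f powr (1/p))"
      using \<open>C \<ge> 0\<close> p q by (simp add: ennreal_rpow_ennreal powr_mult powr_powr mult.assoc)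
    also have "\<dots> = ennreal (C powr (1/q) * W powr ((p - 1) / p)) * Lp_norm (ennreal p) (arc_length_measure \<gamma>) f"
      using p by (simp add: Lp_norm_arc[OF f] ennreal_mult)
    also have "\<dots> \<le> ennreal (C powr (1/q) * W powr ((p - 1) / p)) * (ennreal ((curve_length + 1) powr (1/p)) * Lp_norm p' (arc_length_measure \<gamma>) f)"
      using p pp by (intro mult_left_mono Lp_norm_arc_mono f) auto
    also have "\<dots> = ennreal (K - 1) * Lp_norm p' (arc_length_measure \<gamma>) f"
      by (simp add: K_def ennreal_mult mult.assoc)
    also have "\<dots> \<le> ennreal K * Lp_norm p' (arc_length_measure \<gamma>) f"
      by (intro mult_right_mono ennreal_leI) auto
    finally show ?thesis using q by (simp add: radon_norm_line_power[OF f])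
  qed
  then show ?thesis unfolding radon_estimate_def using \<open>K > 0\<close> by blast
qed

end

section \<open>Lebesgue measure in rotated coordinates; norms on strips\<close>

lemma Basis_real2: "(Basis :: (real^2) set) = {axis 1 1, axis 2 1}"
  by (auto simp: Basis_vec_def UNIV_2)

text \<open>Both measures give a box the product of its side lengths.\<close>

lemma distr_vector_lborel: "distr (lborel \<Otimes>\<^sub>M lborel) borel (\<lambda>(a, b). vector [a, b] :: real^2) = lborel"
proof (rule lborel_eqI[symmetric])
  have eq: "(\<lambda>(a, b). vector [a, b] :: real^2) = (\<lambda>z. fst z *\<^sub>R axis 1 1 + snd z *\<^sub>R axis 2 1)"
    by (auto simp: vec_eq_iff forall_2 axis_def)
  have m: "(\<lambda>(a, b). vector [a, b] :: real^2) \<in> (lborel \<Otimes>\<^sub>M lborel) \<rightarrow>\<^sub>M borel"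
    unfolding eq by measurable
  fix l u :: "real^2" assume lu: "\<And>b. b \<in> Basis \<Longrightarrow> l \<bullet> b \<le> u \<bullet> b"
  have lu': "l $ 1 \<le> u $ 1" "l $ 2 \<le> u $ 2"
    using lu[of "axis 1 1"] lu[of "axis 2 1"] by (auto simp: Basis_real2 inner_axis)
  have "emeasure (distr (lborel \<Otimes>\<^sub>M lborel) borel (\<lambda>(a, b). vector [a, b] :: real^2)) (box l u)
     = emeasure (lborel \<Otimes>\<^sub>M lborel) ({l $ 1<..<u $ 1} \<times> {l $ 2<..<u $ 2})"
    by (subst emeasure_distr[OF m]) (auto simp: box_def Basis_real2 inner_axis space_pair_measure intro!: arg_cong2[where f = emeasure])
  also have "\<dots> = ennreal (u $ 1 - l $ 1) * ennreal (u $ 2 - l $ 2)"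
    using lu' by (subst lborel.emeasure_pair_measure_Times) auto
  also have "\<dots> = (\<Prod>b\<in>Basis. (u - l) \<bullet> b)"
    using lu' by (simp add: Basis_real2 axis_eq_axis inner_axis ennreal_mult)
  finally show "emeasure (distr (lborel \<Otimes>\<^sub>M lborel) borel (\<lambda>(a, b). vector [a, b] :: real^2)) (box l u) = (\<Prod>b\<in>Basis. (u - l) \<bullet> b)" .
qed simp

text \<open>The preimage of a box under \<open>A\<close> is its image under the inverse
  \<open>R\<close>, and orthogonal maps preserve Lebesgue measure; agreement on boxes determines the
  measure.\<close>

lemma distr_lborel_orthogonal:
  fixes A R :: "real^2 \<Rightarrow> real^2"
  assumes R: "orthogonal_transformation R" and A: "A \<in> borel_measurable borel"
    and inv: "\<And>x. A (R x) = x" "\<And>x. R (A x) = x"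
  shows "distr lborel borel A = lborel"
proof (rule lborel_eqI[symmetric])
  fix l u :: "real^2" assume lu: "\<And>b. b \<in> Basis \<Longrightarrow> l \<bullet> b \<le> u \<bullet> b"
  have img: "A -` box l u = R ` box l u"
  proof (intro equalityI subsetI)
    fix x assume "x \<in> A -` box l u"
    then show "x \<in> R ` box l u" by (intro image_eqI[of _ R "A x"]) (auto simp: inv)
  qed (auto simp: inv)
  have lm: "box l u \<in> lmeasurable" by simp
  have "A -` box l u \<in> sets borel" using measurable_sets[OF A, of "box l u"] by simp
  then have "emeasure (distr lborel borel A) (box l u) = emeasure lebesgue (R ` box l u)"
    using A by (subst emeasure_distr) (auto simp: img)
  also have "\<dots> = ennreal (measure lebesgue (R ` box l u))"
    using measurable_orthogonal_image[OF R lm] by (simp add: emeasure_eq_measure2)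
  also have "\<dots> = ennreal (measure lebesgue (box l u))"
    using measure_orthogonal_image[OF R lm] by simp
  also have "\<dots> = emeasure lborel (box l u)"
    using lm by (simp add: emeasure_eq_measure2 flip: emeasure_completion)
  also have "\<dots> = (\<Prod>b\<in>Basis. (u - l) \<bullet> b)"
    using lu by (rule emeasure_lborel_box)
  finally show "emeasure (distr lborel borel A) (box l u) = (\<Prod>b\<in>Basis. (u - l) \<bullet> b)" .
qed simp

text \<open>\<open>A\<close> assembles a point from its coordinates in the rotated frame and
  \<open>R\<close> reads them off; Tonelli's theorem is then applied to these coordinates.\<close>

lemma nn_integral_rotated:
  assumes om: "\<omega> \<in> sphere 0 1" and g [measurable]: "g \<in> borel_measurable borel"
  shows "(\<integral>\<^sup>+ x. g x \<partial>(lborel :: (real^2) measure)) = (\<integral>\<^sup>+ t. \<integral>\<^sup>+ s. g (t *\<^sub>R \<omega> + s *\<^sub>R rot90 \<omega>) \<partial>lborel \<partial>lborel)"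
proof -
  have 1: "\<omega> $ 1 * \<omega> $ 1 + \<omega> $ 2 * \<omega> $ 2 = 1"
    using om by (simp add: norm_eq_1 inner_vec_def sum_2)
  define A where "A = (\<lambda>x::real^2. x $ 1 *\<^sub>R \<omega> + x $ 2 *\<^sub>R rot90 \<omega>)"
  define R where "R = (\<lambda>x::real^2. vector [x \<bullet> \<omega>, x \<bullet> rot90 \<omega>] :: real^2)"
  have Am [measurable]: "A \<in> borel_measurable borel"
    unfolding A_def by (intro borel_measurable_continuous_onI continuous_intros)
  have RA: "R (A x) = x" for x
  proof -
    have "R (A x) $ 1 = x $ 1 * (\<omega> $ 1 * \<omega> $ 1 + \<omega> $ 2 * \<omega> $ 2)" "R (A x) $ 2 = x $ 2 * (\<omega> $ 1 * \<omega> $ 1 + \<omega> $ 2 * \<omega> $ 2)"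
      by (simp_all add: R_def A_def inner_vec_def sum_2 rot90_def algebra_simps)
    then show ?thesis by (simp add: 1 vec_eq_iff forall_2)
  qed
  have AR: "A (R x) = x" for x
  proof -
    have "A (R x) $ 1 = x $ 1 * (\<omega> $ 1 * \<omega> $ 1 + \<omega> $ 2 * \<omega> $ 2)" "A (R x) $ 2 = x $ 2 * (\<omega> $ 1 * \<omega> $ 1 + \<omega> $ 2 * \<omega> $ 2)"
      by (simp_all add: R_def A_def inner_vec_def sum_2 rot90_def algebra_simps)
    then show ?thesis by (simp add: 1 vec_eq_iff forall_2)
  qed
  have "orthogonal_transformation R"
    unfolding orthogonal_transformation_def
  proof (intro conjI allI)
    show "linear R"
      by (rule linearI) (simp_all add: R_def vec_eq_iff forall_2 inner_add_left)
    fix v w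
    have "R v \<bullet> R w = (v $ 1 * w $ 1 + v $ 2 * w $ 2) * (\<omega> $ 1 * \<omega> $ 1 + \<omega> $ 2 * \<omega> $ 2)"
      by (simp add: R_def inner_vec_def sum_2 rot90_def algebra_simps)
    then show "R v \<bullet> R w = v \<bullet> w" by (simp add: 1 inner_vec_def sum_2)
  qed
  then have D: "distr lborel borel A = lborel" by (rule distr_lborel_orthogonal) (auto simp: AR RA)
  have eq: "(\<lambda>(a, b). vector [a, b] :: real^2) = (\<lambda>z. fst z *\<^sub>R axis 1 1 + snd z *\<^sub>R axis 2 1)"
    by (auto simp: vec_eq_iff forall_2 axis_def)
  have [measurable]: "(\<lambda>(a, b). vector [a, b] :: real^2) \<in> borel_measurable (lborel \<Otimes>\<^sub>M lborel)"
    unfolding eq by measurable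
  have "(\<integral>\<^sup>+ x. g x \<partial>(lborel :: (real^2) measure)) = (\<integral>\<^sup>+ x. g (A x) \<partial>lborel)"
    by (subst D[symmetric]) (simp add: nn_integral_distr)
  also have "\<dots> = (\<integral>\<^sup>+ z. g (A (case z of (a, b) \<Rightarrow> vector [a, b])) \<partial>(lborel \<Otimes>\<^sub>M lborel))"
    by (subst distr_vector_lborel[symmetric]) (simp add: nn_integral_distr)
  also have "\<dots> = (\<integral>\<^sup>+ z. g (fst z *\<^sub>R \<omega> + snd z *\<^sub>R rot90 \<omega>) \<partial>(lborel \<Otimes>\<^sub>M lborel))"
    by (intro nn_integral_cong) (auto simp: A_def)
  also have "\<dots> = (\<integral>\<^sup>+ t. \<integral>\<^sup>+ s. g (t *\<^sub>R \<omega> + s *\<^sub>R rot90 \<omega>) \<partial>lborel \<partial>lborel)"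
    by (subst lborel.nn_integral_fst[symmetric]) auto
  finally show ?thesis .
qed

lemma ennreal_rpow_le_cancel:
  assumes "ennreal_rpow x (1/Q) \<le> ennreal N" "Q > 0" "N \<ge> 0"
  shows "x \<le> ennreal (N powr Q)"
proof (cases x)
  case (real y)
  then have "y powr (1/Q) \<le> N" using assms by (simp add: ennreal_rpow_ennreal)
  then have "(y powr (1/Q)) powr Q \<le> N powr Q" using assms by (intro powr_mono2) auto
  then show ?thesis using real assms by (auto simp: powr_powr intro!: ennreal_leI)
qed (use assms in \<open>simp add: ennreal_rpow_def top_unique\<close>)

context curve_line
begin

lemma om'_inner: "(t *\<^sub>R \<omega> + s *\<^sub>R om') \<bullet> \<omega> = t"
proof -
  have "\<omega> $ 1 * \<omega> $ 1 + \<omega> $ 2 * \<omega> $ 2 = 1"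
    using om by (simp add: norm_eq_1 inner_vec_def sum_2)
  moreover have "(t *\<^sub>R \<omega> + s *\<^sub>R om') \<bullet> \<omega> = t * (\<omega> $ 1 * \<omega> $ 1 + \<omega> $ 2 * \<omega> $ 2)"
    by (simp add: om'_def rot90_def inner_vec_def sum_2 algebra_simps)
  ultimately show ?thesis by simp
qed

text \<open>In the rotated frame the strip constrains only the coordinate along
  \<open>\<omega>\<close>.\<close>

lemma Lp_norm_strip:
  assumes f: "continuous_on UNIV f" and Q: "Q > 0"
  shows "Lp_norm (ennreal Q) (lebesgue_on (strip \<omega> t)) (fourier_extension \<gamma> f)
     = ennreal_rpow (\<integral>\<^sup>+ \<tau>. line_power Q f \<tau> * indicator {t - 1/2..t + 1/2} \<tau> \<partial>lborel) (1/Q)"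
proof -
  have [measurable]: "fourier_extension \<gamma> f \<in> borel_measurable borel" by (rule measurable_fourier_extension[OF f])
  have "closed (strip \<omega> t)"
    unfolding strip_def by (intro closed_Collect_le continuous_intros)
  then have [measurable]: "strip \<omega> t \<in> sets borel" by (rule borel_closed)
  then have sl: "strip \<omega> t \<in> sets lebesgue" by simp
  let ?g = "\<lambda>x. ennreal_rpow (ennreal (norm (fourier_extension \<gamma> f x))) Q"
  have "(\<integral>\<^sup>+ x. ?g x \<partial>lebesgue_on (strip \<omega> t)) = (\<integral>\<^sup>+ x. ?g x * indicator (strip \<omega> t) x \<partial>lborel)"
    using sl by (subst nn_integral_restrict_space) (auto simp: nn_integral_completion)
  also have "\<dots> = (\<integral>\<^sup>+ \<tau>. \<integral>\<^sup>+ s. ?g (\<tau> *\<^sub>R \<omega> + s *\<^sub>R om') * indicator (strip \<omega> t) (\<tau> *\<^sub>R \<omega> + s *\<^sub>R om') \<partial>lborel \<partial>lborel)"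
    unfolding om'_def by (rule nn_integral_rotated[OF om]) measurable
  also have "\<dots> = (\<integral>\<^sup>+ \<tau>. \<integral>\<^sup>+ s. ennreal (norm (ext_op phase (ampl f \<tau>) s) powr Q) * indicator {t - 1/2..t + 1/2} \<tau> \<partial>lborel \<partial>lborel)"
  proof (intro nn_integral_cong)
    fix \<tau> s
    have "\<bar>\<tau> - t\<bar> \<le> 1/2 \<longleftrightarrow> \<tau> \<in> {t - 1/2..t + 1/2}" unfolding atLeastAtMost_iff by linarith
    then have "indicator (strip \<omega> t) (\<tau> *\<^sub>R \<omega> + s *\<^sub>R om') = (indicator {t - 1/2..t + 1/2} \<tau> :: ennreal)"
      unfolding indicator_def strip_def by (simp only: mem_Collect_eq om'_inner)
    then show "?g (\<tau> *\<^sub>R \<omega> + s *\<^sub>R om') * indicator (strip \<omega> t) (\<tau> *\<^sub>R \<omega> + s *\<^sub>R om') =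
       ennreal (norm (ext_op phase (ampl f \<tau>) s) powr Q) * indicator {t - 1/2..t + 1/2} \<tau>"
      by (simp add: fourier_extension_line[OF f] ennreal_rpow_ennreal)
  qed
  also have "\<dots> = (\<integral>\<^sup>+ \<tau>. line_power Q f \<tau> * indicator {t - 1/2..t + 1/2} \<tau> \<partial>lborel)"
  proof (rule nn_integral_cong)
    fix \<tau>
    have [measurable]: "ext_op phase (ampl f \<tau>) \<in> borel_measurable borel"
      by (rule measurable_ext_op[OF ampl_props(1)[OF f] measurable_curve(4)])
    show "(\<integral>\<^sup>+ s. ennreal (norm (ext_op phase (ampl f \<tau>) s) powr Q) * indicator {t - 1/2..t + 1/2} \<tau> \<partial>lborel)
      = line_power Q f \<tau> * indicator {t - 1/2..t + 1/2} \<tau>"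
      unfolding line_power_def by (rule nn_integral_multc) measurable
  qed
  finally show ?thesis using Q by (simp add: Lp_norm_def)
qed

text \<open>The strip consists of the lines with offset in an interval of length 1, so integrating
  the uniform bound over the offset reproduces the same constant.\<close>

lemma strip_estimate_of_radon:
  assumes R: "radon_estimate \<gamma> \<omega> p (ennreal Q)" and Q: "Q > 0"
  shows "strip_estimate \<gamma> \<omega> p (ennreal Q)"
proof -
  obtain C where "C > 0" and C: "\<And>t f. schwartz f \<Longrightarrow>
    radon_norm (ennreal Q) (fourier_extension \<gamma> f) \<omega> t \<le> ennreal C * Lp_norm p (arc_length_measure \<gamma>) f"
    using R unfolding radon_estimate_def by blast
  have "Lp_norm (ennreal Q) (lebesgue_on (strip \<omega> t)) (fourier_extension \<gamma> f) \<le> ennreal C * Lp_norm p (arc_length_measure \<gamma>) f"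
    if "schwartz f" for t f
  proof (cases "ennreal C * Lp_norm p (arc_length_measure \<gamma>) f")
    case (real N)
    have f: "continuous_on UNIV f" using that by (rule schwartz_continuous)
    have L: "line_power Q f \<tau> \<le> ennreal (N powr Q)" for \<tau>
    proof (rule ennreal_rpow_le_cancel)
      show "ennreal_rpow (line_power Q f \<tau>) (1/Q) \<le> ennreal N"
        using C[OF that, of \<tau>] real by (simp add: radon_norm_line_power[OF f Q])
    qed (use Q real in auto)
    have "(\<integral>\<^sup>+ \<tau>. line_power Q f \<tau> * indicator {t - 1/2..t + 1/2} \<tau> \<partial>lborel)
       \<le> (\<integral>\<^sup>+ \<tau>. ennreal (N powr Q) * indicator {t - 1/2..t + 1/2} \<tau> \<partial>lborel)"
      by (intro nn_integral_mono mult_right_mono L) auto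
    also have "\<dots> = ennreal (N powr Q)" by (subst nn_integral_cmult_indicator) auto
    finally have "ennreal_rpow (\<integral>\<^sup>+ \<tau>. line_power Q f \<tau> * indicator {t - 1/2..t + 1/2} \<tau> \<partial>lborel) (1/Q)
      \<le> ennreal_rpow (ennreal (N powr Q)) (1/Q)"
      using Q by (intro ennreal_rpow_mono) auto
    also have "\<dots> = ennreal N" using Q real by (simp add: ennreal_rpow_ennreal powr_powr)
    finally show ?thesis using real by (simp add: Lp_norm_strip[OF f Q])
  qed simp
  then show ?thesis unfolding strip_estimate_def using \<open>C > 0\<close> by blast
qed

text \<open>The form in which every test function is fed into (S): only the strip around
  \<open>t = 0\<close> is used, and the quantity \<open>2 * \<eta> * X\<close> is collected from the
  lines with offset in \<open>{-\<eta>..\<eta>}\<close>.\<close>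

lemma strip_estimate_lower:
  assumes S: "strip_estimate \<gamma> \<omega> p (ennreal Q)" and Q: "Q > 0"
  shows "\<exists>C>0. \<forall>f X N \<eta>. schwartz f \<longrightarrow> X \<ge> 0 \<longrightarrow> 0 < \<eta> \<longrightarrow> \<eta> \<le> 1/2 \<longrightarrow>
     (\<forall>t. \<bar>t\<bar> \<le> \<eta> \<longrightarrow> ennreal X \<le> line_power Q f t) \<longrightarrow>
     Lp_norm p (arc_length_measure \<gamma>) f \<le> ennreal N \<longrightarrow> N \<ge> 0 \<longrightarrow> 2 * \<eta> * X \<le> C * N powr Q"
proof -
  obtain C where "C > 0" and C: "\<And>t f. schwartz f \<Longrightarrow>
    Lp_norm (ennreal Q) (lebesgue_on (strip \<omega> t)) (fourier_extension \<gamma> f) \<le> ennreal C * Lp_norm p (arc_length_measure \<gamma>) f"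
    using S unfolding strip_estimate_def by blast
  show ?thesis
  proof (intro exI[of _ "C powr Q"] conjI allI impI)
    show "C powr Q > 0" using \<open>C > 0\<close> by simp
    fix f X N \<eta> assume a: "schwartz f" "(X::real) \<ge> 0" "0 < \<eta>" "\<eta> \<le> 1/2"
     and X: "\<forall>t. \<bar>t\<bar> \<le> \<eta> \<longrightarrow> ennreal X \<le> line_power Q f t"
     and N: "Lp_norm p (arc_length_measure \<gamma>) f \<le> ennreal N" "N \<ge> 0"
    have f: "continuous_on UNIV f" using a(1) by (rule schwartz_continuous)
    have "ennreal_rpow (\<integral>\<^sup>+ \<tau>. line_power Q f \<tau> * indicator {0 - 1/2..0 + 1/2} \<tau> \<partial>lborel) (1/Q) \<le> ennreal C * ennreal N"
      using order_trans[OF C[OF a(1), of 0] mult_left_mono[OF N(1)]] by (simp add: Lp_norm_strip[OF f Q])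
    also have "\<dots> = ennreal (C * N)" using \<open>C > 0\<close> N by (simp add: ennreal_mult)
    finally have up: "(\<integral>\<^sup>+ \<tau>. line_power Q f \<tau> * indicator {0 - 1/2..0 + 1/2} \<tau> \<partial>lborel) \<le> ennreal ((C * N) powr Q)"
      using \<open>C > 0\<close> N Q by (intro ennreal_rpow_le_cancel) auto
    have "ennreal (2 * \<eta> * X) = (\<integral>\<^sup>+ \<tau>. ennreal X * indicator {-\<eta>..\<eta>} \<tau> \<partial>lborel)"
      using a by (subst nn_integral_cmult_indicator) (auto simp: mult.commute simp flip: ennreal_mult)
    also have "\<dots> \<le> (\<integral>\<^sup>+ \<tau>. line_power Q f \<tau> * indicator {0 - 1/2..0 + 1/2} \<tau> \<partial>lborel)"
    proof (rule nn_integral_mono)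
      fix \<tau>
      show "ennreal X * indicator {-\<eta>..\<eta>} \<tau> \<le> line_power Q f \<tau> * indicator {0 - 1/2..0 + 1/2} \<tau>"
      proof (cases "\<bar>\<tau>\<bar> \<le> \<eta>")
        case True
        then show ?thesis using X True a by (auto simp: indicator_def abs_le_iff)
      qed (auto simp: indicator_def abs_le_iff)
    qed
    finally have "2 * \<eta> * X \<le> (C * N) powr Q" using up by (metis ennreal_le_iff order_trans powr_ge_zero)
    then show "2 * \<eta> * X \<le> C powr Q * N powr Q" using \<open>C > 0\<close> N by (simp add: powr_mult)
  qed
qed

lemma norm_fourier_extension_le:
  assumes f: "continuous_on UNIV f"
  shows "norm (fourier_extension \<gamma> f x) \<le> Lp_power 1 f"
proof -
  have [measurable]: "f \<in> borel_measurable borel" using f by (rule borel_measurable_continuous_onI)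
  have "norm (fourier_extension \<gamma> f x) = norm (\<integral> u. speed u *\<^sub>R (f (gm u) * exp (2 * complex_of_real pi * \<i> * complex_of_real (gm u \<bullet> x))) \<partial>lborel)"
    unfolding fourier_extension_def by (subst integral_arc) auto
  also have "\<dots> \<le> (\<integral> u. norm (speed u *\<^sub>R (f (gm u) * exp (2 * complex_of_real pi * \<i> * complex_of_real (gm u \<bullet> x)))) \<partial>lborel)"
    by (rule integral_norm_bound)
  also have "\<dots> = Lp_power 1 f"
    unfolding Lp_power_def by (intro Bochner_Integration.integral_cong refl) (simp add: norm_mult mult.commute)
  finally show ?thesis .
qed

section \<open>Sufficient conditions on the exponents\<close>

lemma estimates_infinity:
  assumes p: "1 \<le> p"
  shows "radon_estimate \<gamma> \<omega> p \<infinity>" "strip_estimate \<gamma> \<omega> p \<infinity>"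
proof -
  define C where "C = curve_length + 1"
  have "C > 0" using curve_length_nonneg by (simp add: C_def)
  \<comment> \<open>The trivial bound by the \<open>L^1\<close> norm, which on a curve of finite
    length is at most a multiple of the \<open>L^p\<close> norm for every
    \<open>p \<ge> 1\<close>.\<close>
  have b: "ennreal (norm (fourier_extension \<gamma> f x)) \<le> ennreal C * Lp_norm p (arc_length_measure \<gamma>) f" if "schwartz f" for f x
  proof -
    have f: "continuous_on UNIV f" using that by (rule schwartz_continuous)
    have "ennreal (norm (fourier_extension \<gamma> f x)) \<le> ennreal (Lp_power 1 f)"
      by (intro ennreal_leI norm_fourier_extension_le f)
    also have "\<dots> = Lp_norm (ennreal 1) (arc_length_measure \<gamma>) f"
      by (subst Lp_norm_arc[OF f]) auto
    also have "\<dots> \<le> ennreal C * Lp_norm p (arc_length_measure \<gamma>) f"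
      using Lp_norm_arc_mono[OF f, of 1 p] p \<open>C > 0\<close> by (simp add: C_def)
    finally show ?thesis .
  qed
  have "radon_norm \<infinity> (fourier_extension \<gamma> f) \<omega> t \<le> ennreal C * Lp_norm p (arc_length_measure \<gamma>) f" if "schwartz f" for f t
  proof -
    have [measurable]: "fourier_extension \<gamma> f \<in> borel_measurable borel"
      by (intro measurable_fourier_extension schwartz_continuous that)
    have s: "sets (line_measure \<omega> t) = sets borel" by (simp add: line_measure_def)
    have "(\<lambda>x. ennreal (norm (fourier_extension \<gamma> f x))) \<in> borel_measurable (line_measure \<omega> t)"
      by (subst measurable_cong_sets[OF s refl]) measurable
    then show ?thesis
      using b[OF that] by (auto simp: radon_norm_def Lp_norm_def)
  qed
  then show "radon_estimate \<gamma> \<omega> p \<infinity>" unfolding radon_estimate_def using \<open>C > 0\<close> by blast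
  have "Lp_norm \<infinity> (lebesgue_on (strip \<omega> t)) (fourier_extension \<gamma> f) \<le> ennreal C * Lp_norm p (arc_length_measure \<gamma>) f" if "schwartz f" for f t
  proof -
    have [measurable]: "fourier_extension \<gamma> f \<in> borel_measurable borel"
      by (intro measurable_fourier_extension schwartz_continuous that)
    have "(\<lambda>x. ennreal (norm (fourier_extension \<gamma> f x))) \<in> borel_measurable lborel" by measurable
    then have "(\<lambda>x. ennreal (norm (fourier_extension \<gamma> f x))) \<in> borel_measurable (lebesgue_on (strip \<omega> t))"
      by (intro measurable_restrict_space1 measurable_completion)
    then show ?thesis
      using b[OF that] by (auto simp: Lp_norm_def)
  qed
  then show "strip_estimate \<gamma> \<omega> p \<infinity>" unfolding strip_estimate_def using \<open>C > 0\<close> by blast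
qed

text \<open>Only the base point of a closed curve has two parameters, 0 and 1, and there velocity
  and acceleration agree by the definition of a closed curve.\<close>

lemma curve_param_cases:
  assumes u: "u \<in> {0..1}"
  shows "velocity \<gamma> (curve_param \<gamma> (\<gamma> u)) = velocity \<gamma> u" "acceleration \<gamma> (curve_param \<gamma> (\<gamma> u)) = acceleration \<gamma> u"
proof -
  define s where "s = curve_param \<gamma> (\<gamma> u)"
  have s: "s \<in> {0..1}" "\<gamma> s = \<gamma> u"
    using inv_into_into[of "\<gamma> u" \<gamma> "{0..1}"] f_inv_into_f[of "\<gamma> u" \<gamma> "{0..1}"] u
    by (auto simp: s_def curve_param_def)
  have "velocity \<gamma> s = velocity \<gamma> u \<and> acceleration \<gamma> s = acceleration \<gamma> u"
  proof (cases "s = u")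
    case False
    then have "\<not> arc \<gamma>" using s u unfolding arc_def inj_on_def by blast
    then have cl: "simple_path \<gamma>" "velocity \<gamma> 1 = velocity \<gamma> 0" "acceleration \<gamma> 1 = acceleration \<gamma> 0"
      using curve by (auto simp: compact_C2_curve_def)
    then have "s = 0 \<and> u = 1 \<or> s = 1 \<and> u = 0"
      using s u False unfolding simple_path_def loop_free_def by blast
    then show ?thesis using cl by auto
  qed simp
  then show "velocity \<gamma> (curve_param \<gamma> (\<gamma> u)) = velocity \<gamma> u" "acceleration \<gamma> (curve_param \<gamma> (\<gamma> u)) = acceleration \<gamma> u"
    by (simp_all add: s_def)
qed

lemma normal_iff: "u \<in> {0..1} \<Longrightarrow> curve_normal \<gamma> (\<gamma> u) \<bullet> \<omega> = 0 \<longleftrightarrow> phase1 u = 0"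
  using velocity_nonzero[of u] by (auto simp: curve_normal_def Let_def curve_param_cases inner_rot90 phase1_def om'_def)

text \<open>If both vanished, velocity and acceleration would be parallel to
  \<open>\<omega>\<close>, and the determinant in the curvature would be 0.\<close>

lemma phase2_nz:
  assumes u: "u \<in> {0..1}" and "phase1 u = 0"
  shows "phase2 u \<noteq> 0"
proof
  assume "phase2 u = 0"
  define v a where "v = velocity \<gamma> u" and "a = acceleration \<gamma> u"
  have 1: "\<omega> $ 1 * \<omega> $ 1 + \<omega> $ 2 * \<omega> $ 2 = 1"
    using om by (simp add: norm_eq_1 inner_vec_def sum_2)
  have v: "v $ 2 * \<omega> $ 1 = v $ 1 * \<omega> $ 2" and a: "a $ 2 * \<omega> $ 1 = a $ 1 * \<omega> $ 2"
    using assms \<open>phase2 u = 0\<close>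
    by (simp_all add: phase1_def phase2_def om'_def rot90_def inner_vec_def sum_2 v_def a_def)
  have "v $ 1 * a $ 2 - v $ 2 * a $ 1 = (v $ 1 * a $ 2 - v $ 2 * a $ 1) * (\<omega> $ 1 * \<omega> $ 1 + \<omega> $ 2 * \<omega> $ 2)"
    by (simp add: 1)
  also have "\<dots> = 0" using v a by algebra
  finally have "curve_curvature \<gamma> (\<gamma> u) = 0"
    using u by (simp add: curve_curvature_def Let_def curve_param_cases v_def a_def)
  moreover have "\<gamma> u \<in> path_image \<gamma>" using u by (auto simp: path_image_def)
  ultimately show False using curv by blast
qed

lemma phase_bound: "\<exists>M. \<forall>u\<in>{0..1}. \<bar>phase u\<bar> \<le> M"
proof -
  have "compact (\<gamma> ` {0..1})" using compact_curve by (simp add: path_image_def)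
  then have "bounded (\<gamma> ` {0..1})" by (rule compact_imp_bounded)
  then obtain B where "\<forall>x\<in>\<gamma> ` {0..1}. norm x \<le> B" unfolding bounded_iff by blast
  then have B: "\<And>u. u \<in> {0..1} \<Longrightarrow> norm (\<gamma> u) \<le> B" by blast
  have "\<bar>phase u\<bar> \<le> B * norm om'" if "u \<in> {0..1}" for u
  proof -
    have "\<bar>\<gamma> u \<bullet> om'\<bar> \<le> norm (\<gamma> u) * norm om'" by (rule Cauchy_Schwarz_ineq2)
    also have "\<dots> \<le> B * norm om'" using B[OF that] by (rule mult_right_mono) simp
    finally show ?thesis using that by (simp add: phase_def)
  qed
  then show ?thesis by blast
qed

text \<open>Hausdorff-Young settles the case \<open>1/p + 1/q = 1\<close>, where both restriction
  exponents are known from \<open>Q\<close>; larger \<open>p\<close> follow from the finite length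
  of the curve.\<close>

lemma radon_sufficient_transversal:
  assumes nz: "\<And>u. u \<in> {0..1} \<Longrightarrow> phase1 u \<noteq> 0" and Q: "Q \<ge> 2" and p: "ennreal (Q / (Q - 1)) \<le> p"
  shows "radon_estimate \<gamma> \<omega> p (ennreal Q)"
proof -
  obtain K where K: "K \<ge> 0" "\<And>G. G \<in> borel_measurable borel \<Longrightarrow>
      (\<integral>\<^sup>+ u. G (phase u) * indicator {0..1} u \<partial>lborel) \<le> ennreal K * (\<integral>\<^sup>+ y. G y \<partial>lborel)"
    using push_transversal[OF measurable_curve(4,5) phase_der cont_phase1 nz] by blast
  let ?P = "Q / (Q - 1)"
  have P: "?P > 1" "1/Q + 1/?P = 1" using Q by (auto simp: field_simps)
  have "restriction_bound phase Q ?P"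
    by (rule restriction_bound_transversal[OF K(2,1) Q P(2)])
  then show ?thesis
    using P Q p by (intro radon_estimate_of_restriction[where p = "?P" and r = Q and P = "?P"]) (auto simp: add.commute)
qed

text \<open>In terms of the conjugate \<open>r\<close> of \<open>P\<close>, the strict condition is
  \<open>Q > 2 * r\<close> and equality is \<open>Q = 2 * r\<close>; in the case of equality
  \<open>P \<le> Q\<close> becomes \<open>r \<ge> 3/2\<close>, the range of the weighted Paley
  inequality.\<close>

lemma radon_sufficient_nontransversal:
  assumes P: "P > 1" and Q: "1/P + 2/Q < 1 \<or> 1/P + 2/Q = 1 \<and> P \<le> Q" and Q1: "Q \<ge> 1" and p: "ennreal P \<le> p"
  shows "radon_estimate \<gamma> \<omega> p (ennreal Q)"
proof -
  obtain M where M: "\<And>u. u \<in> {0..1} \<Longrightarrow> \<bar>phase u\<bar> \<le> M" using phase_bound by blast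
  obtain K Y where K: "K \<ge> 0" and KY: "\<And>G. G \<in> borel_measurable borel \<Longrightarrow>
      (\<integral>\<^sup>+ u. G (phase u) * indicator {0..1} u \<partial>lborel)
        \<le> ennreal K * (\<Sum>y0\<in>Y. \<integral>\<^sup>+ y. G y * ennreal (\<bar>y - y0\<bar> powr (-1/2)) \<partial>lborel)"
    using push_nontransversal[OF measurable_curve(4,5) phase_der phase1_der phase2_nz M] by blast
  define r where "r = P / (P - 1)"
  have r: "r > 1" "1/P + 1/r = 1" using P by (auto simp: r_def field_simps)
  have "1/P > 0" using P by simp
  then have "2/Q < 1" using Q by linarith
  then have "Q > 2" using Q1 by (simp add: field_simps)
  define s where "s = Q / (Q - 1)"
  have s: "s > 1" "1/Q + 1/s = 1" using \<open>Q > 2\<close> by (auto simp: s_def field_simps)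
  have "Q > 2 * r \<or> Q = 2 * r \<and> r \<ge> 3/2"
    using Q
  proof
    assume "1/P + 2/Q < 1"
    then have "2/Q < 1/r" using r by linarith
    then show ?thesis using \<open>Q > 2\<close> r by (simp add: field_simps)
  next
    assume *: "1/P + 2/Q = 1 \<and> P \<le> Q"
    then have "2/Q = 1/r" using r by linarith
    then have "Q = 2 * r" using \<open>Q > 2\<close> r by (simp add: field_simps)
    moreover have "r \<ge> 3/2"
    proof -
      have "1/Q \<le> 1/P" using * P by (simp add: field_simps)
      then have "1/(2*r) \<le> 1 - 1/r" using r(2) unfolding \<open>Q = 2 * r\<close> by linarith
      then show ?thesis using r by (simp add: field_simps)
    qed
    ultimately show ?thesis by simp
  qed
  then have "restriction_bound phase r s"
    by (intro restriction_bound_nontransversal[OF KY K M r(1) _ s(2)])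
  then show ?thesis
    using r s P \<open>Q > 2\<close> p by (intro radon_estimate_of_restriction[where p = P and r = r and P = s]) auto
qed

end

section \<open>Schwartz functions of Gaussian type\<close>

text \<open>The factor \<open>(\<epsilon> + |x - x0|\<^sup>2) powr (-\<theta>)\<close> keeps the class closed under differentiation and makes it
  contain mollified homogeneous functions.\<close>

inductive gauss_class :: "(real^2 \<Rightarrow> complex) \<Rightarrow> bool" where
  base: "\<epsilon> > 0 \<Longrightarrow> \<theta> \<ge> 0 \<Longrightarrow> gauss_class (\<lambda>x. complex_of_real ((\<epsilon> + (x - x0) \<bullet> (x - x0)) powr (- \<theta>)) *
     (complex_of_real (exp (- ((x - x0) \<bullet> (x - x0)) / \<delta>\<^sup>2)) * cis (b \<bullet> x)))" if "\<delta> > 0"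
| coord: "gauss_class f \<Longrightarrow> gauss_class (\<lambda>x. complex_of_real (x $ i) * f x)"
| scale: "gauss_class f \<Longrightarrow> gauss_class (\<lambda>x. c * f x)"
| add: "gauss_class f \<Longrightarrow> gauss_class g \<Longrightarrow> gauss_class (\<lambda>x. f x + g x)"

lemma has_derivative_cis_inner:
  "((\<lambda>x::real^2. cis (b \<bullet> x)) has_derivative (\<lambda>h. (\<i> * complex_of_real (b \<bullet> h)) * cis (b \<bullet> x))) (at x)"
proof -
  have "((\<lambda>x. \<i> * complex_of_real (b \<bullet> x)) has_derivative (\<lambda>h. \<i> * complex_of_real (b \<bullet> h))) (at x)"
    by (intro has_derivative_mult_right bounded_linear.has_derivative[OF bounded_linear_of_real] 
        has_derivative_inner_right has_derivative_ident)
  from has_derivative_compose[OF this DERIV_exp[unfolded has_field_derivative_def]]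
  show ?thesis unfolding cis_conv_exp by (simp add: mult_ac)
qed

text \<open>Differentiating the power factor raises \<open>\<theta>\<close> by 1 and multiplies by a
  linear function; the Gaussian and the character contribute linear and constant factors. All these
  products stay in the class.\<close>

lemma gauss_class_derivative:
  assumes "gauss_class f"
  shows "\<exists>f'. (\<forall>x. (f has_derivative f' x) (at x)) \<and> (\<forall>i. gauss_class (\<lambda>x. f' x (axis i 1)))"
  using assms
proof induction
  case (base \<delta> \<epsilon> \<theta> x0 b)
  let ?r = "\<lambda>x::real^2. (x - x0) \<bullet> (x - x0)"
  let ?f = "\<lambda>\<theta> x. complex_of_real ((\<epsilon> + ?r x) powr (- \<theta>)) * (complex_of_real (exp (- ?r x / \<delta>\<^sup>2)) * cis (b \<bullet> x))"
  let ?d = "\<lambda>x h::real^2. (complex_of_real (-2 * \<theta> * (h \<bullet> (x - x0)))) * ?f (\<theta> + 1) x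
     + (complex_of_real (-2 * (h \<bullet> (x - x0)) / \<delta>\<^sup>2) + \<i> * complex_of_real (b \<bullet> h)) * ?f \<theta> x"
  have pos: "\<epsilon> + ?r x > 0" for x using \<open>\<epsilon> > 0\<close> by (simp add: add_pos_nonneg)
  have A: "(?f \<theta> has_derivative ?d x) (at x)" for x
  proof -
    have "((\<lambda>x. (\<epsilon> + ?r x) powr (- \<theta>)) has_derivative (\<lambda>h. -2 * \<theta> * (h \<bullet> (x - x0)) * (\<epsilon> + ?r x) powr (- (\<theta> + 1)))) (at x)"
    proof -
      have "- (\<theta> + 1) = - \<theta> - 1" by simp
      then have *: "(\<epsilon> + ?r x) powr (- \<theta>) / (\<epsilon> + ?r x) = (\<epsilon> + ?r x) powr (- (\<theta> + 1))"
        using pos[of x] by (simp only: powr_diff) simp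
      show ?thesis
        by (rule has_derivative_eq_rhs, rule has_derivative_powr)
          (use pos[of x] * in \<open>auto intro!: derivative_eq_intros simp: inner_commute field_simps fun_eq_iff\<close>)
    qed
    then have d1: "((\<lambda>x. complex_of_real ((\<epsilon> + ?r x) powr (- \<theta>))) has_derivative 
        (\<lambda>h. complex_of_real (-2 * \<theta> * (h \<bullet> (x - x0)) * (\<epsilon> + ?r x) powr (- (\<theta> + 1))))) (at x)"
      by (rule bounded_linear.has_derivative[OF bounded_linear_of_real])
    have d2: "((\<lambda>x. complex_of_real (exp (- ?r x / \<delta>\<^sup>2))) has_derivative 
        (\<lambda>h. complex_of_real (exp (- ?r x / \<delta>\<^sup>2) * (-2 * (h \<bullet> (x - x0)) / \<delta>\<^sup>2)))) (at x)"
      by (rule bounded_linear.has_derivative[OF bounded_linear_of_real])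
        (use \<open>\<delta> > 0\<close> in \<open>auto intro!: derivative_eq_intros 
           simp: inner_commute field_simps fun_eq_iff power2_eq_square power4_eq_xxxx\<close>)
    show ?thesis
      by (rule has_derivative_eq_rhs[OF has_derivative_mult[OF d1 has_derivative_mult[OF d2 has_derivative_cis_inner]]])
        (simp add: fun_eq_iff algebra_simps)
  qed
  have B: "gauss_class (\<lambda>x. ?d x (axis i 1))" for i
  proof -
    have g: "gauss_class (?f \<theta>)" "gauss_class (?f (\<theta> + 1))"
      by (rule gauss_class.base; use base in simp)+
    \<comment> \<open>At a basis vector \<open>h \<bullet> (x - x0)\<close> splits into the
      coordinate \<open>x $ i\<close> and the constant \<open>x0 $ i\<close>, so that only the
      operations of the class occur.\<close>
    have eq: "(\<lambda>x. ?d x (axis i 1)) = (\<lambda>x. (complex_of_real (-2 * \<theta>) * (complex_of_real (x $ i) * ?f (\<theta> + 1) x)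
       + complex_of_real (2 * \<theta> * x0 $ i) * ?f (\<theta> + 1) x)
       + (complex_of_real (-2 / \<delta>\<^sup>2) * (complex_of_real (x $ i) * ?f \<theta> x)
       + (complex_of_real (2 * x0 $ i / \<delta>\<^sup>2) + \<i> * complex_of_real (b $ i)) * ?f \<theta> x))"
      by (rule ext) (simp add: inner_axis' inner_axis algebra_simps diff_divide_distrib)
    show ?thesis
      by (rule ssubst[where P = gauss_class, OF eq]) (intro gauss_class.add gauss_class.scale gauss_class.coord g)
  qed
  show ?case by (rule exI[of _ ?d], intro conjI allI, rule A, rule B)
next
  case (coord f i)
  then obtain f' where f': "\<And>x. (f has_derivative f' x) (at x)" "\<And>i. gauss_class (\<lambda>x. f' x (axis i 1))" by blast
  have "((\<lambda>x. complex_of_real (x $ i) * f x) has_derivative (\<lambda>h. complex_of_real (x $ i) * f' x h + complex_of_real (h $ i) * f x)) (at x)" for x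
    by (rule has_derivative_mult[OF bounded_linear.has_derivative[OF bounded_linear_of_real] f'(1)])
      (rule bounded_linear.has_derivative[OF bounded_linear_vec_nth has_derivative_ident])
  moreover have "gauss_class (\<lambda>x. complex_of_real (x $ i) * f' x (axis j 1) + complex_of_real (axis j 1 $ i) * f x)" for j
    by (intro gauss_class.add gauss_class.coord gauss_class.scale f' coord)
  ultimately show ?case by (intro exI[of _ "\<lambda>x h. complex_of_real (x $ i) * f' x h + complex_of_real (h $ i) * f x"]) auto
next
  case (scale f c)
  then obtain f' where f': "\<And>x. (f has_derivative f' x) (at x)" "\<And>i. gauss_class (\<lambda>x. f' x (axis i 1))" by blast
  show ?case
    by (intro exI[of _ "\<lambda>x h. c * f' x h"] conjI allI has_derivative_mult_right f' gauss_class.scale)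
next
  case (add f g)
  then obtain f' g' where f': "\<And>x. (f has_derivative f' x) (at x)" "\<And>i. gauss_class (\<lambda>x. f' x (axis i 1))" 
    and g': "\<And>x. (g has_derivative g' x) (at x)" "\<And>i. gauss_class (\<lambda>x. g' x (axis i 1))" by blast
  show ?case
    by (intro exI[of _ "\<lambda>x h. f' x h + g' x h"] conjI allI has_derivative_add f' g' gauss_class.add)
qed

text \<open>The power factor is at most \<open>\<epsilon> powr (- \<theta>)\<close>, and a power of
  \<open>norm x\<close> is dominated by an exponential, which the Gaussian absorbs. The induction is
  for all \<open>N\<close> at once, since a coordinate factor costs one power.\<close>

lemma gauss_class_decay:
  assumes "gauss_class f"
  shows "\<exists>B. \<forall>x. norm x ^ N * norm (f x) \<le> B"
  using assms
proof (induction arbitrary: N)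
  case (base \<delta> \<epsilon> \<theta> x0 b)
  define a where "a = 1 / \<delta>\<^sup>2"
  have "a > 0" using base by (simp add: a_def)
  let ?f = "\<lambda>x. complex_of_real ((\<epsilon> + (x - x0) \<bullet> (x - x0)) powr (- \<theta>)) * (complex_of_real (exp (- ((x - x0) \<bullet> (x - x0)) / \<delta>\<^sup>2)) * cis (b \<bullet> x))"
  have "norm x ^ N * norm (?f x) \<le> \<epsilon> powr (- \<theta>) * exp (N * norm x0 + (real N)\<^sup>2 / (4 * a))" for x
  proof -
    define y where "y = norm (x - x0)"
    have "norm x \<le> y + norm x0" unfolding y_def using norm_triangle_ineq[of "x - x0" x0] by simp
    have "norm x \<le> exp (norm x)" using exp_ge_add_one_self[of "norm x"] by linarith
    then have "norm x ^ N \<le> exp (norm x) ^ N" by (intro power_mono) auto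
    also have "\<dots> = exp (real N * norm x)" by (simp add: exp_of_nat_mult)
    also have "\<dots> \<le> exp (real N * (y + norm x0))"
      using \<open>norm x \<le> y + norm x0\<close> by (simp add: mult_left_mono)
    finally have 1: "norm x ^ N \<le> exp (real N * (y + norm x0))" .
    have "(\<epsilon> + (x - x0) \<bullet> (x - x0)) powr (- \<theta>) \<le> \<epsilon> powr (- \<theta>)"
      using base by (intro powr_mono2') auto
    moreover have "norm (?f x) = (\<epsilon> + (x - x0) \<bullet> (x - x0)) powr (- \<theta>) * exp (- a * y\<^sup>2)"
      by (simp add: norm_mult a_def y_def power2_norm_eq_inner)
    ultimately have 2: "norm (?f x) \<le> \<epsilon> powr (- \<theta>) * exp (- a * y\<^sup>2)"
      by (simp add: mult_right_mono)
    have "norm x ^ N * norm (?f x) \<le> exp (real N * (y + norm x0)) * (\<epsilon> powr (- \<theta>) * exp (- a * y\<^sup>2))"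
      by (intro mult_mono 1 2) auto
    also have "\<dots> = \<epsilon> powr (- \<theta>) * exp (real N * (y + norm x0) - a * y\<^sup>2)"
      by (simp add: exp_diff exp_minus field_simps)
    also have "\<dots> \<le> \<epsilon> powr (- \<theta>) * exp (N * norm x0 + (real N)\<^sup>2 / (4 * a))"
    proof -
      \<comment> \<open>Completing the square bounds \<open>real N * y - a * y^2\<close> by
        \<open>N^2 / (4 * a)\<close>.\<close>
      have "0 \<le> a * (y - real N / (2 * a))\<^sup>2" using \<open>a > 0\<close> by simp
      also have "\<dots> = a * y\<^sup>2 - real N * y + (real N)\<^sup>2 / (4 * a)"
        using \<open>a > 0\<close> by (simp add: power2_eq_square field_simps)
      finally show ?thesis by (intro mult_left_mono) (auto simp: algebra_simps)
    qed
    finally show ?thesis .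
  qed
  then show ?case by blast
next
  case (coord f i)
  obtain B where B: "\<And>x. norm x ^ Suc N * norm (f x) \<le> B" using coord.IH[of "Suc N"] by blast
  have "norm x ^ N * norm (complex_of_real (x $ i) * f x) \<le> B" for x
  proof -
    have "norm x ^ N * norm (complex_of_real (x $ i) * f x) \<le> norm x ^ N * (norm x * norm (f x))"
      using component_le_norm_cart[of x i] by (auto simp: norm_mult intro!: mult_left_mono mult_right_mono)
    also have "\<dots> \<le> B" using B[of x] by (simp add: mult_ac)
    finally show ?thesis .
  qed
  then show ?case by blast
next
  case (scale f c)
  obtain B where B: "\<And>x. norm x ^ N * norm (f x) \<le> B" using scale.IH by blast
  have "norm x ^ N * norm (c * f x) \<le> norm c * B" for x
    using mult_left_mono[OF B[of x], of "norm c"] by (simp add: norm_mult mult_ac)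
  then show ?case by blast
next
  case (add f g)
  obtain B1 B2 where B: "\<And>x. norm x ^ N * norm (f x) \<le> B1" "\<And>x. norm x ^ N * norm (g x) \<le> B2"
    using add.IH by meson
  have "norm x ^ N * norm (f x + g x) \<le> B1 + B2" for x
  proof -
    have "norm x ^ N * norm (f x + g x) \<le> norm x ^ N * (norm (f x) + norm (g x))"
      by (intro mult_left_mono norm_triangle_ineq) auto
    also have "\<dots> \<le> B1 + B2" using B[of x] by (simp add: distrib_left add_mono)
    finally show ?thesis .
  qed
  then show ?case by blast
qed

lemma gauss_class_schwartz:
  assumes "gauss_class f" shows "schwartz f"
proof -
  have g: "gauss_class (foldr partial_derivative is f)" for "is"
  proof (induction "is")
    case (Cons i "is")
    then obtain f' where f': "\<And>x. (foldr partial_derivative is f has_derivative f' x) (at x)" "\<And>i. gauss_class (\<lambda>x. f' x (axis i 1))"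
      using gauss_class_derivative by blast
    have "partial_derivative i (foldr partial_derivative is f) = (\<lambda>x. f' x (axis i 1))"
      by (rule ext) (simp add: partial_derivative_def frechet_derivative_at[OF f'(1), symmetric])
    then show ?case using f'(2) by simp
  qed (use assms in simp)
  show ?thesis unfolding schwartz_def Let_def
  proof (intro allI conjI)
    fix "is" x
    show "foldr partial_derivative is f differentiable (at x)"
      using gauss_class_derivative[OF g] unfolding differentiable_def by blast
  qed (rule gauss_class_decay[OF g])
qed

text \<open>The member \<open>f0\<close> provides the zero function, the value of the empty sum, as
  \<open>0 * f0 x\<close>.\<close>

lemma gauss_class_sum:
  assumes "finite J" "\<And>j. j \<in> J \<Longrightarrow> gauss_class (f j)" "gauss_class f0"
  shows "gauss_class (\<lambda>x. \<Sum>j\<in>J. f j x)"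
  using assms(1,2)
proof (induction J rule: finite_induct)
  case empty
  have "gauss_class (\<lambda>x. 0 * f0 x)" using assms(3) by (rule gauss_class.scale)
  then show ?case by simp
next
  case (insert j J)
  then show ?case by (simp add: gauss_class.add)
qed

definition rec_exp :: "ennreal \<Rightarrow> real" where
  "rec_exp p = (if p = \<infinity> then 0 else 1 / enn2real p)"

section \<open>Distances on the curve, measured in the plane\<close>

context curve_line
begin

text \<open>Distance in the plane and not in the parameter, because test functions are functions on
  the plane.\<close>

definition "chord u0 u = norm (gm u - gm u0)"

lemma chord_nonneg [simp]: "chord u0 u \<ge> 0" by (simp add: chord_def)

lemma measurable_chord [measurable]: "chord u0 \<in> borel_measurable borel"
  unfolding chord_def[abs_def] by measurable

lemma chord_inner: "\<bar>(gm u - gm u0) \<bullet> x\<bar> \<le> chord u0 u * norm x"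
  unfolding chord_def by (rule Cauchy_Schwarz_ineq2)

lemma norm_om': "norm om' = 1"
proof -
  have "om' \<bullet> om' = \<omega> \<bullet> \<omega>" by (simp add: om'_def rot90_def inner_vec_def sum_2)
  then show ?thesis using om by (simp add: norm_eq_sqrt_inner)
qed

lemma along_diff: "u \<in> {0..1} \<Longrightarrow> u0 \<in> {0..1} \<Longrightarrow> \<bar>along u - along u0\<bar> \<le> chord u0 u"
  using chord_inner[of u u0 \<omega>] om by (simp add: along_def gm_def inner_diff_left)

lemma phase_diff: "u \<in> {0..1} \<Longrightarrow> u0 \<in> {0..1} \<Longrightarrow> \<bar>phase u - phase u0\<bar> \<le> chord u0 u"
  using chord_inner[of u u0 om'] norm_om' by (simp add: phase_def gm_def inner_diff_left)

lemma cover_Icc: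
  assumes "\<And>z. z \<in> {0..1} \<Longrightarrow> \<exists>\<epsilon>>0. P z \<epsilon>"
  obtains T \<epsilon> where "finite T" "T \<subseteq> {0..1}" "\<And>z. z \<in> T \<Longrightarrow> \<epsilon> z > 0 \<and> P z (\<epsilon> z)" "\<And>u. u \<in> {0..1} \<Longrightarrow> \<exists>z\<in>T. \<bar>u - z\<bar> < (\<epsilon> z :: real)"
proof -
  have "\<forall>z\<in>{0..1}. \<exists>\<epsilon>. \<epsilon> > 0 \<and> P z \<epsilon>" using assms by blast
  from bchoice[OF this] obtain \<epsilon> where \<epsilon>: "\<forall>z\<in>{0..1}. \<epsilon> z > 0 \<and> P z (\<epsilon> z)" ..
  obtain T where T: "T \<subseteq> {0..1}" "finite T" "{0..1} \<subseteq> (\<Union>z\<in>T. ball z (\<epsilon> z))"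
  proof (rule compactE_image[of "{0..1::real}" "{0..1}" "\<lambda>u. ball u (\<epsilon> u)"])
    show "{0..1} \<subseteq> (\<Union>u\<in>{0..1}. ball u (\<epsilon> u))"
    proof
      fix u :: real assume "u \<in> {0..1}"
      then show "u \<in> (\<Union>u\<in>{0..1}. ball u (\<epsilon> u))" using \<epsilon> by (intro UN_I[of u]) auto
    qed
  qed (use that in auto)
  show ?thesis
  proof (rule that[OF T(2,1)])
    show "\<epsilon> z > 0 \<and> P z (\<epsilon> z)" if "z \<in> T" for z using \<epsilon> T(1) that by blast
    fix u :: real assume "u \<in> {0..1}"
    then obtain z where "z \<in> T" "u \<in> ball z (\<epsilon> z)" using T(3) by blast
    then show "\<exists>z\<in>T. \<bar>u - z\<bar> < \<epsilon> z" by (auto simp: dist_real_def abs_minus_commute)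
  qed
qed

text \<open>If \<open>z\<close> parametrises the same point as \<open>u0\<close>, the nonzero
  velocity gives linear growth. Otherwise the chord stays above half the distance of the two points
  near \<open>z\<close>, and \<open>\<bar>u - z\<bar> \<le> 1\<close>.\<close>

lemma chord_local_lower:
  assumes z: "z \<in> {0..1}" and u0: "u0 \<in> {0..1}"
  shows "\<exists>\<epsilon>>0. \<exists>c>0. \<forall>u\<in>{0..1}. \<bar>u - z\<bar> < \<epsilon> \<longrightarrow> c * \<bar>u - z\<bar> \<le> chord u0 u"
proof (cases "\<gamma> z = \<gamma> u0")
  case True
  define c where "c = norm (velocity \<gamma> z) / 2"
  have "c > 0" using velocity_nonzero[OF z] by (simp add: c_def)
  have "(\<gamma> has_derivative (\<lambda>h. h *\<^sub>R velocity \<gamma> z)) (at z within {0..1})"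
    using curve_derivative[OF z] by (simp add: has_vector_derivative_def)
  then obtain \<epsilon> where "\<epsilon> > 0" and \<epsilon>: "\<And>u. u \<in> {0..1} \<Longrightarrow> \<bar>u - z\<bar> < \<epsilon> \<Longrightarrow>
     norm (\<gamma> u - \<gamma> z - (u - z) *\<^sub>R velocity \<gamma> z) \<le> c * \<bar>u - z\<bar>"
    using \<open>c > 0\<close> z unfolding has_derivative_within_alt by (auto simp: real_norm_def)
  have "c * \<bar>u - z\<bar> \<le> chord u0 u" if u: "u \<in> {0..1}" "\<bar>u - z\<bar> < \<epsilon>" for u
  proof -
    have "2 * c * \<bar>u - z\<bar> = norm ((u - z) *\<^sub>R velocity \<gamma> z)" by (simp add: c_def)
    also have "\<dots> \<le> norm (\<gamma> u - \<gamma> z) + norm (\<gamma> u - \<gamma> z - (u - z) *\<^sub>R velocity \<gamma> z)"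
      using norm_triangle_sub[of "(u - z) *\<^sub>R velocity \<gamma> z" "\<gamma> u - \<gamma> z"] by (simp add: norm_minus_commute)
    also have "\<dots> \<le> norm (\<gamma> u - \<gamma> z) + c * \<bar>u - z\<bar>" using \<epsilon>[OF u] by simp
    finally show ?thesis using u u0 True by (simp add: chord_def gm_def)
  qed
  then show ?thesis using \<open>\<epsilon> > 0\<close> \<open>c > 0\<close> by blast
next
  case False
  define m where "m = norm (\<gamma> z - \<gamma> u0) / 2"
  have "m > 0" using False by (simp add: m_def)
  obtain \<epsilon> where "\<epsilon> > 0" and \<epsilon>: "\<And>u. u \<in> {0..1} \<Longrightarrow> dist u z < \<epsilon> \<Longrightarrow> dist (\<gamma> u) (\<gamma> z) < m"
    using continuous_on_curve z \<open>m > 0\<close> unfolding continuous_on_iff by blast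
  have "m * \<bar>u - z\<bar> \<le> chord u0 u" if u: "u \<in> {0..1}" "\<bar>u - z\<bar> < \<epsilon>" for u
  proof -
    have "norm (\<gamma> u - \<gamma> z) < m" using \<epsilon>[OF u(1)] u(2) by (simp add: dist_norm)
    moreover have "2 * m \<le> norm (\<gamma> u - \<gamma> u0) + norm (\<gamma> u - \<gamma> z)"
      unfolding m_def using norm_triangle_ineq4[of "\<gamma> u - \<gamma> u0" "\<gamma> u - \<gamma> z"] by simp
    ultimately have "m \<le> norm (\<gamma> u - \<gamma> u0)" by linarith
    moreover have "\<bar>u - z\<bar> \<le> 1" using u z by auto
    ultimately have "m * \<bar>u - z\<bar> \<le> norm (\<gamma> u - \<gamma> u0)"
      using \<open>m > 0\<close> mult_left_mono[of "\<bar>u - z\<bar>" 1 m] by linarith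
    then show ?thesis using u u0 by (simp add: chord_def gm_def)
  qed
  then show ?thesis using \<open>\<epsilon> > 0\<close> \<open>m > 0\<close> by blast
qed

text \<open>The curve may pass through \<open>\<gamma> u0\<close> several times, hence the finite set of parameters.\<close>

lemma chord_lower:
  assumes u0: "u0 \<in> {0..1}"
  obtains T c where "finite T" "T \<subseteq> {0..1}" "c > 0" "\<And>u. u \<in> {0..1} \<Longrightarrow> \<exists>z\<in>T. c * \<bar>u - z\<bar> \<le> chord u0 u"
proof -
  obtain T \<epsilon> where T: "finite T" "T \<subseteq> {0..1}" 
    and \<epsilon>: "\<And>z. z \<in> T \<Longrightarrow> \<epsilon> z > 0 \<and> (\<exists>c>0. \<forall>u\<in>{0..1}. \<bar>u - z\<bar> < \<epsilon> z \<longrightarrow> c * \<bar>u - z\<bar> \<le> chord u0 u)"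
    and cov: "\<And>u. u \<in> {0..1} \<Longrightarrow> \<exists>z\<in>T. \<bar>u - z\<bar> < \<epsilon> z"
    by (rule cover_Icc[OF chord_local_lower[OF _ u0]]) blast+
  have "\<forall>z\<in>T. \<exists>c. c > 0 \<and> (\<forall>u\<in>{0..1}. \<bar>u - z\<bar> < \<epsilon> z \<longrightarrow> c * \<bar>u - z\<bar> \<le> chord u0 u)" using \<epsilon> by blast
  from bchoice[OF this] obtain c where c: "\<forall>z\<in>T. c z > 0 \<and> (\<forall>u\<in>{0..1}. \<bar>u - z\<bar> < \<epsilon> z \<longrightarrow> c z * \<bar>u - z\<bar> \<le> chord u0 u)" ..
  \<comment> \<open>The inserted 1 guards the minimum against an empty set.\<close>
  define c0 where "c0 = Min (insert 1 (c ` T))"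
  have fin: "finite (insert 1 (c ` T))" using T by simp
  have "c0 > 0" unfolding c0_def using fin c by (subst Min_gr_iff) auto
  have c0: "c0 \<le> c z" if "z \<in> T" for z unfolding c0_def using fin that by (intro Min_le) auto
  show ?thesis
  proof (rule that[OF T \<open>c0 > 0\<close>])
    fix u :: real assume u: "u \<in> {0..1}"
    then obtain z where z: "z \<in> T" "\<bar>u - z\<bar> < \<epsilon> z" using cov by blast
    then have "c z * \<bar>u - z\<bar> \<le> chord u0 u" using c u by blast
    moreover have "c0 * \<bar>u - z\<bar> \<le> c z * \<bar>u - z\<bar>" using c0[OF z(1)] by (rule mult_right_mono) simp
    ultimately show "\<exists>z\<in>T. c0 * \<bar>u - z\<bar> \<le> chord u0 u" using z(1) by (intro bexI[of _ z]) auto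
  qed
qed

text \<open>A decreasing function of the chord is dominated by the sum of its values at
  \<open>c * \<bar>u - z\<bar>\<close>, with \<open>z\<close> in the finite set from
  \<open>chord_lower\<close>. Each summand is translated to the origin, and \<open>u - z\<close>
  stays in \<open>{-1..1}\<close>.\<close>

lemma nn_integral_chord_le:
  assumes u0: "u0 \<in> {0..1}"
  shows "\<exists>m c::real. c > 0 \<and> m \<ge> 0 \<and> (\<forall>g. g \<in> borel_measurable borel \<longrightarrow> (\<forall>x y. 0 \<le> x \<longrightarrow> x \<le> y \<longrightarrow> g y \<le> g x) \<longrightarrow>
     (\<integral>\<^sup>+ u. g (chord u0 u) * ennreal (speed u) \<partial>lborel) \<le> ennreal m * (\<integral>\<^sup>+ v. g (c * \<bar>v\<bar>) * indicator {-1..1} v \<partial>lborel))"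
proof -
  obtain T c where T: "finite T" "T \<subseteq> {0..1}" and "c > 0" and Tc: "\<And>u. u \<in> {0..1} \<Longrightarrow> \<exists>z\<in>T. c * \<bar>u - z\<bar> \<le> chord u0 u"
    using chord_lower[OF u0] by blast
  obtain c' W where W: "W > 0" "\<And>u. speed u \<le> W" by (rule speed_bounds) blast
  show ?thesis
  proof (rule exI[of _ "W * real (card T)"], rule exI[of _ c], intro conjI allI impI)
    show "c > 0" by fact
    show "0 \<le> W * real (card T)" using W by simp
    fix g :: "real \<Rightarrow> ennreal" assume [measurable]: "g \<in> borel_measurable borel" and anti: "\<forall>x y. 0 \<le> x \<longrightarrow> x \<le> y \<longrightarrow> g y \<le> g x"
    let ?I = "\<integral>\<^sup>+ v. g (c * \<bar>v\<bar>) * indicator {-1..1} v \<partial>lborel"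
    have "(\<integral>\<^sup>+ u. g (chord u0 u) * ennreal (speed u) \<partial>lborel)
       \<le> (\<integral>\<^sup>+ u. ennreal W * (\<Sum>z\<in>T. g (c * \<bar>u - z\<bar>) * indicator {-1..1} (u - z)) \<partial>lborel)"
    proof (rule nn_integral_mono)
      fix u
      show "g (chord u0 u) * ennreal (speed u) \<le> ennreal W * (\<Sum>z\<in>T. g (c * \<bar>u - z\<bar>) * indicator {-1..1} (u - z))"
      proof (cases "u \<in> {0..1}")
        case True
        then obtain z where z: "z \<in> T" "c * \<bar>u - z\<bar> \<le> chord u0 u" using Tc by blast
        have "u - z \<in> {-1..1}" using True z(1) T(2) by auto
        then have "g (chord u0 u) \<le> g (c * \<bar>u - z\<bar>) * indicator {-1..1} (u - z)"
          using anti z(2) \<open>c > 0\<close> by simp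
        also have "\<dots> \<le> (\<Sum>z\<in>T. g (c * \<bar>u - z\<bar>) * indicator {-1..1} (u - z))"
          using z(1) T(1) by (intro member_le_sum) auto
        finally have "ennreal (speed u) * g (chord u0 u) \<le> ennreal W * (\<Sum>z\<in>T. g (c * \<bar>u - z\<bar>) * indicator {-1..1} (u - z))"
          using W(2)[of u] by (intro mult_mono ennreal_leI) auto
        then show ?thesis by (simp add: mult.commute)
      next
        case False
        then have "speed u = 0" by (rule speed_outside)
        then show ?thesis by simp
      qed
    qed
    also have "\<dots> = ennreal W * (\<Sum>z\<in>T. \<integral>\<^sup>+ u. g (c * \<bar>u - z\<bar>) * indicator {-1..1} (u - z) \<partial>lborel)"
      by (subst nn_integral_cmult) (auto simp: nn_integral_sum)
    also have "(\<Sum>z\<in>T. \<integral>\<^sup>+ u. g (c * \<bar>u - z\<bar>) * indicator {-1..1} (u - z) \<partial>lborel) = (\<Sum>z\<in>T. ?I)"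
    proof (rule sum.cong[OF refl])
      fix z
      show "(\<integral>\<^sup>+ u. g (c * \<bar>u - z\<bar>) * indicator {-1..1} (u - z) \<partial>lborel) = ?I"
        by (subst nn_integral_real_affine[where c = 1 and t = z]) auto
    qed
    also have "ennreal W * (\<Sum>z\<in>T. ?I) = ennreal (W * real (card T)) * ?I"
      using W by (simp add: ennreal_mult mult.assoc ennreal_of_nat_eq_real_of_nat)
    finally show "(\<integral>\<^sup>+ u. g (chord u0 u) * ennreal (speed u) \<partial>lborel) \<le> ennreal (W * real (card T)) * ?I" .
  qed
qed

lemma chord_upper: obtains V where "V > 0" "\<And>u u0. u \<in> {0..1} \<Longrightarrow> u0 \<in> {0..1} \<Longrightarrow> chord u0 u \<le> V * \<bar>u - u0\<bar>"
proof -
  obtain c W where W: "W > 0" "\<And>u. speed u \<le> W" by (rule speed_bounds) blast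
  have "chord u0 u \<le> W * \<bar>u - u0\<bar>" if u: "u \<in> {0..1}" "u0 \<in> {0..1}" for u u0
  proof -
    have "norm (\<gamma> u - \<gamma> u0) \<le> W * norm (u - u0)"
    proof (rule differentiable_bound[of "{0..1}"])
      show "convex {0..1::real}" by simp
      show "\<And>x. x \<in> {0..1} \<Longrightarrow> (\<gamma> has_derivative (\<lambda>h. h *\<^sub>R velocity \<gamma> x)) (at x within {0..1})"
        using curve_derivative by (simp add: has_vector_derivative_def)
      fix x :: real assume "x \<in> {0..1}"
      then have "norm (velocity \<gamma> x) \<le> W" using W(2)[of x] by (simp add: speed_def)
      then show "onorm (\<lambda>h. h *\<^sub>R velocity \<gamma> x) \<le> W"
        by (intro onorm_bound) (use W(1) in \<open>auto simp: mult.commute[of W] intro!: mult_left_mono\<close>)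
    qed (use u in auto)
    then show ?thesis using u by (simp add: chord_def gm_def)
  qed
  then show ?thesis using that W(1) by blast
qed

text \<open>Near a parameter \<open>z\<close> of the same point the phase is critical as well, since
  the two velocities agree, and a second-order estimate compares its increment with the square of
  the chord. Elsewhere the chord is bounded below by some \<open>m\<close>, and the Lipschitz bound
  by one chord is at most \<open>1 / m\<close> times its square.\<close>

lemma phase_quadratic:
  assumes u0: "u0 \<in> {0..1}" and crit: "phase1 u0 = 0"
  obtains C where "C > 0" "\<And>u. u \<in> {0..1} \<Longrightarrow> \<bar>phase u - phase u0\<bar> \<le> C * (chord u0 u)\<^sup>2"
proof -
  have loc: "\<exists>\<epsilon>>0. \<exists>C>0. \<forall>u\<in>{0..1}. \<bar>u - z\<bar> < \<epsilon> \<longrightarrow> \<bar>phase u - phase u0\<bar> \<le> C * (chord u0 u)\<^sup>2" if z: "z \<in> {0..1}" for z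
  proof (cases "\<gamma> z = \<gamma> u0")
    case True
    have "velocity \<gamma> z = velocity \<gamma> u0"
      using curve_param_cases(1)[OF z] curve_param_cases(1)[OF u0] by (simp add: True)
    then have crit_z: "phase1 z = 0" using crit z u0 by (simp add: phase1_def)
    have phz: "phase z = phase u0" using True z u0 by (simp add: phase_def)
    obtain \<epsilon>1 c where e1: "\<epsilon>1 > 0" and "c > 0" and c: "\<And>u. u \<in> {0..1} \<Longrightarrow> \<bar>u - z\<bar> < \<epsilon>1 \<Longrightarrow> c * \<bar>u - z\<bar> \<le> chord u0 u"
      using chord_local_lower[OF z u0] by blast
    \<comment> \<open>Differentiability of \<open>phase1\<close> at \<open>z\<close> bounds it by
      this multiple of \<open>\<bar>u - z\<bar>\<close>; the summand 1 is the error allowed in the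
      linear approximation.\<close>
    define D where "D = \<bar>phase2 z\<bar> + 1"
    have "D > 0" by (simp add: D_def)
    have "(phase1 has_derivative (*) (phase2 z)) (at z within {0..1})"
      using phase1_der[OF z] by (simp add: has_field_derivative_def)
    then obtain \<epsilon>2 where e2: "\<epsilon>2 > 0" and d2: "\<And>u. u \<in> {0..1} \<Longrightarrow> \<bar>u - z\<bar> < \<epsilon>2 \<Longrightarrow> \<bar>phase1 u - phase2 z * (u - z)\<bar> \<le> 1 * \<bar>u - z\<bar>"
      using z crit_z unfolding has_derivative_within_alt real_norm_def by (metis diff_zero zero_less_one)
    have b: "\<bar>phase1 u\<bar> \<le> D * \<bar>u - z\<bar>" if "u \<in> {0..1}" "\<bar>u - z\<bar> < \<epsilon>2" for u
    proof -
      have "\<bar>phase2 z * (u - z)\<bar> = \<bar>phase2 z\<bar> * \<bar>u - z\<bar>" by (rule abs_mult)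
      moreover have "\<bar>phase1 u\<bar> \<le> \<bar>w\<bar> + \<bar>phase1 u - w\<bar>" for w by linarith
      ultimately have "\<bar>phase1 u\<bar> \<le> \<bar>phase2 z\<bar> * \<bar>u - z\<bar> + \<bar>u - z\<bar>" using d2[OF that] by (metis add_left_mono mult_1 order_trans)
      then show ?thesis by (simp add: D_def distrib_right)
    qed
    have "\<bar>phase u - phase u0\<bar> \<le> (D / c\<^sup>2) * (chord u0 u)\<^sup>2" if u: "u \<in> {0..1}" "\<bar>u - z\<bar> < min \<epsilon>1 \<epsilon>2" for u
    proof -
      let ?S = "{min u z..max u z}"
      have S: "x \<in> {0..1}" "\<bar>x - z\<bar> \<le> \<bar>u - z\<bar>" if "x \<in> ?S" for x
        using that u z by (auto simp: min_def max_def split: if_splits)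
      have "norm (phase u - phase z) \<le> (D * \<bar>u - z\<bar>) * norm (u - z)"
      proof (rule field_differentiable_bound[of ?S])
        show "convex ?S" by simp
        show "(phase has_field_derivative phase1 x) (at x within ?S)" if "x \<in> ?S" for x
          by (rule DERIV_subset[OF phase_der]) (use S that in blast)+
        show "norm (phase1 x) \<le> D * \<bar>u - z\<bar>" if "x \<in> ?S" for x
        proof -
          have "\<bar>phase1 x\<bar> \<le> D * \<bar>x - z\<bar>" using b[OF S(1)[OF that]] S(2)[OF that] u by simp
          also have "\<dots> \<le> D * \<bar>u - z\<bar>" using S(2)[OF that] \<open>D > 0\<close> by simp
          finally show ?thesis by simp
        qed
      qed auto
      then have 1: "\<bar>phase u - phase u0\<bar> \<le> D * \<bar>u - z\<bar>\<^sup>2" by (simp add: phz power2_eq_square mult.assoc)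
      have "(c * \<bar>u - z\<bar>)\<^sup>2 \<le> (chord u0 u)\<^sup>2" using c[of u] u \<open>c > 0\<close> by (intro power_mono) auto
      then have "\<bar>u - z\<bar>\<^sup>2 \<le> (chord u0 u)\<^sup>2 / c\<^sup>2" using \<open>c > 0\<close> by (simp add: power_mult_distrib field_simps)
      then have "D * \<bar>u - z\<bar>\<^sup>2 \<le> D * ((chord u0 u)\<^sup>2 / c\<^sup>2)" using \<open>D > 0\<close> by (intro mult_left_mono) auto
      then show ?thesis using 1 by simp
    qed
    then show ?thesis using e1 e2 \<open>D > 0\<close> \<open>c > 0\<close>
      by (intro exI[of _ "min \<epsilon>1 \<epsilon>2"] conjI exI[of _ "D / c\<^sup>2"]) auto
  next
    case False
    define m where "m = norm (\<gamma> z - \<gamma> u0) / 2"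
    have "m > 0" using False by (simp add: m_def)
    obtain \<epsilon> where "\<epsilon> > 0" and \<epsilon>: "\<And>u. u \<in> {0..1} \<Longrightarrow> dist u z < \<epsilon> \<Longrightarrow> dist (\<gamma> u) (\<gamma> z) < m"
      using continuous_on_curve z \<open>m > 0\<close> unfolding continuous_on_iff by blast
    have "\<bar>phase u - phase u0\<bar> \<le> 1 / m * (chord u0 u)\<^sup>2" if u: "u \<in> {0..1}" "\<bar>u - z\<bar> < \<epsilon>" for u
    proof -
      have "norm (\<gamma> u - \<gamma> z) < m" using \<epsilon>[OF u(1)] u(2) by (simp add: dist_norm)
      moreover have "2 * m \<le> norm (\<gamma> u - \<gamma> u0) + norm (\<gamma> u - \<gamma> z)"
        unfolding m_def using norm_triangle_ineq4[of "\<gamma> u - \<gamma> u0" "\<gamma> u - \<gamma> z"] by simp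
      ultimately have "m \<le> chord u0 u" using u u0 by (simp add: chord_def gm_def)
      then have "1 * chord u0 u \<le> 1 / m * chord u0 u * chord u0 u"
        using \<open>m > 0\<close> by (intro mult_right_mono) auto
      then show ?thesis using phase_diff[OF u(1) u0] by (simp add: power2_eq_square)
    qed
    then show ?thesis using \<open>\<epsilon> > 0\<close> \<open>m > 0\<close> by (intro exI[of _ \<epsilon>] conjI exI[of _ "1 / m"]) auto
  qed
  obtain T \<epsilon> where T: "finite T" "T \<subseteq> {0..1}" 
    and \<epsilon>: "\<And>z. z \<in> T \<Longrightarrow> \<epsilon> z > 0 \<and> (\<exists>C>0. \<forall>u\<in>{0..1}. \<bar>u - z\<bar> < \<epsilon> z \<longrightarrow> \<bar>phase u - phase u0\<bar> \<le> C * (chord u0 u)\<^sup>2)"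
    and cov: "\<And>u. u \<in> {0..1} \<Longrightarrow> \<exists>z\<in>T. \<bar>u - z\<bar> < \<epsilon> z"
    by (rule cover_Icc[OF loc]) blast+
  have "\<forall>z\<in>T. \<exists>C. C > 0 \<and> (\<forall>u\<in>{0..1}. \<bar>u - z\<bar> < \<epsilon> z \<longrightarrow> \<bar>phase u - phase u0\<bar> \<le> C * (chord u0 u)\<^sup>2)" using \<epsilon> by blast
  from bchoice[OF this] obtain C where C: "\<forall>z\<in>T. C z > 0 \<and> (\<forall>u\<in>{0..1}. \<bar>u - z\<bar> < \<epsilon> z \<longrightarrow> \<bar>phase u - phase u0\<bar> \<le> C z * (chord u0 u)\<^sup>2)" ..
  define C0 where "C0 = Max (insert 1 (C ` T))"
  have fin: "finite (insert 1 (C ` T))" using T by simp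
  have C0: "C z \<le> C0" if "z \<in> T" for z unfolding C0_def using fin that by (intro Max_ge) auto
  have "1 \<le> C0" unfolding C0_def using fin by (intro Max_ge) auto
  show ?thesis
  proof (rule that[of C0])
    show "C0 > 0" using \<open>1 \<le> C0\<close> by simp
    fix u :: real assume u: "u \<in> {0..1}"
    then obtain z where z: "z \<in> T" "\<bar>u - z\<bar> < \<epsilon> z" using cov by blast
    then have "\<bar>phase u - phase u0\<bar> \<le> C z * (chord u0 u)\<^sup>2" using C u by blast
    also have "\<dots> \<le> C0 * (chord u0 u)\<^sup>2" using C0[OF z(1)] by (rule mult_right_mono) simp
    finally show "\<bar>phase u - phase u0\<bar> \<le> C0 * (chord u0 u)\<^sup>2" .
  qed
qed

end

section \<open>Necessary conditions\<close>

lemma one_minus_cos_le: "1 - \<bar>x\<bar> \<le> cos (x::real)"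
proof -
  have "1 - cos x = 2 * (sin (x/2))\<^sup>2"
    using cos_double_sin[of "x/2"] by simp
  also have "\<dots> \<le> 2 * \<bar>sin (x/2)\<bar>"
  proof -
    have "(sin (x/2))\<^sup>2 = \<bar>sin (x/2)\<bar> * \<bar>sin (x/2)\<bar>" by (simp add: power2_eq_square)
    also have "\<dots> \<le> \<bar>sin (x/2)\<bar> * 1" by (intro mult_left_mono) auto
    finally show ?thesis by simp
  qed
  also have "\<dots> \<le> \<bar>x\<bar>" using abs_sin_x_le_abs_x[of "x/2"] by simp
  finally show ?thesis by simp
qed

text \<open>The constant phase \<open>\<theta>0\<close> does not change the modulus, and the real
  part of the remaining integral is estimated by \<open>1 - \<bar>x\<bar> \<le> cos x\<close>. The
  majorant \<open>\<Theta>\<close> measures the loss.\<close>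

lemma norm_integral_cis_lower:
  fixes g \<theta> \<Theta> :: "real \<Rightarrow> real"
  assumes g: "integrable lborel g" and nn: "\<And>u. g u \<ge> 0" and [measurable]: "\<theta> \<in> borel_measurable borel"
    and b: "\<And>u. g u * \<bar>\<theta> u\<bar> \<le> \<Theta> u" and \<Theta>: "integrable lborel \<Theta>"
  shows "(\<integral>u. g u \<partial>lborel) - (\<integral>u. \<Theta> u \<partial>lborel) \<le> norm (\<integral>u. complex_of_real (g u) * cis (\<theta> u + \<theta>0) \<partial>lborel)"
proof -
  have [measurable]: "g \<in> borel_measurable borel" using g by auto
  have i: "integrable lborel (\<lambda>u. complex_of_real (g u) * cis (\<theta> u))"
    by (rule Bochner_Integration.integrable_bound[OF g]) (auto simp: norm_mult nn cis_conv_exp)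
  have "(\<integral>u. g u \<partial>lborel) - (\<integral>u. \<Theta> u \<partial>lborel) = (\<integral>u. g u - \<Theta> u \<partial>lborel)"
    using g \<Theta> by simp
  also have "\<dots> \<le> (\<integral>u. Re (complex_of_real (g u) * cis (\<theta> u)) \<partial>lborel)"
  proof (rule Bochner_Integration.integral_mono)
    fix u
    have "g u - \<Theta> u \<le> g u * (1 - \<bar>\<theta> u\<bar>)" using b[of u] by (simp add: algebra_simps)
    also have "\<dots> \<le> g u * cos (\<theta> u)" by (intro mult_left_mono one_minus_cos_le nn)
    finally show "g u - \<Theta> u \<le> Re (complex_of_real (g u) * cis (\<theta> u))" by simp
  qed (use g \<Theta> i in \<open>auto simp del: Re_complex_of_real times_complex.sel\<close>)
  also have "\<dots> = Re (\<integral>u. complex_of_real (g u) * cis (\<theta> u) \<partial>lborel)"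
    using i by (rule integral_Re)
  also have "\<dots> \<le> norm (\<integral>u. complex_of_real (g u) * cis (\<theta> u) \<partial>lborel)" by (rule complex_Re_le_cmod)
  also have "\<dots> = norm ((\<integral>u. complex_of_real (g u) * cis (\<theta> u) \<partial>lborel) * cis \<theta>0)"
    by (simp add: norm_mult)
  also have "\<dots> = norm (\<integral>u. complex_of_real (g u) * cis (\<theta> u + \<theta>0) \<partial>lborel)"
    using i by (simp add: mult.assoc cis_mult flip: integral_mult_left_zero)
  finally show ?thesis .
qed

text \<open>If \<open>b\<close> were larger than \<open>a\<close>, dividing by
  \<open>\<delta> powr a\<close> and letting \<open>\<delta>\<close> tend to 0 would give
  \<open>A \<le> 0\<close>.\<close>

lemma powr_exponent_le:
  assumes "A > 0" and le: "\<And>\<delta>. 0 < \<delta> \<Longrightarrow> \<delta> \<le> 1/2 \<Longrightarrow> A * \<delta> powr a \<le> B * \<delta> powr b"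
  shows "b \<le> (a::real)"
proof (rule ccontr)
  assume "\<not> b \<le> a"
  then have ba: "b - a > 0" by simp
  have "((\<lambda>\<delta>. B * \<delta> powr (b - a)) \<longlongrightarrow> B * 0) (at_right 0)"
    by (intro tendsto_intros) (use ba in real_asymp)
  then have "((\<lambda>\<delta>. B * \<delta> powr (b - a)) \<longlongrightarrow> 0) (at_right 0)" by simp
  from order_tendstoD(2)[OF this \<open>A > 0\<close>]
  have "eventually (\<lambda>\<delta>. B * \<delta> powr (b - a) < A) (at_right 0)" .
  moreover have "eventually (\<lambda>\<delta>::real. 0 < \<delta> \<and> \<delta> < 1/2) (at_right 0)"
    by (auto simp: eventually_at_right[of 0 1] intro!: exI[of _ "1/2"])
  ultimately have "eventually (\<lambda>\<delta>. B * \<delta> powr (b - a) < A \<and> 0 < \<delta> \<and> \<delta> < 1/2) (at_right 0)"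
    by eventually_elim auto
  then obtain \<delta> where d: "B * \<delta> powr (b - a) < A" "0 < \<delta>" "\<delta> < 1/2"
    using eventually_happens[of _ "at_right (0::real)"] by auto
  have "B * \<delta> powr (b - a) * \<delta> powr a < A * \<delta> powr a"
    using d by (intro mult_strict_right_mono) auto
  also have "B * \<delta> powr (b - a) * \<delta> powr a = B * \<delta> powr b"
    by (simp add: mult.assoc flip: powr_add)
  finally show False using le[of \<delta>] d by simp
qed

section \<open>Gaussian test functions: Knapp's example\<close>

context curve_line
begin

text \<open>Treats finite and infinite exponents in one statement; for
  \<open>p = \<infinity>\<close> a bound on the whole plane bounds the essential supremum on the
  curve.\<close>

lemma Lp_norm_le_real:
  assumes f: "continuous_on UNIV f" and p: "1 \<le> p" and X: "X \<ge> 0"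
    and fin: "\<And>P. p = ennreal P \<Longrightarrow> 1 \<le> P \<Longrightarrow> Lp_power P f \<le> X powr P"
    and inf: "p = \<infinity> \<Longrightarrow> \<forall>x. norm (f x) \<le> X"
  shows "Lp_norm p (arc_length_measure \<gamma>) f \<le> ennreal X"
proof (cases p)
  case (real P)
  then have P: "P \<ge> 1" using p by simp
  have "Lp_power P f powr (1/P) \<le> (X powr P) powr (1/P)"
    using fin[OF real(2) P] P by (intro powr_mono2) auto
  also have "\<dots> = X" using P X by (simp add: powr_powr)
  finally have "ennreal (Lp_power P f powr (1/P)) \<le> ennreal X" by (rule ennreal_leI)
  then show ?thesis using Lp_norm_arc[OF f, of P] P real by simp
next
  case top
  have [measurable]: "f \<in> borel_measurable borel" using f by (rule borel_measurable_continuous_onI)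
  have s: "sets (arc_length_measure \<gamma>) = sets borel" by (simp add: arc_length_measure_def)
  have "(\<lambda>x. ennreal (norm (f x))) \<in> borel_measurable (arc_length_measure \<gamma>)"
    by (subst measurable_cong_sets[OF s refl]) measurable
  moreover have "\<forall>x. norm (f x) \<le> X" using inf top by simp
  ultimately have "esssup (arc_length_measure \<gamma>) (\<lambda>x. ennreal (norm (f x))) \<le> ennreal X"
    by (intro esssup_I AE_I2) (auto intro: ennreal_leI)
  then show ?thesis using top by (simp add: Lp_norm_def)
qed

text \<open>The point \<open>u0\<close> may be an end of the parameter interval, so the interval is
  placed on the side where there is room.\<close>

lemma near_interval:
  assumes "u0 \<in> {0..1}" "0 < \<rho>" "\<rho> \<le> 1/2"
  shows "\<exists>a. {a..a + \<rho>} \<subseteq> {0..1::real} \<and> (\<forall>u\<in>{a..a + \<rho>}. \<bar>u - u0\<bar> \<le> \<rho>)"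
proof (cases "u0 \<le> 1/2")
  case True
  then show ?thesis using assms by (intro exI[of _ u0]) auto
next
  case False
  then show ?thesis using assms by (intro exI[of _ "u0 - \<rho>"]) auto
qed

lemma integral_near_lower:
  fixes g :: "real \<Rightarrow> real"
  assumes u0: "u0 \<in> {0..1}" "0 < \<rho>" "\<rho> \<le> 1/2" and g: "integrable lborel g" "\<And>u. g u \<ge> 0"
    and low: "\<And>u. u \<in> {0..1} \<Longrightarrow> \<bar>u - u0\<bar> \<le> \<rho> \<Longrightarrow> c \<le> g u" 
  shows "c * \<rho> \<le> (\<integral>u. g u \<partial>lborel)"
proof -
  obtain a where a: "{a..a + \<rho>} \<subseteq> {0..1}" "\<forall>u\<in>{a..a + \<rho>}. \<bar>u - u0\<bar> \<le> \<rho>"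
    using near_interval[OF u0] by blast
  have "c * \<rho> = (\<integral>u. c * indicator {a..a + \<rho>} u \<partial>lborel)" using u0 by simp
  also have "\<dots> \<le> (\<integral>u. g u \<partial>lborel)"
  proof (rule Bochner_Integration.integral_mono)
    fix u show "c * indicator {a..a + \<rho>} u \<le> g u"
      using low[of u] a g(2)[of u] by (auto simp: indicator_def)
  next
    show "integrable lborel (\<lambda>u. c * indicator {a..a + \<rho>} u)"
      by (intro integrable_mult_right integrable_real_indicator) (auto simp: emeasure_lborel_Icc_eq)
  qed (use g in auto)
  finally show ?thesis .
qed

text \<open>A Gaussian of the chord is decreasing, so \<open>nn_integral_chord_le\<close> reduces it
  to a Gaussian on the line, whose integral is proportional to \<open>\<sigma>\<close>.\<close>

lemma gauss_chord:
  assumes u0: "u0 \<in> {0..1}"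
  shows "\<exists>K>0. \<forall>\<sigma>>0. integrable lborel (\<lambda>u. exp (- (chord u0 u / \<sigma>)\<^sup>2) * speed u) \<and>
    (\<integral>u. exp (- (chord u0 u / \<sigma>)\<^sup>2) * speed u \<partial>lborel) \<le> K * \<sigma>"
proof -
  obtain m c where "c > 0" "m \<ge> 0" and mc: "\<forall>g. g \<in> borel_measurable borel \<longrightarrow> (\<forall>x y. 0 \<le> x \<longrightarrow> x \<le> y \<longrightarrow> g y \<le> g x) \<longrightarrow>
     (\<integral>\<^sup>+ u. g (chord u0 u) * ennreal (speed u) \<partial>lborel) \<le> ennreal m * (\<integral>\<^sup>+ v. g (c * \<bar>v\<bar>) * indicator {-1..1} v \<partial>lborel)"
    using nn_integral_chord_le[OF u0] by auto
  define K where "K = m * sqrt pi / c + 1"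
  have "K > 0" using \<open>m \<ge> 0\<close> \<open>c > 0\<close> by (simp add: K_def add_nonneg_pos)
  show ?thesis
  proof (rule exI[of _ K], intro conjI allI impI)
    show "K > 0" by fact
    fix \<sigma> :: real assume "\<sigma> > 0"
    show int: "integrable lborel (\<lambda>u. exp (- (chord u0 u / \<sigma>)\<^sup>2) * speed u)"
      by (rule Bochner_Integration.integrable_bound[OF integrable_speed]) (auto intro!: AE_I2 mult_left_le_one_le)
    \<comment> \<open>Chosen so that
      \<open>(2 * pi * s * v)^2 / 2 = (c * \<bar>v\<bar> / \<sigma>)^2\<close>, the form in which
      the Gaussian integral is available.\<close>
    define s where "s = c / (sqrt 2 * pi * \<sigma>)"
    have "s > 0" using \<open>c > 0\<close> \<open>\<sigma> > 0\<close> by (simp add: s_def)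
    have "ennreal (\<integral>u. exp (- (chord u0 u / \<sigma>)\<^sup>2) * speed u \<partial>lborel) = (\<integral>\<^sup>+ u. ennreal (exp (- (chord u0 u / \<sigma>)\<^sup>2)) * ennreal (speed u) \<partial>lborel)"
      using int by (subst nn_integral_eq_integral[symmetric]) (auto simp: ennreal_mult)
    also have "\<dots> \<le> ennreal m * (\<integral>\<^sup>+ v. ennreal (exp (- (c * \<bar>v\<bar> / \<sigma>)\<^sup>2)) * indicator {-1..1} v \<partial>lborel)"
    proof (rule mc[rule_format, of "\<lambda>x. ennreal (exp (- (x / \<sigma>)\<^sup>2))"])
      show "ennreal (exp (- (y / \<sigma>)\<^sup>2)) \<le> ennreal (exp (- (x / \<sigma>)\<^sup>2))" if "0 \<le> x" "x \<le> y" for x y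
        using that \<open>\<sigma> > 0\<close> by (intro ennreal_leI) (auto intro!: power_mono divide_right_mono)
    qed measurable
    also have "\<dots> \<le> ennreal m * (\<integral>\<^sup>+ v. ennreal (exp (- ((2 * pi * s * (v - 0))\<^sup>2) / 2)) \<partial>lborel)"
    proof (intro mult_left_mono nn_integral_mono)
      fix v
      have "(2 * pi * s * v)\<^sup>2 / 2 = (c * \<bar>v\<bar> / \<sigma>)\<^sup>2"
        by (simp add: s_def power_mult_distrib power_divide)
      then show "ennreal (exp (- (c * \<bar>v\<bar> / \<sigma>)\<^sup>2)) * indicator {-1..1} v \<le> ennreal (exp (- ((2 * pi * s * (v - 0))\<^sup>2) / 2))"
        by (auto simp: indicator_def)
    qed simp
    also have "\<dots> = ennreal m * ennreal (1 / (sqrt (2*pi) * s))"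
      by (simp only: nn_integral_exp_sq[OF \<open>s > 0\<close>])
    also have "1 / (sqrt (2*pi) * s) = sqrt pi * \<sigma> / c"
    proof -
      have "sqrt (2*pi) * s * (sqrt pi * \<sigma>) = sqrt 2 * (sqrt pi * sqrt pi) * s * \<sigma>"
        by (simp only: real_sqrt_mult mult_ac)
      also have "\<dots> = c" using \<open>\<sigma> > 0\<close> by (simp add: s_def)
      finally have "sqrt (2*pi) * s = c / (sqrt pi * \<sigma>)" using \<open>\<sigma> > 0\<close> by (simp add: nonzero_eq_divide_eq)
      then show ?thesis by simp
    qed
    also have "ennreal m * ennreal (sqrt pi * \<sigma> / c) = ennreal (m * sqrt pi / c * \<sigma>)"
      using \<open>m \<ge> 0\<close> \<open>c > 0\<close> \<open>\<sigma> > 0\<close> by (simp flip: ennreal_mult)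
    also have "\<dots> \<le> ennreal (K * \<sigma>)"
      using \<open>\<sigma> > 0\<close> by (intro ennreal_leI mult_right_mono) (auto simp: K_def)
    finally show "(\<integral>u. exp (- (chord u0 u / \<sigma>)\<^sup>2) * speed u \<partial>lborel) \<le> K * \<sigma>"
      using \<open>K > 0\<close> \<open>\<sigma> > 0\<close> by simp
  qed
qed

text \<open>One half of the exponent absorbs the power; the other half is a Gaussian of width
  \<open>sqrt 2 * \<delta>\<close>.\<close>

lemma power_gauss_le:
  assumes "k = 1 \<or> k = (2::nat)" "x \<ge> (0::real)" "\<delta> > 0"
  shows "x ^ k * exp (- (x / \<delta>)\<^sup>2) \<le> 2 * \<delta> ^ k * exp (- (x / (sqrt 2 * \<delta>))\<^sup>2)"
proof -
  define y where "y = x / \<delta>"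
  have "1 + y\<^sup>2 / 2 \<le> exp (y\<^sup>2 / 2)" by (rule exp_ge_add_one_self)
  moreover have "2 * y \<le> 1 + y\<^sup>2" using zero_le_power2[of "y - 1"] by (simp add: power2_eq_square algebra_simps)
  ultimately have "y \<le> 2 * exp (y\<^sup>2 / 2)" "y\<^sup>2 \<le> 2 * exp (y\<^sup>2 / 2)"
    using zero_le_power2[of y] by linarith+
  then have "y ^ k \<le> 2 * exp (y\<^sup>2 / 2)" using assms(1) by auto
  then have "y ^ k * exp (- y\<^sup>2) \<le> 2 * exp (y\<^sup>2 / 2) * exp (- y\<^sup>2)" by (rule mult_right_mono) simp
  also have "\<dots> = 2 * exp (- (y\<^sup>2 / 2))" by (simp flip: exp_add)
  finally have "\<delta> ^ k * (y ^ k * exp (- y\<^sup>2)) \<le> \<delta> ^ k * (2 * exp (- (y\<^sup>2 / 2)))"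
    using assms by (intro mult_left_mono) auto
  then show ?thesis using assms by (simp add: y_def power_divide power_mult_distrib mult_ac)
qed

text \<open>For a Gaussian of width \<open>\<delta>\<close> at \<open>\<gamma> u0\<close> the extension is at least \<open>c\<cdot>\<delta>\<close> in absolute value
  for \<open>\<bar>t\<bar> \<le> c\<close> and \<open>\<bar>s\<bar> \<le> c / \<delta>^m\<close>.\<close>

lemma knapp_necessary:
  assumes S: "strip_estimate \<gamma> \<omega> p (ennreal Q)" and Q: "Q \<ge> 1" and p: "1 \<le> p"
    and u0: "u0 \<in> {0..1}" and m: "m = 1 \<or> m = (2::nat)"
    and C: "C > 0" "\<And>u. u \<in> {0..1} \<Longrightarrow> \<bar>phase u - phase u0\<bar> \<le> C * chord u0 u ^ m"
  shows "rec_exp p + real m / Q \<le> 1"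
proof -
  obtain K0 where K0: "K0 > 0" "\<And>\<sigma>. \<sigma> > 0 \<Longrightarrow> integrable lborel (\<lambda>u. exp (- (chord u0 u / \<sigma>)\<^sup>2) * speed u)"
    "\<And>\<sigma>. \<sigma> > 0 \<Longrightarrow> (\<integral>u. exp (- (chord u0 u / \<sigma>)\<^sup>2) * speed u \<partial>lborel) \<le> K0 * \<sigma>"
    using gauss_chord[OF u0] by auto
  \<comment> \<open>At least 1, so that \<open>K0 \<le> K powr P\<close> for every exponent
    \<open>P \<ge> 1\<close>.\<close>
  define K where "K = max K0 1"
  have K: "K \<ge> 1" "K0 \<le> K" by (auto simp: K_def)
  obtain V where V0: "V > 0" "\<And>u v. u \<in> {0..1} \<Longrightarrow> v \<in> {0..1} \<Longrightarrow> chord v u \<le> V * \<bar>u - v\<bar>"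
    by (rule chord_upper) blast
  have V: "V > 0" "\<And>u. u \<in> {0..1} \<Longrightarrow> chord u0 u \<le> V * \<bar>u - u0\<bar>"
    using V0(1) V0(2)[OF _ u0] by auto
  obtain c W where c: "c > 0" "\<And>u. u \<in> {0..1} \<Longrightarrow> c \<le> speed u" by (rule speed_bounds) blast
  define c1 where "c1 = exp (- V\<^sup>2) * c"
  have "c1 > 0" using c by (simp add: c1_def)
  define K' where "K' = 2 * sqrt 2 * K0"
  have "K' > 0" using K0 by (simp add: K'_def)
  \<comment> \<open>Offsets up to \<open>\<kappa>\<close> and positions up to
    \<open>\<kappa> / \<delta> ^ m\<close> keep the total phase error, computed from the moments
    below, within half of the main term \<open>c1 * \<delta>\<close>.\<close>
  define \<kappa> where "\<kappa> = min (1/2) (c1 / (4 * pi * K' * (1 + C)))"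
  have \<kappa>: "\<kappa> > 0" "\<kappa> \<le> 1/2" using \<open>c1 > 0\<close> \<open>K' > 0\<close> C(1) by (auto simp: \<kappa>_def)
  have \<kappa>2: "2 * pi * \<kappa> * K' * (1 + C) \<le> c1 / 2"
  proof -
    have "\<kappa> \<le> c1 / (4 * pi * K' * (1 + C))" by (simp add: \<kappa>_def)
    moreover have "4 * pi * K' * (1 + C) > 0" using \<open>K' > 0\<close> C(1) by simp
    ultimately have "\<kappa> * (4 * pi * K' * (1 + C)) \<le> c1" by (simp only: pos_le_divide_eq)
    moreover have "\<kappa> * (4 * pi * K' * (1 + C)) = 2 * (2 * pi * \<kappa> * K' * (1 + C))" by algebra
    ultimately show ?thesis by linarith
  qed
  obtain C1 where "C1 > 0" and C1: "\<forall>f X N \<eta>. schwartz f \<longrightarrow> X \<ge> 0 \<longrightarrow> 0 < \<eta> \<longrightarrow> \<eta> \<le> 1/2 \<longrightarrow>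
     (\<forall>t. \<bar>t\<bar> \<le> \<eta> \<longrightarrow> ennreal X \<le> line_power Q f t) \<longrightarrow>
     Lp_norm p (arc_length_measure \<gamma>) f \<le> ennreal N \<longrightarrow> N \<ge> 0 \<longrightarrow> 2 * \<eta> * X \<le> C1 * N powr Q"
    using strip_estimate_lower[OF S] Q by auto
  have main: "(4 * \<kappa>\<^sup>2 * (c1 / 2) powr Q) * \<delta> powr (Q - real m) \<le> (C1 * K powr Q) * \<delta> powr (Q * rec_exp p)"
    if \<delta>: "0 < \<delta>" "\<delta> \<le> 1/2" for \<delta>
  proof -
    define E where "E = (\<lambda>u. exp (- (chord u0 u / \<delta>)\<^sup>2))"
    \<comment> \<open>Exponent \<open>\<theta> = 0\<close> and frequency 0: a pure Gaussian of width
      \<open>\<delta>\<close> centred at the point \<open>gm u0\<close>.\<close>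
    define f where "f = (\<lambda>x. complex_of_real ((1 + (x - gm u0) \<bullet> (x - gm u0)) powr (- 0)) *
       (complex_of_real (exp (- ((x - gm u0) \<bullet> (x - gm u0)) / \<delta>\<^sup>2)) * cis (0 \<bullet> x)))"
    have "gauss_class f" unfolding f_def using \<delta> by (intro gauss_class.base) auto
    then have sf: "schwartz f" by (rule gauss_class_schwartz)
    then have cf: "continuous_on UNIV f" by (rule schwartz_continuous)
    \<comment> \<open>\<open>x powr 0\<close> is 1 only for \<open>x \<noteq> 0\<close>.\<close>
    have one: "1 + y \<bullet> y \<noteq> 0" for y :: "real^2" using inner_ge_zero[of y] by linarith
    have fE: "f (gm u) = complex_of_real (E u)" for u
      using one by (simp add: f_def E_def chord_def power2_norm_eq_inner power_divide)
    have f1: "norm (f x) \<le> 1" for x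
      using one by (simp add: f_def norm_mult)
    have E01: "0 < E u" "E u \<le> 1" for u by (auto simp: E_def)
    have [measurable]: "E \<in> borel_measurable borel" unfolding E_def by measurable
    have intE: "integrable lborel (\<lambda>u. E u * speed u)" using K0(2)[OF \<delta>(1)] by (simp add: E_def)
    have Lp: "Lp_norm p (arc_length_measure \<gamma>) f \<le> ennreal (K * \<delta> powr rec_exp p)"
    proof (rule Lp_norm_le_real[OF cf p])
      show "0 \<le> K * \<delta> powr rec_exp p" using K by simp
      show "\<forall>x. norm (f x) \<le> K * \<delta> powr rec_exp p" if "p = \<infinity>"
        using f1 K \<delta> that by (auto simp: rec_exp_def intro: order_trans)
      fix P assume P: "p = ennreal P" "1 \<le> P"
      have "Lp_power P f \<le> (\<integral>u. E u * speed u \<partial>lborel)"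
        unfolding Lp_power_def
      proof (rule Bochner_Integration.integral_mono)
        fix u
        \<comment> \<open>\<open>E\<close> is at most 1, so a single bound of order
          \<open>\<delta>\<close> serves every finite exponent; its \<open>P\<close>-th root has
          order \<open>\<delta> powr (1/P)\<close>.\<close>
        have "E u powr P \<le> E u powr 1" using E01[of u] P by (intro powr_mono') auto
        then show "norm (f (gm u)) powr P * speed u \<le> E u * speed u"
          using E01[of u] by (intro mult_right_mono) (auto simp: fE)
      qed (use intE integrable_Lp_power[OF cf] P in auto)
      also have "\<dots> \<le> K0 * \<delta>" using K0(3)[OF \<delta>(1)] by (simp add: E_def)
      also have "\<dots> \<le> K powr P * \<delta>"
      proof (rule mult_right_mono)
        have "K powr 1 \<le> K powr P" using K P by (intro powr_mono) auto
        then show "K0 \<le> K powr P" using K by simp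
      qed (use \<delta> in simp)
      also have "\<dots> = (K * \<delta> powr rec_exp p) powr P"
        using P K \<delta> by (simp add: rec_exp_def powr_mult powr_powr)
      finally show "Lp_power P f \<le> (K * \<delta> powr rec_exp p) powr P" .
    qed
    have A0: "c1 * \<delta> \<le> (\<integral>u. E u * speed u \<partial>lborel)"
    proof (rule integral_near_lower[OF u0 \<delta> intE])
      show "0 \<le> E u * speed u" for u using E01[of u] by simp
      fix u assume u: "u \<in> {0..1}" "\<bar>u - u0\<bar> \<le> \<delta>"
      have "chord u0 u \<le> V * \<delta>" using V(2)[OF u(1)] mult_left_mono[OF u(2), of V] V(1) by linarith
      then have "chord u0 u / \<delta> \<le> V" using \<delta> by (simp add: field_simps)
      then have "(chord u0 u / \<delta>)\<^sup>2 \<le> V\<^sup>2" using \<delta> by (intro power_mono) auto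
      then have "exp (- V\<^sup>2) \<le> E u" by (simp add: E_def)
      then show "c1 \<le> E u * speed u" unfolding c1_def using c u E01(1)[of u] by (intro mult_mono) auto
    qed
    \<comment> \<open>First and second moments have order \<open>\<delta>^2\<close> and
      \<open>\<delta>^3\<close>; multiplied by the ranges of \<open>t\<close> and \<open>s\<close>,
      each costs at most a small multiple of \<open>\<delta>\<close>.\<close>
    have mom: "integrable lborel (\<lambda>u. chord u0 u ^ k * E u * speed u)" "(\<integral>u. chord u0 u ^ k * E u * speed u \<partial>lborel) \<le> K' * \<delta> ^ (k + 1)"
      if k: "k = 1 \<or> k = 2" for k
    proof -
      have le: "chord u0 u ^ k * E u * speed u \<le> 2 * \<delta> ^ k * (exp (- (chord u0 u / (sqrt 2 * \<delta>))\<^sup>2) * speed u)" for u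
      proof -
        have "chord u0 u ^ k * E u \<le> 2 * \<delta> ^ k * exp (- (chord u0 u / (sqrt 2 * \<delta>))\<^sup>2)"
          unfolding E_def by (rule power_gauss_le[OF k _ \<delta>(1)]) simp
        from mult_right_mono[OF this, of "speed u"] show ?thesis by (simp add: mult.assoc)
      qed
      have s: "sqrt 2 * \<delta> > 0" using \<delta> by simp
      have i: "integrable lborel (\<lambda>u. 2 * \<delta> ^ k * (exp (- (chord u0 u / (sqrt 2 * \<delta>))\<^sup>2) * speed u))"
        using K0(2)[OF s] by simp
      show int: "integrable lborel (\<lambda>u. chord u0 u ^ k * E u * speed u)"
      proof (rule Bochner_Integration.integrable_bound[OF i])
        show "AE u in lborel. norm (chord u0 u ^ k * E u * speed u) \<le> norm (2 * \<delta> ^ k * (exp (- (chord u0 u / (sqrt 2 * \<delta>))\<^sup>2) * speed u))"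
        proof (rule AE_I2)
          fix u
          have "0 \<le> chord u0 u ^ k * E u * speed u" using E01[of u] by simp
          then show "norm (chord u0 u ^ k * E u * speed u) \<le> norm (2 * \<delta> ^ k * (exp (- (chord u0 u / (sqrt 2 * \<delta>))\<^sup>2) * speed u))"
            using le[of u] by (simp only: real_norm_def)
        qed
      qed measurable
      have "(\<integral>u. chord u0 u ^ k * E u * speed u \<partial>lborel) \<le> (\<integral>u. 2 * \<delta> ^ k * (exp (- (chord u0 u / (sqrt 2 * \<delta>))\<^sup>2) * speed u) \<partial>lborel)"
        by (rule Bochner_Integration.integral_mono[OF int i le])
      also have "\<dots> = 2 * \<delta> ^ k * (\<integral>u. exp (- (chord u0 u / (sqrt 2 * \<delta>))\<^sup>2) * speed u \<partial>lborel)" by simp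
      also have "\<dots> \<le> 2 * \<delta> ^ k * (K0 * (sqrt 2 * \<delta>))"
        using K0(3)[OF s] \<delta> by (intro mult_left_mono) auto
      also have "\<dots> = K' * \<delta> ^ (k + 1)" by (simp add: K'_def)
      finally show "(\<integral>u. chord u0 u ^ k * E u * speed u \<partial>lborel) \<le> K' * \<delta> ^ (k + 1)" .
    qed
    have low: "c1 / 2 * \<delta> \<le> norm (ext_op phase (ampl f t) s)" if t: "\<bar>t\<bar> \<le> \<kappa>" and s: "\<bar>s\<bar> \<le> \<kappa> / \<delta> ^ m" for t s
    proof -
      define \<theta> where "\<theta> = (\<lambda>u. 2 * pi * t * (along u - along u0) + 2 * pi * s * (phase u - phase u0))"
      have [measurable]: "\<theta> \<in> borel_measurable borel" unfolding \<theta>_def by measurable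
      define \<Theta> where "\<Theta> = (\<lambda>u. 2 * pi * \<kappa> * (chord u0 u ^ 1 * E u * speed u) + 2 * pi * (\<kappa> / \<delta> ^ m) * C * (chord u0 u ^ m * E u * speed u))"
      have int\<Theta>: "integrable lborel \<Theta>"
        unfolding \<Theta>_def using mom(1)[of 1] mom(1)[OF m] by auto
      have b: "E u * speed u * \<bar>\<theta> u\<bar> \<le> \<Theta> u" for u
      proof (cases "u \<in> {0..1}")
        case True
        have "\<bar>\<theta> u\<bar> \<le> 2 * pi * (\<bar>t\<bar> * \<bar>along u - along u0\<bar>) + 2 * pi * (\<bar>s\<bar> * \<bar>phase u - phase u0\<bar>)"
          unfolding \<theta>_def by (rule order_trans[OF abs_triangle_ineq]) (simp add: abs_mult)
        also have "\<dots> \<le> 2 * pi * (\<kappa> * chord u0 u) + 2 * pi * ((\<kappa> / \<delta> ^ m) * (C * chord u0 u ^ m))"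
          using t s along_diff[OF True u0] C(2)[OF True] \<kappa> \<delta>
          by (intro add_mono mult_left_mono mult_mono) auto
        finally have "E u * speed u * \<bar>\<theta> u\<bar> \<le> E u * speed u * (2 * pi * (\<kappa> * chord u0 u) + 2 * pi * ((\<kappa> / \<delta> ^ m) * (C * chord u0 u ^ m)))"
          using E01[of u] by (intro mult_left_mono) auto
        then show ?thesis by (simp add: \<Theta>_def algebra_simps)
      next
        case False
        then have "speed u = 0" by (rule speed_outside)
        then show ?thesis by (simp add: \<Theta>_def)
      qed
      have "(\<integral>u. \<Theta> u \<partial>lborel) = 2 * pi * \<kappa> * (\<integral>u. chord u0 u ^ 1 * E u * speed u \<partial>lborel) + 2 * pi * (\<kappa> / \<delta> ^ m) * C * (\<integral>u. chord u0 u ^ m * E u * speed u \<partial>lborel)"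
        unfolding \<Theta>_def using mom(1)[of 1] mom(1)[OF m] by (subst Bochner_Integration.integral_add) auto
      also have "\<dots> \<le> 2 * pi * \<kappa> * (K' * \<delta> ^ (1 + 1)) + 2 * pi * (\<kappa> / \<delta> ^ m) * C * (K' * \<delta> ^ (m + 1))"
        using \<kappa> \<delta> C(1) by (intro add_mono mult_left_mono mom m) auto
      also have "\<dots> = 2 * pi * \<kappa> * K' * (\<delta> + C) * \<delta>"
        using \<delta> by (simp add: field_simps power2_eq_square)
      also have "\<dots> \<le> 2 * pi * \<kappa> * K' * (1 + C) * \<delta>"
        using \<kappa> \<delta> \<open>K' > 0\<close> by (intro mult_right_mono mult_left_mono) auto
      also have "\<dots> \<le> c1 / 2 * \<delta>" using \<kappa>2 \<delta> by (intro mult_right_mono) auto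
      finally have "c1 / 2 * \<delta> \<le> (\<integral>u. E u * speed u \<partial>lborel) - (\<integral>u. \<Theta> u \<partial>lborel)"
        using A0 by simp
      also have "\<dots> \<le> norm (\<integral>u. complex_of_real (E u * speed u) * cis (\<theta> u + (2 * pi * t * along u0 + 2 * pi * s * phase u0)) \<partial>lborel)"
        using E01(1) by (intro norm_integral_cis_lower intE b int\<Theta>) (auto simp: less_imp_le)
      also have "(\<integral>u. complex_of_real (E u * speed u) * cis (\<theta> u + (2 * pi * t * along u0 + 2 * pi * s * phase u0)) \<partial>lborel) = ext_op phase (ampl f t) s"
        unfolding ext_op_def ampl_def fE
        by (intro Bochner_Integration.integral_cong refl) (simp add: \<theta>_def mult.assoc cis_mult algebra_simps)
      finally show ?thesis .
    qed
    \<comment> \<open>Length \<open>2 * \<kappa> / \<delta> ^ m\<close> of the range of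
      \<open>s\<close> times the \<open>Q\<close>-th power of the lower bound.\<close>
    define X where "X = 2 * (\<kappa> / \<delta> ^ m) * (c1 / 2 * \<delta>) powr Q"
    have "2 * \<kappa> * X \<le> C1 * (K * \<delta> powr rec_exp p) powr Q"
    proof (rule C1[rule_format, OF sf _ \<kappa> _ Lp])
      show "0 \<le> X" "0 \<le> K * \<delta> powr rec_exp p" using \<kappa> \<delta> K by (auto simp: X_def)
      fix t assume t: "\<bar>t\<bar> \<le> \<kappa>"
      let ?r = "\<kappa> / \<delta> ^ m"
      have "?r \<ge> 0" using \<kappa> \<delta> by simp
      then have "emeasure lborel {-?r..?r} = ennreal (2 * ?r)" by simp
      moreover have "ennreal X = ennreal ((c1 / 2 * \<delta>) powr Q) * ennreal (2 * ?r)"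
        unfolding X_def using \<open>?r \<ge> 0\<close> by (subst ennreal_mult''[symmetric]) (simp_all only: mult.commute zero_le_mult_iff, simp)
      ultimately have "ennreal X = (\<integral>\<^sup>+ s. ennreal ((c1 / 2 * \<delta>) powr Q) * indicator {-?r..?r} s \<partial>lborel)"
        by (subst nn_integral_cmult_indicator) auto
      also have "\<dots> \<le> line_power Q f t" unfolding line_power_def
      proof (rule nn_integral_mono)
        fix s
        show "ennreal ((c1 / 2 * \<delta>) powr Q) * indicator {-?r..?r} s \<le> ennreal (norm (ext_op phase (ampl f t) s) powr Q)"
        proof (cases "\<bar>s\<bar> \<le> ?r")
          case True
          then show ?thesis using low[OF t True] \<open>c1 > 0\<close> \<delta> Q
            by (auto simp: indicator_def intro!: ennreal_leI powr_mono2)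
        qed (auto simp: indicator_def abs_le_iff)
      qed
      finally show "ennreal X \<le> line_power Q f t" .
    qed
    also have "(K * \<delta> powr rec_exp p) powr Q = K powr Q * \<delta> powr (Q * rec_exp p)"
      using K by (simp add: powr_mult powr_powr mult.commute)
    also have "2 * \<kappa> * X = (4 * \<kappa>\<^sup>2 * (c1 / 2) powr Q) * \<delta> powr (Q - real m)"
    proof -
      have "\<delta> powr (Q - real m) = \<delta> powr Q / \<delta> ^ m" using \<delta> by (simp add: powr_diff powr_realpow)
      moreover have "(c1 / 2 * \<delta>) powr Q = (c1 / 2) powr Q * \<delta> powr Q"
        by (rule powr_mult)
      ultimately show ?thesis unfolding X_def by (simp add: power2_eq_square)
    qed
    finally show ?thesis by (simp add: mult.assoc)
  qed
  \<comment> \<open>Comparison of the powers of \<open>\<delta>\<close> as \<open>\<delta>\<close>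
    tends to 0; division by \<open>Q\<close> gives the claim.\<close>
  have "Q * rec_exp p \<le> Q - real m"
    by (rule powr_exponent_le[OF _ main]) (use \<kappa> \<open>c1 > 0\<close> in auto)
  then show ?thesis using Q by (simp add: field_simps)
qed

end

section \<open>Rudin-Shapiro polynomials and lower bounds by duality\<close>

lemma pow2_exponent_le:
  assumes "A > 0" and le: "\<And>n::nat. A * (2 ^ n) powr a \<le> B * (2 ^ n) powr b"
  shows "a \<le> (b::real)"
proof (rule ccontr)
  assume "\<not> a \<le> b"
  then have ab: "a - b > 0" by simp
  have "filterlim (\<lambda>n::nat. A * (2 ^ n) powr (a - b)) at_top sequentially"
    using ab \<open>A > 0\<close> by real_asymp
  then have "eventually (\<lambda>n::nat. B < A * (2 ^ n) powr (a - b)) sequentially"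
    by (simp add: filterlim_at_top_dense)
  then obtain n :: nat where n: "B < A * (2 ^ n) powr (a - b)" by (auto simp: eventually_sequentially)
  have "B * (2 ^ n) powr b < A * (2 ^ n) powr (a - b) * (2 ^ n) powr b"
    using n by (intro mult_strict_right_mono) auto
  also have "\<dots> = A * (2 ^ n) powr a" by (simp add: mult.assoc flip: powr_add)
  finally show False using le[of n] by simp
qed

text \<open>The recursion replaces \<open>P\<close> and \<open>Q\<close> by
  \<open>P + z^(2^n) Q\<close> and \<open>P - z^(2^n) Q\<close>; by the parallelogram law the sum of
  squares doubles on the unit circle.\<close>

lemma rudin_shapiro:
  "\<exists>a b :: nat \<Rightarrow> real. (\<forall>j. \<bar>a j\<bar> = 1 \<and> \<bar>b j\<bar> = 1) \<and>
     (\<forall>z::complex. norm z = 1 \<longrightarrow>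
       (norm (\<Sum>j<2^n. complex_of_real (a j) * z ^ j))\<^sup>2 + (norm (\<Sum>j<2^n. complex_of_real (b j) * z ^ j))\<^sup>2 = 2 * 2 ^ n)"
proof (induction n)
  case 0
  show ?case by (intro exI[of _ "\<lambda>_. 1"]) auto
next
  case (Suc n)
  then obtain a b :: "nat \<Rightarrow> real" where ab: "\<And>j. \<bar>a j\<bar> = 1 \<and> \<bar>b j\<bar> = 1"
    and PQ: "\<And>z::complex. norm z = 1 \<Longrightarrow>
       (norm (\<Sum>j<2^n. complex_of_real (a j) * z ^ j))\<^sup>2 + (norm (\<Sum>j<2^n. complex_of_real (b j) * z ^ j))\<^sup>2 = 2 * 2 ^ n"
    by blast
  define a' where "a' = (\<lambda>j. if j < 2 ^ n then a j else b (j - 2 ^ n))"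
  define b' where "b' = (\<lambda>j. if j < 2 ^ n then a j else - b (j - 2 ^ n))"
  have split: "(\<Sum>j<2^Suc n. g j) = (\<Sum>j<2^n. g j) + (\<Sum>j<2^n. g (2 ^ n + j))" for g :: "nat \<Rightarrow> complex"
  proof -
    have "(\<Sum>j<2^Suc n. g j) = (\<Sum>j\<in>{..<2^n} \<union> {2^n..<2^n + 2^n}. g j)"
      by (intro sum.cong) auto
    also have "\<dots> = (\<Sum>j<2^n. g j) + (\<Sum>j=2^n..<2^n + 2^n. g j)"
      by (rule sum.union_disjoint) auto
    also have "(\<Sum>j=2^n..<2^n + 2^n. g j) = (\<Sum>j<2^n. g (2 ^ n + j))"
      using sum.shift_bounds_nat_ivl[of g 0 "2^n" "2^n"] by (simp add: lessThan_atLeast0 add.commute)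
    finally show ?thesis .
  qed
  show ?case
  proof (rule exI[of _ a'], rule exI[of _ b'], intro conjI allI impI)
    fix z :: complex assume z: "norm z = 1"
    let ?P = "\<Sum>j<2^n. complex_of_real (a j) * z ^ j" and ?Q = "\<Sum>j<2^n. complex_of_real (b j) * z ^ j"
    have 1: "(\<Sum>j<2^Suc n. complex_of_real (a' j) * z ^ j) = ?P + z ^ 2 ^ n * ?Q"
      unfolding split by (simp add: a'_def power_add sum_distrib_left mult_ac)
    have 2: "(\<Sum>j<2^Suc n. complex_of_real (b' j) * z ^ j) = ?P - z ^ 2 ^ n * ?Q"
      unfolding split by (simp add: b'_def power_add sum_distrib_left sum_negf mult_ac)
    have par: "(norm (p + q))\<^sup>2 + (norm (p - q))\<^sup>2 = 2 * ((norm p)\<^sup>2 + (norm q)\<^sup>2)" for p q :: complex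
      unfolding cmod_power2 by (simp add: power2_eq_square algebra_simps)
    show "(norm (\<Sum>j<2^Suc n. complex_of_real (a' j) * z ^ j))\<^sup>2 + (norm (\<Sum>j<2^Suc n. complex_of_real (b' j) * z ^ j))\<^sup>2 = 2 * 2 ^ Suc n"
      unfolding 1 2 par using PQ[OF z] z by (simp add: norm_mult norm_power)
  qed (use ab in \<open>auto simp: a'_def b'_def\<close>)
qed

context curve_line
begin

text \<open>The pairing of the extension with \<open>h\<close>, computed on the curve, is at least
  \<open>A\<close>. On the line it is split pointwise by an inequality of Young type: the part
  \<open>H\<close> integrates to at most \<open>A / 2\<close> and is absorbed, and the rest is
  \<open>c1\<close> times the power sought. An abstract \<open>H\<close> also covers
  \<open>Q = 1\<close>, whose dual exponent is infinite.\<close>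

lemma line_power_lower:
  assumes f: "continuous_on UNIV f" and h: "bdd_cpt h" and "c1 > 0" and "A \<ge> 0"
    and young: "\<And>x s. x \<ge> 0 \<Longrightarrow> x * norm (h s) \<le> c1 * x powr Q + H s"
    and H: "integrable lborel H" "(\<integral>s. H s \<partial>lborel) \<le> A / 2" "\<And>s. H s \<ge> 0"
    and low: "A \<le> norm (\<integral>u. ampl f t u * ft h (phase u) \<partial>lborel)"
  shows "ennreal (A / (2 * c1)) \<le> line_power Q f t"
proof -
  obtain B where B: "\<And>u. norm (ampl f t u) \<le> B" using ampl_props(4)[OF f] by blast
  let ?T = "ext_op phase (ampl f t)"
  have [measurable]: "?T \<in> borel_measurable borel"
    by (rule measurable_ext_op[OF ampl_props(1)[OF f] measurable_curve(4)])
  have [measurable]: "h \<in> borel_measurable borel" by (rule bdd_cpt_measurable[OF h])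
  have [measurable]: "H \<in> borel_measurable borel" using H(1) by auto
  have Th: "bdd_cpt (\<lambda>s. h s * ?T s)"
    by (rule bdd_cpt_mult[OF h, where B = B]) (auto intro!: norm_ext_op_le[OF ampl_props(1)[OF f] measurable_curve(4) B ampl_props(3)[OF f]])
  have "ennreal A \<le> ennreal (norm (\<integral>s. ?T s * h s \<partial>lborel))"
    using low ext_op_pairing[OF ampl_props(1)[OF f] measurable_curve(4) B ampl_props(3)[OF f] h] by (auto intro!: ennreal_leI)
  also have "\<dots> \<le> (\<integral>\<^sup>+ s. ennreal (norm (?T s * h s)) \<partial>lborel)"
    using bdd_cpt_integrable[OF Th] by (intro integral_norm_bound_ennreal) (simp add: mult.commute)
  also have "\<dots> \<le> (\<integral>\<^sup>+ s. ennreal c1 * ennreal (norm (?T s) powr Q) + ennreal (H s) \<partial>lborel)"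
    using young[of "norm (?T _)"] \<open>c1 > 0\<close> H(3)
    by (intro nn_integral_mono) (auto simp: norm_mult intro!: ennreal_leI simp flip: ennreal_mult ennreal_plus)
  also have "\<dots> = ennreal c1 * line_power Q f t + (\<integral>\<^sup>+ s. ennreal (H s) \<partial>lborel)"
    unfolding line_power_def by (subst nn_integral_add) (auto simp: nn_integral_cmult)
  also have "(\<integral>\<^sup>+ s. ennreal (H s) \<partial>lborel) = ennreal (\<integral>s. H s \<partial>lborel)"
    using H by (intro nn_integral_eq_integral) auto
  also have "ennreal c1 * line_power Q f t + \<dots> \<le> ennreal c1 * line_power Q f t + ennreal (A / 2)"
    using H(2) by (intro add_left_mono ennreal_leI)
  finally have 1: "ennreal A \<le> ennreal c1 * line_power Q f t + ennreal (A / 2)" .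
  show ?thesis
  proof (cases "line_power Q f t")
    case (real L)
    then have "ennreal A \<le> ennreal (c1 * L + A / 2)"
      using 1 \<open>c1 > 0\<close> \<open>A \<ge> 0\<close> by (simp add: ennreal_mult ennreal_plus)
    then have "A \<le> c1 * L + A / 2" using real \<open>c1 > 0\<close> \<open>A \<ge> 0\<close> by (subst (asm) ennreal_le_iff) auto
    then have "A / (2 * c1) \<le> L" using \<open>c1 > 0\<close> by (simp add: field_simps)
    then show ?thesis using real by (simp add: ennreal_leI)
  qed simp
qed

lemma gm_bound: obtains B where "B > 0" "\<And>u. u \<in> {0..1} \<Longrightarrow> norm (gm u) \<le> B"
  using continuous_bounded_on_curve[of "\<lambda>x. x"] by auto

text \<open>With \<open>\<plusminus>1\<close> coefficients \<open>d j\<close> whose trigonometric polynomial is bounded by \<open>sqrt (2\<cdot>2^n)\<close>, take for \<open>f\<close> its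
  conjugate as a function of \<open>phase\<close> and test \<open>E f\<close> against the step function with values \<open>d j\<close>: the pairing
  is \<open>\<ge> c\<cdot>2^n\<close> on an interval of length \<open>\<eta>\<cdot>2^n\<close>.\<close>

lemma rudin_shapiro_necessary:
  assumes S: "strip_estimate \<gamma> \<omega> p (ennreal Q)" and Q: "Q \<ge> 1" and p: "1 \<le> p"
  shows "Q \<ge> 2"
proof -
  obtain B where B: "B > 0" "\<And>u. u \<in> {0..1} \<Longrightarrow> norm (gm u) \<le> B" by (rule gm_bound) blast
  obtain c W where c: "c > 0" "\<And>u. u \<in> {0..1} \<Longrightarrow> c \<le> speed u" by (rule speed_bounds) blast
  have alongB: "\<bar>along u\<bar> \<le> B" and phaseB: "\<bar>phase u\<bar> \<le> B" if "u \<in> {0..1}" for u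
  proof -
    have "\<bar>gm u \<bullet> \<omega>\<bar> \<le> norm (gm u) * norm \<omega>" "\<bar>gm u \<bullet> om'\<bar> \<le> norm (gm u) * norm om'" by (rule Cauchy_Schwarz_ineq2)+
    then show "\<bar>along u\<bar> \<le> B" "\<bar>phase u\<bar> \<le> B" using B(2)[OF that] that om norm_om' by (auto simp: along_def phase_def gm_def)
  qed
  \<comment> \<open>For \<open>\<bar>t\<bar>\<close> and \<open>\<bar>s\<bar>\<close> up to
    \<open>\<eta>\<close> the total phase \<open>2 * pi * (t * along u + s * phase u)\<close> is at
    most \<open>1/2\<close> in modulus, so its cosine is at least \<open>1/2\<close>.\<close>
  define \<eta> where "\<eta> = 1 / (8 * pi * (B + 1))"
  have \<eta>: "\<eta> > 0" "\<eta> \<le> 1/2" "2 * pi * \<eta> * (B + B) \<le> 1/2"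
  proof -
    show "\<eta> > 0" using B by (simp add: \<eta>_def)
    have "1 * 2 \<le> pi * 2" using pi_ge_two by simp
    then have "2 \<le> 8 * pi * 1" by simp
    also have "\<dots> \<le> 8 * pi * (B + 1)" using B by (intro mult_left_mono) auto
    finally show "\<eta> \<le> 1/2" unfolding \<eta>_def using B by (simp add: divide_le_eq)
    define k where "k = 8 * pi * \<eta>"
    have "k * (B + 1) = 1" using B by (simp add: k_def \<eta>_def)
    then have "k * B + k = 1" by (simp add: distrib_left)
    moreover have "k > 0" using \<open>\<eta> > 0\<close> by (simp add: k_def)
    moreover have "2 * pi * \<eta> * (B + B) = k * B / 2" by (simp add: k_def)
    ultimately show "2 * pi * \<eta> * (B + B) \<le> 1/2" by linarith
  qed
  define G where "G = (\<lambda>u. exp (- (gm u \<bullet> gm u)) * speed u)"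
  have [measurable]: "G \<in> borel_measurable borel" unfolding G_def by measurable
  have G0: "G u \<ge> 0" for u by (simp add: G_def)
  have intG: "integrable lborel G"
    unfolding G_def by (rule Bochner_Integration.integrable_bound[OF integrable_speed]) (auto intro!: AE_I2 mult_left_le_one_le)
  define I0 where "I0 = (\<integral>u. G u \<partial>lborel)"
  have "I0 > 0"
  proof -
    have "exp (- B\<^sup>2) * c * (1/2) \<le> I0" unfolding I0_def
    proof (rule integral_near_lower[of 0 "1/2", OF _ _ _ intG G0])
      fix u :: real assume u: "u \<in> {0..1}"
      have "gm u \<bullet> gm u \<le> B\<^sup>2" using B(2)[OF u] B(1) by (simp add: power2_norm_eq_inner[symmetric] power_mono)
      then show "exp (- B\<^sup>2) * c \<le> G u" unfolding G_def using c u by (intro mult_mono) auto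
    qed auto
    moreover have "exp (- B\<^sup>2) * c * (1/2) > 0" using c by simp
    ultimately show ?thesis by linarith
  qed
  \<comment> \<open>This threshold makes the integral of the absorbed part,
    \<open>L * \<eta> * 2^n\<close>, equal to half of the pairing bound
    \<open>A = \<eta> / 2 * (2 ^ n * I0)\<close>.\<close>
  define L where "L = I0 / 4"
  have "L > 0" using \<open>I0 > 0\<close> by (simp add: L_def)
  define c1 where "c1 = L powr (1 - Q)"
  have "c1 > 0" using \<open>L > 0\<close> by (simp add: c1_def)
  define K where "K = curve_length + 1"
  have K: "K \<ge> 1" using curve_length_nonneg by (simp add: K_def)
  obtain C1 where "C1 > 0" and C1: "\<forall>f X N \<eta>. schwartz f \<longrightarrow> X \<ge> 0 \<longrightarrow> 0 < \<eta> \<longrightarrow> \<eta> \<le> 1/2 \<longrightarrow>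
     (\<forall>t. \<bar>t\<bar> \<le> \<eta> \<longrightarrow> ennreal X \<le> line_power Q f t) \<longrightarrow>
     Lp_norm p (arc_length_measure \<gamma>) f \<le> ennreal N \<longrightarrow> N \<ge> 0 \<longrightarrow> 2 * \<eta> * X \<le> C1 * N powr Q"
    using strip_estimate_lower[OF S] Q by auto
  have main: "(2 * \<eta> * (\<eta> * I0 / (4 * c1))) * (2 ^ n) powr 1 \<le> (C1 * (K * sqrt 2) powr Q) * (2 ^ n) powr (Q / 2)" for n :: nat
  proof -
    let ?N = "(2::nat) ^ n"
    obtain a b :: "nat \<Rightarrow> real" where ab: "\<And>j. \<bar>a j\<bar> = 1" "\<And>j. \<bar>b j\<bar> = 1" and
     RS: "\<And>z::complex. norm z = 1 \<Longrightarrow>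
       (norm (\<Sum>j<2^n. complex_of_real (a j) * z ^ j))\<^sup>2 + (norm (\<Sum>j<2^n. complex_of_real (b j) * z ^ j))\<^sup>2 = 2 * 2 ^ n"
      using rudin_shapiro[of n] by blast
    define z where "z = (\<lambda>u. cis (2 * pi * \<eta> * phase u))"
    have [measurable]: "z \<in> borel_measurable borel" unfolding z_def cis_conv_exp by measurable
    define PP where "PP = (\<lambda>d u. \<Sum>j<2^n. complex_of_real (d j) * z u ^ j)" for d :: "nat \<Rightarrow> real"
    have [measurable]: "PP d \<in> borel_measurable borel" for d unfolding PP_def by measurable
    have RSu: "(norm (PP a u))\<^sup>2 + (norm (PP b u))\<^sup>2 = 2 * 2 ^ n" for u
      unfolding PP_def by (rule RS) (simp add: z_def)
    have iP: "integrable lborel (\<lambda>u. (norm (PP d u))\<^sup>2 * G u)" if "d = a \<or> d = b" for d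
    proof (rule Bochner_Integration.integrable_bound)
      show "integrable lborel (\<lambda>u. 2 * 2 ^ n * G u)" using intG by simp
      have "(norm (PP d u))\<^sup>2 \<le> 2 * 2 ^ n" for u
      proof -
        have "(norm (PP a u))\<^sup>2 \<le> 2 * 2 ^ n" "(norm (PP b u))\<^sup>2 \<le> 2 * 2 ^ n"
          using RSu[of u] zero_le_power2[of "norm (PP a u)"] zero_le_power2[of "norm (PP b u)"] by linarith+
        then show ?thesis using that by blast
      qed
      then show "AE u in lborel. norm ((norm (PP d u))\<^sup>2 * G u) \<le> norm (2 * 2 ^ n * G u)"
        using G0 by (intro AE_I2) (auto simp: abs_mult intro!: mult_right_mono)
    qed measurable
    \<comment> \<open>The squares of the two polynomials add up to a constant, so one of the two
      carries at least half of the total \<open>2 * 2 ^ n * I0\<close>.\<close>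
    have "(\<integral>u. (norm (PP a u))\<^sup>2 * G u \<partial>lborel) + (\<integral>u. (norm (PP b u))\<^sup>2 * G u \<partial>lborel) = (\<integral>u. 2 * 2 ^ n * G u \<partial>lborel)"
      by (subst Bochner_Integration.integral_add[symmetric]) (auto simp: iP RSu simp flip: distrib_right)
    also have "\<dots> = 2 * 2 ^ n * I0" by (simp add: I0_def)
    finally have "2 ^ n * I0 \<le> (\<integral>u. (norm (PP a u))\<^sup>2 * G u \<partial>lborel) \<or> 2 ^ n * I0 \<le> (\<integral>u. (norm (PP b u))\<^sup>2 * G u \<partial>lborel)"
      by linarith
    then obtain d where d: "d = a \<or> d = b" "2 ^ n * I0 \<le> (\<integral>u. (norm (PP d u))\<^sup>2 * G u \<partial>lborel)" by blast
    have d1: "\<bar>d j\<bar> = 1" for j using d(1) ab by auto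
    \<comment> \<open>Plane waves in the direction \<open>om'\<close> restrict on the curve to
      powers of the conjugate of \<open>z u\<close>.\<close>
    define f0 where "f0 = (\<lambda>j::nat. \<lambda>x. complex_of_real ((1 + (x - 0) \<bullet> (x - 0)) powr (- 0)) *
       (complex_of_real (exp (- ((x - 0) \<bullet> (x - 0)) / 1\<^sup>2)) * cis (((- 2 * pi * \<eta> * real j) *\<^sub>R om') \<bullet> x)))"
    define f where "f = (\<lambda>x. \<Sum>j<2^n. complex_of_real (d j) * f0 j x)"
    have g0: "gauss_class (f0 j)" for j unfolding f0_def by (intro gauss_class.base) auto
    have "gauss_class f" unfolding f_def
      by (rule gauss_class_sum[OF _ gauss_class.scale[OF g0] g0[of 0]]) simp
    then have sf: "schwartz f" by (rule gauss_class_schwartz)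
    then have cf: "continuous_on UNIV f" by (rule schwartz_continuous)
    have one: "1 + y \<bullet> y \<noteq> 0" for y :: "real^2" using inner_ge_zero[of y] by linarith
    have fx: "f x = complex_of_real (exp (- (x \<bullet> x))) * cnj (\<Sum>j<2^n. complex_of_real (d j) * cis (2 * pi * \<eta> * (om' \<bullet> x)) ^ j)" for x
      unfolding f_def f0_def using one
      by (simp add: sum_distrib_left Complex.DeMoivre cis_cnj mult_ac)
    have fbound: "norm (f x) \<le> sqrt (2 * 2 ^ n)" for x
    proof -
      let ?S = "\<lambda>d. \<Sum>j<2^n. complex_of_real (d j) * cis (2 * pi * \<eta> * (om' \<bullet> x)) ^ j"
      have "(norm (?S a))\<^sup>2 + (norm (?S b))\<^sup>2 = 2 * 2 ^ n" by (rule RS) simp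
      then have "(norm (?S a))\<^sup>2 \<le> 2 * 2 ^ n" "(norm (?S b))\<^sup>2 \<le> 2 * 2 ^ n"
        using zero_le_power2[of "norm (?S a)"] zero_le_power2[of "norm (?S b)"] by linarith+
      then have "(norm (?S d))\<^sup>2 \<le> 2 * 2 ^ n" using d(1) by blast
      then have "norm (?S d) \<le> sqrt (2 * 2 ^ n)" by (rule real_le_rsqrt)
      then show ?thesis unfolding fx norm_mult complex_mod_cnj
        using mult_mono[of "exp (- (x \<bullet> x))" 1 "norm (?S d)"] by simp
    qed
    have Lp: "Lp_norm p (arc_length_measure \<gamma>) f \<le> ennreal (K * sqrt (2 * 2 ^ n))"
    proof (rule Lp_norm_le_real[OF cf p])
      show "\<forall>x. norm (f x) \<le> K * sqrt (2 * 2 ^ n)" if "p = \<infinity>"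
      proof
        fix x show "norm (f x) \<le> K * sqrt (2 * 2 ^ n)"
        proof (rule order_trans[OF fbound])
          show "sqrt (2 * 2 ^ n) \<le> K * sqrt (2 * 2 ^ n)" using mult_right_mono[OF K, of "sqrt (2 * 2 ^ n)"] by simp
        qed
      qed
      fix P assume "p = ennreal P" and P: "1 \<le> P"
      have "Lp_power P f \<le> (\<integral>u. sqrt (2 * 2 ^ n) powr P * speed u \<partial>lborel)"
        unfolding Lp_power_def
      proof (rule Bochner_Integration.integral_mono)
        fix u show "norm (f (gm u)) powr P * speed u \<le> sqrt (2 * 2 ^ n) powr P * speed u"
          using fbound[of "gm u"] P by (intro mult_right_mono powr_mono2) auto
      qed (use integrable_speed integrable_Lp_power[OF cf] P in auto)
      also have "\<dots> = sqrt (2 * 2 ^ n) powr P * curve_length" by (simp add: curve_length_def)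
      also have "\<dots> \<le> sqrt (2 * 2 ^ n) powr P * K powr P"
      proof (rule mult_left_mono)
        have "K powr 1 \<le> K powr P" using K P by (intro powr_mono) auto
        then show "curve_length \<le> K powr P" using K by (simp add: K_def)
      qed simp
      also have "\<dots> = (K * sqrt (2 * 2 ^ n)) powr P" using K by (simp add: powr_mult)
      finally show "Lp_power P f \<le> (K * sqrt (2 * 2 ^ n)) powr P" .
    qed (use K in simp)
    define k where "k = (\<lambda>s. \<Sum>j<2^n. complex_of_real (d j) * indicator {\<eta> * real j..<\<eta> * real j + \<eta>} s)"
    have [measurable]: "k \<in> borel_measurable borel" unfolding k_def by measurable
    \<comment> \<open>Consecutive cells tile the interval without overlap, so the step function
      \<open>k\<close> has modulus at most 1.\<close>
    have cells: "(\<Sum>j<m. indicator {\<eta> * real j..<\<eta> * real j + \<eta>} s) = (indicator {0..<\<eta> * real m} s :: real)" for m :: nat and s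
    proof (induction m)
      case (Suc m)
      have "indicator {0..<x} s + indicator {x..<x + \<eta>} s = (indicator {0..<x + \<eta>} s :: real)" if "0 \<le> x" for x
        using \<eta>(1) that by (auto simp: indicator_def)
      from this[of "\<eta> * real m"] show ?case using Suc \<eta>(1) by (simp add: distrib_left add.commute)
    qed simp
    have kb: "norm (k s) \<le> indicator {0..<\<eta> * real ?N} s" for s
    proof -
      have "norm (k s) \<le> (\<Sum>j<2^n. norm (complex_of_real (d j) * indicator {\<eta> * real j..<\<eta> * real j + \<eta>} s))"
        unfolding k_def by (rule norm_sum)
      also have "\<dots> = (\<Sum>j<2^n. indicator {\<eta> * real j..<\<eta> * real j + \<eta>} s)"
        by (intro sum.cong refl) (auto simp: norm_mult d1 indicator_def)
      also have "\<dots> = indicator {0..<\<eta> * real ?N} s" by (rule cells)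
      finally show ?thesis .
    qed
    have k: "bdd_cpt k" unfolding bdd_cpt_def
    proof (intro conjI)
      have "norm (k s) \<le> 1" for s by (rule order_trans[OF kb]) (simp add: indicator_def)
      then show "\<exists>B. \<forall>s. norm (k s) \<le> B" by blast
      have "k s = 0" if "\<bar>s\<bar> > \<eta> * real ?N" for s
      proof -
        have "indicator {0..<\<eta> * real ?N} s = (0::real)" using that by (auto simp: indicator_def)
        then show ?thesis using kb[of s] by simp
      qed
      then show "\<exists>R. \<forall>s. \<bar>s\<bar> > R \<longrightarrow> k s = 0" by blast
    qed measurable
    \<comment> \<open>Transform of one cell. The cell with index \<open>j\<close> is its translate
      by \<open>\<eta> * j\<close>, which multiplies the transform by \<open>z u ^ j\<close>, so the
      transform of \<open>k\<close> is the polynomial times this common factor.\<close>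
    define DD where "DD = (\<lambda>y. \<integral>s. indicator {0..<\<eta>} s * cis (2 * pi * s * y) \<partial>lborel)"
    have ii: "integrable lborel (\<lambda>s. indicator {x..<x + \<eta>} s * cis (2 * pi * s * y))" for x y
    proof (rule integrableI_bounded_set[where A = "{x..<x + \<eta>}" and B = 1])
      show "(\<lambda>s. indicator {x..<x + \<eta>} s * cis (2 * pi * s * y)) \<in> borel_measurable lborel"
        unfolding cis_conv_exp by measurable
    qed (use \<eta> in \<open>auto intro!: AE_I2 simp: norm_mult indicator_def\<close>)
    have ftk: "ft k (phase u) = PP d u * DD (phase u)" for u
    proof -
      have "ft k (phase u) = (\<integral>s. (\<Sum>j<2^n. complex_of_real (d j) * (indicator {\<eta> * real j..<\<eta> * real j + \<eta>} s * cis (2 * pi * s * phase u))) \<partial>lborel)"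
        unfolding ft_def k_def by (simp only: sum_distrib_right mult.assoc)
      also have "\<dots> = (\<Sum>j<2^n. complex_of_real (d j) * (\<integral>s. indicator {\<eta> * real j..<\<eta> * real j + \<eta>} s * cis (2 * pi * s * phase u) \<partial>lborel))"
        using ii by (subst Bochner_Integration.integral_sum) auto
      also have "\<dots> = (\<Sum>j<2^n. complex_of_real (d j) * (z u ^ j * DD (phase u)))"
      proof (intro sum.cong refl arg_cong2[where f = "(*)"])
        fix j
        have "(\<integral>s. indicator {\<eta> * real j..<\<eta> * real j + \<eta>} s * cis (2 * pi * s * phase u) \<partial>lborel)
          = (\<integral>s. indicator {\<eta> * real j..<\<eta> * real j + \<eta>} (\<eta> * real j + 1 * s) * cis (2 * pi * (\<eta> * real j + 1 * s) * phase u) \<partial>lborel)"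
          by (subst lborel_integral_real_affine[where c = 1 and t = "\<eta> * real j"]) auto
        also have "\<dots> = (\<integral>s. z u ^ j * (indicator {0..<\<eta>} s * cis (2 * pi * s * phase u)) \<partial>lborel)"
        proof (intro Bochner_Integration.integral_cong refl)
          fix s
          have "cis (2 * pi * (\<eta> * real j + 1 * s) * phase u) = z u ^ j * cis (2 * pi * s * phase u)"
            by (simp add: z_def Complex.DeMoivre cis_mult algebra_simps)
          then show "indicator {\<eta> * real j..<\<eta> * real j + \<eta>} (\<eta> * real j + 1 * s) * cis (2 * pi * (\<eta> * real j + 1 * s) * phase u)
             = z u ^ j * (indicator {0..<\<eta>} s * cis (2 * pi * s * phase u))"
            by (auto simp: indicator_def)
        qed
        finally show "(\<integral>s. indicator {\<eta> * real j..<\<eta> * real j + \<eta>} s * cis (2 * pi * s * phase u) \<partial>lborel) = z u ^ j * DD (phase u)"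
          unfolding DD_def by simp
      qed
      finally show ?thesis by (simp add: PP_def sum_distrib_right mult.assoc)
    qed
    define A where "A = \<eta> / 2 * (2 ^ n * I0)"
    have "A \<ge> 0" using \<eta> \<open>I0 > 0\<close> by (simp add: A_def)
    have low: "A \<le> norm (\<integral>u. ampl f t u * ft k (phase u) \<partial>lborel)" if t: "\<bar>t\<bar> \<le> \<eta>" for t
    proof -
      \<comment> \<open>The factor common to all cells, together with the phase due to the offset,
        has real part at least half the length of a cell. The pairing therefore has real part at
        least \<open>\<eta> / 2\<close> times the integral of the squared polynomial.\<close>
      have ReD: "\<eta> / 2 \<le> Re (cis (2 * pi * t * along u) * DD (phase u))" if u: "u \<in> {0..1}" for u
      proof -
        have ic: "integrable lborel (\<lambda>s. cis (2 * pi * t * along u) * (indicator {0..<0 + \<eta>} s * cis (2 * pi * s * phase u)))"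
          using ii[of 0 "phase u"] by simp
        have "\<eta> / 2 = (\<integral>s. 1/2 * indicator {0..<\<eta>} s \<partial>lborel)" using \<eta> by simp
        also have "\<dots> \<le> (\<integral>s. Re (cis (2 * pi * t * along u) * (indicator {0..<0 + \<eta>} s * cis (2 * pi * s * phase u))) \<partial>lborel)"
        proof (rule Bochner_Integration.integral_mono)
          fix s :: real
          show "1/2 * indicator {0..<\<eta>} s \<le> Re (cis (2 * pi * t * along u) * (indicator {0..<0 + \<eta>} s * cis (2 * pi * s * phase u)))"
          proof (cases "s \<in> {0..<\<eta>}")
            case True
            let ?th = "2 * pi * t * along u + 2 * pi * s * phase u"
            have "\<bar>?th\<bar> \<le> 2 * pi * (\<bar>t\<bar> * \<bar>along u\<bar>) + 2 * pi * (\<bar>s\<bar> * \<bar>phase u\<bar>)"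
              by (rule order_trans[OF abs_triangle_ineq]) (simp add: abs_mult)
            also have "\<dots> \<le> 2 * pi * (\<eta> * B) + 2 * pi * (\<eta> * B)"
              using t True alongB[OF u] phaseB[OF u] \<eta> by (intro add_mono mult_left_mono mult_mono) auto
            also have "\<dots> \<le> 1/2" using \<eta>(3) by (simp add: algebra_simps)
            finally have "1/2 \<le> cos ?th" using one_minus_cos_le[of ?th] by linarith
            moreover have "cis (2 * pi * t * along u) * (indicator {0..<0 + \<eta>} s * cis (2 * pi * s * phase u)) = cis ?th"
              using True by (simp add: cis_mult)
            ultimately show ?thesis using True by simp
          qed simp
        qed (use \<eta> ic in \<open>auto simp del: times_complex.sel\<close>)
        also have "\<dots> = Re (\<integral>s. cis (2 * pi * t * along u) * (indicator {0..<0 + \<eta>} s * cis (2 * pi * s * phase u)) \<partial>lborel)"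
          using ic by (rule integral_Re)
        finally show ?thesis by (simp add: DD_def)
      qed
      have amp: "ampl f t u * ft k (phase u) = complex_of_real ((norm (PP d u))\<^sup>2 * G u) * (cis (2 * pi * t * along u) * DD (phase u))" for u
      proof (cases "u \<in> {0..1}")
        case True
        have "f (gm u) = complex_of_real (exp (- (gm u \<bullet> gm u))) * cnj (PP d u)"
          unfolding fx using True by (simp add: PP_def z_def phase_def gm_def inner_commute)
        then show ?thesis
          unfolding ampl_def ftk G_def of_real_mult complex_norm_square by (simp add: mult_ac)
      next
        case False
        then have "speed u = 0" by (rule speed_outside)
        then show ?thesis by (simp add: ampl_def G_def)
      qed
      obtain B1 where B1: "\<And>u. norm (ampl f t u) \<le> B1" using ampl_props(4)[OF cf] by blast
      have int1: "integrable lborel (\<lambda>u. ampl f t u * ft k (phase u))"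
      proof (rule integrable_bdd_cpt[where B = "B1 * (\<integral>s. norm (k s) \<partial>lborel)" and R = 1])
        show "(\<lambda>u. ampl f t u * ft k (phase u)) \<in> borel_measurable borel"
          using ampl_props(1)[OF cf] measurable_ft[OF k] by measurable
        fix u :: real
        show "norm (ampl f t u * ft k (phase u)) \<le> B1 * (\<integral>s. norm (k s) \<partial>lborel)"
          unfolding norm_mult using B1[of u] norm_ft_le[OF k, of "phase u"] order_trans[OF norm_ge_zero B1]
          by (intro mult_mono) auto
        assume "1 < \<bar>u\<bar>"
        then have "u \<notin> {0..1}" by auto
        then show "ampl f t u * ft k (phase u) = 0" using ampl_props(3)[OF cf] by simp
      qed
      have "A \<le> (\<integral>u. \<eta> / 2 * ((norm (PP d u))\<^sup>2 * G u) \<partial>lborel)"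
        unfolding A_def using d(2) \<eta> by (simp add: mult_left_mono)
      also have "\<dots> \<le> (\<integral>u. Re (ampl f t u * ft k (phase u)) \<partial>lborel)"
      proof (rule Bochner_Integration.integral_mono)
        fix u
        show "\<eta> / 2 * ((norm (PP d u))\<^sup>2 * G u) \<le> Re (ampl f t u * ft k (phase u))"
        proof (cases "u \<in> {0..1}")
          case True
          have "((norm (PP d u))\<^sup>2 * G u) * (\<eta> / 2) \<le> ((norm (PP d u))\<^sup>2 * G u) * Re (cis (2 * pi * t * along u) * DD (phase u))"
            using ReD[OF True] G0 by (intro mult_left_mono) auto
          moreover have "Re (complex_of_real x * w) = x * Re w" for x w by simp
          ultimately show ?thesis unfolding amp by (simp only: mult.commute[of "\<eta> / 2"])
        next
          case False
          then have "speed u = 0" by (rule speed_outside)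
          then show ?thesis by (simp add: ampl_def G_def)
        qed
      qed (use iP[OF d(1)] int1 in \<open>auto simp del: times_complex.sel\<close>)
      also have "\<dots> = Re (\<integral>u. ampl f t u * ft k (phase u) \<partial>lborel)" using int1 by (rule integral_Re)
      also have "\<dots> \<le> norm (\<integral>u. ampl f t u * ft k (phase u) \<partial>lborel)" by (rule complex_Re_le_cmod)
      finally show ?thesis .
    qed
    \<comment> \<open>Values up to the threshold \<open>L\<close> go into the absorbed part; above
      it \<open>x \<le> c1 * x powr Q\<close> by the choice
      \<open>c1 = L powr (1 - Q)\<close>.\<close>
    have young: "x * norm (k s) \<le> c1 * x powr Q + L * indicator {0..<\<eta> * real ?N} s" if "x \<ge> 0" for x s
    proof (cases "x \<le> L")
      case True
      have "x * norm (k s) \<le> L * indicator {0..<\<eta> * real ?N} s"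
        using True kb[of s] \<open>L > 0\<close> that by (intro mult_mono) auto
      moreover have "0 \<le> c1 * x powr Q" using \<open>c1 > 0\<close> by simp
      ultimately show ?thesis by linarith
    next
      case False
      then have "x > 0" using \<open>L > 0\<close> by simp
      have "norm (k s) \<le> 1" by (rule order_trans[OF kb]) (simp add: indicator_def)
      then have "x * norm (k s) \<le> x * 1" using that by (rule mult_left_mono)
      also have "\<dots> = x powr (1 - Q) * x powr Q" using \<open>x > 0\<close> by (simp flip: powr_add)
      also have "\<dots> \<le> c1 * x powr Q"
        unfolding c1_def using False \<open>L > 0\<close> Q by (intro mult_right_mono powr_mono2') auto
      finally show ?thesis using \<open>L > 0\<close> by (simp add: add_increasing2)
    qed
    have "ennreal (A / (2 * c1)) \<le> line_power Q f t" if "\<bar>t\<bar> \<le> \<eta>" for t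
    proof (rule line_power_lower[OF cf k \<open>c1 > 0\<close> \<open>A \<ge> 0\<close> young _ _ _ low[OF that]])
      show "integrable lborel (\<lambda>s. L * indicator {0..<\<eta> * real ?N} s)" using \<eta> by auto
      show "(\<integral>s. L * indicator {0..<\<eta> * real ?N} s \<partial>lborel) \<le> A / 2"
        using \<eta> by (simp add: L_def A_def)
      show "0 \<le> L * indicator {0..<\<eta> * real ?N} s" for s using \<open>L > 0\<close> by simp
    qed
    then have "2 * \<eta> * (A / (2 * c1)) \<le> C1 * (K * sqrt (2 * 2 ^ n)) powr Q"
      using \<open>A \<ge> 0\<close> \<open>c1 > 0\<close> K by (intro C1[rule_format, OF sf _ \<eta>(1,2) _ Lp]) auto
    also have "(K * sqrt (2 * 2 ^ n)) powr Q = (K * sqrt 2) powr Q * (2 ^ n) powr (Q / 2)"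
    proof -
      have "sqrt (2 ^ n) powr Q = (2 ^ n) powr (Q / 2)" by (simp add: powr_half_sqrt[symmetric] powr_powr)
      then show ?thesis using K by (simp add: real_sqrt_mult powr_mult)
    qed
    finally show ?thesis by (simp add: A_def mult_ac)
  qed
  \<comment> \<open>The lower bound grows like \<open>2^n\<close>, the upper bound like its power
    with exponent \<open>Q / 2\<close>.\<close>
  have "1 \<le> Q / 2"
    by (rule pow2_exponent_le[OF _ main]) (use \<eta> \<open>I0 > 0\<close> \<open>c1 > 0\<close> in auto)
  then show ?thesis by simp
qed

end

section \<open>The critical line: triangle functions and dyadic sums\<close>

definition tri :: "real \<Rightarrow> real" where "tri s = max 0 (1 - \<bar>s\<bar>)"

lemma tri_bounds: "0 \<le> tri s" "tri s \<le> 1" "\<bar>s\<bar> \<ge> 1 \<Longrightarrow> tri s = 0"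
  by (auto simp: tri_def)

lemma measurable_tri [measurable]: "tri \<in> borel_measurable borel"
  unfolding tri_def[abs_def] by measurable

lemma bdd_cpt_tri: "bdd_cpt (\<lambda>s. complex_of_real (tri s))"
  unfolding bdd_cpt_def
proof (intro conjI)
  show "\<exists>B. \<forall>s. norm (complex_of_real (tri s)) \<le> B" using tri_bounds by (intro exI[of _ 1]) auto
  show "\<exists>R. \<forall>s. \<bar>s\<bar> > R \<longrightarrow> complex_of_real (tri s) = 0" using tri_bounds(3) by (intro exI[of _ 1]) auto
qed measurable

definition ft_tri :: "real \<Rightarrow> real" where "ft_tri x = (\<integral>s. tri s * cos (2 * pi * s * x) \<partial>lborel)"

lemma integrable_tri:
  assumes "g \<in> borel_measurable borel" "\<And>s. \<bar>g s\<bar> \<le> 1"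
  shows "integrable lborel (\<lambda>s. tri s * g s)"
proof (rule integrable_bdd_cpt[where B = 1 and R = 1])
  fix s
  show "norm (tri s * g s) \<le> 1"
    using mult_mono[of "tri s" 1 "\<bar>g s\<bar>" 1] tri_bounds[of s] assms(2)[of s] by (simp add: abs_mult)
  show "1 < \<bar>s\<bar> \<Longrightarrow> tri s * g s = 0" using tri_bounds(3)[of s] by simp
qed (use assms(1) in measurable)

text \<open>The triangle is even, so the sine part of its transform integrates to 0.\<close>

lemma ft_tri: "ft (\<lambda>s. complex_of_real (tri s)) x = complex_of_real (ft_tri x)"
proof -
  have ic: "integrable lborel (\<lambda>s. tri s * cos (2 * pi * s * x))"
    and is': "integrable lborel (\<lambda>s. tri s * sin (2 * pi * s * x))"
    by (intro integrable_tri; simp)+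
  have "(\<integral>s. tri s * sin (2 * pi * s * x) \<partial>lborel) = (\<integral>s. tri (-s) * sin (2 * pi * (-s) * x) \<partial>lborel)"
    by (subst lborel_integral_real_affine[where c = "-1" and t = 0]) auto
  also have "\<dots> = - (\<integral>s. tri s * sin (2 * pi * s * x) \<partial>lborel)" by (simp add: tri_def)
  finally have s0: "(\<integral>s. tri s * sin (2 * pi * s * x) \<partial>lborel) = 0" by simp
  have "ft (\<lambda>s. complex_of_real (tri s)) x = 
      (\<integral>s. complex_of_real (tri s * cos (2 * pi * s * x)) + \<i> * complex_of_real (tri s * sin (2 * pi * s * x)) \<partial>lborel)"
    unfolding ft_def by (intro Bochner_Integration.integral_cong refl) (simp add: cis.ctr complex_eq_iff)
  also have "\<dots> = complex_of_real (ft_tri x) + \<i> * complex_of_real (\<integral>s. tri s * sin (2 * pi * s * x) \<partial>lborel)"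
    unfolding ft_tri_def using ic is' by (subst Bochner_Integration.integral_add) (auto simp del: of_real_mult)
  finally show ?thesis by (simp add: s0)
qed

text \<open>Explicit antiderivatives give \<open>2 * (1 - cos c) / c^2\<close> with
  \<open>c = 2 * pi * x\<close>, a Fejer kernel. Positivity is what prevents cancellation between
  the dyadic scales in the endpoint example.\<close>

lemma ft_tri_nonneg: "ft_tri x \<ge> 0"
proof (cases "x = 0")
  case True
  then show ?thesis unfolding ft_tri_def using tri_bounds by simp
next
  case False
  define c where "c = 2 * pi * x"
  have "c \<noteq> 0" using False by (simp add: c_def)
  let ?G1 = "\<lambda>s. (1 - s) * sin (c * s) / c - cos (c * s) / c\<^sup>2"
  let ?G2 = "\<lambda>s. (1 + s) * sin (c * s) / c + cos (c * s) / c\<^sup>2"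
  have 1: "(\<integral>s. indicator {0..1} s *\<^sub>R ((1 - s) * cos (c * s)) \<partial>lborel) = ?G1 1 - ?G1 0"
  proof (rule integral_FTC_atLeastAtMost)
    fix s
    have "(?G1 has_real_derivative (1 - s) * cos (c * s)) (at s within {0..1})"
      using \<open>c \<noteq> 0\<close> by (auto intro!: derivative_eq_intros simp: field_simps power2_eq_square)
    then show "(?G1 has_vector_derivative (1 - s) * cos (c * s)) (at s within {0..1})"
      by (simp add: has_real_derivative_iff_has_vector_derivative)
  qed (auto intro!: continuous_intros)
  have 2: "(\<integral>s. indicator {-1..0} s *\<^sub>R ((1 + s) * cos (c * s)) \<partial>lborel) = ?G2 0 - ?G2 (-1)"
  proof (rule integral_FTC_atLeastAtMost)
    fix s
    have "(?G2 has_real_derivative (1 + s) * cos (c * s)) (at s within {-1..0})"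
      using \<open>c \<noteq> 0\<close> by (auto intro!: derivative_eq_intros simp: field_simps power2_eq_square)
    then show "(?G2 has_vector_derivative (1 + s) * cos (c * s)) (at s within {-1..0})"
      by (simp add: has_real_derivative_iff_has_vector_derivative)
  qed (auto intro!: continuous_intros)
  have i1: "integrable lborel (\<lambda>s. indicator {0..1} s *\<^sub>R ((1 - s) * cos (c * s)))"
    and i2: "integrable lborel (\<lambda>s. indicator {-1..0} s *\<^sub>R ((1 + s) * cos (c * s)))"
    unfolding set_integrable_def[symmetric]
    by (intro borel_integrable_atLeastAtMost' continuous_intros)+
  have "ft_tri x = (\<integral>s. indicator {0..1} s *\<^sub>R ((1 - s) * cos (c * s)) + indicator {-1..0} s *\<^sub>R ((1 + s) * cos (c * s)) \<partial>lborel)"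
    unfolding ft_tri_def
  proof (rule integral_cong_AE)
    show "AE s in lborel. tri s * cos (2 * pi * s * x) = indicator {0..1} s *\<^sub>R ((1 - s) * cos (c * s)) + indicator {-1..0} s *\<^sub>R ((1 + s) * cos (c * s))"
      using AE_lborel_singleton[of "0::real"]
      by (rule eventually_mono) (auto simp: tri_def indicator_def c_def mult_ac max_def)
  qed measurable
  also have "\<dots> = (?G1 1 - ?G1 0) + (?G2 0 - ?G2 (-1))"
    using i1 i2 by (simp only: Bochner_Integration.integral_add 1 2)
  also have "\<dots> = 2 * (1 - cos c) / c\<^sup>2" using \<open>c \<noteq> 0\<close> by (simp add: field_simps)
  also have "\<dots> \<ge> 0" by simp
  finally show ?thesis .
qed

text \<open>By \<open>pi < 4\<close> the argument of the cosine is at most \<open>1/2\<close> on the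
  support, so the cosine is at least \<open>1/2\<close>; the triangle is at least \<open>1/2\<close>
  on the middle interval of length 1.\<close>

lemma ft_tri_lower:
  assumes "\<bar>x\<bar> \<le> 1/16" shows "1/4 \<le> ft_tri x"
proof -
  have "(1/4::real) = (\<integral>s. 1/4 * indicator {-1/2..1/2::real} s \<partial>lborel)" by simp
  also have "\<dots> \<le> ft_tri x"
    unfolding ft_tri_def
  proof (rule Bochner_Integration.integral_mono)
    fix s :: real
    have c: "1/2 \<le> cos (2 * pi * s * x)" if "\<bar>s\<bar> \<le> 1"
    proof -
      have "\<bar>2 * pi * s * x\<bar> = 2 * pi * (\<bar>s\<bar> * \<bar>x\<bar>)" by (simp add: abs_mult)
      also have "\<dots> \<le> 2 * 4 * (1 * (1/16))" 
        using that assms pi_less_4 by (intro mult_mono) auto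
      finally show ?thesis using one_minus_cos_le[of "2 * pi * s * x"] by linarith
    qed
    show "1/4 * indicator {-1/2..1/2} s \<le> tri s * cos (2 * pi * s * x)"
    proof (cases "\<bar>s\<bar> \<le> 1/2")
      case True
      then have "1/2 * (1/2) \<le> tri s * cos (2 * pi * s * x)"
        using c by (intro mult_mono) (auto simp: tri_def)
      then show ?thesis by (auto simp: indicator_def)
    next
      case False
      then have i: "indicator {-1/2..1/2} s = (0::real)" by (auto simp: indicator_def)
      show ?thesis
      proof (cases "\<bar>s\<bar> \<le> 1")
        case True
        then have "0 \<le> tri s * cos (2 * pi * s * x)"
          using c tri_bounds(1)[of s] by (intro mult_nonneg_nonneg) auto
        then show ?thesis by (simp only: i mult_zero_right)
      next
        case False
        then have "tri s = 0" by (intro tri_bounds(3)) simp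
        then show ?thesis by (simp only: i mult_zero_right mult_zero_left)
      qed
    qed
  qed (auto intro!: integrable_tri)
  finally show ?thesis .
qed

lemma ft_tri_scaled:
  assumes "L > 0"
  shows "ft (\<lambda>s. complex_of_real (tri (s / L)) * cis (2 * pi * s * (- y0))) y = complex_of_real (L * ft_tri (L * (y - y0)))"
proof -
  have "ft (\<lambda>s. complex_of_real (tri (s / L)) * cis (2 * pi * s * (- y0))) y
     = L *\<^sub>R (\<integral>s. complex_of_real (tri (L * s / L)) * cis (2 * pi * (L * s) * (- y0)) * cis (2 * pi * (L * s) * y) \<partial>lborel)"
    unfolding ft_def using assms by (subst lborel_integral_real_affine[where c = L and t = 0]) auto
  also have "(\<integral>s. complex_of_real (tri (L * s / L)) * cis (2 * pi * (L * s) * (- y0)) * cis (2 * pi * (L * s) * y) \<partial>lborel)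
     = ft (\<lambda>s. complex_of_real (tri s)) (L * (y - y0))"
    unfolding ft_def using assms
    by (intro Bochner_Integration.integral_cong refl) (simp add: mult.assoc cis_mult algebra_simps)
  finally show ?thesis by (simp add: ft_tri scaleR_conv_of_real)
qed

lemma bdd_cpt_sum:
  assumes "finite J" "\<And>j. j \<in> J \<Longrightarrow> bdd_cpt (h j)"
  shows "bdd_cpt (\<lambda>s. \<Sum>j\<in>J. h j s)"
  using assms
proof (induction J rule: finite_induct)
  case (insert j J)
  obtain B R where 1: "h j \<in> borel_measurable borel" "\<And>s. norm (h j s) \<le> B" "\<And>s. \<bar>s\<bar> > R \<Longrightarrow> h j s = 0"
    using insert.prems[of j] unfolding bdd_cpt_def by auto
  obtain B' R' where 2: "(\<lambda>s. \<Sum>j\<in>J. h j s) \<in> borel_measurable borel" "\<And>s. norm (\<Sum>j\<in>J. h j s) \<le> B'" 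
     "\<And>s. \<bar>s\<bar> > R' \<Longrightarrow> (\<Sum>j\<in>J. h j s) = 0"
    using insert unfolding bdd_cpt_def by auto
  have "norm (h j s + (\<Sum>j\<in>J. h j s)) \<le> B + B'" for s
    using norm_triangle_ineq[of "h j s"] 1(2)[of s] 2(2)[of s] by (meson add_mono order_trans)
  moreover have "h j s + (\<Sum>j\<in>J. h j s) = 0" if "\<bar>s\<bar> > max R R'" for s using that 1(3)[of s] 2(3)[of s] by simp
  moreover have "(\<lambda>s. h j s + (\<Sum>j\<in>J. h j s)) \<in> borel_measurable borel"
    using 1(1) 2(1) by (rule borel_measurable_add)
  ultimately have "bdd_cpt (\<lambda>s. h j s + (\<Sum>j\<in>J. h j s))" unfolding bdd_cpt_def by blast
  then show ?case using insert.hyps by simp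
qed (auto simp: bdd_cpt_def)

lemma bdd_cpt_cmult: "bdd_cpt h \<Longrightarrow> bdd_cpt (\<lambda>s. c * h s)"
  using bdd_cpt_mult[of h "\<lambda>_. c" "norm c"] by (simp add: mult.commute)

lemma ft_sum:
  assumes "finite J" "\<And>j. j \<in> J \<Longrightarrow> bdd_cpt (h j)"
  shows "ft (\<lambda>s. \<Sum>j\<in>J. c j * h j s) y = (\<Sum>j\<in>J. c j * ft (h j) y)"
proof -
  have "ft (\<lambda>s. \<Sum>j\<in>J. c j * h j s) y = (\<integral>s. (\<Sum>j\<in>J. c j * (h j s * cis (2 * pi * s * y))) \<partial>lborel)"
    unfolding ft_def by (simp only: sum_distrib_right mult.assoc)
  also have "\<dots> = (\<Sum>j\<in>J. c j * (\<integral>s. h j s * cis (2 * pi * s * y) \<partial>lborel))"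
    using integrable_ft_integrand[OF assms(2)] by (subst Bochner_Integration.integral_sum) auto
  finally show ?thesis by (simp add: ft_def)
qed

text \<open>A geometric series starting at the first \<open>k\<close> with
  \<open>v \<le> 2 ^ k\<close>, summed by telescoping: each term times \<open>1 - \<rho>\<close> is
  at most the decrease of \<open>\<phi>\<close>. The truncation of \<open>\<phi>\<close> at
  \<open>v powr (- \<beta>)\<close> replaces the search for that \<open>k\<close>.\<close>

lemma dyadic_tail_sum:
  fixes v \<beta> :: real
  assumes v: "v > 0" and b: "\<beta> > 0"
  shows "(\<Sum>k<N. if v \<le> 2 ^ k then (2 ^ k) powr (- \<beta>) else 0) \<le> v powr (- \<beta>) / (1 - 2 powr (- \<beta>))"
proof -
  define \<rho> where "\<rho> = 2 powr (- \<beta>)"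
  have \<rho>: "0 < \<rho>" "\<rho> < 1" using b by (auto simp: \<rho>_def powr_less_one)
  define \<phi> where "\<phi> = (\<lambda>k::nat. min (v powr (- \<beta>)) ((2 ^ k) powr (- \<beta>)))"
  have step: "(1 - \<rho>) * (if v \<le> 2 ^ k then (2 ^ k) powr (- \<beta>) else 0) \<le> \<phi> k - \<phi> (Suc k)" for k
  proof (cases "v \<le> 2 ^ k")
    case True
    have "(2 ^ Suc k) powr (- \<beta>) = \<rho> * (2 ^ k) powr (- \<beta>)" by (simp add: \<rho>_def powr_mult)
    moreover have "\<phi> k = (2 ^ k) powr (- \<beta>)" unfolding \<phi>_def using True v b by (intro min_absorb2 powr_mono2') auto
    moreover have "\<phi> (Suc k) \<le> (2 ^ Suc k) powr (- \<beta>)" by (simp add: \<phi>_def)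
    ultimately show ?thesis using True by (simp add: algebra_simps)
  next
    case False
    have "(2 ^ Suc k) powr (- \<beta>) \<le> (2 ^ k) powr (- \<beta>)" using b by (intro powr_mono2') auto
    then have "\<phi> (Suc k) \<le> \<phi> k" unfolding \<phi>_def by linarith
    then show ?thesis using False by simp
  qed
  have "(1 - \<rho>) * (\<Sum>k<N. if v \<le> 2 ^ k then (2 ^ k) powr (- \<beta>) else 0) \<le> (\<Sum>k<N. \<phi> k - \<phi> (Suc k))"
    unfolding sum_distrib_left by (intro sum_mono step)
  also have "\<dots> = \<phi> 0 - \<phi> N" by (rule sum_lessThan_telescope')
  also have "\<dots> \<le> v powr (- \<beta>)"
  proof -
    have "\<phi> 0 \<le> v powr (- \<beta>)" "0 \<le> \<phi> N" by (auto simp: \<phi>_def)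
    then show ?thesis by linarith
  qed
  finally show ?thesis using \<rho> by (simp add: \<rho>_def field_simps)
qed

text \<open>Source of the linear growth in \<open>N\<close> of both norms in the endpoint example,
  where the ratio \<open>R / a\<close> is exponential in \<open>N\<close>.\<close>

lemma nn_integral_log:
  assumes a: "0 < a" "a \<le> R"
  shows "(\<integral>\<^sup>+ v. ennreal (1 / max a \<bar>v\<bar>) * indicator {-R..R} v \<partial>lborel) \<le> ennreal (2 + 2 * ln (R / a))"
proof -
  have hi: "((\<lambda>v. 1 / v) has_integral (ln R - ln a)) {a..R}"
  proof (rule fundamental_theorem_of_calculus[OF a(2)])
    fix v assume "v \<in> {a..R}"
    then show "(ln has_vector_derivative 1 / v) (at v within {a..R})"
      using a unfolding has_real_derivative_iff_has_vector_derivative[symmetric]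
      by (intro DERIV_ln_divide DERIV_subset[OF DERIV_ln_divide]) auto
  qed
  have p: "(\<integral>\<^sup>+ v. ennreal (1 / v) * indicator {a..R} v \<partial>lborel) = ennreal (ln R - ln a)"
    by (rule nn_integral_has_integral_lebesgue'[OF _ hi]) (use a in auto)
  have "(\<integral>\<^sup>+ v. ennreal (1 / - v) * indicator {-R..-a} v \<partial>lborel)
     = (\<integral>\<^sup>+ v. ennreal (1 / v) * indicator {-R..-a} (- v) \<partial>lborel)"
    by (subst nn_integral_real_affine[where c = "-1" and t = 0]) auto
  also have "\<dots> = (\<integral>\<^sup>+ v. ennreal (1 / v) * indicator {a..R} v \<partial>lborel)"
    by (intro nn_integral_cong) (auto simp: indicator_def)
  finally have m: "(\<integral>\<^sup>+ v. ennreal (1 / - v) * indicator {-R..-a} v \<partial>lborel) = ennreal (ln R - ln a)" by (simp only: p)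
  have c: "(\<integral>\<^sup>+ v. ennreal (1 / a) * indicator {-a..a} v \<partial>lborel) = ennreal 2"
    using a by (subst nn_integral_cmult_indicator) (auto simp flip: ennreal_mult)
  have "(\<integral>\<^sup>+ v. ennreal (1 / max a \<bar>v\<bar>) * indicator {-R..R} v \<partial>lborel)
    \<le> (\<integral>\<^sup>+ v. ennreal (1 / a) * indicator {-a..a} v + (ennreal (1 / v) * indicator {a..R} v + ennreal (1 / - v) * indicator {-R..-a} v) \<partial>lborel)"
  proof (rule nn_integral_mono)
    fix v :: real
    consider "\<bar>v\<bar> \<le> a" | "v > a" | "v < -a" by linarith
    then show "ennreal (1 / max a \<bar>v\<bar>) * indicator {-R..R} v \<le> ennreal (1 / a) * indicator {-a..a} v + (ennreal (1 / v) * indicator {a..R} v + ennreal (1 / - v) * indicator {-R..-a} v)"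
    proof cases
      case 1
      then have "max a \<bar>v\<bar> = a" "v \<in> {-a..a}" by auto
      then show ?thesis by (auto simp: indicator_def add_increasing2)
    next
      case 2
      then have "max a \<bar>v\<bar> = v" "v \<notin> {-a..a}" "v \<notin> {-R..-a}" using a by auto
      then show ?thesis using 2 a by (auto simp: indicator_def)
    next
      case 3
      then have "max a \<bar>v\<bar> = - v" "v \<notin> {-a..a}" "v \<notin> {a..R}" using a by auto
      then show ?thesis using 3 a by (auto simp: indicator_def)
    qed
  qed
  also have "\<dots> = ennreal 2 + (ennreal (ln R - ln a) + ennreal (ln R - ln a))"
  proof -
    let ?A = "\<lambda>v. ennreal (1 / a) * indicator {-a..a} v"
    let ?B = "\<lambda>v. ennreal (1 / v) * indicator {a..R} v" and ?C = "\<lambda>v. ennreal (1 / - v) * indicator {-R..-a} v"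
    have "(\<integral>\<^sup>+ v. ?A v + (?B v + ?C v) \<partial>lborel) = (\<integral>\<^sup>+ v. ?A v \<partial>lborel) + (\<integral>\<^sup>+ v. ?B v + ?C v \<partial>lborel)"
      by (rule nn_integral_add) measurable
    also have "(\<integral>\<^sup>+ v. ?B v + ?C v \<partial>lborel) = (\<integral>\<^sup>+ v. ?B v \<partial>lborel) + (\<integral>\<^sup>+ v. ?C v \<partial>lborel)"
      by (rule nn_integral_add) measurable
    finally show ?thesis by (simp only: c p m)
  qed
  also have "\<dots> = ennreal (2 + 2 * ln (R / a))"
  proof -
    have l: "ln (R / a) = ln R - ln a" "ln R - ln a \<ge> 0" using a by (auto simp: ln_div)
    have "ennreal (2 + 2 * ln (R / a)) = ennreal (2 + ((ln R - ln a) + (ln R - ln a)))" by (simp add: l(1))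
    also have "\<dots> = ennreal 2 + (ennreal (ln R - ln a) + ennreal (ln R - ln a))"
      using l(2) by (simp only: ennreal_plus add_nonneg_nonneg zero_le_numeral)
    finally show ?thesis ..
  qed
  finally show ?thesis .
qed

context curve_line
begin

text \<open>On the critical line take \<open>f\<close> to be \<open>\<bar>\<xi> - \<gamma> u0\<bar> powr (- r)\<close>, with \<open>r = 1/p\<close>, mollified at scale \<open>2 powr (- N/2)\<close>, and test
  \<open>E f\<close> against a sum of \<open>N\<close> dyadic dilates of the triangle function. The transforms of the dilates are
  nonnegative, so their pairings with \<open>f\<close> add up to at least \<open>c\<cdot>N\<close>, while the \<open>p\<close>-th and \<open>q'\<close>-th powers
  of the two norms are \<open>O(N)\<close>. This forces \<open>N \<le> C\<cdot>N powr (r + 1/q')\<close>, that is, \<open>1/q \<le> r\<close>.\<close>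

lemma endpoint_necessary:
  assumes S: "strip_estimate \<gamma> \<omega> p (ennreal Q)" and Q: "Q > 1" and p: "1 \<le> p"
    and u0: "u0 \<in> {0..1}" "phase1 u0 = 0" and crit: "rec_exp p + 2 / Q = 1"
  shows "1 / Q \<le> rec_exp p"
proof -
  define r where "r = rec_exp p"
  have r: "0 \<le> r" "r \<le> 1"
  proof -
    show "0 \<le> r" by (simp add: r_def rec_exp_def)
    have "2 / Q > 0" using Q by simp
    then show "r \<le> 1" using crit unfolding r_def by linarith
  qed
  define Q' where "Q' = Q / (Q - 1)"
  have Q': "Q' > 1" "1/Q + 1/Q' = 1" using Q by (auto simp: Q'_def field_simps)
  define \<beta> where "\<beta> = 1 - 1/Q"
  have \<beta>: "\<beta> > 0" "\<beta> * Q' = 1" using Q by (auto simp: \<beta>_def Q'_def field_simps)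
  define C\<beta> where "C\<beta> = 1 / (1 - 2 powr (- \<beta>))"
  have "2 powr (- \<beta>) < 1" using \<beta> by (simp add: powr_less_one)
  then have "C\<beta> > 0" by (simp add: C\<beta>_def)
  obtain C where C: "C > 0" "\<And>u. u \<in> {0..1} \<Longrightarrow> \<bar>phase u - phase u0\<bar> \<le> C * (chord u0 u)\<^sup>2"
    by (rule phase_quadratic[OF u0]) blast
  obtain V where V0: "V > 0" "\<And>u v. u \<in> {0..1} \<Longrightarrow> v \<in> {0..1} \<Longrightarrow> chord v u \<le> V * \<bar>u - v\<bar>"
    by (rule chord_upper) blast
  have V: "V > 0" "\<And>u. u \<in> {0..1} \<Longrightarrow> chord u0 u \<le> V * \<bar>u - u0\<bar>"
    using V0(1) V0(2)[OF _ u0(1)] by auto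
  obtain c W where c: "c > 0" "\<And>u. u \<in> {0..1} \<Longrightarrow> c \<le> speed u" by (rule speed_bounds) blast
  obtain m cd where "cd > 0" "m \<ge> 0" and mc: "\<forall>g. g \<in> borel_measurable borel \<longrightarrow> (\<forall>x y. 0 \<le> x \<longrightarrow> x \<le> y \<longrightarrow> g y \<le> g x) \<longrightarrow>
     (\<integral>\<^sup>+ u. g (chord u0 u) * ennreal (speed u) \<partial>lborel) \<le> ennreal m * (\<integral>\<^sup>+ v. g (cd * \<bar>v\<bar>) * indicator {-1..1} v \<partial>lborel)"
    using nn_integral_chord_le[OF u0(1)] by auto
  \<comment> \<open>Keeps the part of the phase that depends on the offset at most
    \<open>1/2\<close> in modulus, since chords are at most \<open>V\<close>.\<close>
  define \<kappa> where "\<kappa> = 1 / (4 * pi * (V + 1))"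
  have \<kappa>: "\<kappa> > 0" "\<kappa> \<le> 1/2" "2 * pi * \<kappa> * V \<le> 1/2"
  proof -
    show "\<kappa> > 0" using V by (simp add: \<kappa>_def)
    define k where "k = 4 * pi * \<kappa>"
    have "k * (V + 1) = 1" using V by (simp add: k_def \<kappa>_def)
    then have kv: "k * V + k = 1" by (simp add: distrib_left)
    have k: "k > 0" "k * V > 0" using \<open>\<kappa> > 0\<close> V by (simp_all add: k_def)
    have "2 * pi * \<kappa> * V = k * V / 2" by (simp add: k_def)
    then show "2 * pi * \<kappa> * V \<le> 1/2" using kv k by linarith
    have "2 * \<kappa> \<le> pi * \<kappa>" using pi_ge_two \<open>\<kappa> > 0\<close> by (intro mult_right_mono) auto
    moreover have "k = 4 * (pi * \<kappa>)" by (simp add: k_def)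
    ultimately show "\<kappa> \<le> 1/2" using kv k by linarith
  qed
  \<comment> \<open>At parameter distance up to \<open>\<rho> / sqrt L\<close> from
    \<open>u0\<close>, \<open>L\<close> times the increment of the phase is at most
    \<open>1/16\<close>, where the transform of the triangle is at least \<open>1/4\<close>.\<close>
  define \<rho> where "\<rho> = min (1/2) (min (1 / V) (1 / (4 * V * sqrt C)))"
  have \<rho>: "\<rho> > 0" "\<rho> \<le> 1/2" "V * \<rho> \<le> 1" "C * (V * \<rho>)\<^sup>2 \<le> 1/16"
  proof -
    show "\<rho> > 0" "\<rho> \<le> 1/2" using V C by (auto simp: \<rho>_def)
    have "\<rho> \<le> 1 / V" by (simp add: \<rho>_def)
    then show "V * \<rho> \<le> 1" using V by (simp add: field_simps)
    have "\<rho> \<le> 1 / (4 * V * sqrt C)" by (simp add: \<rho>_def)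
    then have "sqrt C * (V * \<rho>) \<le> 1/4" using V C by (simp add: field_simps)
    then have "(sqrt C * (V * \<rho>))\<^sup>2 \<le> (1/4)\<^sup>2" using V C \<open>\<rho> > 0\<close> by (intro power_mono) auto
    then show "C * (V * \<rho>)\<^sup>2 \<le> 1/16" using C by (simp add: power_mult_distrib power_divide)
  qed
  define c3 where "c3 = c * exp (-1) / 8 * \<rho>"
  have "c3 > 0" using c \<rho> by (simp add: c3_def)
  \<comment> \<open>Weight in Young's inequality, chosen so that the integral of \<open>H\<close> is
    at most half of \<open>A\<close>.\<close>
  define \<kappa>1 where "\<kappa>1 = (16 * C\<beta> powr Q' / c3) powr (1 / Q')"
  have "\<kappa>1 > 0" using \<open>c3 > 0\<close> \<open>C\<beta> > 0\<close> by (simp add: \<kappa>1_def)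
  have \<kappa>1Q: "\<kappa>1 powr Q' = 16 * C\<beta> powr Q' / c3"
    using \<open>c3 > 0\<close> \<open>C\<beta> > 0\<close> Q' by (simp add: \<kappa>1_def powr_powr)
  define c1 where "c1 = \<kappa>1 powr Q"
  have "c1 > 0" using \<open>\<kappa>1 > 0\<close> by (simp add: c1_def)
  define K where "K = max 1 (m / cd * (3 + 2 * ln (cd + 1)))"
  have K: "K \<ge> 1" "m / cd * (3 + 2 * ln (cd + 1)) \<le> K" by (auto simp: K_def)
  obtain C1 where "C1 > 0" and C1: "\<forall>f X N \<eta>. schwartz f \<longrightarrow> X \<ge> 0 \<longrightarrow> 0 < \<eta> \<longrightarrow> \<eta> \<le> 1/2 \<longrightarrow>
     (\<forall>t. \<bar>t\<bar> \<le> \<eta> \<longrightarrow> ennreal X \<le> line_power Q f t) \<longrightarrow>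
     Lp_norm p (arc_length_measure \<gamma>) f \<le> ennreal N \<longrightarrow> N \<ge> 0 \<longrightarrow> 2 * \<eta> * X \<le> C1 * N powr Q"
    using strip_estimate_lower[OF S] Q by auto
  have main: "(\<kappa> * c3 / (2 * c1)) * (2 ^ n) powr 1 \<le> (C1 * (K * 2 powr r) powr Q) * (2 ^ n) powr (Q * r)" for n :: nat
  proof -
    \<comment> \<open>The number of scales is itself a power of 2, so that exponents can be compared
      by \<open>pow2_exponent_le\<close>.\<close>
    define N where "N = (2::nat) ^ n"
    have "N \<ge> 1" by (simp add: N_def)
    \<comment> \<open>At most \<open>1 / 2 ^ k\<close> for all \<open>k < N\<close>, so that the
      mollification does not reduce the order of \<open>f\<close> at the scales used.\<close>
    define \<epsilon> where "\<epsilon> = (1/2::real) ^ N"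
    have \<epsilon>: "\<epsilon> > 0" "\<epsilon> \<le> 1" by (auto simp: \<epsilon>_def power_le_one)
    define f where "f = (\<lambda>x. complex_of_real ((\<epsilon> + (x - gm u0) \<bullet> (x - gm u0)) powr (- (r/2))) *
       (complex_of_real (exp (- ((x - gm u0) \<bullet> (x - gm u0)) / 1\<^sup>2)) * cis (0 \<bullet> x)))"
    have "gauss_class f" unfolding f_def using \<epsilon> r by (intro gauss_class.base) auto
    then have sf: "schwartz f" by (rule gauss_class_schwartz)
    then have cf: "continuous_on UNIV f" by (rule schwartz_continuous)
    define F where "F = (\<lambda>u. (\<epsilon> + (chord u0 u)\<^sup>2) powr (- (r/2)) * exp (- (chord u0 u)\<^sup>2))"
    have [measurable]: "F \<in> borel_measurable borel" unfolding F_def by measurable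
    have F0: "F u \<ge> 0" for u by (simp add: F_def)
    have fF: "f (gm u) = complex_of_real (F u)" for u
      by (simp add: f_def F_def chord_def power2_norm_eq_inner)
    have Lp: "Lp_norm p (arc_length_measure \<gamma>) f \<le> ennreal (K * (1 + real N) powr r)"
    proof (rule Lp_norm_le_real[OF cf p])
      show "0 \<le> K * (1 + real N) powr r" using K by simp
      show "\<forall>x. norm (f x) \<le> K * (1 + real N) powr r" if "p = \<infinity>"
      proof
        fix x
        have "r = 0" using that by (simp add: r_def rec_exp_def)
        have "\<epsilon> + (x - gm u0) \<bullet> (x - gm u0) \<noteq> 0" using \<epsilon>(1) inner_ge_zero[of "x - gm u0"] by linarith
        then have "norm (f x) \<le> 1" by (simp add: f_def \<open>r = 0\<close> norm_mult)
        then show "norm (f x) \<le> K * (1 + real N) powr r" using K by (simp add: \<open>r = 0\<close>)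
      qed
      fix P assume pP: "p = ennreal P" and P: "1 \<le> P"
      have rP: "r = 1/P" using pP P by (simp add: r_def rec_exp_def)
      \<comment> \<open>By \<open>r * P = 1\<close> the \<open>P\<close>-th power of
        \<open>norm f\<close> is at most the reciprocal of the square root of
        \<open>\<epsilon>\<close> plus the squared chord; \<open>a\<close> is the resulting cut-off
        in terms of the parameter.\<close>
      define a where "a = sqrt \<epsilon> / cd"
      define R where "R = 1 + 1 / cd"
      have a: "0 < a" "a \<le> R" "1 \<le> R"
      proof -
        show "0 < a" "1 \<le> R" using \<epsilon> \<open>cd > 0\<close> by (auto simp: a_def R_def)
        have "sqrt \<epsilon> \<le> 1" using \<epsilon> by simp
        then have "a \<le> 1 / cd" using \<open>cd > 0\<close> by (simp add: a_def divide_right_mono)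
        then show "a \<le> R" by (simp add: R_def)
      qed
      have i: "integrable lborel (\<lambda>u. norm (f (gm u)) powr P * speed u)" using integrable_Lp_power[OF cf] P by simp
      have "ennreal (Lp_power P f) = (\<integral>\<^sup>+ u. ennreal (norm (f (gm u)) powr P * speed u) \<partial>lborel)"
        unfolding Lp_power_def using i by (intro nn_integral_eq_integral[symmetric]) auto
      also have "\<dots> \<le> (\<integral>\<^sup>+ u. ennreal ((\<epsilon> + (max 0 (chord u0 u))\<^sup>2) powr (-1/2)) * ennreal (speed u) \<partial>lborel)"
      proof (rule nn_integral_mono)
        fix u
        have "norm (f (gm u)) powr P = (\<epsilon> + (chord u0 u)\<^sup>2) powr (- (r/2) * P) * exp (- (chord u0 u)\<^sup>2) powr P"
        proof -
          have "norm (f (gm u)) = F u" using F0[of u] by (simp only: fF norm_of_real abs_of_nonneg)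
          then show ?thesis by (simp only: F_def powr_mult powr_powr)
        qed
        also have "\<dots> \<le> (\<epsilon> + (chord u0 u)\<^sup>2) powr (- (r/2) * P) * 1"
          using P powr_mono2[of P "exp (- (chord u0 u)\<^sup>2)" 1] by (intro mult_left_mono) auto
        also have "- (r/2) * P = -1/2" using P by (simp add: rP)
        finally show "ennreal (norm (f (gm u)) powr P * speed u) \<le> ennreal ((\<epsilon> + (max 0 (chord u0 u))\<^sup>2) powr (-1/2)) * ennreal (speed u)"
          by (auto simp: max_absorb2 intro!: ennreal_leI mult_right_mono simp flip: ennreal_mult)
      qed
      also have "\<dots> \<le> ennreal m * (\<integral>\<^sup>+ v. ennreal ((\<epsilon> + (max 0 (cd * \<bar>v\<bar>))\<^sup>2) powr (-1/2)) * indicator {-1..1} v \<partial>lborel)"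
      proof (rule mc[rule_format, of "\<lambda>x. ennreal ((\<epsilon> + (max 0 x)\<^sup>2) powr (-1/2))"])
        fix x y :: real assume "0 \<le> x" "x \<le> y"
        then have "x\<^sup>2 \<le> y\<^sup>2" by (intro power_mono)
        then show "ennreal ((\<epsilon> + (max 0 y)\<^sup>2) powr (-1/2)) \<le> ennreal ((\<epsilon> + (max 0 x)\<^sup>2) powr (-1/2))"
          using \<open>0 \<le> x\<close> \<open>x \<le> y\<close> \<epsilon> by (intro ennreal_leI powr_mono2') (auto simp: max_absorb2 add_pos_nonneg)
      qed measurable
      also have "\<dots> \<le> ennreal m * (\<integral>\<^sup>+ v. ennreal (1/cd) * (ennreal (1 / max a \<bar>v\<bar>) * indicator {-R..R} v) \<partial>lborel)"
      proof (intro mult_left_mono nn_integral_mono)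
        fix v
        have "cd * max a \<bar>v\<bar> = max (sqrt \<epsilon>) (cd * \<bar>v\<bar>)"
          using \<open>cd > 0\<close> by (simp add: a_def max_mult_distrib_left)
        also have "\<dots> \<le> sqrt (\<epsilon> + (cd * \<bar>v\<bar>)\<^sup>2)"
          using \<epsilon> \<open>cd > 0\<close> by (auto intro!: real_sqrt_le_mono real_le_rsqrt)
        finally have le: "cd * max a \<bar>v\<bar> \<le> sqrt (\<epsilon> + (cd * \<bar>v\<bar>)\<^sup>2)" .
        have pos: "0 < cd * max a \<bar>v\<bar>" using \<open>cd > 0\<close> a(1) by (simp add: less_max_iff_disj)
        have "(\<epsilon> + (max 0 (cd * \<bar>v\<bar>))\<^sup>2) powr (-1/2) = 1 / sqrt (\<epsilon> + (cd * \<bar>v\<bar>)\<^sup>2)"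
          using \<epsilon> \<open>cd > 0\<close> by (simp add: max_absorb2 powr_minus_divide powr_half_sqrt)
        also have "\<dots> \<le> 1 / (cd * max a \<bar>v\<bar>)" using le pos by (simp only: divide_left_mono zero_le_one mult_pos_pos less_le_trans[OF pos le])
        finally have "(\<epsilon> + (max 0 (cd * \<bar>v\<bar>))\<^sup>2) powr (-1/2) \<le> 1/cd * (1 / max a \<bar>v\<bar>)" by simp
        then have "ennreal ((\<epsilon> + (max 0 (cd * \<bar>v\<bar>))\<^sup>2) powr (-1/2)) \<le> ennreal (1/cd) * ennreal (1 / max a \<bar>v\<bar>)"
          using \<open>cd > 0\<close> a(1) by (subst ennreal_mult[symmetric]) (auto intro!: ennreal_leI simp: le_max_iff_disj)
        moreover have "indicator {-1..1} v \<le> (indicator {-R..R} v :: ennreal)" using a by (auto simp: indicator_def)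
        ultimately have "ennreal ((\<epsilon> + (max 0 (cd * \<bar>v\<bar>))\<^sup>2) powr (-1/2)) * indicator {-1..1} v 
           \<le> (ennreal (1/cd) * ennreal (1 / max a \<bar>v\<bar>)) * indicator {-R..R} v"
          by (intro mult_mono) auto
        then show "ennreal ((\<epsilon> + (max 0 (cd * \<bar>v\<bar>))\<^sup>2) powr (-1/2)) * indicator {-1..1} v 
           \<le> ennreal (1/cd) * (ennreal (1 / max a \<bar>v\<bar>) * indicator {-R..R} v)"
          by (simp only: mult.assoc)
      qed simp
      also have "\<dots> = ennreal m * (ennreal (1/cd) * (\<integral>\<^sup>+ v. ennreal (1 / max a \<bar>v\<bar>) * indicator {-R..R} v \<partial>lborel))"
        by (subst nn_integral_cmult) auto
      also have "\<dots> \<le> ennreal m * (ennreal (1/cd) * ennreal (2 + 2 * ln (R / a)))"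
        using a by (intro mult_left_mono nn_integral_log) auto
      also have "\<dots> = ennreal (m / cd * (2 + 2 * ln (R / a)))"
      proof -
        have "0 \<le> ln (R / a)" using a by simp
        then have l: "0 \<le> 2 + 2 * ln (R / a)" by simp
        show ?thesis using \<open>m \<ge> 0\<close> \<open>cd > 0\<close> l
          by (simp only: ennreal_mult[symmetric] mult_nonneg_nonneg divide_nonneg_pos zero_le_one) simp
      qed
      finally have "Lp_power P f \<le> m / cd * (2 + 2 * ln (R / a))"
        using \<open>m \<ge> 0\<close> \<open>cd > 0\<close> a by (subst (asm) ennreal_le_iff) (auto simp: ln_div)
      \<comment> \<open>Since \<open>\<epsilon>\<close> is the \<open>N\<close>-th power of
        \<open>1/2\<close>, the logarithm is linear in \<open>N\<close>.\<close>
      also have "2 * ln (R / a) = 2 * ln (cd + 1) + real N * ln 2"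
      proof -
        have "R = (cd + 1) / cd" using \<open>cd > 0\<close> by (simp add: R_def add_divide_distrib)
        then have "R / a = (cd + 1) / sqrt \<epsilon>" using \<open>cd > 0\<close> by (simp add: a_def)
        moreover have "ln (sqrt \<epsilon>) = - (real N * ln 2) / 2"
          by (simp add: \<epsilon>_def ln_sqrt ln_realpow ln_div)
        ultimately show ?thesis using \<open>cd > 0\<close> \<epsilon> by (simp add: ln_div)
      qed
      also have "m / cd * (2 + (2 * ln (cd + 1) + real N * ln 2)) \<le> m / cd * ((3 + 2 * ln (cd + 1)) * (1 + real N))"
      proof (rule mult_left_mono)
        have "real N * ln 2 \<le> real N * 1" using ln_2_less_1 by (intro mult_left_mono) auto
        moreover have "0 \<le> ln (cd + 1) * real N" using \<open>cd > 0\<close> by simp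
        ultimately show "2 + (2 * ln (cd + 1) + real N * ln 2) \<le> (3 + 2 * ln (cd + 1)) * (1 + real N)"
          by (simp add: algebra_simps)
      qed (use \<open>m \<ge> 0\<close> \<open>cd > 0\<close> in simp)
      also have "\<dots> \<le> K * (1 + real N)"
        using mult_right_mono[OF K(2), of "1 + real N"] by (simp add: mult.assoc)
      also have "\<dots> \<le> K powr P * (1 + real N)"
      proof (rule mult_right_mono)
        have "K powr 1 \<le> K powr P" using K P by (intro powr_mono) auto
        then show "K \<le> K powr P" using K by simp
      qed simp
      also have "\<dots> = (K * (1 + real N) powr r) powr P"
        using P K by (simp add: rP powr_mult powr_powr)
      finally show "Lp_power P f \<le> (K * (1 + real N) powr r) powr P" .
    qed
    let ?h = "\<lambda>k s. complex_of_real (tri (s / 2 ^ k)) * cis (2 * pi * s * (- phase u0))"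
    \<comment> \<open>The exponent \<open>\<beta> = 1 / Q'\<close> makes \<open>h\<close> dominated
      by a multiple of \<open>\<bar>s\<bar> powr (- 1 / Q')\<close> up to \<open>2 ^ N\<close>, the
      borderline for the dual norm. The modulation centres the transforms at the critical value of
      the phase.\<close>
    define h where "h = (\<lambda>s. \<Sum>k<N. complex_of_real ((2 ^ k) powr (- \<beta>)) * ?h k s)"
    have hk: "bdd_cpt (?h k)" for k :: nat
    proof -
      have "bdd_cpt (\<lambda>s. complex_of_real (tri (s / 2 ^ k)))"
        unfolding bdd_cpt_def
      proof (intro conjI)
        show "\<exists>B. \<forall>s. norm (complex_of_real (tri (s / 2 ^ k))) \<le> B" using tri_bounds by (intro exI[of _ 1]) auto
        show "\<exists>R. \<forall>s. \<bar>s\<bar> > R \<longrightarrow> complex_of_real (tri (s / 2 ^ k)) = 0"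
          by (intro exI[of _ "2 ^ k"]) (auto intro!: tri_bounds(3) simp: le_divide_eq)
      qed measurable
      then show ?thesis by (rule bdd_cpt_modulate)
    qed
    have h: "bdd_cpt h" unfolding h_def by (intro bdd_cpt_sum bdd_cpt_cmult hk) simp
    \<comment> \<open>Dilation by \<open>2 ^ k\<close> multiplies the transform by
      \<open>2 ^ k\<close>, and together with the coefficient this gives the power
      \<open>1 / Q\<close> of \<open>2 ^ k\<close>.\<close>
    define SS where "SS = (\<lambda>u. \<Sum>k<N. (2 ^ k) powr (1 / Q) * ft_tri (2 ^ k * (phase u - phase u0)))"
    have fth: "ft h (phase u) = complex_of_real (SS u)" for u
    proof -
      have "ft h (phase u) = (\<Sum>k<N. complex_of_real ((2 ^ k) powr (- \<beta>)) * ft (?h k) (phase u))"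
        unfolding h_def by (rule ft_sum[OF _ hk]) simp
      also have "\<dots> = (\<Sum>k<N. complex_of_real ((2 ^ k) powr (1 / Q) * ft_tri (2 ^ k * (phase u - phase u0))))"
      proof (rule sum.cong[OF refl])
        fix k :: nat
        have "(2 ^ k) powr (- \<beta>) * 2 ^ k = ((2::real) ^ k) powr (- \<beta>) * (2 ^ k) powr 1" by simp
        also have "\<dots> = (2 ^ k) powr (1 / Q)" by (simp only: powr_add[symmetric]) (simp add: \<beta>_def)
        finally have "(2 ^ k) powr (- \<beta>) * (2 ^ k * ft_tri (2 ^ k * (phase u - phase u0))) = (2 ^ k) powr (1 / Q) * ft_tri (2 ^ k * (phase u - phase u0))"
          by (simp only: mult.assoc[symmetric])
        then show "complex_of_real ((2 ^ k) powr (- \<beta>)) * ft (?h k) (phase u) = complex_of_real ((2 ^ k) powr (1 / Q) * ft_tri (2 ^ k * (phase u - phase u0)))"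
          by (subst ft_tri_scaled) (simp_all only: of_real_mult[symmetric] zero_less_power zero_less_numeral)
      qed
      finally show ?thesis by (simp add: SS_def)
    qed
    have SS0: "SS u \<ge> 0" for u unfolding SS_def by (intro sum_nonneg mult_nonneg_nonneg ft_tri_nonneg) auto
    have ftm: "ft (\<lambda>s. complex_of_real (tri s)) \<in> borel_measurable borel" by (rule measurable_ft[OF bdd_cpt_tri])
    have [measurable]: "ft_tri \<in> borel_measurable borel"
    proof -
      have "(\<lambda>x. Re (ft (\<lambda>s. complex_of_real (tri s)) x)) \<in> borel_measurable borel" using ftm by measurable
      then show ?thesis by (simp add: ft_tri)
    qed
    have [measurable]: "SS \<in> borel_measurable borel" unfolding SS_def by measurable
    have ft1: "ft_tri x \<le> 2" for x
    proof -
      have "norm (complex_of_real (ft_tri x)) \<le> (\<integral>s. norm (complex_of_real (tri s)) \<partial>lborel)"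
        unfolding ft_tri[symmetric] by (rule norm_ft_le[OF bdd_cpt_tri])
      also have "\<dots> \<le> (\<integral>s. 1 * indicator {-1..1::real} s \<partial>lborel)"
      proof (rule Bochner_Integration.integral_mono)
        show "integrable lborel (\<lambda>s. norm (complex_of_real (tri s)))" by (intro integrable_norm bdd_cpt_integrable bdd_cpt_tri)
        fix s show "norm (complex_of_real (tri s)) \<le> 1 * indicator {-1..1} s"
          using tri_bounds[of s] by (cases "\<bar>s\<bar> \<le> 1") (auto simp: indicator_def abs_le_iff)
      qed auto
      also have "\<dots> = 2" by simp
      finally show ?thesis by simp
    qed
    define A where "A = c3 * real N / 2"
    have "A \<ge> 0" using \<open>c3 > 0\<close> by (simp add: A_def)
    have Fb: "F u \<le> \<epsilon> powr (- (r/2))" for u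
    proof -
      have "(\<epsilon> + (chord u0 u)\<^sup>2) powr (- (r/2)) \<le> \<epsilon> powr (- (r/2))" using \<epsilon> r by (intro powr_mono2') auto
      then have "F u \<le> \<epsilon> powr (- (r/2)) * 1" unfolding F_def by (intro mult_mono) auto
      then show ?thesis by simp
    qed
    have iFk: "integrable lborel (\<lambda>u. F u * speed u * ft_tri (2 ^ k * (phase u - phase u0)))" for k :: nat
    proof (rule Bochner_Integration.integrable_bound)
      show "integrable lborel (\<lambda>u. \<epsilon> powr (- (r/2)) * 2 * speed u)" using integrable_speed by simp
      show "AE u in lborel. norm (F u * speed u * ft_tri (2 ^ k * (phase u - phase u0))) \<le> norm (\<epsilon> powr (- (r/2)) * 2 * speed u)"
      proof (rule AE_I2)
        fix u
        have "F u * ft_tri (2 ^ k * (phase u - phase u0)) \<le> \<epsilon> powr (- (r/2)) * 2"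
          using Fb[of u] ft1 ft_tri_nonneg F0 by (intro mult_mono) auto
        then have "F u * ft_tri (2 ^ k * (phase u - phase u0)) * speed u \<le> \<epsilon> powr (- (r/2)) * 2 * speed u" by (rule mult_right_mono) simp
        moreover have "0 \<le> F u * speed u * ft_tri (2 ^ k * (phase u - phase u0))" using F0 ft_tri_nonneg by simp
        ultimately show "norm (F u * speed u * ft_tri (2 ^ k * (phase u - phase u0))) \<le> norm (\<epsilon> powr (- (r/2)) * 2 * speed u)"
          by (simp add: mult_ac)
      qed
    qed measurable
    define g where "g = (\<lambda>u. F u * speed u * SS u)"
    have g_sum: "g u = (\<Sum>k<N. (2 ^ k) powr (1 / Q) * (F u * speed u * ft_tri (2 ^ k * (phase u - phase u0))))" for u
      by (simp add: g_def SS_def sum_distrib_left mult_ac)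
    have g0: "g u \<ge> 0" for u unfolding g_def using F0 SS0 by simp
    have ig: "integrable lborel g" unfolding g_sum[abs_def] using iFk by auto
    have gN: "c3 * real N \<le> (\<integral>u. g u \<partial>lborel)"
    proof -
      \<comment> \<open>Only parameters within \<open>\<rho> / sqrt L\<close> of \<open>u0\<close>
        are used, with \<open>L = 2 ^ k\<close>. There \<open>f\<close> is at least a constant times
        \<open>L powr (r/2)\<close>, and the powers of \<open>L\<close> cancel because
        \<open>1/Q + r/2 = 1/2\<close> on the critical line: every scale contributes the same
        amount.\<close>
      have each: "c3 \<le> (2 ^ k) powr (1 / Q) * (\<integral>u. F u * speed u * ft_tri (2 ^ k * (phase u - phase u0)) \<partial>lborel)" if k: "k < N" for k
      proof -
        define L where "L = (2::real) ^ k"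
        have L: "L \<ge> 1" by (simp add: L_def)
        define \<rho>k where "\<rho>k = \<rho> / sqrt L"
        have \<rho>k: "0 < \<rho>k" "\<rho>k \<le> 1/2"
        proof -
          show "0 < \<rho>k" using \<rho> L by (simp add: \<rho>k_def)
          have "\<rho>k \<le> \<rho> / 1" unfolding \<rho>k_def using \<rho> L by (intro divide_left_mono) auto
          then show "\<rho>k \<le> 1/2" using \<rho> by simp
        qed
        have "(c * exp (-1) / 8 * L powr (r/2)) * \<rho>k \<le> (\<integral>u. F u * speed u * ft_tri (L * (phase u - phase u0)) \<partial>lborel)"
        proof (rule integral_near_lower[OF u0(1) \<rho>k])
          show "integrable lborel (\<lambda>u. F u * speed u * ft_tri (L * (phase u - phase u0)))" using iFk[of k] by (simp add: L_def)
          show "0 \<le> F u * speed u * ft_tri (L * (phase u - phase u0))" for u using F0 ft_tri_nonneg by simp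
          fix u assume u: "u \<in> {0..1}" "\<bar>u - u0\<bar> \<le> \<rho>k"
          have "chord u0 u \<le> V * \<rho>k" using V(2)[OF u(1)] mult_left_mono[OF u(2), of V] V(1) by linarith
          then have d2': "(chord u0 u)\<^sup>2 \<le> (V * \<rho>k)\<^sup>2" by (intro power_mono) auto
          have Vk: "(V * \<rho>k)\<^sup>2 = (V * \<rho>)\<^sup>2 / L" using L by (simp add: \<rho>k_def power_divide power_mult_distrib)
          have "(V * \<rho>)\<^sup>2 \<le> 1\<^sup>2" using \<rho> V by (intro power_mono) auto
          then have d2: "(chord u0 u)\<^sup>2 \<le> 1 / L" using d2' L unfolding Vk by (smt (verit) divide_right_mono one_power2)
          have "L * \<bar>phase u - phase u0\<bar> \<le> L * (C * ((V * \<rho>)\<^sup>2 / L))"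
          proof (rule mult_left_mono)
            have "C * (chord u0 u)\<^sup>2 \<le> C * ((V * \<rho>)\<^sup>2 / L)" using d2' C unfolding Vk by (intro mult_left_mono) auto
            then show "\<bar>phase u - phase u0\<bar> \<le> C * ((V * \<rho>)\<^sup>2 / L)" using C(2)[OF u(1)] by linarith
          qed (use L in simp)
          also have "\<dots> = C * (V * \<rho>)\<^sup>2" using L by simp
          finally have "\<bar>L * (phase u - phase u0)\<bar> \<le> 1/16" using \<rho>(4) L by (simp add: abs_mult)
          then have T: "1/4 \<le> ft_tri (L * (phase u - phase u0))" by (rule ft_tri_lower)
          have "\<epsilon> \<le> 1 / L"
          proof -
            have "(1/2::real) ^ N \<le> (1/2) ^ k" using k by (intro power_decreasing) auto
            then show ?thesis by (simp add: \<epsilon>_def L_def power_divide)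
          qed
          then have "\<epsilon> + (chord u0 u)\<^sup>2 \<le> 2 / L" using d2 by simp
          then have "(2 / L) powr (- (r/2)) \<le> (\<epsilon> + (chord u0 u)\<^sup>2) powr (- (r/2))"
            using \<epsilon> r by (intro powr_mono2') (auto intro: add_pos_nonneg)
          moreover have "(1/2) * L powr (r/2) \<le> (2 / L) powr (- (r/2))"
          proof -
            have "(2::real) powr (-1) \<le> 2 powr (- (r/2))" using r by (intro powr_mono) auto
            then have "1/2 \<le> (2::real) powr (- (r/2))" by (simp add: powr_minus_divide)
            then have "(1/2) * L powr (r/2) \<le> 2 powr (- (r/2)) * L powr (r/2)" by (rule mult_right_mono) simp
            also have "\<dots> = (2 / L) powr (- (r/2))" using L by (simp add: powr_divide powr_minus_divide)
            finally show ?thesis .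
          qed
          moreover have "exp (-1) \<le> exp (- (chord u0 u)\<^sup>2)"
          proof -
            have "1 / L \<le> 1" using L by simp
            then have "(chord u0 u)\<^sup>2 \<le> 1" using d2 by linarith
            then show ?thesis by simp
          qed
          ultimately have "((1/2) * L powr (r/2)) * exp (-1) \<le> F u"
            unfolding F_def by (intro mult_mono) auto
          then have "(((1/2) * L powr (r/2)) * exp (-1)) * c * (1/4) \<le> F u * speed u * ft_tri (L * (phase u - phase u0))"
            using c u T F0[of u] by (intro mult_mono) auto
          then show "c * exp (-1) / 8 * L powr (r/2) \<le> F u * speed u * ft_tri (L * (phase u - phase u0))"
            by (simp add: mult_ac)
        qed
        then have "L powr (1 / Q) * ((c * exp (-1) / 8 * L powr (r/2)) * \<rho>k) \<le> L powr (1 / Q) * (\<integral>u. F u * speed u * ft_tri (L * (phase u - phase u0)) \<partial>lborel)"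
          by (rule mult_left_mono) simp
        also have "L powr (1 / Q) * ((c * exp (-1) / 8 * L powr (r/2)) * \<rho>k) = c3"
        proof -
          have "1 / Q + r/2 + (- (1/2)) = 0" using crit by (simp add: r_def)
          then have e: "L powr (1 / Q) * L powr (r/2) * L powr (- (1/2)) = 1"
            using L by (simp only: powr_add[symmetric]) simp
          have "\<rho>k = \<rho> * L powr (- (1/2))" using L by (simp add: \<rho>k_def powr_minus_divide powr_half_sqrt)
          then have "L powr (1 / Q) * ((c * exp (-1) / 8 * L powr (r/2)) * \<rho>k) = c3 * (L powr (1 / Q) * L powr (r/2) * L powr (- (1/2)))"
            by (simp add: c3_def)
          then show ?thesis by (simp only: e mult_1_right)
        qed
        finally show ?thesis by (simp add: L_def)
      qed
      have "c3 * real N = (\<Sum>k<N. c3)" by simp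
      also have "\<dots> \<le> (\<Sum>k<N. (2 ^ k) powr (1 / Q) * (\<integral>u. F u * speed u * ft_tri (2 ^ k * (phase u - phase u0)) \<partial>lborel))"
        by (intro sum_mono each) simp
      also have "\<dots> = (\<integral>u. g u \<partial>lborel)"
        unfolding g_sum using iFk by (subst Bochner_Integration.integral_sum) auto
      finally show ?thesis .
    qed
    have low: "A \<le> norm (\<integral>u. ampl f t u * ft h (phase u) \<partial>lborel)" if t: "\<bar>t\<bar> \<le> \<kappa>" for t
    proof -
      define \<theta> where "\<theta> = (\<lambda>u. 2 * pi * t * (along u - along u0))"
      have "(\<integral>u. g u \<partial>lborel) - (\<integral>u. g u / 2 \<partial>lborel) \<le> norm (\<integral>u. complex_of_real (g u) * cis (\<theta> u + 2 * pi * t * along u0) \<partial>lborel)"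
      proof (rule norm_integral_cis_lower[OF ig g0])
        show "\<theta> \<in> borel_measurable borel" unfolding \<theta>_def by measurable
        fix u
        show "g u * \<bar>\<theta> u\<bar> \<le> g u / 2"
        proof (cases "u \<in> {0..1}")
          case True
          have "chord u0 u \<le> V * 1"
            using V(2)[OF True] True u0(1) V(1) by (intro order_trans[OF V(2)[OF True]] mult_left_mono) auto
          then have "\<bar>along u - along u0\<bar> \<le> V" using along_diff[OF True u0(1)] by simp
          have "\<bar>\<theta> u\<bar> = 2 * pi * (\<bar>t\<bar> * \<bar>along u - along u0\<bar>)" by (simp add: \<theta>_def abs_mult)
          also have "\<dots> \<le> 2 * pi * (\<kappa> * V)" using t \<open>\<bar>along u - along u0\<bar> \<le> V\<close> \<kappa> by (intro mult_left_mono mult_mono) auto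
          also have "\<dots> \<le> 1/2" using \<kappa>(3) by (simp only: mult.assoc)
          finally have "g u * \<bar>\<theta> u\<bar> \<le> g u * (1/2)" using g0 by (intro mult_left_mono) auto
          then show ?thesis by simp
        next
          case False
          then have "speed u = 0" by (rule speed_outside)
          then show ?thesis by (simp add: g_def)
        qed
      qed (use ig in auto)
      moreover have "(\<integral>u. g u / 2 \<partial>lborel) = (\<integral>u. g u \<partial>lborel) / 2" by simp
      moreover have "complex_of_real (g u) * cis (\<theta> u + 2 * pi * t * along u0) = ampl f t u * ft h (phase u)" for u
        by (simp add: ampl_def fF fth g_def \<theta>_def algebra_simps)
      ultimately show ?thesis using gN by (simp add: A_def)
    qed
    \<comment> \<open>Majorant of the \<open>Q'\<close>-th power of \<open>norm (h s)\<close> up to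
      the factor \<open>C\<beta> powr Q'\<close>; its integral is at most
      \<open>4 * N\<close>.\<close>
    define mm where "mm = (\<lambda>s. 1 / max 1 \<bar>s\<bar> * indicator {- (2 ^ N)..2 ^ N} s :: real)"
    have [measurable]: "mm \<in> borel_measurable borel" unfolding mm_def by measurable
    have mm0: "mm s \<ge> 0" for s by (simp add: mm_def)
    have imm: "integrable lborel mm"
      by (rule integrable_bdd_cpt[where B = 1 and R = "2 ^ N"]) (auto simp: mm_def indicator_def)
    have mmI: "(\<integral>s. mm s \<partial>lborel) \<le> 4 * real N"
    proof -
      have "ennreal (\<integral>s. mm s \<partial>lborel) = (\<integral>\<^sup>+ s. ennreal (mm s) \<partial>lborel)"
        using imm mm0 by (intro nn_integral_eq_integral[symmetric]) auto
      also have "\<dots> = (\<integral>\<^sup>+ v. ennreal (1 / max 1 \<bar>v\<bar>) * indicator {- (2 ^ N)..2 ^ N} v \<partial>lborel)"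
        by (intro nn_integral_cong) (auto simp: mm_def indicator_def)
      also have "\<dots> \<le> ennreal (2 + 2 * ln (2 ^ N / 1))" by (rule nn_integral_log) auto
      finally have "(\<integral>s. mm s \<partial>lborel) \<le> 2 + 2 * ln (2 ^ N / 1)" by (subst (asm) ennreal_le_iff) auto
      also have "\<dots> = 2 + 2 * (real N * ln 2)" by (simp add: ln_realpow)
      also have "\<dots> \<le> 4 * real N"
      proof -
        have "real N * ln 2 \<le> real N * 1" using ln_2_less_1 by (intro mult_left_mono) auto
        moreover have "1 \<le> real N" using \<open>N \<ge> 1\<close> by simp
        ultimately show ?thesis by linarith
      qed
      finally show ?thesis .
    qed
    have hb: "norm (h s) powr Q' \<le> C\<beta> powr Q' * mm s" for s
    proof -
      define v where "v = max 1 \<bar>s\<bar>"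
      have "v \<ge> 1" by (simp add: v_def)
      have "norm (h s) \<le> (\<Sum>k<N. norm (complex_of_real ((2 ^ k) powr (- \<beta>)) * ?h k s))"
        unfolding h_def by (rule norm_sum)
      also have "\<dots> \<le> (\<Sum>k<N. if v \<le> 2 ^ k then (2 ^ k) powr (- \<beta>) else 0)"
      proof (rule sum_mono)
        fix k :: nat
        show "norm (complex_of_real ((2 ^ k) powr (- \<beta>)) * ?h k s) \<le> (if v \<le> 2 ^ k then (2 ^ k) powr (- \<beta>) else 0)"
        proof (cases "v \<le> 2 ^ k")
          case True
          then show ?thesis using tri_bounds[of "s / 2 ^ k"] mult_left_mono[of "tri (s / 2 ^ k)" 1 "(2 ^ k) powr (- \<beta>)"]
            by (simp add: norm_mult)
        next
          case False
          have "(1::real) \<le> 2 ^ k" by simp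
          then have "2 ^ k \<le> \<bar>s\<bar>" using False unfolding v_def by (simp add: max_def split: if_splits)
          then have "1 \<le> \<bar>s / 2 ^ k\<bar>" by (simp add: le_divide_eq)
          then show ?thesis using False by (simp add: tri_bounds(3))
        qed
      qed
      finally have 1: "norm (h s) \<le> (\<Sum>k<N. if v \<le> 2 ^ k then (2 ^ k) powr (- \<beta>) else 0)" .
      show ?thesis
      proof (cases "\<bar>s\<bar> \<le> 2 ^ N")
        case True
        have "norm (h s) \<le> C\<beta> * v powr (- \<beta>)"
          using order_trans[OF 1 dyadic_tail_sum[OF _ \<beta>(1)]] \<open>v \<ge> 1\<close> by (simp add: C\<beta>_def)
        then have "norm (h s) powr Q' \<le> (C\<beta> * v powr (- \<beta>)) powr Q'" using Q' by (intro powr_mono2) auto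
        also have "\<dots> = C\<beta> powr Q' * v powr (- (\<beta> * Q'))"
          using \<open>C\<beta> > 0\<close> by (simp add: powr_mult powr_powr)
        also have "v powr (- (\<beta> * Q')) = mm s"
          using True \<open>v \<ge> 1\<close> unfolding \<beta>(2) by (auto simp: powr_minus_divide mm_def v_def indicator_def abs_le_iff)
        finally show ?thesis .
      next
        case False
        have "(if v \<le> 2 ^ k then ((2::real) ^ k) powr (- \<beta>) else 0) = 0" if "k < N" for k
        proof -
          have "(2::real) ^ k \<le> 2 ^ N" using that by (intro power_increasing) auto
          then have "\<not> \<bar>s\<bar> \<le> 2 ^ k" using False by linarith
          then have "\<not> v \<le> 2 ^ k" by (simp add: v_def)
          then show ?thesis by simp
        qed
        then have "(\<Sum>k<N. if v \<le> 2 ^ k then ((2::real) ^ k) powr (- \<beta>) else 0) = 0" by (intro sum.neutral) auto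
        then have "norm (h s) = 0" using 1 by simp
        then show ?thesis using mm0 by simp
      qed
    qed
    \<comment> \<open>The dual term of Young's inequality with weight \<open>\<kappa>1\<close>; the
      factors \<open>1 / Q\<close> and \<open>1 / Q'\<close> are bounded by 1.\<close>
    define H where "H = (\<lambda>s. \<kappa>1 powr (- Q') * C\<beta> powr Q' * mm s)"
    have young: "x * norm (h s) \<le> c1 * x powr Q + H s" if "x \<ge> 0" for x s
    proof -
      have "(x * \<kappa>1) * (norm (h s) / \<kappa>1) \<le> (x * \<kappa>1) powr Q / Q + (norm (h s) / \<kappa>1) powr Q' / Q'"
        using that \<open>\<kappa>1 > 0\<close> by (intro Youngs_inequality Q Q') auto
      also have "\<dots> \<le> (x * \<kappa>1) powr Q / 1 + (norm (h s) / \<kappa>1) powr Q' / 1"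
        using Q Q' by (intro add_mono divide_left_mono) auto
      also have "(x * \<kappa>1) powr Q / 1 = c1 * x powr Q"
        using that \<open>\<kappa>1 > 0\<close> by (simp add: c1_def powr_mult mult.commute)
      also have "(norm (h s) / \<kappa>1) powr Q' / 1 = \<kappa>1 powr (- Q') * norm (h s) powr Q'"
        using \<open>\<kappa>1 > 0\<close> by (simp add: powr_divide powr_minus_divide)
      also have "\<dots> \<le> \<kappa>1 powr (- Q') * (C\<beta> powr Q' * mm s)" by (intro mult_left_mono hb) simp
      finally show ?thesis using \<open>\<kappa>1 > 0\<close> by (simp add: H_def mult.assoc)
    qed
    have "ennreal (A / (2 * c1)) \<le> line_power Q f t" if "\<bar>t\<bar> \<le> \<kappa>" for t
    proof (rule line_power_lower[OF cf h \<open>c1 > 0\<close> \<open>A \<ge> 0\<close> young _ _ _ low[OF that]])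
      show "integrable lborel H" unfolding H_def using imm by simp
      show "0 \<le> H s" for s unfolding H_def using mm0 by simp
      have "(\<integral>s. H s \<partial>lborel) = \<kappa>1 powr (- Q') * C\<beta> powr Q' * (\<integral>s. mm s \<partial>lborel)" by (simp add: H_def)
      also have "\<dots> \<le> \<kappa>1 powr (- Q') * C\<beta> powr Q' * (4 * real N)" by (intro mult_left_mono mmI) simp
      also have "\<kappa>1 powr (- Q') * C\<beta> powr Q' = c3 / 16"
        unfolding powr_minus_divide \<kappa>1Q using \<open>C\<beta> > 0\<close> \<open>c3 > 0\<close> by (simp add: field_simps)
      also have "c3 / 16 * (4 * real N) = A / 2" by (simp add: A_def)
      finally show "(\<integral>s. H s \<partial>lborel) \<le> A / 2" .
    qed
    then have "2 * \<kappa> * (A / (2 * c1)) \<le> C1 * (K * (1 + real N) powr r) powr Q"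
      using \<open>A \<ge> 0\<close> \<open>c1 > 0\<close> K by (intro C1[rule_format, OF sf _ \<kappa>(1,2) _ Lp]) auto
    also have "\<dots> \<le> C1 * ((K * 2 powr r) powr Q * (2 ^ n) powr (Q * r))"
    proof (rule mult_left_mono)
      have "(1 + real N) powr r \<le> (2 * real N) powr r" using \<open>N \<ge> 1\<close> r by (intro powr_mono2) auto
      also have "\<dots> = 2 powr r * (2 ^ n) powr r" by (simp add: powr_mult N_def)
      finally have "(K * (1 + real N) powr r) powr Q \<le> (K * (2 powr r * (2 ^ n) powr r)) powr Q"
        using K Q by (intro powr_mono2 mult_left_mono) auto
      also have "\<dots> = (K * 2 powr r) powr Q * (2 ^ n) powr (Q * r)"
        using K by (simp add: powr_mult powr_powr mult_ac)
      finally show "(K * (1 + real N) powr r) powr Q \<le> (K * 2 powr r) powr Q * (2 ^ n) powr (Q * r)" .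
    qed (use \<open>C1 > 0\<close> in simp)
    finally show ?thesis by (simp add: A_def N_def mult_ac)
  qed
  \<comment> \<open>Compares \<open>N\<close> with \<open>N powr (Q * r)\<close> as \<open>N\<close>
    runs through the powers of 2.\<close>
  have "1 \<le> Q * r"
    by (rule pow2_exponent_le[OF _ main]) (use \<kappa> \<open>c3 > 0\<close> \<open>c1 > 0\<close> in auto)
  then show ?thesis using Q by (simp add: r_def field_simps)
qed

section \<open>Equivalence of the estimates with the conditions on the exponents\<close>

lemma estimates_transversal:
  assumes nz: "\<And>u. u \<in> {0..1} \<Longrightarrow> phase1 u \<noteq> 0" and p: "1 \<le> p" and Q: "Q \<ge> 1"
  shows "strip_estimate \<gamma> \<omega> p (ennreal Q) \<longleftrightarrow> rec_exp p + 1 / Q \<le> 1 \<and> Q \<ge> 2"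
    and "radon_estimate \<gamma> \<omega> p (ennreal Q) \<longleftrightarrow> rec_exp p + 1 / Q \<le> 1 \<and> Q \<ge> 2"
proof -
  have 1: "radon_estimate \<gamma> \<omega> p (ennreal Q)" if c: "rec_exp p + 1 / Q \<le> 1 \<and> Q \<ge> 2"
  proof (rule radon_sufficient_transversal[OF nz])
    show "ennreal (Q / (Q - 1)) \<le> p"
    proof (cases p)
      case (real P)
      then have "P \<ge> 1" using p by simp
      then have "1/P + 1/Q \<le> 1" using c real by (simp add: rec_exp_def)
      then have "Q / (Q - 1) \<le> P" using c \<open>P \<ge> 1\<close> by (simp add: field_simps)
      then show ?thesis using real by (simp add: ennreal_leI)
    qed simp
  qed (use c in auto)
  have 2: "strip_estimate \<gamma> \<omega> p (ennreal Q)" if "radon_estimate \<gamma> \<omega> p (ennreal Q)"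
    using strip_estimate_of_radon[OF that] Q by simp
  have 3: "rec_exp p + 1 / Q \<le> 1 \<and> Q \<ge> 2" if S: "strip_estimate \<gamma> \<omega> p (ennreal Q)"
    \<comment> \<open>Knapp's example at the arbitrary parameter 0 with \<open>m = 1\<close>: the
      phase is Lipschitz in the chord with constant 1.\<close>
    using knapp_necessary[OF S Q p, of 0 1 1] phase_diff[of _ 0] rudin_shapiro_necessary[OF S Q p] by auto
  show "strip_estimate \<gamma> \<omega> p (ennreal Q) \<longleftrightarrow> rec_exp p + 1 / Q \<le> 1 \<and> Q \<ge> 2"
    and "radon_estimate \<gamma> \<omega> p (ennreal Q) \<longleftrightarrow> rec_exp p + 1 / Q \<le> 1 \<and> Q \<ge> 2"
    using 1 2 3 by blast+
qed

lemma estimates_nontransversal: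
  assumes u0: "u0 \<in> {0..1}" "phase1 u0 = 0" and p: "1 \<le> p" and Q: "Q \<ge> 1"
  defines "cond \<equiv> (if p \<le> ennreal Q then rec_exp p + 2 / Q \<le> 1 else rec_exp p + 2 / Q < 1)"
  shows "strip_estimate \<gamma> \<omega> p (ennreal Q) \<longleftrightarrow> cond" and "radon_estimate \<gamma> \<omega> p (ennreal Q) \<longleftrightarrow> cond"
proof -
  have 1: "radon_estimate \<gamma> \<omega> p (ennreal Q)" if c: cond
  proof (cases p)
    case (real P)
    then have P1: "P \<ge> 1" using p by simp
    then have r: "rec_exp p = 1/P" using real by (simp add: rec_exp_def)
    have le: "1/P + 2/Q \<le> 1" using c by (auto simp: cond_def r split: if_splits)
    moreover have "2/Q > 0" using Q by simp
    ultimately have "1/P < 1" by linarith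
    then have "P > 1" using P1 by (simp add: field_simps)
    moreover have "1/P + 2/Q < 1 \<or> 1/P + 2/Q = 1 \<and> P \<le> Q"
      using c le real Q P1 by (auto simp: cond_def rec_exp_def split: if_splits)
    ultimately show ?thesis using Q real by (intro radon_sufficient_nontransversal[of P]) auto
  next
    case top
    then have c': "2/Q < 1" using c by (simp add: cond_def rec_exp_def top_unique)
    \<comment> \<open>A finite exponent with \<open>1/P = (1 - 2/Q) / 2\<close>, half of the
      available gap; the case \<open>p = \<infinity>\<close> follows from it by monotonicity of the
      norms.\<close>
    define P where "P = 2 / (1 - 2/Q)"
    have "2/Q > 0" using Q by simp
    have P1: "P > 1" unfolding P_def using c' \<open>2/Q > 0\<close> by (subst less_divide_eq_1_pos) linarith+
    have P2: "1/P + 2/Q < 1" unfolding P_def using c' by (simp add: field_simps)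
    show ?thesis using P1 P2 Q top by (intro radon_sufficient_nontransversal[of P]) auto
  qed
  have 2: "strip_estimate \<gamma> \<omega> p (ennreal Q)" if "radon_estimate \<gamma> \<omega> p (ennreal Q)"
    using strip_estimate_of_radon[OF that] Q by simp
  have 3: cond if S: "strip_estimate \<gamma> \<omega> p (ennreal Q)"
  proof -
    obtain C where C: "C > 0" "\<And>u. u \<in> {0..1} \<Longrightarrow> \<bar>phase u - phase u0\<bar> \<le> C * (chord u0 u)\<^sup>2"
      by (rule phase_quadratic[OF u0]) blast
    \<comment> \<open>Knapp's example at the tangency point, where \<open>m = 2\<close> is
      allowed.\<close>
    have le: "rec_exp p + 2 / Q \<le> 1" using knapp_necessary[OF S Q p u0(1) _ C] by simp
    show cond
    proof (cases "p \<le> ennreal Q")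
      case False
      have lt: "rec_exp p < 1 / Q"
      proof (cases p)
        case (real P)
        then have "P > Q" using False Q by (simp add: ennreal_leI not_le[symmetric])
        then show ?thesis using real Q by (simp add: rec_exp_def field_simps)
      qed (use Q in \<open>simp add: rec_exp_def\<close>)
      have "rec_exp p \<ge> 0" by (simp add: rec_exp_def)
      then have "2 / Q \<le> 1" using le by linarith
      then have "Q > 1" using Q by (simp add: field_simps)
      \<comment> \<open>Here \<open>p\<close> exceeds \<open>q\<close>, so equality would contradict
        the endpoint example.\<close>
      then have "rec_exp p + 2 / Q \<noteq> 1"
        using endpoint_necessary[OF S _ p u0] lt by auto
      then show ?thesis using le False by (simp add: cond_def)
    qed (use le in \<open>simp add: cond_def\<close>)
  qed
  show "strip_estimate \<gamma> \<omega> p (ennreal Q) \<longleftrightarrow> cond" and "radon_estimate \<gamma> \<omega> p (ennreal Q) \<longleftrightarrow> cond"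
    using 1 2 3 by blast+
qed

end

lemma inverse_exponent:
  assumes "1 \<le> (p::ennreal)"
  shows "1 / p = ennreal (rec_exp p)" "2 / p = ennreal (2 * rec_exp p)" "rec_exp p \<ge> 0"
proof -
  show "rec_exp p \<ge> 0" by (simp add: rec_exp_def)
  show "1 / p = ennreal (rec_exp p)"
  proof (cases p)
    case (real P)
    then have "P \<ge> 1" using assms by simp
    then show ?thesis using real divide_ennreal[of 1 P] by (simp add: rec_exp_def)
  qed (simp add: rec_exp_def)
  show "2 / p = ennreal (2 * rec_exp p)"
  proof (cases p)
    case (real P)
    then have "P \<ge> 1" using assms by simp
    then show ?thesis using real divide_ennreal[of 2 P] by (simp add: rec_exp_def)
  qed (simp add: rec_exp_def)
qed

theorem theorem3:
  fixes \<gamma> :: "real \<Rightarrow> real^2" and \<Sigma> :: "(real^2) set" and \<omega> :: "real^2" and p q :: ennreal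
  assumes "compact_C2_curve \<gamma>" and "\<Sigma> = path_image \<gamma>"
    and "\<forall>\<xi>\<in>\<Sigma>. curve_curvature \<gamma> \<xi> \<noteq> 0"
    and "\<omega> \<in> sphere 0 1"
    and "1 \<le> p" and "1 \<le> q"
  shows
    "((\<forall>\<xi>\<in>\<Sigma>. curve_normal \<gamma> \<xi> \<bullet> \<omega> \<noteq> 0) \<longrightarrow>
        (strip_estimate \<gamma> \<omega> p q \<longleftrightarrow> 1/p + 1/q \<le> 1 \<and> q \<ge> 2) \<and>
        (radon_estimate \<gamma> \<omega> p q \<longleftrightarrow> 1/p + 1/q \<le> 1 \<and> q \<ge> 2)) \<and>
     ((\<exists>\<xi>\<in>\<Sigma>. curve_normal \<gamma> \<xi> \<bullet> \<omega> = 0) \<longrightarrow>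
        (strip_estimate \<gamma> \<omega> p q \<longleftrightarrow> (if p \<le> q then 1/p + 2/q \<le> 1 else 1/p + 2/q < 1)) \<and>
        (radon_estimate \<gamma> \<omega> p q \<longleftrightarrow> (if p \<le> q then 1/p + 2/q \<le> 1 else 1/p + 2/q < 1)))"
proof -
  interpret curve_line \<gamma> \<omega>
    using assms by unfold_locales auto
  have img: "\<xi> \<in> \<Sigma> \<longleftrightarrow> (\<exists>u\<in>{0..1}. \<xi> = \<gamma> u)" for \<xi>
    using assms(2) by (auto simp: path_image_def)
  have rp: "rec_exp p \<le> 1"
  proof (cases p)
    case (real P)
    then have "P \<ge> 1" using assms by simp
    then show ?thesis using real by (simp add: rec_exp_def)
  qed (simp add: rec_exp_def)
  show ?thesis
  proof (cases q)
    case top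
    \<comment> \<open>For \<open>q = \<infinity>\<close> all the conditions hold, and so do the
      estimates.\<close>
    have "1/p + 1/q \<le> 1 \<and> q \<ge> 2" and "if p \<le> q then 1/p + 2/q \<le> 1 else 1/p + 2/q < 1"
      using inverse_exponent[OF assms(5)] rp top by auto
    then show ?thesis using estimates_infinity[OF assms(5)] top by auto
  next
    case (real Q)
    then have Q: "Q \<ge> 1" using assms by simp
    have rq: "rec_exp q = 1 / Q" using real Q by (simp add: rec_exp_def)
    note ip = inverse_exponent[OF assms(5)] and iq = inverse_exponent[OF assms(6), unfolded rq]
    have c1: "1/p + 1/q \<le> 1 \<longleftrightarrow> rec_exp p + 1 / Q \<le> 1"
      unfolding ip(1) iq(1) using ip(3) Q by (simp flip: ennreal_plus)
    have c2: "q \<ge> 2 \<longleftrightarrow> Q \<ge> 2" using real Q by (simp flip: ennreal_numeral)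
    have c3: "1/p + 2/q \<le> 1 \<longleftrightarrow> rec_exp p + 2 / Q \<le> 1"
      unfolding ip(1) iq(2) using ip(3) Q by (simp flip: ennreal_plus)
    have c4: "1/p + 2/q < 1 \<longleftrightarrow> rec_exp p + 2 / Q < 1"
      unfolding ip(1) iq(2) using ip(3) Q by (simp add: ennreal_less_one_iff flip: ennreal_plus)
    have a: "(strip_estimate \<gamma> \<omega> p q \<longleftrightarrow> 1/p + 1/q \<le> 1 \<and> q \<ge> 2) \<and> (radon_estimate \<gamma> \<omega> p q \<longleftrightarrow> 1/p + 1/q \<le> 1 \<and> q \<ge> 2)"
      if tr: "\<forall>\<xi>\<in>\<Sigma>. curve_normal \<gamma> \<xi> \<bullet> \<omega> \<noteq> 0"
    proof -
      have nz: "phase1 u \<noteq> 0" if "u \<in> {0..1}" for u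
      proof -
        have "\<gamma> u \<in> \<Sigma>" using img that by auto
        then show ?thesis using tr normal_iff[OF that] by auto
      qed
      from estimates_transversal[OF this assms(5) Q] show ?thesis
        unfolding c1 c2 using real by simp
    qed
    have b: "(strip_estimate \<gamma> \<omega> p q \<longleftrightarrow> (if p \<le> q then 1/p + 2/q \<le> 1 else 1/p + 2/q < 1)) \<and>
        (radon_estimate \<gamma> \<omega> p q \<longleftrightarrow> (if p \<le> q then 1/p + 2/q \<le> 1 else 1/p + 2/q < 1))"
      if ex: "\<exists>\<xi>\<in>\<Sigma>. curve_normal \<gamma> \<xi> \<bullet> \<omega> = 0"
    proof -
      obtain \<xi> where x: "\<xi> \<in> \<Sigma>" "curve_normal \<gamma> \<xi> \<bullet> \<omega> = 0" using ex by auto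
      obtain u0 where u0: "u0 \<in> {0..1}" "\<xi> = \<gamma> u0" using x(1) img by auto
      have "phase1 u0 = 0" using normal_iff[OF u0(1)] x(2) u0(2) by auto
      note u0 = u0 this
      from estimates_nontransversal[OF u0(1,3) assms(5) Q] show ?thesis
        unfolding c3 c4 using real by simp
    qed
    show ?thesis using a b by blast
  qed
qed

end
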